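(* Let $\psi$ be a measurable function on $\Omega_T$ with $0\le\psi\le L$ for some constant $L$, let $w=\inf_{u\in\mathcal S_\psi}u$ and let $w^*$ be the least solution with obstacle $\psi$. Then $w^*$ is a weak supersolution in $\Omega_T$, and $w=w^*$ almost everywhere in $\Omega_T$.
   Context: Throughout, $p>2$, $\Omega\subset\mathbb R^n$ is a bounded domain with regular boundary, $T>0$, $\Omega_T=\Omega\times(0,T)$. A function $u\in L^p_{loc}(0,T;W^{1,p}_{loc}(\Omega))$ is a weak supersolution (of $\partial_t u=\operatorname{div}(|\nabla u|^{p-2}\nabla u)$) in $\Omega_T$ if $\int\!\!\int_{\Omega_T}(|\nabla u|^{p-2}\nabla u\cdot\nabla\varphi-u\,\partial_t\varphi)\,dx\,dt\ge0$ for all $\varphi\in C_0^\infty(\Omega_T)$ with $\varphi\ge0$. Let $Q_r(x,t)=B_r(x)\times(t-r^p,t+r^p)$. For a function $f$ on $\Omega_T$, its ess liminf regularization is $f^*(x,t)=\lim_{r\to0}\operatorname{ess\,inf}_{Q_r(x,t)\cap\Omega_T}f$, and $f$ is ess liminf-regularized if $f=f^*$. $\mathcal S_\psi$ denotes the class of ess liminf-regularized weak supersolutions $u$ in $\Omega_T$ with $u\ge\psi$ a.e. in $\Omega_T$; with $w=\inf_{u\in\mathcal S_\psi}u$ (pointwise), the least solution with obstacle $\psi$ is $w^*$. *)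

theory Defs
  imports "HOL-Analysis.Analysis"
begin

text \<open>Points of space-time are pairs (x,t) with x in a Euclidean space 'a (playing R^n)
  and t real. Functions on the space-time cylinder are maps 'a \<times> real \<Rightarrow> real.\<close>

definition cyl :: "'a set \<Rightarrow> real \<Rightarrow> ('a \<times> real) set" where
  "cyl \<Omega> T = \<Omega> \<times> {0<..<T}"

fun dirderivs :: "('a::real_normed_vector) list \<Rightarrow> ('a \<Rightarrow> real) \<Rightarrow> 'a \<Rightarrow> real" where
  "dirderivs [] f = f"
| "dirderivs (v # vs) f = (\<lambda>z. frechet_derivative (dirderivs vs f) (at z) v)"

definition smooth_fun :: "('a::real_normed_vector \<Rightarrow> real) \<Rightarrow> bool" where
  "smooth_fun f \<longleftrightarrow> (\<forall>vs z. dirderivs vs f differentiable (at z))"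

definition test_fun :: "('a::real_normed_vector) set \<Rightarrow> ('a \<Rightarrow> real) \<Rightarrow> bool" where
  "test_fun U \<phi> \<longleftrightarrow> smooth_fun \<phi> \<and> compact (closure {z. \<phi> z \<noteq> 0}) \<and> closure {z. \<phi> z \<noteq> 0} \<subseteq> U"

definition grad_x :: "('a::euclidean_space \<times> real \<Rightarrow> real) \<Rightarrow> 'a \<times> real \<Rightarrow> 'a" where
  "grad_x \<phi> z = (\<Sum>b\<in>Basis. frechet_derivative \<phi> (at z) (b, 0) *\<^sub>R b)"

definition dt :: "('a::euclidean_space \<times> real \<Rightarrow> real) \<Rightarrow> 'a \<times> real \<Rightarrow> real" where
  "dt \<phi> z = frechet_derivative \<phi> (at z) (0, 1)"

text \<open>u \<in> L^p_loc(0,T; W^{1,p}_loc(\<Omega>)) with spatial weak gradient g: u and |g| are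
  Lebesgue measurable on \<Omega>_T, p-integrable on compact subsets of \<Omega>_T, and g is the
  distributional spatial gradient of u in \<Omega>_T.\<close>
definition weak_grad_loc ::
  "'a::euclidean_space set \<Rightarrow> real \<Rightarrow> real \<Rightarrow> ('a \<times> real \<Rightarrow> real) \<Rightarrow> ('a \<times> real \<Rightarrow> 'a) \<Rightarrow> bool" where
  "weak_grad_loc \<Omega> T p u g \<longleftrightarrow>
     set_borel_measurable lebesgue (cyl \<Omega> T) u \<and>
     set_borel_measurable lebesgue (cyl \<Omega> T) g \<and>
     (\<forall>K. compact K \<and> K \<subseteq> cyl \<Omega> T \<longrightarrow>
        set_integrable lebesgue K (\<lambda>z. \<bar>u z\<bar> powr p) \<and>
        set_integrable lebesgue K (\<lambda>z. norm (g z) powr p)) \<and>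
     (\<forall>\<phi> b. test_fun (cyl \<Omega> T) \<phi> \<and> b \<in> Basis \<longrightarrow>
        (\<integral>z. u z * frechet_derivative \<phi> (at z) (b, 0) \<partial>lebesgue)
          = - (\<integral>z. (g z \<bullet> b) * \<phi> z \<partial>lebesgue))"

definition weak_supersol ::
  "'a::euclidean_space set \<Rightarrow> real \<Rightarrow> real \<Rightarrow> ('a \<times> real \<Rightarrow> real) \<Rightarrow> bool" where
  "weak_supersol \<Omega> T p u \<longleftrightarrow>
     (\<exists>g. weak_grad_loc \<Omega> T p u g \<and>
        (\<forall>\<phi>. test_fun (cyl \<Omega> T) \<phi> \<and> (\<forall>z. 0 \<le> \<phi> z) \<longrightarrow>
           (\<integral>z. (norm (g z) powr (p - 2)) * (g z \<bullet> grad_x \<phi> z) - u z * dt \<phi> z \<partial>lebesgue) \<ge> 0))"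

definition Qcyl :: "real \<Rightarrow> real \<Rightarrow> 'a::euclidean_space \<times> real \<Rightarrow> ('a \<times> real) set" where
  "Qcyl p r z = ball (fst z) r \<times> {snd z - r powr p <..< snd z + r powr p}"

definition ess_inf_on :: "('a::euclidean_space \<Rightarrow> real) \<Rightarrow> 'a set \<Rightarrow> ereal" where
  "ess_inf_on f A = Sup {c::ereal. AE z in lebesgue. z \<in> A \<longrightarrow> c \<le> ereal (f z)}"

text \<open>lim_{r\<rightarrow>0} ess inf_{Q_r(z) \<inter> \<Omega>_T} f  (the limit of a monotone family, i.e. its supremum).\<close>
definition ess_liminf_e ::
  "'a::euclidean_space set \<Rightarrow> real \<Rightarrow> real \<Rightarrow> ('a \<times> real \<Rightarrow> real) \<Rightarrow> 'a \<times> real \<Rightarrow> ereal" where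
  "ess_liminf_e \<Omega> T p f z = Lim (at_right 0) (\<lambda>r. ess_inf_on f (Qcyl p r z \<inter> cyl \<Omega> T))"

definition ess_liminf_reg ::
  "'a::euclidean_space set \<Rightarrow> real \<Rightarrow> real \<Rightarrow> ('a \<times> real \<Rightarrow> real) \<Rightarrow> 'a \<times> real \<Rightarrow> real" where
  "ess_liminf_reg \<Omega> T p f z = real_of_ereal (ess_liminf_e \<Omega> T p f z)"

definition ess_liminf_regularized ::
  "'a::euclidean_space set \<Rightarrow> real \<Rightarrow> real \<Rightarrow> ('a \<times> real \<Rightarrow> real) \<Rightarrow> bool" where
  "ess_liminf_regularized \<Omega> T p f \<longleftrightarrow> (\<forall>z\<in>cyl \<Omega> T. ereal (f z) = ess_liminf_e \<Omega> T p f z)"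

definition S_class ::
  "'a::euclidean_space set \<Rightarrow> real \<Rightarrow> real \<Rightarrow> ('a \<times> real \<Rightarrow> real) \<Rightarrow> ('a \<times> real \<Rightarrow> real) set" where
  "S_class \<Omega> T p \<psi> = {u. weak_supersol \<Omega> T p u \<and> ess_liminf_regularized \<Omega> T p u \<and>
                          (AE z in lebesgue. z \<in> cyl \<Omega> T \<longrightarrow> \<psi> z \<le> u z)}"

definition w_inf ::
  "'a::euclidean_space set \<Rightarrow> real \<Rightarrow> real \<Rightarrow> ('a \<times> real \<Rightarrow> real) \<Rightarrow> 'a \<times> real \<Rightarrow> real" where
  "w_inf \<Omega> T p \<psi> z = Inf {u z | u. u \<in> S_class \<Omega> T p \<psi>}"

end

theory Submission
  imports Defs
begin

text \<open>
  The minimum of two supersolutions is a supersolution, and a bounded almost everywhere convergent sequence of supersolutions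
  has a supersolution as its limit: subtracting the two inequalities, tested with a smoothed step function of $u_m - u_n$, shows
  that the gradients converge locally in $L^1$. A nonnegative supersolution agrees almost everywhere with its ess liminf regularization:
  if it is below a level $k$ only on a small fraction of a parabolic cylinder, De Giorgi's iteration bounds it from below by any
  $\kappa < k$ on the half cylinder, and the fraction is small around almost every point where the function exceeds $k$.

  Minimise $\int u$ over the members $u \leq L$ of the class $S_\psi$. Finite minima of a minimising sequence
  decrease to a supersolution whose regularization $V$ again belongs to $S_\psi$. If $u$ is any other member, then $\min(u,V)$ is an
  admissible competitor, so $u \geq V$ almost everywhere, and everywhere after regularizing. Hence $V$ is the pointwise infimum
  $w$, and $w = w^*$ even pointwise.
\<close>

section \<open>Continuously differentiable functions and a smooth mollifier\<close>

definition C1 :: "('e::euclidean_space \<Rightarrow> real) \<Rightarrow> ('e \<Rightarrow> 'e \<Rightarrow> real) \<Rightarrow> bool" where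
  "C1 f D \<longleftrightarrow> (\<forall>z. (f has_derivative D z) (at z)) \<and> (\<forall>v. continuous_on UNIV (\<lambda>z. D z v))"

lemma C1_D: "C1 f D \<Longrightarrow> (f has_derivative D z) (at z)"
  and C1_cont_D: "C1 f D \<Longrightarrow> continuous_on UNIV (\<lambda>z. D z v)"
  by (auto simp: C1_def)

lemma C1_cont: "C1 f D \<Longrightarrow> continuous_on UNIV f"
  by (meson C1_D continuous_at_imp_continuous_on has_derivative_continuous)

lemma C1_linear: "C1 f D \<Longrightarrow> linear (D z)"
  by (rule has_derivative_linear[OF C1_D])

lemma C1_const: "C1 (\<lambda>z. c) (\<lambda>z v. 0)"
  unfolding C1_def by (intro conjI allI has_derivative_const continuous_on_const)

lemma C1_diff: "C1 f D \<Longrightarrow> C1 g D' \<Longrightarrow> C1 (\<lambda>z. f z - g z) (\<lambda>z v. D z v - D' z v)"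
  by (auto simp: C1_def intro!: has_derivative_diff continuous_intros)

lemma C1_mult:
  assumes f: "C1 f D" and g: "C1 g D'"
  shows "C1 (\<lambda>z. f z * g z) (\<lambda>z v. f z * D' z v + D z v * g z)"
  unfolding C1_def
proof (intro conjI allI)
  show "((\<lambda>z. f z * g z) has_derivative (\<lambda>v. f z * D' z v + D z v * g z)) (at z)" for z
    by (rule has_derivative_mult[OF C1_D[OF f] C1_D[OF g]])
  show "continuous_on UNIV (\<lambda>z. f z * D' z v + D z v * g z)" for v
    by (intro continuous_intros C1_cont[OF f] C1_cont[OF g] C1_cont_D[OF f] C1_cont_D[OF g])
qed

lemma C1_compose:
  assumes h: "\<And>s. (h has_real_derivative h' s) (at s)" and h': "continuous_on UNIV h'" and f: "C1 f D"
  shows "C1 (\<lambda>z. h (f z)) (\<lambda>z v. h' (f z) * D z v)"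
  unfolding C1_def
proof (intro conjI allI)
  show "((\<lambda>z. h (f z)) has_derivative (\<lambda>v. h' (f z) * D z v)) (at z)" for z
    using has_derivative_compose[OF C1_D[OF f] h[of "f z", unfolded has_field_derivative_def]]
    by simp
  have "continuous_on UNIV (\<lambda>z. h' (f z))"
    using continuous_on_compose2[OF h' C1_cont[OF f]] by auto
  then show "continuous_on UNIV (\<lambda>z. h' (f z) * D z v)" for v
    by (intro continuous_intros C1_cont_D[OF f])
qed

lemma C1_D_zero:
  assumes f: "C1 f D" and K: "closed K" "\<And>z. z \<notin> K \<Longrightarrow> f z = 0" and z: "z \<notin> K"
  shows "D z v = 0"
proof -
  have "((\<lambda>z. 0) has_derivative D z) (at z)"
    by (rule has_derivative_transform_within_open[OF C1_D[OF f], of "- K"]) (use K z in auto)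
  then have "D z = (\<lambda>v. 0)"
    using has_derivative_unique has_derivative_const by blast
  then show ?thesis by simp
qed

lemma integrable_cont_compact_support:
  fixes f :: "'e::euclidean_space \<Rightarrow> 'b::{banach,second_countable_topology}"
  assumes "continuous_on UNIV f" "compact K" "\<And>z. z \<notin> K \<Longrightarrow> f z = 0"
  shows "integrable lborel f"
proof -
  have "integrable lborel (\<lambda>x. indicator K x *\<^sub>R f x)"
    by (rule borel_integrable_compact[OF assms(2) continuous_on_subset[OF assms(1) subset_UNIV]])
  moreover have "(\<lambda>x. indicator K x *\<^sub>R f x) = f" using assms(3) by (auto simp: indicator_def fun_eq_iff)
  ultimately show ?thesis by simp
qed

lemma cont_compact_support_bounded:
  fixes f :: "'e::euclidean_space \<Rightarrow> real"
  assumes "continuous_on UNIV f" "compact K" "\<And>z. z \<notin> K \<Longrightarrow> f z = 0"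
  shows "\<exists>B>0. \<forall>z. \<bar>f z\<bar> \<le> B"
proof -
  have "compact (f ` K)" using assms continuous_on_subset compact_continuous_image by blast
  then obtain B where "\<forall>x\<in>f ` K. norm x \<le> B" using compact_imp_bounded bounded_iff by blast
  then have "\<bar>f z\<bar> \<le> max B 1" for z using assms(3)[of z] by (cases "z \<in> K") (force simp: max_def)+
  then show ?thesis by (intro exI[of _ "max B 1"]) auto
qed

lemma lborel_integrable_translation:
  fixes f :: "'e::euclidean_space \<Rightarrow> 'b::{banach,second_countable_topology}"
  assumes "integrable lborel f" shows "integrable lborel (\<lambda>z. f (z + c))"
proof -
  have "f \<in> borel_measurable lborel" using assms by auto
  then have "integrable (distr lborel borel ((+) c)) f \<longleftrightarrow> integrable lborel (\<lambda>z. f (c + z))"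
    by (intro integrable_distr_eq) auto
  then show ?thesis using assms by (simp add: lborel_distr_plus add.commute)
qed

lemma lborel_integral_translation:
  fixes f :: "'e::euclidean_space \<Rightarrow> 'b::{banach,second_countable_topology}"
  assumes "f \<in> borel_measurable borel"
  shows "(\<integral>z. f (z + c) \<partial>lborel) = (\<integral>z. f z \<partial>lborel)"
proof -
  have "integral\<^sup>L (distr lborel borel ((+) c)) f = (\<integral>z. f (c + z) \<partial>lborel)"
    using assms by (intro integral_distr) auto
  then show ?thesis by (simp add: lborel_distr_plus add.commute)
qed

lemma lborel_nn_integral_translation:
  fixes f :: "'e::euclidean_space \<Rightarrow> ennreal"
  assumes "f \<in> borel_measurable borel"
  shows "(\<integral>\<^sup>+z. f (z + c) \<partial>lborel) = (\<integral>\<^sup>+z. f z \<partial>lborel)"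
proof -
  have "integral\<^sup>N (distr lborel borel ((+) c)) f = (\<integral>\<^sup>+z. f (c + z) \<partial>lborel)"
    using assms by (intro nn_integral_distr) auto
  then show ?thesis by (simp add: lborel_distr_plus add.commute)
qed

lemma C1_line_derivative:
  assumes "C1 f D"
  shows "((\<lambda>s. f (z + s *\<^sub>R v)) has_real_derivative D (z + s *\<^sub>R v) v) (at s within A)"
proof -
  have "((\<lambda>s. z + s *\<^sub>R v) has_derivative (\<lambda>s. s *\<^sub>R v)) (at s within A)"
    by (auto intro!: derivative_eq_intros)
  from has_derivative_compose[OF this C1_D[OF assms]]
  have "((\<lambda>s. f (z + s *\<^sub>R v)) has_derivative (\<lambda>x. D (z + s *\<^sub>R v) (x *\<^sub>R v))) (at s within A)" .
  moreover have "(\<lambda>x. D (z + s *\<^sub>R v) (x *\<^sub>R v)) = (*) (D (z + s *\<^sub>R v) v)"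
    using linear_scale[OF C1_linear[OF assms]] by (auto simp: fun_eq_iff)
  ultimately show ?thesis by (simp add: has_field_derivative_def)
qed

lemma C1_Lipschitz_direction:
  assumes f: "C1 f D" and B: "\<And>z. \<bar>D z v\<bar> \<le> B" and h: "h \<ge> 0"
  shows "\<bar>f (z + h *\<^sub>R v) - f z\<bar> \<le> B * h"
proof (cases "h = 0")
  case False
  then have "h > 0" using h by simp
  then obtain \<xi> where "f (z + h *\<^sub>R v) - f (z + 0 *\<^sub>R v) = (h - 0) * D (z + \<xi> *\<^sub>R v) v"
    using MVT2[of 0 h "\<lambda>s. f (z + s *\<^sub>R v)" "\<lambda>s. D (z + s *\<^sub>R v) v"] C1_line_derivative[OF f] by blast
  then show ?thesis using B[of "z + \<xi> *\<^sub>R v"] \<open>h > 0\<close>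
    by (simp add: abs_mult mult.commute)
qed (use assms in simp)

lemma C1_integral_derivative_zero:
  fixes f :: "'e::euclidean_space \<Rightarrow> real"
  assumes f: "C1 f D" and K: "compact K" "\<And>z. z \<notin> K \<Longrightarrow> f z = 0"
  shows "(\<integral>z. D z v \<partial>lborel) = 0" "integrable lborel (\<lambda>z. D z v)"
proof -
  have D0: "D z v = 0" if "z \<notin> K" for z
    by (rule C1_D_zero[OF f _ K(2) that]) (use K compact_imp_closed in auto)
  show "integrable lborel (\<lambda>z. D z v)"
    by (rule integrable_cont_compact_support[OF C1_cont_D[OF f] K(1)]) (use D0 in auto)
  obtain B where B: "B > 0" "\<And>z. \<bar>D z v\<bar> \<le> B"
    using cont_compact_support_bounded[OF C1_cont_D[OF f, of v] K(1) D0] by blast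
  define K' where "K' = (\<lambda>(z,s). z - s *\<^sub>R v) ` (K \<times> {0..1::real})"
  have K': "compact K'" unfolding K'_def
    by (intro compact_continuous_image compact_Times K compact_Icc) (auto intro!: continuous_intros simp: case_prod_beta)
  define h :: "nat \<Rightarrow> real" where "h n = 1 / Suc n" for n
  have h: "h n > 0" "h n \<le> 1" for n by (auto simp: h_def)
  have h0: "h \<longlonglongrightarrow> 0" unfolding h_def using LIMSEQ_inverse_real_of_nat by (simp add: inverse_eq_divide)
  define q where "q n z = (f (z + h n *\<^sub>R v) - f z) / h n" for n z
  have cf: "continuous_on UNIV f" using C1_cont[OF f] .
  have [measurable]: "f \<in> borel_measurable borel" using cf by (rule borel_measurable_continuous_onI)
  have intf: "integrable lborel f" by (rule integrable_cont_compact_support[OF cf K])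
  have q0: "(\<integral>z. q n z \<partial>lborel) = 0" for n
    unfolding q_def using lborel_integral_translation[of f "h n *\<^sub>R v"] intf
      lborel_integrable_translation[OF intf, of "h n *\<^sub>R v"] by simp
  have "(\<lambda>n. \<integral>z. q n z \<partial>lborel) \<longlonglongrightarrow> (\<integral>z. D z v \<partial>lborel)"
  proof (rule integral_dominated_convergence[where w="\<lambda>z. indicator K' z * B"])
    show "(\<lambda>z. D z v) \<in> borel_measurable lborel"
      using borel_measurable_continuous_onI[OF C1_cont_D[OF f]] by simp
    show "q n \<in> borel_measurable lborel" for n unfolding q_def by measurable
    show "integrable lborel (\<lambda>z. indicator K' z * B)"
      using K' by (intro integrable_mult_left) (simp add: integrable_indicator_iff borel_compact emeasure_bounded_finite[OF compact_imp_bounded, unfolded infinity_ennreal_def])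
    show "AE z in lborel. (\<lambda>n. q n z) \<longlonglongrightarrow> D z v"
    proof (rule AE_I2)
      fix z
      have "((\<lambda>s. (f (z + s *\<^sub>R v) - f (z + 0 *\<^sub>R v)) / (s - 0)) \<longlongrightarrow> D (z + 0 *\<^sub>R v) v) (at 0)"
        using C1_line_derivative[OF f, of z v 0 UNIV] unfolding has_field_derivative_iff by simp
      then have "((\<lambda>s. (f (z + s *\<^sub>R v) - f z) / s) \<longlongrightarrow> D z v) (at 0)" by simp
      moreover have "filterlim h (at 0) sequentially"
        using h0 h(1) by (auto simp: filterlim_at intro!: always_eventually) (metis less_irrefl)
      ultimately show "(\<lambda>n. q n z) \<longlonglongrightarrow> D z v"
        unfolding q_def using filterlim_compose by blast
    qed
    show "AE z in lborel. norm (q n z) \<le> indicator K' z * B" for n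
    proof (rule AE_I2)
      fix z
      have b: "\<bar>q n z\<bar> \<le> B"
        using C1_Lipschitz_direction[OF f B(2), of "h n" z] h[of n] by (simp add: q_def field_simps)
      have "q n z = 0" if "z \<notin> K'"
      proof -
        have "z \<notin> K" using that unfolding K'_def by (auto simp: image_iff Bex_def dest!: spec[of _ z] spec[of _ "0::real"])
        moreover have "z + h n *\<^sub>R v \<notin> K"
        proof
          assume "z + h n *\<^sub>R v \<in> K"
          then have "(\<lambda>(z,s). z - s *\<^sub>R v) (z + h n *\<^sub>R v, h n) \<in> K'"
            unfolding K'_def using h[of n] by (intro imageI) auto
          then show False using that by simp
        qed
        ultimately show ?thesis using K(2) by (simp add: q_def)
      qed
      then show "norm (q n z) \<le> indicator K' z * B" using b by (cases "z \<in> K'") auto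
    qed
  qed
  then show "(\<integral>z. D z v \<partial>lborel) = 0" unfolding q0 using LIMSEQ_unique tendsto_const by blast
qed

lemma C1_D_uniformly_continuous:
  fixes f :: "'e::euclidean_space \<Rightarrow> real"
  assumes f: "C1 f D" and K: "compact K" "\<And>z. z \<notin> K \<Longrightarrow> f z = 0" and e: "e > 0"
  shows "\<exists>d>0. \<forall>x y. dist x y < d \<longrightarrow> \<bar>D x b - D y b\<bar> < e"
proof -
  have D0: "D z v = 0" if "z \<notin> K" for z v
    by (rule C1_D_zero[OF f _ K(2) that]) (use K compact_imp_closed in auto)
  obtain a where a: "K \<subseteq> cball 0 a" "a > 0"
    using compact_imp_bounded[OF K(1)] bounded_pos[of K] by (auto simp: subset_iff)
  have "uniformly_continuous_on (cball 0 (a+1)) (\<lambda>z. D z b)"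
    by (rule compact_uniformly_continuous[OF continuous_on_subset[OF C1_cont_D[OF f]]]) auto
  then obtain d where d: "d > 0" "\<And>x y. x \<in> cball 0 (a+1) \<Longrightarrow> y \<in> cball 0 (a+1) \<Longrightarrow> dist y x < d \<Longrightarrow> dist (D y b) (D x b) < e"
    unfolding uniformly_continuous_on_def using e by blast
  show ?thesis
  proof (intro exI[of _ "min d 1"] conjI allI impI)
    fix x y :: 'e assume xy: "dist x y < min d 1"
    show "\<bar>D x b - D y b\<bar> < e"
    proof (cases "x \<in> K \<or> y \<in> K")
      case True
      then have "norm x \<le> a \<or> norm y \<le> a" using a by auto
      moreover have "norm x \<le> norm y + dist x y" "norm y \<le> norm x + dist x y"
        by (metis dist_norm norm_triangle_sub, metis dist_norm dist_commute norm_triangle_sub)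
      ultimately have "x \<in> cball 0 (a+1)" "y \<in> cball 0 (a+1)" using xy by auto
      then show ?thesis using d(2)[of y x] xy by (auto simp: dist_real_def)
    next
      case False
      then show ?thesis using D0 e by simp
    qed
  qed (use d in auto)
qed

lemma C1_uniform_linearization:
  fixes f :: "'e::euclidean_space \<Rightarrow> real"
  assumes f: "C1 f D" and K: "compact K" "\<And>z. z \<notin> K \<Longrightarrow> f z = 0" and e: "e > 0"
  shows "\<exists>d>0. \<forall>w h. norm h < d \<longrightarrow> \<bar>f (w + h) - f w - D w h\<bar> \<le> e * norm h"
proof -
  define n where "n = real DIM('e)"
  have n: "n > 0" by (simp add: n_def)
  have "\<exists>d>0. \<forall>x y. dist x y < d \<longrightarrow> \<bar>D x b - D y b\<bar> < e / n" for b
    using C1_D_uniformly_continuous[OF f K divide_pos_pos[OF e n]] .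
  then obtain d where d: "\<And>b. d b > 0" "\<And>b x y. dist x y < d b \<Longrightarrow> \<bar>D x b - D y b\<bar> < e / n"
    by metis
  define d0 where "d0 = Min (d ` Basis)"
  have d0: "d0 > 0" "\<And>b. b \<in> Basis \<Longrightarrow> d0 \<le> d b" unfolding d0_def using d(1) by auto
  show ?thesis
  proof (intro exI[of _ d0] conjI allI impI d0)
    fix w h :: 'e assume h: "norm h < d0"
    define g where "g s = f (w + s *\<^sub>R h) - s * D w h" for s
    have "(g has_real_derivative (D (w + s *\<^sub>R h) h - D w h)) (at s)" for s
      unfolding g_def by (auto intro!: derivative_eq_intros C1_line_derivative[OF f])
    then obtain s where s: "0 < s" "s < 1" "g 1 - g 0 = (1 - 0) * (D (w + s *\<^sub>R h) h - D w h)"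
      using MVT2[of 0 1 g "\<lambda>s. D (w + s *\<^sub>R h) h - D w h"] by auto
    have rep: "D z h = (\<Sum>b\<in>Basis. (h \<bullet> b) * D z b)" for z
    proof -
      have "D z h = D z (\<Sum>b\<in>Basis. (h \<bullet> b) *\<^sub>R b)" by (simp add: euclidean_representation)
      also have "\<dots> = (\<Sum>b\<in>Basis. (h \<bullet> b) * D z b)"
        by (simp add: linear_sum[OF C1_linear[OF f]] linear_scale[OF C1_linear[OF f]])
      finally show ?thesis .
    qed
    have "\<bar>D (w + s *\<^sub>R h) h - D w h\<bar> = \<bar>\<Sum>b\<in>Basis. (h \<bullet> b) * (D (w + s *\<^sub>R h) b - D w b)\<bar>"
      unfolding rep by (simp add: sum_subtractf right_diff_distrib)
    also have "\<dots> \<le> (\<Sum>b\<in>(Basis::'e set). norm h * (e / n))"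
    proof (rule order_trans[OF sum_abs], rule sum_mono)
      fix b :: 'e assume b: "b \<in> Basis"
      have "norm (s *\<^sub>R h) \<le> norm h" using s by (simp add: mult_left_le_one_le)
      then have "dist (w + s *\<^sub>R h) w < d b"
        using h d0(2)[OF b] by (simp add: dist_norm)
      from d(2)[OF this] show "\<bar>(h \<bullet> b) * (D (w + s *\<^sub>R h) b - D w b)\<bar> \<le> norm h * (e / n)"
        using Basis_le_norm[OF b, of h] unfolding abs_mult by (intro mult_mono) auto
    qed
    also have "\<dots> = e * norm h" using n by (simp add: n_def)
    finally show "\<bar>f (w + h) - f w - D w h\<bar> \<le> e * norm h"
      using s(3) by (simp add: g_def)
  qed
qed

lemma smooth_fun_coinduct:
  assumes "P f" and "\<And>f z. P f \<Longrightarrow> f differentiable (at z)"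
    and "\<And>f v. P f \<Longrightarrow> P (\<lambda>z. frechet_derivative f (at z) v)"
  shows "smooth_fun f"
proof -
  have "P (dirderivs vs f)" for vs by (induction vs) (use assms in auto)
  then show ?thesis unfolding smooth_fun_def using assms(2) by blast
qed

lemma smooth_fun_C1:
  assumes "smooth_fun f" shows "C1 f (\<lambda>z. frechet_derivative f (at z))"
  unfolding C1_def
proof (intro conjI allI)
  have d: "dirderivs vs f differentiable (at z)" for vs z using assms by (auto simp: smooth_fun_def)
  show "(f has_derivative frechet_derivative f (at z)) (at z)" for z
    using d[of "[]" z] by (simp add: frechet_derivative_works)
  show "continuous_on UNIV (\<lambda>z. frechet_derivative f (at z) v)" for v
    using d[of "[v]"] by (auto intro!: continuous_at_imp_continuous_on differentiable_imp_continuous_within)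
qed

definition bumpe :: "nat \<Rightarrow> real \<Rightarrow> real" where
  "bumpe m s = (if s \<le> 0 then 0 else exp (- 1 / s) / s ^ m)"

lemma power_le_fact_exp: "x \<ge> 0 \<Longrightarrow> x ^ n \<le> fact n * exp (x::real)"
proof -
  assume x: "x \<ge> 0"
  have "(\<Sum>k<Suc n. x ^ k / fact k) \<le> exp x"
  proof -
    have "(\<lambda>k. x ^ k /\<^sub>R fact k) = (\<lambda>k. x ^ k / fact k)" by (auto simp: divide_inverse mult.commute)
    moreover from this have "summable (\<lambda>k. x ^ k / fact k)" using summable_exp_generic[of x] by simp
    ultimately show ?thesis unfolding exp_def using x by (simp only:) (rule sum_le_suminf, auto)
  qed
  moreover have "x ^ n / fact n \<le> (\<Sum>k<Suc n. x ^ k / fact k)"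
    by (rule member_le_sum[of n "{..<Suc n}" "\<lambda>k. x ^ k / fact k"]) (use x in auto)
  ultimately show ?thesis by (simp add: field_simps)
qed

lemma bumpe_le: "\<bar>bumpe m s\<bar> \<le> fact (m + 2) * s\<^sup>2"
proof (cases "s \<le> 0")
  case False
  then have s: "s > 0" by simp
  have "(1/s) ^ (m+2) \<le> fact (m+2) * exp (1/s)" by (rule power_le_fact_exp) (use s in simp)
  then have "(1/s) ^ (m+2) * s\<^sup>2 / exp (1/s) \<le> fact (m+2) * exp (1/s) * s\<^sup>2 / exp (1/s)"
    by (intro divide_right_mono mult_right_mono) auto
  then have "(1/s) ^ (m+2) * s\<^sup>2 / exp (1/s) \<le> fact (m+2) * s\<^sup>2" by simp
  moreover have "(1/s) ^ (m+2) * s\<^sup>2 / exp (1/s) = exp (-1/s) / s^m"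
    using s by (simp add: exp_minus power_add power2_eq_square divide_simps)
  ultimately have "exp (-1/s) / s^m \<le> fact (m+2) * s\<^sup>2" by simp
  then show ?thesis using s by (simp add: bumpe_def)
qed (simp add: bumpe_def)

lemma bumpe_derivative:
  "(bumpe m has_real_derivative (bumpe (m+2) s - m * bumpe (m+1) s)) (at s)"
proof -
  consider "s < 0" | "s = 0" | "s > 0" by linarith
  then show ?thesis
  proof cases
    case 1
    have "((\<lambda>s. 0) has_real_derivative 0) (at s)" by simp
    then have "(bumpe m has_real_derivative 0) (at s)"
      by (rule has_field_derivative_transform_within_open[of _ _ _ "{..<0}"]) (use 1 in \<open>auto simp: bumpe_def\<close>)
    then show ?thesis using 1 by (simp add: bumpe_def)
  next
    case 2
    have "((\<lambda>y. (bumpe m y - bumpe m 0) / (y - 0)) \<longlongrightarrow> 0) (at 0)"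
    proof (rule Lim_null_comparison)
      show "\<forall>\<^sub>F y in at 0. norm ((bumpe m y - bumpe m 0) / (y - 0)) \<le> fact (m+2) * \<bar>y\<bar>"
      proof (rule always_eventually, rule allI)
        fix y :: real
        show "norm ((bumpe m y - bumpe m 0) / (y - 0)) \<le> fact (m+2) * \<bar>y\<bar>"
        proof (cases "y = 0")
          case False
          then have "\<bar>bumpe m y\<bar> / \<bar>y\<bar> \<le> fact (m+2) * y\<^sup>2 / \<bar>y\<bar>"
            using bumpe_le[of m y] by (intro divide_right_mono) auto
          also have "y\<^sup>2 / \<bar>y\<bar> = \<bar>y\<bar>" using False by (simp add: power2_eq_square field_simps)
          then have "fact (m+2) * y\<^sup>2 / \<bar>y\<bar> = fact (m+2) * \<bar>y\<bar>" by (metis times_divide_eq_right)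
          finally show ?thesis by (simp add: bumpe_def[of m 0])
        qed simp
      qed
      have "((\<lambda>y. fact (m+2) * \<bar>y\<bar>) \<longlongrightarrow> fact (m+2) * \<bar>0::real\<bar>) (at 0)"
        by (intro tendsto_intros)
      then show "((\<lambda>y. fact (m+2) * \<bar>y\<bar>) \<longlongrightarrow> (0::real)) (at 0)" by simp
    qed
    then show ?thesis using 2 by (simp add: has_field_derivative_iff bumpe_def)
  next
    case 3
    have "((\<lambda>s. exp (- 1 / s) / s ^ m) has_real_derivative (bumpe (m+2) s - m * bumpe (m+1) s)) (at s)"
      using 3 by (auto intro!: derivative_eq_intros simp: bumpe_def power2_eq_square)
        (cases m; simp add: field_simps)
    then show ?thesis
      by (rule has_field_derivative_transform_within_open[of _ _ _ "{0<..}"]) (use 3 in \<open>auto simp: bumpe_def\<close>)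
  qed
qed

text \<open>A family closed under directional derivatives that contains the bump function, so that each member is smooth.\<close>

inductive bumpfam :: "'e::euclidean_space \<Rightarrow> real \<Rightarrow> ('e \<Rightarrow> real) \<Rightarrow> bool" for a r where
  base: "bumpfam a r (\<lambda>z. bumpe m (r - (z - a) \<bullet> (z - a)))"
| mul: "bumpfam a r f \<Longrightarrow> bumpfam a r (\<lambda>z. ((z - a) \<bullet> v) * f z)"
| add: "bumpfam a r f \<Longrightarrow> bumpfam a r g \<Longrightarrow> bumpfam a r (\<lambda>z. f z + g z)"
| scale: "bumpfam a r f \<Longrightarrow> bumpfam a r (\<lambda>z. c * f z)"

lemma bumpfam_derivative:
  assumes "bumpfam a r f"
  shows "\<exists>D. (\<forall>z. (f has_derivative D z) (at z)) \<and> (\<forall>v. bumpfam a r (\<lambda>z. D z v))"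
  using assms
proof induction
  case (base m)
  define b where "b k z = bumpe k (r - (z - a) \<bullet> (z - a))" for k z
  have "((\<lambda>z. bumpe m (r - (z - a) \<bullet> (z - a))) has_derivative
      (\<lambda>v. (b (m+2) z - m * b (m+1) z) * (- (2 * ((z - a) \<bullet> v))))) (at z)" for z
  proof -
    have "((\<lambda>z. r - (z - a) \<bullet> (z - a)) has_derivative (\<lambda>v. - (2 * ((z - a) \<bullet> v)))) (at z)"
      by (auto intro!: derivative_eq_intros simp: inner_commute)
    from has_derivative_compose[OF this bumpe_derivative[of m, unfolded has_field_derivative_def]]
    show ?thesis by (simp add: b_def)
  qed
  moreover have "bumpfam a r (\<lambda>z. (b (m+2) z - m * b (m+1) z) * (- (2 * ((z - a) \<bullet> v))))" for v
  proof -
    have "bumpfam a r (\<lambda>z. (-2) * (((z - a) \<bullet> v) * (b (m+2) z + (- real m) * b (m+1) z)))"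
      unfolding b_def by (intro bumpfam.intros)
    then show ?thesis by (simp add: algebra_simps)
  qed
  ultimately show ?case by (intro exI[of _ "\<lambda>z v. (b (m+2) z - m * b (m+1) z) * (- (2 * ((z - a) \<bullet> v)))"]) auto
next
  case (mul f v)
  then obtain D where D: "\<And>z. (f has_derivative D z) (at z)" "\<And>v. bumpfam a r (\<lambda>z. D z v)" by blast
  have "((\<lambda>z. ((z - a) \<bullet> v) * f z) has_derivative (\<lambda>w. ((z - a) \<bullet> v) * D z w + (w \<bullet> v) * f z)) (at z)" for z
    by (auto intro!: derivative_eq_intros D)
  moreover have "bumpfam a r (\<lambda>z. ((z - a) \<bullet> v) * D z w + (w \<bullet> v) * f z)" for w
    by (intro bumpfam.intros D mul)
  ultimately show ?case by (intro exI[of _ "\<lambda>z w. ((z - a) \<bullet> v) * D z w + (w \<bullet> v) * f z"]) auto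
next
  case (add f g)
  then obtain D D' where D: "\<And>z. (f has_derivative D z) (at z)" "\<And>v. bumpfam a r (\<lambda>z. D z v)"
    "\<And>z. (g has_derivative D' z) (at z)" "\<And>v. bumpfam a r (\<lambda>z. D' z v)" by blast
  then show ?case
    by (intro exI[of _ "\<lambda>z w. D z w + D' z w"]) (auto intro!: has_derivative_add bumpfam.intros)
next
  case (scale f c)
  then obtain D where D: "\<And>z. (f has_derivative D z) (at z)" "\<And>v. bumpfam a r (\<lambda>z. D z v)" by blast
  then show ?case
    by (intro exI[of _ "\<lambda>z w. c * D z w"]) (auto intro!: has_derivative_mult_right bumpfam.intros)
qed

lemma bumpfam_smooth: "bumpfam a r f \<Longrightarrow> smooth_fun f"
proof (rule smooth_fun_coinduct[of "bumpfam a r"])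
  fix f v assume "bumpfam a r f"
  then obtain D where D: "\<And>z. (f has_derivative D z) (at z)" "\<And>v. bumpfam a r (\<lambda>z. D z v)"
    using bumpfam_derivative by blast
  then have "frechet_derivative f (at z) = D z" for z by (metis frechet_derivative_at)
  then show "bumpfam a r (\<lambda>z. frechet_derivative f (at z) v)" using D by simp
qed (use bumpfam_derivative differentiableI in blast)+

definition kern :: "real \<Rightarrow> 'e::euclidean_space \<Rightarrow> real" where
  "kern \<epsilon> z = 1 / (\<integral>y. bumpe 0 (\<epsilon>\<^sup>2 - (y::'e) \<bullet> y) \<partial>lborel) * bumpe 0 (\<epsilon>\<^sup>2 - z \<bullet> z)"

lemma kern_reflect_smooth: "smooth_fun (\<lambda>y. kern \<epsilon> (z - y))"
proof -
  have *: "(z - y) \<bullet> (z - y) = (y - z) \<bullet> (y - z)" for y by (simp add: algebra_simps inner_commute)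
  have "bumpfam z (\<epsilon>\<^sup>2) (\<lambda>y. 1 / (\<integral>y. bumpe 0 (\<epsilon>\<^sup>2 - (y::'a) \<bullet> y) \<partial>lborel) * bumpe 0 (\<epsilon>\<^sup>2 - (y - z) \<bullet> (y - z)))"
    by (intro bumpfam.intros)
  then show ?thesis unfolding kern_def * by (rule bumpfam_smooth)
qed

lemma kern_even: "kern \<epsilon> (- z) = kern \<epsilon> z" by (simp add: kern_def)

lemma kern_C1: "\<exists>D. C1 (kern \<epsilon>) D"
proof -
  have "smooth_fun (\<lambda>y::'a. kern \<epsilon> (0 - y))" by (rule kern_reflect_smooth)
  then have "smooth_fun (kern \<epsilon> :: 'a \<Rightarrow> real)" by (simp add: kern_even)
  then show ?thesis using smooth_fun_C1 by blast
qed

lemma kern_nonneg: "kern \<epsilon> z \<ge> 0"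
  unfolding kern_def by (intro mult_nonneg_nonneg divide_nonneg_nonneg integral_nonneg) (auto simp: bumpe_def)

lemma kern_zero: "norm z \<ge> \<epsilon> \<Longrightarrow> \<epsilon> \<ge> 0 \<Longrightarrow> kern \<epsilon> z = 0"
  using power_mono[of \<epsilon> "norm z" 2] by (simp add: kern_def bumpe_def dot_square_norm)

lemma bump_pos_integral:
  assumes "\<epsilon> > 0"
  shows "(\<integral>y. bumpe 0 (\<epsilon>\<^sup>2 - (y::'e::euclidean_space) \<bullet> y) \<partial>lborel) > 0"
    and "integrable lborel (\<lambda>y::'e. bumpe 0 (\<epsilon>\<^sup>2 - y \<bullet> y))"
proof -
  let ?f = "\<lambda>y::'e. bumpe 0 (\<epsilon>\<^sup>2 - y \<bullet> y)"
  have c: "continuous_on UNIV ?f"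
  proof -
    have "continuous_on UNIV (bumpe 0)"
      by (meson DERIV_continuous bumpe_derivative continuous_at_imp_continuous_on)
    then show ?thesis by (rule continuous_on_compose2) (auto intro!: continuous_intros)
  qed
  have nn: "?f y \<ge> 0" for y by (simp add: bumpe_def)
  have z: "?f y = 0" if "y \<notin> cball 0 \<epsilon>" for y
  proof -
    have "\<epsilon>\<^sup>2 \<le> (norm y)\<^sup>2" using that assms by (intro power_mono) auto
    then show ?thesis by (auto simp: bumpe_def dot_square_norm)
  qed
  show I: "integrable lborel ?f" by (rule integrable_cont_compact_support[OF c compact_cball z])
  show "(\<integral>y. ?f y \<partial>lborel) > 0"
  proof (rule ccontr)
    assume "\<not> ?thesis"
    moreover have "(\<integral>y. ?f y \<partial>lborel) \<ge> 0" using nn by simp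
    ultimately have "(\<integral>y. ?f y \<partial>lborel) = 0" by simp
    then have "AE y in lborel. ?f y = 0" using integral_nonneg_eq_0_iff_AE[OF I] nn by simp
    moreover have "?f y \<noteq> 0" if "y \<in> ball 0 \<epsilon>" for y
    proof -
      have "(norm y)\<^sup>2 < \<epsilon>\<^sup>2" using that assms by (intro power_strict_mono) auto
      then show ?thesis by (auto simp: bumpe_def dot_square_norm)
    qed
    ultimately have "AE y in lborel. y \<notin> ball (0::'e) \<epsilon>" by (auto elim!: eventually_mono)
    then have "emeasure lborel (ball (0::'e) \<epsilon>) = 0" by (subst (asm) AE_iff_measurable[of "ball 0 \<epsilon>"]) auto
    moreover have "measure lborel (ball (0::'e) \<epsilon>) > 0" using assms content_ball_pos by blast
    ultimately show False by (simp add: measure_def)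
  qed
qed

lemma kern_integral:
  assumes "\<epsilon> > 0"
  shows "integrable lborel (kern \<epsilon> :: 'e::euclidean_space \<Rightarrow> real)" "(\<integral>z. kern \<epsilon> (z::'e) \<partial>lborel) = 1"
  using bump_pos_integral[OF assms, where 'e='e] unfolding kern_def by auto

lemma kern_measurable[measurable]: "kern \<epsilon> \<in> borel_measurable borel"
  using kern_C1[of \<epsilon>] C1_cont borel_measurable_continuous_onI by blast

lemma kern_bounded: "\<epsilon> > 0 \<Longrightarrow> \<exists>B>0. \<forall>z::'e::euclidean_space. \<bar>kern \<epsilon> z\<bar> \<le> B"
proof -
  assume e: "\<epsilon> > 0"
  obtain D where "C1 (kern \<epsilon> :: 'e \<Rightarrow> real) D" using kern_C1 by blast
  then show ?thesis
    by (intro cont_compact_support_bounded[OF C1_cont compact_cball[of 0 \<epsilon>]]) (use e in \<open>auto intro!: kern_zero\<close>)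
qed

lemma kern_test_fun:
  assumes "\<epsilon> > 0" "cball z \<epsilon> \<subseteq> U"
  shows "test_fun U (\<lambda>y. kern \<epsilon> (z - y))"
proof -
  have "{y. kern \<epsilon> (z - y) \<noteq> 0} \<subseteq> cball z \<epsilon>"
    using kern_zero[of \<epsilon> "z - y" for y] assms(1) by (force simp: dist_norm)
  then have *: "closure {y. kern \<epsilon> (z - y) \<noteq> 0} \<subseteq> cball z \<epsilon>" by (simp add: closure_minimal)
  then show ?thesis unfolding test_fun_def
    using kern_reflect_smooth assms(2) compact_Int_closed[OF compact_cball closed_closure, of z \<epsilon>]
    by (metis Int_absorb1 order_trans)
qed

section \<open>Mollification of integrable functions\<close>

lemma finite_measure_compact_inside:
  fixes A :: "'e::euclidean_space set"
  assumes A: "A \<in> sets borel" "emeasure lborel A < \<infinity>" and e: "e > 0"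
  obtains C where "compact C" "C \<subseteq> A" "emeasure lborel (A - C) < ennreal e"
proof -
  define M where "M = density lborel (indicator A :: 'e \<Rightarrow> ennreal)"
  have M: "emeasure M X = emeasure lborel (A \<inter> X)" if "X \<in> sets borel" for X
    unfolding M_def using that A by (simp add: emeasure_density indicator_inter_arith[symmetric])
  have MA: "emeasure M A = emeasure lborel A" using M[of A] A by simp
  have "emeasure M A = (SUP K \<in> {K. K \<subseteq> A \<and> compact K}. emeasure M K)"
    by (rule inner_regular) (use A M[of UNIV] in \<open>auto simp: M_def\<close>)
  then have S: "(SUP K \<in> {K. K \<subseteq> A \<and> compact K}. emeasure M K) = emeasure M A" by simp
  have "\<exists>K. K \<subseteq> A \<and> compact K \<and> emeasure M A < emeasure M K + ennreal e"
  proof (rule ccontr)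
    assume "\<not> ?thesis"
    then have "(SUP K \<in> {K. K \<subseteq> A \<and> compact K}. emeasure M K + ennreal e) \<le> emeasure M A"
      by (intro SUP_least) (auto simp: not_less)
    moreover have "(SUP K \<in> {K. K \<subseteq> A \<and> compact K}. emeasure M K + ennreal e) = emeasure M A + ennreal e"
      unfolding S[symmetric] by (rule ennreal_SUP_add_left) auto
    moreover have "emeasure M A < emeasure M A + ennreal e" using MA A e
      by (simp add: ennreal_less_top less_top[symmetric] ennreal_add_left_cancel_less[of "emeasure M A" 0, simplified])
    ultimately show False by simp
  qed
  then obtain K where K: "K \<subseteq> A" "compact K" "emeasure M A < emeasure M K + ennreal e" by blast
  have Kb: "K \<in> sets borel" using K(2) borel_compact by blast
  have "emeasure M K = emeasure lborel K" using M[OF Kb] K by (simp add: Int_absorb1)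
  moreover have "emeasure lborel A = emeasure lborel K + emeasure lborel (A - K)"
    using K(1) Kb A by (subst plus_emeasure) (auto simp: Un_absorb1)
  ultimately have "emeasure lborel K + emeasure lborel (A - K) < emeasure lborel K + ennreal e"
    using K(3) MA by simp
  moreover have "emeasure lborel K \<noteq> \<infinity>"
    using emeasure_mono[of K A lborel] K(1) A by (auto simp: top_unique)
  ultimately have "emeasure lborel (A - K) < ennreal e"
    by (simp add: ennreal_add_left_cancel_less)
  then show ?thesis using that K by blast
qed

lemma translation_continuous_L1:
  fixes f :: "'e::euclidean_space \<Rightarrow> 'b::{banach,second_countable_topology}"
  assumes "integrable lborel f"
  shows "\<forall>e>0. \<exists>d>0. \<forall>h. norm h < d \<longrightarrow> (\<integral>z. norm (f (z + h) - f z) \<partial>lborel) \<le> e"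
  using assms
proof (induct rule: integrable_induct)
  case (base A c)
  have A[measurable]: "A \<in> sets borel" using base by simp
  show ?case
  proof (intro allI impI)
    fix e :: real assume e: "e > 0"
    define e' where "e' = e / (norm c + 1) / 4"
    have e': "e' > 0" unfolding e'_def using e by (simp add: add_nonneg_pos)
    obtain U where U: "open U" "A \<subseteq> U" "emeasure lborel (U - A) < ennreal e'"
      using outer_regular_lborel[OF A e'] by blast
    obtain C where C: "compact C" "C \<subseteq> A" "emeasure lborel (A - C) < ennreal e'"
      using finite_measure_compact_inside[OF A base(2) e'] by blast
    have Cb[measurable]: "C \<in> sets borel" using C borel_compact by blast
    have Ub[measurable]: "U \<in> sets borel" using U(1) by (rule borel_open)
    define V where "V = U - C"
    have Vb[measurable]: "V \<in> sets borel" unfolding V_def by measurable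
    have "V = (U - A) \<union> (A - C)" using U C by (auto simp: V_def)
    then have "emeasure lborel V \<le> emeasure lborel (U - A) + emeasure lborel (A - C)"
      using emeasure_subadditive[of "U - A" lborel "A - C"] by auto
    also have "\<dots> \<le> ennreal e' + ennreal e'" using U C by (intro add_mono) auto
    also have "\<dots> = ennreal (2 * e')" using e' by (simp flip: ennreal_plus)
    finally have Vm: "emeasure lborel V \<le> ennreal (2 * e')" .
    then have Vf: "emeasure lborel V < \<infinity>" using le_less_trans ennreal_less_top by (auto simp: top_unique less_top[symmetric])
    have Vmeas: "measure lborel V \<le> 2 * e'" unfolding measure_def
      using Vm e' by (intro enn2real_leI) auto
    have "compact C" "closed (- U)" "C \<inter> - U = {}" using U C by auto
    then obtain d where d: "d > 0" "\<forall>x\<in>C. \<forall>y\<in>-U. d \<le> dist x y"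
      using separate_compact_closed[of C "-U"] by blast
    show "\<exists>d>0. \<forall>h. norm h < d \<longrightarrow> (\<integral>z. norm (indicator A (z + h) *\<^sub>R c - indicator A z *\<^sub>R c) \<partial>lborel) \<le> e"
    proof (intro exI[of _ d] conjI allI impI d)
      fix h :: 'e assume h: "norm h < d"
      have inU: "x + h \<in> U" "x - h \<in> U" if "x \<in> C" for x
        using d(2) that h by (force simp: dist_norm)+
      have pt: "norm (indicator A (z + h) *\<^sub>R c - indicator A z *\<^sub>R c) \<le> norm c * (indicator V z + indicator V (z + h))" for z
        using inU(1)[of z] inU(2)[of "z + h"] C U by (auto simp: indicator_def V_def)
      have iV: "integrable lborel (indicator V :: 'e \<Rightarrow> real)" using Vf by (intro integrable_real_indicator) auto
      have iV': "integrable lborel (\<lambda>z. indicator V (z + h) :: real)"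
        using lborel_integrable_translation[OF iV] by simp
      have "(\<integral>z. norm (indicator A (z + h) *\<^sub>R c - indicator A z *\<^sub>R c) \<partial>lborel)
         \<le> (\<integral>z. norm c * (indicator V z + indicator V (z + h)) \<partial>lborel)"
        by (rule integral_mono') (use pt iV iV' in auto)
      also have "\<dots> = norm c * (measure lborel V + measure lborel V)"
        using iV iV' lborel_integral_translation[of "indicator V :: 'e \<Rightarrow> real" h] by simp
      also have "\<dots> \<le> norm c * (4 * e')" using Vmeas by (intro mult_left_mono) auto
      also have "\<dots> = e * (norm c / (norm c + 1))"
      proof -
        have "e / (norm c + 1) = 4 * e'"
        proof -
          have "q = 4 * (q / 4)" for q :: real by simp
          then show ?thesis unfolding e'_def .
        qed
        then show ?thesis by (simp only: times_divide_eq_right mult.commute[of "norm c" e] flip: \<open>e / (norm c + 1) = 4 * e'\<close>)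
      qed
      also have "\<dots> \<le> e * 1" using e by (intro mult_left_mono) (auto simp: divide_le_eq add_nonneg_pos)
      also have "\<dots> = e" by simp
      finally show "(\<integral>z. norm (indicator A (z + h) *\<^sub>R c - indicator A z *\<^sub>R c) \<partial>lborel) \<le> e" .
    qed
  qed
next
  case (add f g)
  show ?case
  proof (intro allI impI)
    fix e :: real assume e: "e > 0"
    then have e2: "e/2 > 0" by simp
    obtain d1 where d1: "d1 > 0" "\<And>h. norm h < d1 \<Longrightarrow> (\<integral>z. norm (f (z + h) - f z) \<partial>lborel) \<le> e/2"
      using add(2) e2 by blast
    obtain d2 where d2: "d2 > 0" "\<And>h. norm h < d2 \<Longrightarrow> (\<integral>z. norm (g (z + h) - g z) \<partial>lborel) \<le> e/2"
      using add(4) e2 by blast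
    show "\<exists>d>0. \<forall>h. norm h < d \<longrightarrow> (\<integral>z. norm (f (z + h) + g (z + h) - (f z + g z)) \<partial>lborel) \<le> e"
    proof (intro exI[of _ "min d1 d2"] conjI allI impI)
      fix h :: 'e assume h: "norm h < min d1 d2"
      note i = lborel_integrable_translation[OF add(1), of h] lborel_integrable_translation[OF add(3), of h] add(1,3)
      have "(\<integral>z. norm (f (z + h) + g (z + h) - (f z + g z)) \<partial>lborel)
        \<le> (\<integral>z. norm (f (z + h) - f z) + norm (g (z + h) - g z) \<partial>lborel)"
        by (rule integral_mono') (use i in \<open>auto intro!: integrable_add integrable_norm integrable_diff norm_diff_triangle_ineq\<close>)
      also have "\<dots> = (\<integral>z. norm (f (z + h) - f z) \<partial>lborel) + (\<integral>z. norm (g (z + h) - g z) \<partial>lborel)"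
        using i by (intro Bochner_Integration.integral_add) auto
      also have "\<dots> \<le> e" using d1(2)[of h] d2(2)[of h] h by simp
      finally show "(\<integral>z. norm (f (z + h) + g (z + h) - (f z + g z)) \<partial>lborel) \<le> e" .
    qed (use d1 d2 in auto)
  qed
next
  case (lim f s)
  show ?case
  proof (intro allI impI)
    fix e :: real assume e: "e > 0"
    have [measurable]: "f \<in> borel_measurable borel" "\<And>i. s i \<in> borel_measurable borel" using lim(1,5) by auto
    have "(\<lambda>i. \<integral>z. norm (s i z - f z) \<partial>lborel) \<longlonglongrightarrow> (\<integral>z. 0 \<partial>(lborel::'e measure))"
    proof (rule integral_dominated_convergence[where w="\<lambda>z. 3 * norm (f z)"])
      show "AE z in lborel. (\<lambda>i. norm (s i z - f z)) \<longlonglongrightarrow> 0"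
      proof (rule AE_I2)
        fix z
        have "(\<lambda>i. s i z - f z) \<longlonglongrightarrow> f z - f z" using lim(3)[of z] by (intro tendsto_intros) auto
        then show "(\<lambda>i. norm (s i z - f z)) \<longlonglongrightarrow> 0" using tendsto_norm_zero by force
      qed
      show "AE z in lborel. norm (norm (s i z - f z)) \<le> 3 * norm (f z)" for i
      proof (rule AE_I2)
        fix z show "norm (norm (s i z - f z)) \<le> 3 * norm (f z)"
          using norm_triangle_ineq4[of "s i z" "f z"] lim(4)[of z i] by simp
      qed
    qed (use lim(5) in auto)
    then have "\<forall>\<^sub>F i in sequentially. (\<integral>z. norm (s i z - f z) \<partial>lborel) < e/3"
      using e by (intro order_tendstoD(2)) auto
    then obtain i where i: "(\<integral>z. norm (s i z - f z) \<partial>lborel) < e/3"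
      using eventually_happens'[OF sequentially_bot] by blast
    obtain d where d: "d > 0" "\<And>h. norm h < d \<Longrightarrow> (\<integral>z. norm (s i (z + h) - s i z) \<partial>lborel) \<le> e/3"
      using lim(2)[of i] e by (metis divide_pos_pos zero_less_numeral)
    show "\<exists>d>0. \<forall>h. norm h < d \<longrightarrow> (\<integral>z. norm (f (z + h) - f z) \<partial>lborel) \<le> e"
    proof (intro exI[of _ d] conjI allI impI d(1))
      fix h :: 'e assume h: "norm h < d"
      note I = lborel_integrable_translation[OF lim(5), of h] lborel_integrable_translation[OF lim(1), of i h] lim(1)[of i] lim(5)
      have "norm (f (z + h) - f z) \<le> norm (s i (z + h) - f (z + h)) + norm (s i (z + h) - s i z) + norm (s i z - f z)" for z
      proof -
        have "f (z + h) - f z = - (s i (z + h) - f (z + h)) + (s i (z + h) - s i z) + (s i z - f z)" by simp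
        then show ?thesis by (metis (no_types, lifting) norm_triangle_mono norm_minus_cancel order_refl)
      qed
      then have "(\<integral>z. norm (f (z + h) - f z) \<partial>lborel)
        \<le> (\<integral>z. norm (s i (z + h) - f (z + h)) + norm (s i (z + h) - s i z) + norm (s i z - f z) \<partial>lborel)"
        by (intro integral_mono') (use I in \<open>auto intro!: integrable_add integrable_norm integrable_diff\<close>)
      also have "\<dots> = (\<integral>z. norm (s i (z + h) - f (z + h)) \<partial>lborel) + (\<integral>z. norm (s i (z + h) - s i z) \<partial>lborel) + (\<integral>z. norm (s i z - f z) \<partial>lborel)"
        using I by (subst Bochner_Integration.integral_add, simp, simp, subst Bochner_Integration.integral_add) auto
      also have "(\<integral>z. norm (s i (z + h) - f (z + h)) \<partial>lborel) = (\<integral>z. norm (s i z - f z) \<partial>lborel)"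
        by (rule lborel_integral_translation[of "\<lambda>z. norm (s i z - f z)"]) measurable
      also have "(\<integral>z. norm (s i z - f z) \<partial>lborel) + (\<integral>z. norm (s i (z + h) - s i z) \<partial>lborel) + (\<integral>z. norm (s i z - f z) \<partial>lborel) \<le> e"
        using i d(2)[OF h] by simp
      finally show "(\<integral>z. norm (f (z + h) - f z) \<partial>lborel) \<le> e" .
    qed
  qed
qed

lemma kernel_average_L1:
  fixes f :: "'e::euclidean_space \<Rightarrow> 'b::{banach,second_countable_topology}"
  assumes f: "integrable lborel f" and e: "e > 0"
  obtains d where "d > 0"
    "\<And>\<kappa>. \<kappa> \<in> borel_measurable borel \<Longrightarrow> (\<And>h. \<kappa> h \<noteq> 0 \<Longrightarrow> norm h < d) \<Longrightarrow> (\<integral>\<^sup>+h. \<kappa> h \<partial>lborel) \<le> 1 \<Longrightarrow>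
       (\<integral>\<^sup>+z. (\<integral>\<^sup>+h. \<kappa> h * ennreal (norm (f (z + h) - f z)) \<partial>lborel) \<partial>lborel) \<le> ennreal e"
proof -
  obtain d where d: "d > 0" "\<And>h. norm h < d \<Longrightarrow> (\<integral>z. norm (f (z + h) - f z) \<partial>lborel) \<le> e"
    using translation_continuous_L1[OF f] e by blast
  have [measurable]: "f \<in> borel_measurable borel" using f by auto
  show ?thesis
  proof (rule that[OF d(1)])
    fix \<kappa> :: "'e \<Rightarrow> ennreal" assume [measurable]: "\<kappa> \<in> borel_measurable borel"
      and \<kappa>: "\<And>h. \<kappa> h \<noteq> 0 \<Longrightarrow> norm h < d" "(\<integral>\<^sup>+h. \<kappa> h \<partial>lborel) \<le> 1"
    have "(\<integral>\<^sup>+z. (\<integral>\<^sup>+h. \<kappa> h * ennreal (norm (f (z + h) - f z)) \<partial>lborel) \<partial>lborel)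
       = (\<integral>\<^sup>+h. (\<integral>\<^sup>+z. \<kappa> h * ennreal (norm (f (z + h) - f z)) \<partial>lborel) \<partial>lborel)"
      by (rule lborel_pair.Fubini') measurable
    also have "\<dots> \<le> (\<integral>\<^sup>+h. \<kappa> h * ennreal e \<partial>lborel)"
    proof (rule nn_integral_mono)
      fix h :: 'e
      have "(\<integral>\<^sup>+z. ennreal (norm (f (z + h) - f z)) \<partial>lborel) \<le> ennreal e" if "norm h < d"
        using d(2)[OF that] lborel_integrable_translation[OF f, of h] f e
        by (subst nn_integral_eq_integral) auto
      then show "(\<integral>\<^sup>+z. \<kappa> h * ennreal (norm (f (z + h) - f z)) \<partial>lborel) \<le> \<kappa> h * ennreal e"
        using \<kappa>(1)[of h] by (cases "\<kappa> h = 0") (auto simp: nn_integral_cmult intro!: mult_left_mono)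
    qed
    also have "\<dots> \<le> 1 * ennreal e" using \<kappa>(2) by (subst nn_integral_multc) (simp, rule mult_right_mono, auto)
    finally show "(\<integral>\<^sup>+z. (\<integral>\<^sup>+h. \<kappa> h * ennreal (norm (f (z + h) - f z)) \<partial>lborel) \<partial>lborel) \<le> ennreal e" by simp
  qed
qed

definition moll :: "real \<Rightarrow> ('e::euclidean_space \<Rightarrow> 'b::{banach,second_countable_topology}) \<Rightarrow> 'e \<Rightarrow> 'b" where
  "moll \<epsilon> f z = (\<integral>y. kern \<epsilon> (z - y) *\<^sub>R f y \<partial>lborel)"

lemma kern_scaleR_integrable:
  fixes f :: "'e::euclidean_space \<Rightarrow> 'b::{banach,second_countable_topology}"
  assumes f: "integrable lborel f" and \<epsilon>: "\<epsilon> > 0"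
  shows "integrable lborel (\<lambda>y. kern \<epsilon> (z - y) *\<^sub>R f y)" "integrable lborel (\<lambda>h. kern \<epsilon> h *\<^sub>R f (z + h))"
proof -
  have [measurable]: "f \<in> borel_measurable borel" using f by auto
  obtain B where B: "B > 0" "\<And>z::'e. \<bar>kern \<epsilon> z\<bar> \<le> B" using kern_bounded[OF \<epsilon>] by blast
  show "integrable lborel (\<lambda>y. kern \<epsilon> (z - y) *\<^sub>R f y)"
    by (rule Bochner_Integration.integrable_bound[of _ "\<lambda>y. B *\<^sub>R f y"]) (use f B in \<open>auto intro!: mult_right_mono\<close>)
  have "integrable lborel (\<lambda>h. f (z + h))" using lborel_integrable_translation[OF f, of z] by (simp add: add.commute)
  then show "integrable lborel (\<lambda>h. kern \<epsilon> h *\<^sub>R f (z + h))"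
    by (rule Bochner_Integration.integrable_bound[of _ "\<lambda>y. B *\<^sub>R f (z + y)", OF integrable_scaleR_right]) (use B in \<open>auto intro!: mult_right_mono\<close>)
qed

lemma moll_shift:
  fixes f :: "'e::euclidean_space \<Rightarrow> 'b::{banach,second_countable_topology}"
  assumes [measurable]: "f \<in> borel_measurable borel"
  shows "moll \<epsilon> f z = (\<integral>h. kern \<epsilon> h *\<^sub>R f (z + h) \<partial>lborel)"
proof -
  have "(\<integral>y. kern \<epsilon> (z - y) *\<^sub>R f y \<partial>lborel) = (\<integral>y. kern \<epsilon> (z - (y + z)) *\<^sub>R f (y + z) \<partial>lborel)"
    by (rule lborel_integral_translation[symmetric]) measurable
  then show ?thesis by (simp add: moll_def kern_even add.commute)
qed

lemma moll_measurable[measurable]: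
  fixes f :: "'e::euclidean_space \<Rightarrow> 'b::{banach,second_countable_topology}"
  assumes [measurable]: "f \<in> borel_measurable borel"
  shows "moll \<epsilon> f \<in> borel_measurable borel"
proof -
  have "(\<lambda>(z, y). kern \<epsilon> (z - y) *\<^sub>R f y) \<in> borel_measurable (borel \<Otimes>\<^sub>M lborel)" by measurable
  then show ?thesis unfolding moll_def by (rule lborel.borel_measurable_lebesgue_integral)
qed

lemma moll_L1:
  fixes f :: "'e::euclidean_space \<Rightarrow> 'b::{banach,second_countable_topology}"
  assumes f: "integrable lborel f" and e: "e > 0"
  obtains d where "d > 0" "\<And>\<epsilon>. 0 < \<epsilon> \<Longrightarrow> \<epsilon> < d \<Longrightarrow> (\<integral>\<^sup>+z. norm (moll \<epsilon> f z - f z) \<partial>lborel) \<le> ennreal e"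
proof -
  have [measurable]: "f \<in> borel_measurable borel" using f by auto
  obtain d where d: "d > 0" "\<And>\<kappa>. \<kappa> \<in> borel_measurable borel \<Longrightarrow> (\<And>h. \<kappa> h \<noteq> 0 \<Longrightarrow> norm h < d) \<Longrightarrow> (\<integral>\<^sup>+h. \<kappa> h \<partial>lborel) \<le> 1 \<Longrightarrow>
       (\<integral>\<^sup>+z. (\<integral>\<^sup>+h. \<kappa> h * ennreal (norm (f (z + h) - f z)) \<partial>lborel) \<partial>lborel) \<le> ennreal e"
    using kernel_average_L1[OF f e] by blast
  show ?thesis
  proof (rule that[OF d(1)])
    fix \<epsilon> :: real assume \<epsilon>: "0 < \<epsilon>" "\<epsilon> < d"
    have "(\<integral>\<^sup>+z. norm (moll \<epsilon> f z - f z) \<partial>lborel)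
       \<le> (\<integral>\<^sup>+z. (\<integral>\<^sup>+h. ennreal (kern \<epsilon> h) * ennreal (norm (f (z + h) - f z)) \<partial>lborel) \<partial>lborel)"
    proof (rule nn_integral_mono)
      fix z :: 'e
      have "f z = (\<integral>h. kern \<epsilon> (h::'e) *\<^sub>R f z \<partial>lborel)" using kern_integral[OF \<epsilon>(1), where 'e='e] by simp
      then have "moll \<epsilon> f z - f z = (\<integral>h. kern \<epsilon> h *\<^sub>R f (z + h) \<partial>lborel) - (\<integral>h. kern \<epsilon> (h::'e) *\<^sub>R f z \<partial>lborel)"
        by (simp add: moll_shift)
      also have "\<dots> = (\<integral>h. kern \<epsilon> h *\<^sub>R (f (z + h) - f z) \<partial>lborel)"
        using kern_scaleR_integrable[OF f \<epsilon>(1)] kern_integral[OF \<epsilon>(1), where 'e='e]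
        by (subst Bochner_Integration.integral_diff[symmetric]) (auto simp: scaleR_diff_right)
      finally have eq: "moll \<epsilon> f z - f z = (\<integral>h. kern \<epsilon> h *\<^sub>R (f (z + h) - f z) \<partial>lborel)" .
      have "integrable lborel (\<lambda>h. kern \<epsilon> h *\<^sub>R (f (z + h) - f z))"
        using kern_scaleR_integrable[OF f \<epsilon>(1)] kern_integral[OF \<epsilon>(1), where 'e='e]
        by (auto simp: scaleR_diff_right)
      then have "ennreal (norm (moll \<epsilon> f z - f z)) \<le> (\<integral>\<^sup>+h. norm (kern \<epsilon> h *\<^sub>R (f (z + h) - f z)) \<partial>lborel)"
        unfolding eq by (rule integral_norm_bound_ennreal)
      then show "ennreal (norm (moll \<epsilon> f z - f z)) \<le> (\<integral>\<^sup>+h. ennreal (kern \<epsilon> h) * ennreal (norm (f (z + h) - f z)) \<partial>lborel)"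
        by (simp add: kern_nonneg ennreal_mult)
    qed
    also have "\<dots> \<le> ennreal e"
    proof (rule d(2))
      show "norm h < d" if "ennreal (kern \<epsilon> h) \<noteq> 0" for h :: 'e
        using kern_zero[of \<epsilon> h] that \<epsilon> by force
      show "(\<integral>\<^sup>+h. ennreal (kern \<epsilon> (h::'e)) \<partial>lborel) \<le> 1"
        using kern_integral[OF \<epsilon>(1), where 'e='e] by (subst nn_integral_eq_integral) (auto simp: kern_nonneg)
    qed measurable
    finally show "(\<integral>\<^sup>+z. norm (moll \<epsilon> f z - f z) \<partial>lborel) \<le> ennreal e" .
  qed
qed

lemma fast_L1_convergence:
  fixes f :: "'e::euclidean_space \<Rightarrow> 'b::{banach,second_countable_topology}"
  assumes f: "integrable lborel f" and s[measurable]: "\<And>n. s n \<in> borel_measurable borel"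
    and fast: "\<And>n. (\<integral>\<^sup>+z. norm (s n z - f z) \<partial>lborel) \<le> ennreal ((1/2) ^ n)"
  shows "AE z in lborel. (\<lambda>n. s n z) \<longlonglongrightarrow> f z"
    and "\<exists>H. integrable lborel H \<and> (\<forall>z. 0 \<le> H z) \<and> (AE z in lborel. \<forall>n. norm (s n z) \<le> H z)"
proof -
  have [measurable]: "f \<in> borel_measurable borel" using f by auto
  define G where "G z = (\<Sum>n. ennreal (norm (s n z - f z)))" for z
  have [measurable]: "G \<in> borel_measurable borel" unfolding G_def by measurable
  have "(\<integral>\<^sup>+z. G z \<partial>lborel) = (\<Sum>n. (\<integral>\<^sup>+z. norm (s n z - f z) \<partial>lborel))"
    unfolding G_def by (rule nn_integral_suminf) measurable
  also have "\<dots> \<le> (\<Sum>n. ennreal ((1/2) ^ n))" by (intro suminf_le fast) auto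
  also have "\<dots> = ennreal (\<Sum>n. (1/2) ^ n)" by (rule suminf_ennreal2) (auto simp: summable_geometric)
  also have "\<dots> < \<infinity>" by simp
  finally have Gf: "(\<integral>\<^sup>+z. G z \<partial>lborel) < \<infinity>" .
  then have AEG: "AE z in lborel. G z < \<infinity>" by (intro finite_nn_integral_imp_ae_finite) auto
  have sm: "summable (\<lambda>n. norm (s n z - f z))" if "G z < \<infinity>" for z
    using that unfolding G_def by (intro summable_suminf_not_top) auto
  show "AE z in lborel. (\<lambda>n. s n z) \<longlonglongrightarrow> f z"
    using AEG
  proof (rule AE_mp, intro AE_I2 impI)
    fix z assume "G z < \<infinity>"
    from summable_LIMSEQ_zero[OF sm[OF this]]
    have "(\<lambda>n. s n z - f z) \<longlonglongrightarrow> 0" by (rule tendsto_norm_zero_cancel)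
    then show "(\<lambda>n. s n z) \<longlonglongrightarrow> f z" by (rule LIM_zero_cancel)
  qed
  have iG: "integrable lborel (\<lambda>z. enn2real (G z))"
  proof (rule integrableI_nonneg)
    have "(\<integral>\<^sup>+z. ennreal (enn2real (G z)) \<partial>lborel) = (\<integral>\<^sup>+z. G z \<partial>lborel)"
      by (rule nn_integral_cong_AE) (use AEG in \<open>auto elim!: eventually_mono\<close>)
    then show "(\<integral>\<^sup>+z. ennreal (enn2real (G z)) \<partial>lborel) < \<infinity>" using Gf by simp
  qed auto
  have "AE z in lborel. \<forall>n. norm (s n z) \<le> norm (f z) + enn2real (G z)"
    using AEG
  proof (rule AE_mp, intro AE_I2 impI allI)
    fix z n assume G: "G z < \<infinity>"
    have "ennreal (norm (s n z - f z)) \<le> G z" unfolding G_def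
      by (rule order_trans[OF _ sum_le_suminf[OF summableI, of "{n}"]]) simp_all
    then have "norm (s n z - f z) \<le> enn2real (G z)"
      using G enn2real_mono[of "ennreal (norm (s n z - f z))" "G z"] by simp
    then show "norm (s n z) \<le> norm (f z) + enn2real (G z)"
      using norm_triangle_sub[of "s n z" "f z"] by simp
  qed
  then show "\<exists>H. integrable lborel H \<and> (\<forall>z. 0 \<le> H z) \<and> (AE z in lborel. \<forall>n. norm (s n z) \<le> H z)"
    using iG f by (intro exI[of _ "\<lambda>z. norm (f z) + enn2real (G z)"]) auto
qed

lemma powr_above_tangent:
  fixes a t q :: real
  assumes "a \<ge> 0" "t \<ge> 0" "q \<ge> 1"
  shows "t powr q \<ge> a powr q + q * a powr (q - 1) * (t - a)"
proof (cases "a = 0 \<or> t = 0")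
  case True
  then show ?thesis
  proof
    assume "t = 0"
    have "a powr q = a * a powr (q - 1)" using assms by (simp add: powr_mult_base)
    moreover have "a * a powr (q - 1) \<le> q * (a * a powr (q - 1))"
      using assms by (simp add: mult_le_cancel_right1 mult_less_0_iff not_less)
    ultimately show ?thesis using \<open>t = 0\<close> assms by (simp add: algebra_simps)
  qed (use assms in auto)
next
  case False
  then have a: "a > 0" "t > 0" using assms by auto
  have "t powr q - a powr q \<ge> (q * a powr (q - 1)) * (t - a)"
  proof (rule convex_on_imp_above_tangent[of "{0<..}"])
    show "convex_on {0<..} (\<lambda>x. x powr q)" using assms by (intro powr_convex)
    show "((\<lambda>x. x powr q) has_real_derivative q * a powr (q - 1)) (at a within {0<..})"
      using a by (auto intro!: derivative_eq_intros)
  qed (use a in \<open>auto simp: interior_open\<close>)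
  then show ?thesis by simp
qed

lemma moll_Jensen:
  fixes f :: "'e::euclidean_space \<Rightarrow> 'b::{banach,second_countable_topology}"
  assumes f: "integrable lborel f" and fq: "integrable lborel (\<lambda>z. norm (f z) powr q)"
    and q: "q \<ge> 1" and \<epsilon>: "\<epsilon> > 0"
  shows "norm (moll \<epsilon> f z) powr q \<le> moll \<epsilon> (\<lambda>z. norm (f z) powr q) z"
proof -
  have [measurable]: "f \<in> borel_measurable borel" using f by auto
  note k = kern_integral[OF \<epsilon>, where 'e='e]
  define a where "a = (\<integral>h. kern \<epsilon> h * norm (f (z + h)) \<partial>lborel)"
  have i1: "integrable lborel (\<lambda>h. kern \<epsilon> h * norm (f (z + h)))"
    using kern_scaleR_integrable(2)[OF integrable_norm[OF f] \<epsilon>] by simp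
  have i2: "integrable lborel (\<lambda>h. kern \<epsilon> h * norm (f (z + h)) powr q)"
    using kern_scaleR_integrable(2)[OF fq \<epsilon>] by simp
  have a0: "a \<ge> 0" unfolding a_def by (intro Bochner_Integration.integral_nonneg mult_nonneg_nonneg kern_nonneg) auto
  have "norm (moll \<epsilon> f z) \<le> (\<integral>h. norm (kern \<epsilon> h *\<^sub>R f (z + h)) \<partial>lborel)"
    unfolding moll_shift[OF \<open>f \<in> borel_measurable borel\<close>] by (rule integral_norm_bound)
  then have "norm (moll \<epsilon> f z) \<le> a" by (simp add: a_def kern_nonneg)
  then have "norm (moll \<epsilon> f z) powr q \<le> a powr q" using q by (intro powr_mono2) auto
  also have "a powr q = (\<integral>h. kern \<epsilon> h * a powr q + (q * a powr (q - 1)) * (kern \<epsilon> h * norm (f (z + h)) - a * kern \<epsilon> h) \<partial>lborel)"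
    using k i1 by (simp add: a_def[symmetric])
  also have "\<dots> \<le> (\<integral>h. kern \<epsilon> h * norm (f (z + h)) powr q \<partial>lborel)"
  proof (rule integral_mono)
    fix h
    have "kern \<epsilon> h * (a powr q + q * a powr (q - 1) * (norm (f (z + h)) - a)) \<le> kern \<epsilon> h * norm (f (z + h)) powr q"
      using powr_above_tangent[OF a0 _ q, of "norm (f (z + h))"] by (intro mult_left_mono kern_nonneg) auto
    then show "kern \<epsilon> h * a powr q + (q * a powr (q - 1)) * (kern \<epsilon> h * norm (f (z + h)) - a * kern \<epsilon> h) \<le> kern \<epsilon> h * norm (f (z + h)) powr q"
      by (simp add: algebra_simps)
  qed (use k i1 i2 in auto)
  also have "\<dots> = moll \<epsilon> (\<lambda>z. norm (f z) powr q) z" by (simp add: moll_shift)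
  finally show ?thesis .
qed

lemma moll_C1:
  fixes f :: "'e::euclidean_space \<Rightarrow> real"
  assumes f: "integrable lborel f" and \<epsilon>: "\<epsilon> > 0"
  shows "C1 (moll \<epsilon> f) (\<lambda>z v. - (\<integral>y. frechet_derivative (\<lambda>y. kern \<epsilon> (z - y)) (at y) v * f y \<partial>lborel))"
proof -
  have [measurable]: "f \<in> borel_measurable borel" using f by auto
  obtain D where D: "C1 (kern \<epsilon> :: 'e \<Rightarrow> real) D" using kern_C1 by blast
  have K: "compact (cball (0::'e) \<epsilon>)" "kern \<epsilon> z = 0" if "z \<notin> cball 0 \<epsilon>" for z :: 'e
    using that \<epsilon> by (auto intro!: kern_zero)
  have K2: "kern \<epsilon> z = 0" if "z \<notin> cball 0 \<epsilon>" for z :: 'e using K that by blast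
  have D0: "D z v = 0" if "z \<notin> cball 0 \<epsilon>" for z v
    by (rule C1_D_zero[OF D closed_cball K2 that])
  have fre: "frechet_derivative (\<lambda>y. kern \<epsilon> (z - y)) (at y) v = - D (z - y) v" for z y v
  proof -
    have "((\<lambda>y. z - y) has_derivative (\<lambda>v. - v)) (at y)" by (auto intro!: derivative_eq_intros)
    from has_derivative_compose[OF this C1_D[OF D]]
    have "((\<lambda>y. kern \<epsilon> (z - y)) has_derivative (\<lambda>v. D (z - y) (- v))) (at y)" .
    then have "frechet_derivative (\<lambda>y. kern \<epsilon> (z - y)) (at y) = (\<lambda>v. D (z - y) (- v))"
      by (rule frechet_derivative_at[symmetric])
    then show ?thesis by (simp add: linear_neg[OF C1_linear[OF D]])
  qed
  have Dm[measurable]: "(\<lambda>z. D z v) \<in> borel_measurable borel" for v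
    using C1_cont_D[OF D] by (rule borel_measurable_continuous_onI)
  have i: "integrable lborel (\<lambda>y. D (z - y) v * f y)" for z v
  proof -
    obtain B where B: "B > 0" "\<And>z::'e. \<bar>D z v\<bar> \<le> B"
      using cont_compact_support_bounded[OF C1_cont_D[OF D] compact_cball D0] by blast
    show ?thesis
      by (rule Bochner_Integration.integrable_bound[of _ "\<lambda>y. B * f y"]) (use f B in \<open>auto simp: abs_mult intro!: mult_right_mono\<close>)
  qed
  have ik: "integrable lborel (\<lambda>y. kern \<epsilon> (z - y) * f y)" for z
    using kern_scaleR_integrable(1)[OF f \<epsilon>] by simp
  define N where "N = (\<integral>y. \<bar>f y\<bar> \<partial>lborel)"
  have N: "N \<ge> 0" by (simp add: N_def)
  define E where "E z v = (\<integral>y. D (z - y) v * f y \<partial>lborel)" for z v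
  have "C1 (moll \<epsilon> f) E" unfolding C1_def
  proof (intro conjI allI)
    fix z
    have lin: "linear (E z)"
      by (rule linearI) (use i in \<open>auto simp: E_def linear_add[OF C1_linear[OF D]] linear_scale[OF C1_linear[OF D]] distrib_right mult.assoc\<close>)
    show "(moll \<epsilon> f has_derivative E z) (at z)"
      unfolding has_derivative_within_alt
    proof (intro conjI allI impI)
      show "bounded_linear (E z)" using lin by (simp add: linear_conv_bounded_linear)
      fix e :: real assume e: "e > 0"
      then have "e / (N + 1) > 0" using N by simp
      from C1_uniform_linearization[OF D compact_cball K2 this]
      obtain d where d: "d > 0" "\<And>w h. norm h < d \<Longrightarrow> \<bar>kern \<epsilon> (w + h) - kern \<epsilon> w - D w h\<bar> \<le> e / (N + 1) * norm h" by blast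
      show "\<exists>d>0. \<forall>y\<in>UNIV. norm (y - z) < d \<longrightarrow> norm (moll \<epsilon> f y - moll \<epsilon> f z - E z (y - z)) \<le> e * norm (y - z)"
      proof (intro exI[of _ d] conjI ballI impI d(1))
        fix x assume x: "norm (x - z) < d"
        have "moll \<epsilon> f x - moll \<epsilon> f z - E z (x - z) = (\<integral>y. (kern \<epsilon> (x - y) - kern \<epsilon> (z - y) - D (z - y) (x - z)) * f y \<partial>lborel)"
          unfolding moll_def E_def using i ik by (simp add: left_diff_distrib)
        also have "norm \<dots> \<le> (\<integral>y. e / (N + 1) * norm (x - z) * \<bar>f y\<bar> \<partial>lborel)"
        proof (rule order_trans[OF integral_norm_bound integral_mono'])
          fix y
          have "\<bar>kern \<epsilon> (z - y + (x - z)) - kern \<epsilon> (z - y) - D (z - y) (x - z)\<bar> \<le> e / (N + 1) * norm (x - z)"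
            by (rule d(2)[OF x])
          then have "\<bar>kern \<epsilon> (x - y) - kern \<epsilon> (z - y) - D (z - y) (x - z)\<bar> * \<bar>f y\<bar> \<le> (e / (N + 1) * norm (x - z)) * \<bar>f y\<bar>"
            by (intro mult_right_mono) simp_all
          then show "norm ((kern \<epsilon> (x - y) - kern \<epsilon> (z - y) - D (z - y) (x - z)) * f y) \<le> e / (N + 1) * norm (x - z) * \<bar>f y\<bar>"
            by (simp add: abs_mult)
        qed (use f e N in auto)
        also have "\<dots> = e * norm (x - z) * (N / (N + 1))" by (simp add: N_def)
        also have "\<dots> \<le> e * norm (x - z)" using N e by (intro mult_left_le) (auto simp: field_simps)
        finally show "norm (moll \<epsilon> f x - moll \<epsilon> f z - E z (x - z)) \<le> e * norm (x - z)" .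
      qed
    qed
  next
    fix v
    show "continuous_on UNIV (\<lambda>z. E z v)"
      unfolding continuous_on_iff
    proof (intro ballI allI impI)
      fix z :: 'e and e :: real assume e: "e > 0"
      then have "e / (N + 1) > 0" using N by simp
      from C1_D_uniformly_continuous[OF D compact_cball K2 this]
      obtain d where d: "d > 0" "\<And>x y. dist x y < d \<Longrightarrow> \<bar>D x v - D y v\<bar> < e / (N + 1)" by blast
      show "\<exists>d>0. \<forall>x'\<in>UNIV. dist x' z < d \<longrightarrow> dist (E x' v) (E z v) < e"
      proof (intro exI[of _ d] conjI ballI impI d(1))
        fix x assume x: "dist x z < d"
        have "E x v - E z v = (\<integral>y. (D (x - y) v - D (z - y) v) * f y \<partial>lborel)"
          unfolding E_def using i by (simp add: left_diff_distrib)
        also have "norm \<dots> \<le> (\<integral>y. e / (N + 1) * \<bar>f y\<bar> \<partial>lborel)"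
        proof (rule order_trans[OF integral_norm_bound integral_mono'])
          fix y
          have "dist (x - y) (z - y) < d" using x by (simp add: dist_norm)
          from d(2)[OF this]
          have "\<bar>D (x - y) v - D (z - y) v\<bar> * \<bar>f y\<bar> \<le> e / (N + 1) * \<bar>f y\<bar>"
            by (intro mult_right_mono) simp_all
          then show "norm ((D (x - y) v - D (z - y) v) * f y) \<le> e / (N + 1) * \<bar>f y\<bar>"
            by (simp add: abs_mult)
        qed (use f e N in auto)
        also have "\<dots> = e * (N / (N + 1))" by (simp add: N_def)
        also have "\<dots> < e" using N e by (simp add: field_simps)
        finally show "dist (E x v) (E z v) < e" by (simp add: dist_real_def)
      qed
    qed
  qed
  then show ?thesis unfolding fre E_def by simp
qed

section \<open>Smooth approximation of supersolutions\<close>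

definition Aflux :: "real \<Rightarrow> 'a::euclidean_space \<Rightarrow> 'a" where
  "Aflux p g = norm g powr (p - 2) *\<^sub>R g"

lemma norm_Aflux: "norm (Aflux p g) = norm g powr (p - 1)"
proof (cases "g = 0")
  case False
  then have "norm g powr (p - 2) * norm g = norm g powr (p - 2) * norm g powr 1" by simp
  also have "\<dots> = norm g powr (p - 1)" by (subst powr_add[symmetric]) simp
  finally show ?thesis by (simp add: Aflux_def)
qed (simp add: Aflux_def)

lemma Aflux_zero[simp]: "Aflux p 0 = 0" by (simp add: Aflux_def)

lemma inner_Aflux_self: "p > 1 \<Longrightarrow> Aflux p g \<bullet> g = norm g powr p"
proof (cases "g = 0")
  case False
  have "norm g powr (p - 2) * (norm g)\<^sup>2 = norm g powr (p - 2) * norm g powr 2"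
    using False by (simp add: powr_numeral)
  also have "\<dots> = norm g powr p" by (subst powr_add[symmetric]) simp
  finally show ?thesis by (simp add: Aflux_def dot_square_norm)
qed simp

lemma Aflux_measurable[measurable]: "Aflux p \<in> borel_measurable borel"
  unfolding Aflux_def[abs_def] by measurable

lemma tendsto_Aflux:
  assumes "p > 2" "(f \<longlongrightarrow> l) F" shows "((\<lambda>x. Aflux p (f x)) \<longlongrightarrow> Aflux p l) F"
proof -
  have "((\<lambda>x. norm (f x) powr (p - 2)) \<longlongrightarrow> norm l powr (p - 2)) F"
    by (rule tendsto_powr'[OF tendsto_norm[OF assms(2)] tendsto_const]) (use assms in auto)
  then show ?thesis unfolding Aflux_def by (intro tendsto_scaleR assms)
qed

lemma Aflux_monotone:
  assumes p: "p > 2"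
  shows "(Aflux p a - Aflux p b) \<bullet> (a - b) \<ge> 2 powr (1 - p) * norm (a - b) powr p"
proof -
  define x y where "x = norm a" and "y = norm b"
  define X Y where "X = x powr (p - 2)" and "Y = y powr (p - 2)"
  have xy: "x \<ge> 0" "y \<ge> 0" "X \<ge> 0" "Y \<ge> 0" by (auto simp: x_def y_def X_def Y_def)
  have aa: "a \<bullet> a = x\<^sup>2" "b \<bullet> b = y\<^sup>2" by (auto simp: x_def y_def dot_square_norm)
  have nd: "(norm (a - b))\<^sup>2 = x\<^sup>2 + y\<^sup>2 - 2 * (a \<bullet> b)"
    by (simp add: aa[symmetric] dot_square_norm[symmetric] inner_diff inner_commute)
  have "(Aflux p a - Aflux p b) \<bullet> (a - b) = X * x\<^sup>2 + Y * y\<^sup>2 - (X + Y) * (a \<bullet> b)"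
    unfolding Aflux_def x_def[symmetric] y_def[symmetric] X_def[symmetric] Y_def[symmetric]
    by (simp add: inner_diff aa inner_commute algebra_simps)
  also have "\<dots> = (X + Y) / 2 * (norm (a - b))\<^sup>2 + (X - Y) * (x\<^sup>2 - y\<^sup>2) / 2"
    unfolding nd by (simp add: field_simps)
  finally have 1: "(Aflux p a - Aflux p b) \<bullet> (a - b) = (X + Y) / 2 * (norm (a - b))\<^sup>2 + (X - Y) * (x\<^sup>2 - y\<^sup>2) / 2" .
  have 2: "(X - Y) * (x\<^sup>2 - y\<^sup>2) \<ge> 0"
  proof (cases "x \<le> y")
    case True
    then have "X \<le> Y" "x\<^sup>2 \<le> y\<^sup>2" unfolding X_def Y_def using xy p by (auto intro!: powr_mono2 power_mono)
    then show ?thesis by (simp add: mult_nonpos_nonpos)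
  next
    case False
    then have "Y \<le> X" "y\<^sup>2 \<le> x\<^sup>2" unfolding X_def Y_def using xy p by (auto intro!: powr_mono2 power_mono)
    then show ?thesis by simp
  qed
  define d where "d = norm (a - b)"
  have d: "d \<le> x + y" "d \<ge> 0" unfolding d_def x_def y_def by (auto intro: norm_triangle_ineq4)
  have 3: "(d / 2) powr (p - 2) \<le> X + Y"
  proof (cases "x \<le> y")
    case True
    then have "(d/2) powr (p - 2) \<le> Y" unfolding Y_def using d xy p by (intro powr_mono2) auto
    then show ?thesis using xy by simp
  next
    case False
    then have "(d/2) powr (p - 2) \<le> X" unfolding X_def using d xy p by (intro powr_mono2) auto
    then show ?thesis using xy by simp
  qed
  have "2 powr (1 - p) * d powr p = (d/2) powr (p - 2) / 2 * d\<^sup>2"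
  proof (cases "d = 0")
    case False
    then have d0: "d > 0" using d by simp
    have "(d/2) powr (p - 2) = d powr (p - 2) * 2 powr (2 - p)"
    proof -
      have "(2::real) powr (2 - p) = 1 / 2 powr (p - 2)" using powr_minus_divide[of 2 "p - 2"] by simp
      then show ?thesis using d0 by (simp add: powr_divide)
    qed
    moreover have "d powr (p - 2) * d\<^sup>2 = d powr p" using d0
      by (simp add: powr_numeral[symmetric] powr_add[symmetric] del: powr_numeral)
    moreover have "2 powr (2 - p) / 2 = (2::real) powr (1 - p)"
      using powr_diff[of 2 "2 - p" 1] by simp
    ultimately show ?thesis by (simp add: field_simps)
  qed simp
  also have "\<dots> \<le> (X + Y) / 2 * d\<^sup>2" using 3 by (intro mult_right_mono divide_right_mono) auto
  finally show ?thesis using 1 2 by (simp add: d_def)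
qed

text \<open>Borel representatives \<open>u\<close>, \<open>g\<close> of a weak supersolution and of its spatial gradient.\<close>

definition superpair :: "('a::euclidean_space \<times> real) set \<Rightarrow> real \<Rightarrow> ('a \<times> real \<Rightarrow> real) \<Rightarrow> ('a \<times> real \<Rightarrow> 'a) \<Rightarrow> bool" where
  "superpair U p u g \<longleftrightarrow>
     u \<in> borel_measurable borel \<and> g \<in> borel_measurable borel \<and>
     (\<forall>K. compact K \<and> K \<subseteq> U \<longrightarrow> integrable lborel (\<lambda>z. indicator K z * \<bar>u z\<bar> powr p) \<and>
        integrable lborel (\<lambda>z. indicator K z * norm (g z) powr p)) \<and>
     (\<forall>\<phi> b. test_fun U \<phi> \<and> b \<in> Basis \<longrightarrow>
        (\<integral>z. u z * frechet_derivative \<phi> (at z) (b, 0) \<partial>lborel) = - (\<integral>z. (g z \<bullet> b) * \<phi> z \<partial>lborel)) \<and>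
     (\<forall>\<phi>. test_fun U \<phi> \<and> (\<forall>z. 0 \<le> \<phi> z) \<longrightarrow>
        0 \<le> (\<integral>z. Aflux p (g z) \<bullet> grad_x \<phi> z - u z * dt \<phi> z \<partial>lborel))"

lemma le_one_plus_powr: "(x::real) \<ge> 0 \<Longrightarrow> q \<le> p \<Longrightarrow> 0 \<le> q \<Longrightarrow> x powr q \<le> 1 + x powr p"
proof (cases "x \<le> 1")
  case True
  assume "x \<ge> 0" "q \<le> p" "0 \<le> q"
  then have "x powr q \<le> 1" using True powr_mono2[of q x 1] by simp
  then show ?thesis by (simp add: add_increasing2)
next
  case False
  assume "q \<le> p"
  then have "x powr q \<le> x powr p" using False by (intro powr_mono) auto
  then show ?thesis by simp
qed

lemma le_one_plus_powr1: "(x::real) \<ge> 0 \<Longrightarrow> 1 \<le> p \<Longrightarrow> x \<le> 1 + x powr p"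
  using le_one_plus_powr[of x 1 p] powr_one[of x] by linarith

lemma integrable_indicator_compact:
  "compact K \<Longrightarrow> integrable lborel (indicator K :: 'e::euclidean_space \<Rightarrow> real)"
  by (intro integrable_real_indicator) (auto simp: borel_compact emeasure_bounded_finite[OF compact_imp_bounded, unfolded infinity_ennreal_def])

lemma compact_neighbourhood:
  fixes C :: "'e::euclidean_space set"
  assumes "compact C" "open U" "C \<subseteq> U"
  obtains e C' where "e > 0" "compact C'" "C' \<subseteq> U" "\<And>x. x \<in> C \<Longrightarrow> cball x e \<subseteq> C'"
proof -
  obtain e where e: "e > 0" "(\<Union>x\<in>C. cball x e) \<subseteq> U"
    using compact_subset_open_imp_cball_epsilon_subset[OF assms] by blast
  have "compact ((\<lambda>(x,y). x + y) ` (C \<times> cball 0 e))"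
    by (intro compact_continuous_image compact_Times assms compact_cball) (auto simp: case_prod_beta intro!: continuous_intros)
  moreover have "(\<lambda>(x,y). x + y) ` (C \<times> cball 0 e) = (\<Union>x\<in>C. cball x e)"
  proof (intro equalityI subsetI)
    fix z assume "z \<in> (\<Union>x\<in>C. cball x e)"
    then obtain x where "x \<in> C" "dist x z \<le> e" by auto
    then show "z \<in> (\<lambda>(x,y). x + y) ` (C \<times> cball 0 e)"
      by (intro image_eqI[of _ _ "(x, z - x)"]) (auto simp: dist_norm norm_minus_commute)
  qed (force simp: dist_norm)
  ultimately show ?thesis using that e by (metis UN_upper)
qed

lemma superpair_approx:
  fixes u :: "'a::euclidean_space \<times> real \<Rightarrow> real" and g :: "'a \<times> real \<Rightarrow> 'a"
  assumes S: "superpair U p u g" and p: "p > 2" and U: "open U" and C: "compact C" "C \<subseteq> U"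
  obtains un :: "nat \<Rightarrow> 'a \<times> real \<Rightarrow> real" and Dn and Gn Fn :: "nat \<Rightarrow> 'a \<times> real \<Rightarrow> 'a" and DF and H :: "'a \<times> real \<Rightarrow> real"
  where "\<And>n. C1 (un n) (Dn n)"
    and "\<And>n b. C1 (\<lambda>z. Fn n z \<bullet> b) (DF n b)"
    and "\<And>n z. z \<in> C \<Longrightarrow> (\<Sum>b\<in>Basis. DF n b z (b, 0)) \<le> Dn n z (0, 1)"
    and "\<And>n z b. z \<in> C \<Longrightarrow> b \<in> Basis \<Longrightarrow> Dn n z (b, 0) = Gn n z \<bullet> b"
    and "\<And>n. Gn n \<in> borel_measurable borel"
    and "AE z in lborel. z \<in> C \<longrightarrow> (\<lambda>n. un n z) \<longlonglongrightarrow> u z"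
    and "AE z in lborel. z \<in> C \<longrightarrow> (\<lambda>n. Gn n z) \<longlonglongrightarrow> g z"
    and "AE z in lborel. z \<in> C \<longrightarrow> (\<lambda>n. Fn n z) \<longlonglongrightarrow> Aflux p (g z)"
    and "integrable lborel H" and "\<And>z. 0 \<le> H z"
    and "AE z in lborel. \<forall>n. \<bar>un n z\<bar> \<le> H z \<and> norm (Gn n z) powr p \<le> H z \<and> norm (Fn n z) powr (p / (p - 1)) \<le> H z"
proof -
  have [measurable]: "u \<in> borel_measurable borel" "g \<in> borel_measurable borel" using S by (auto simp: superpair_def)
  obtain e0 C' where e0: "e0 > 0" "compact C'" "C' \<subseteq> U" "\<And>x. x \<in> C \<Longrightarrow> cball x e0 \<subseteq> C'"
    using compact_neighbourhood[OF C(1) U C(2)] by metis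
  have CC': "z \<in> C'" if "z \<in> C" for z using e0(4)[OF that] e0(1) by auto
  have [measurable]: "C' \<in> sets borel" using e0 borel_compact by blast
  have iC: "integrable lborel (indicator C' :: _ \<Rightarrow> real)" using integrable_indicator_compact[OF e0(2)] .
  have iu: "integrable lborel (\<lambda>z. indicator C' z * \<bar>u z\<bar> powr p)"
    and ig: "integrable lborel (\<lambda>z. indicator C' z * norm (g z) powr p)"
    using S e0 by (auto simp: superpair_def)
  define u' where "u' z = indicator C' z * u z" for z
  define g' where "g' z = indicator C' z *\<^sub>R g z" for z
  define F' where "F' z = Aflux p (g' z)" for z
  define P where "P z = norm (g' z) powr p" for z
  have [measurable]: "u' \<in> borel_measurable borel" "g' \<in> borel_measurable borel" "F' \<in> borel_measurable borel" "P \<in> borel_measurable borel"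
    unfolding u'_def g'_def F'_def P_def by measurable
  have iu': "integrable lborel u'"
    by (rule Bochner_Integration.integrable_bound[OF Bochner_Integration.integrable_add[OF iC iu]])
      (use p in \<open>auto simp: u'_def indicator_def intro!: le_one_plus_powr1\<close>)
  have ig': "integrable lborel g'"
    by (rule Bochner_Integration.integrable_bound[OF Bochner_Integration.integrable_add[OF iC ig]])
      (use p in \<open>auto simp: g'_def indicator_def intro!: le_one_plus_powr1\<close>)
  have iF': "integrable lborel F'"
    by (rule Bochner_Integration.integrable_bound[OF Bochner_Integration.integrable_add[OF iC ig]])
      (use p in \<open>auto simp: F'_def norm_Aflux g'_def indicator_def intro!: le_one_plus_powr\<close>)
  have iP: "integrable lborel P"
    by (rule Bochner_Integration.integrable_bound[OF ig]) (use p in \<open>auto simp: P_def g'_def indicator_def\<close>)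
  have PF: "norm (F' z) powr (p / (p - 1)) = P z" for z
    using p by (simp add: F'_def norm_Aflux powr_powr P_def)
  define Q where "Q n \<epsilon> \<longleftrightarrow> 0 < \<epsilon> \<and> \<epsilon> < e0 \<and> (\<integral>\<^sup>+z. norm (moll \<epsilon> u' z - u' z) \<partial>lborel) \<le> ennreal ((1/2)^n)
    \<and> (\<integral>\<^sup>+z. norm (moll \<epsilon> g' z - g' z) \<partial>lborel) \<le> ennreal ((1/2)^n)
    \<and> (\<integral>\<^sup>+z. norm (moll \<epsilon> F' z - F' z) \<partial>lborel) \<le> ennreal ((1/2)^n)
    \<and> (\<integral>\<^sup>+z. norm (moll \<epsilon> P z - P z) \<partial>lborel) \<le> ennreal ((1/2)^n)" for n :: nat and \<epsilon> :: real
  have "\<exists>\<epsilon>. Q n \<epsilon>" for n :: nat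
  proof -
    have pos: "(1/2::real)^n > 0" by simp
    obtain d1 where d1: "d1 > 0" "\<And>\<epsilon>. 0 < \<epsilon> \<Longrightarrow> \<epsilon> < d1 \<Longrightarrow> (\<integral>\<^sup>+z. norm (moll \<epsilon> u' z - u' z) \<partial>lborel) \<le> ennreal ((1/2)^n)"
      using moll_L1[OF iu' pos] by blast
    obtain d2 where d2: "d2 > 0" "\<And>\<epsilon>. 0 < \<epsilon> \<Longrightarrow> \<epsilon> < d2 \<Longrightarrow> (\<integral>\<^sup>+z. norm (moll \<epsilon> g' z - g' z) \<partial>lborel) \<le> ennreal ((1/2)^n)"
      using moll_L1[OF ig' pos] by blast
    obtain d3 where d3: "d3 > 0" "\<And>\<epsilon>. 0 < \<epsilon> \<Longrightarrow> \<epsilon> < d3 \<Longrightarrow> (\<integral>\<^sup>+z. norm (moll \<epsilon> F' z - F' z) \<partial>lborel) \<le> ennreal ((1/2)^n)"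
      using moll_L1[OF iF' pos] by blast
    obtain d4 where d4: "d4 > 0" "\<And>\<epsilon>. 0 < \<epsilon> \<Longrightarrow> \<epsilon> < d4 \<Longrightarrow> (\<integral>\<^sup>+z. norm (moll \<epsilon> P z - P z) \<partial>lborel) \<le> ennreal ((1/2)^n)"
      using moll_L1[OF iP pos] by blast
    define \<epsilon> where "\<epsilon> = min e0 (min d1 (min d2 (min d3 d4))) / 2"
    have m: "min e0 (min d1 (min d2 (min d3 d4))) > 0" using e0 d1 d2 d3 d4 by simp
    have "0 < \<epsilon>" "\<epsilon> < min e0 (min d1 (min d2 (min d3 d4)))" unfolding \<epsilon>_def using m by linarith+
    then show ?thesis using d1(2) d2(2) d3(2) d4(2) unfolding Q_def by (intro exI[of _ \<epsilon>]) auto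
  qed
  then obtain \<epsilon> :: "nat \<Rightarrow> real" where Q: "\<And>n. Q n (\<epsilon> n)" using choice[of Q] by blast
  then have \<epsilon>: "\<And>n. 0 < \<epsilon> n" "\<And>n. \<epsilon> n < e0"
    and L1: "\<And>n. (\<integral>\<^sup>+z. norm (moll (\<epsilon> n) u' z - u' z) \<partial>lborel) \<le> ennreal ((1/2)^n)"
     "\<And>n. (\<integral>\<^sup>+z. norm (moll (\<epsilon> n) g' z - g' z) \<partial>lborel) \<le> ennreal ((1/2)^n)"
     "\<And>n. (\<integral>\<^sup>+z. norm (moll (\<epsilon> n) F' z - F' z) \<partial>lborel) \<le> ennreal ((1/2)^n)"
     "\<And>n. (\<integral>\<^sup>+z. norm (moll (\<epsilon> n) P z - P z) \<partial>lborel) \<le> ennreal ((1/2)^n)"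
    unfolding Q_def by blast+
  note cu = fast_L1_convergence[OF iu' _ L1(1)] and cg = fast_L1_convergence(1)[OF ig' _ L1(2)]
    and cF = fast_L1_convergence(1)[OF iF' _ L1(3)] and cP = fast_L1_convergence(2)[OF iP _ L1(4)]
  obtain H1 where H1: "integrable lborel H1" "\<And>z. 0 \<le> H1 z" "AE z in lborel. \<forall>n. norm (moll (\<epsilon> n) u' z) \<le> H1 z"
    using cu(2) by auto
  obtain H2 where H2: "integrable lborel H2" "\<And>z. 0 \<le> H2 z" "AE z in lborel. \<forall>n. norm (moll (\<epsilon> n) P z) \<le> H2 z"
    using cP by auto
  define \<phi> where "\<phi> n z y = kern (\<epsilon> n) (z - y)" for n and z y :: "'a \<times> real"
  have tf: "test_fun U (\<phi> n z)" if "z \<in> C" for n z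
    unfolding \<phi>_def
  proof (rule kern_test_fun[OF \<epsilon>(1)])
    have "cball z (\<epsilon> n) \<subseteq> cball z e0" using \<epsilon>(2)[of n] by (intro subset_cball) simp
    then show "cball z (\<epsilon> n) \<subseteq> U" using e0(4)[OF that] e0(3) by blast
  qed
  have C1\<phi>: "C1 (\<phi> n z) (\<lambda>y. frechet_derivative (\<phi> n z) (at y))" for n z
    unfolding \<phi>_def by (rule smooth_fun_C1[OF kern_reflect_smooth])
  have \<phi>0: "\<phi> n z y = 0" if "y \<notin> cball z (\<epsilon> n)" for n z y
    unfolding \<phi>_def using that \<epsilon>(1)[of n] by (intro kern_zero) (auto simp: dist_norm)
  have D\<phi>0: "frechet_derivative (\<phi> n z) (at y) v = 0" if "y \<notin> cball z (\<epsilon> n)" for n z y v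
    using C1_D_zero[OF C1\<phi> closed_cball \<phi>0 that] .
  have inC': "y \<in> C'" if "z \<in> C" "y \<in> cball z (\<epsilon> n)" for n z y
    using e0(4)[OF that(1)] that(2) \<epsilon>(2)[of n] by auto
  have Dm[measurable]: "(\<lambda>y. frechet_derivative (\<phi> n z) (at y) v) \<in> borel_measurable borel" for n z v
    using C1_cont_D[OF C1\<phi>] by (rule borel_measurable_continuous_onI)
  define Dn where "Dn n z v = - (\<integral>y. frechet_derivative (\<phi> n z) (at y) v * u' y \<partial>lborel)" for n z v
  define DF where "DF n b z v = - (\<integral>y. frechet_derivative (\<phi> n z) (at y) v * (F' y \<bullet> b) \<partial>lborel)" for n b z v
  show thesis
  proof (rule that[of "\<lambda>n. moll (\<epsilon> n) u'" Dn "\<lambda>n. moll (\<epsilon> n) F'" DF "\<lambda>n. moll (\<epsilon> n) g'" "\<lambda>z. H1 z + H2 z"])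
    show "C1 (moll (\<epsilon> n) u') (Dn n)" for n
      using moll_C1[OF iu' \<epsilon>(1)] unfolding Dn_def \<phi>_def .
    show "C1 (\<lambda>z. moll (\<epsilon> n) F' z \<bullet> b) (DF n b)" for n b
    proof -
      have "moll (\<epsilon> n) F' z \<bullet> b = moll (\<epsilon> n) (\<lambda>y. F' y \<bullet> b) z" for z
        unfolding moll_def using kern_scaleR_integrable(1)[OF iF' \<epsilon>(1)[of n]] by (simp flip: integral_inner_left)
      then show ?thesis
        using moll_C1[OF integrable_inner_left[OF iF'] \<epsilon>(1)] unfolding DF_def \<phi>_def by simp
    qed
    show "(\<Sum>b\<in>Basis. DF n b z (b, 0)) \<le> Dn n z (0, 1)" if z: "z \<in> C" for n z
    proof -
      have ii: "integrable lborel (\<lambda>y. frechet_derivative (\<phi> n z) (at y) v * f y)" if "integrable lborel f" for v and f :: "_ \<Rightarrow> real"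
      proof -
        obtain B where B: "B > 0" "\<And>y. \<bar>frechet_derivative (\<phi> n z) (at y) v\<bar> \<le> B"
          using cont_compact_support_bounded[OF C1_cont_D[OF C1\<phi>] compact_cball D\<phi>0] by blast
        show ?thesis
          by (rule Bochner_Integration.integrable_bound[of _ "\<lambda>y. B * f y"]) (use that B in \<open>auto simp: abs_mult intro!: mult_right_mono\<close>)
      qed
      have "0 \<le> (\<integral>y. Aflux p (g y) \<bullet> grad_x (\<phi> n z) y - u y * dt (\<phi> n z) y \<partial>lborel)"
        using S tf[OF z, of n] kern_nonneg unfolding superpair_def \<phi>_def by blast
      also have "\<dots> = (\<integral>y. (\<Sum>b\<in>Basis. frechet_derivative (\<phi> n z) (at y) (b, 0) * (F' y \<bullet> b)) - frechet_derivative (\<phi> n z) (at y) (0, 1) * u' y \<partial>lborel)"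
      proof (rule Bochner_Integration.integral_cong[OF refl])
        fix y
        show "Aflux p (g y) \<bullet> grad_x (\<phi> n z) y - u y * dt (\<phi> n z) y
          = (\<Sum>b\<in>Basis. frechet_derivative (\<phi> n z) (at y) (b, 0) * (F' y \<bullet> b)) - frechet_derivative (\<phi> n z) (at y) (0, 1) * u' y"
        proof (cases "y \<in> cball z (\<epsilon> n)")
          case True
          then have "y \<in> C'" using inC'[OF z] by blast
          then show ?thesis
            by (simp add: grad_x_def dt_def F'_def g'_def u'_def inner_sum_right)
        next
          case False
          then show ?thesis using D\<phi>0 by (simp add: grad_x_def dt_def)
        qed
      qed
      also have "\<dots> = (\<Sum>b\<in>Basis. (\<integral>y. frechet_derivative (\<phi> n z) (at y) (b, 0) * (F' y \<bullet> b) \<partial>lborel)) - (\<integral>y. frechet_derivative (\<phi> n z) (at y) (0, 1) * u' y \<partial>lborel)"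
        using ii[OF integrable_inner_left[OF iF']] ii[OF iu'] by (subst Bochner_Integration.integral_diff) auto
      finally show ?thesis by (simp add: DF_def Dn_def sum_negf)
    qed
    show "Dn n z (b, 0) = moll (\<epsilon> n) g' z \<bullet> b" if z: "z \<in> C" and b: "b \<in> Basis" for n z b
    proof -
      have "(\<integral>y. frechet_derivative (\<phi> n z) (at y) (b, 0) * u' y \<partial>lborel) = (\<integral>y. u y * frechet_derivative (\<phi> n z) (at y) (b, 0) \<partial>lborel)"
      proof (rule Bochner_Integration.integral_cong[OF refl])
        fix y show "frechet_derivative (\<phi> n z) (at y) (b, 0) * u' y = u y * frechet_derivative (\<phi> n z) (at y) (b, 0)"
          using D\<phi>0[of y z n] inC'[OF z, of y n] by (cases "y \<in> cball z (\<epsilon> n)") (auto simp: u'_def)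
      qed
      also have "\<dots> = - (\<integral>y. (g y \<bullet> b) * \<phi> n z y \<partial>lborel)"
        using S tf[OF z] b unfolding superpair_def by blast
      also have "(\<integral>y. (g y \<bullet> b) * \<phi> n z y \<partial>lborel) = (\<integral>y. (kern (\<epsilon> n) (z - y) *\<^sub>R g' y) \<bullet> b \<partial>lborel)"
      proof (rule Bochner_Integration.integral_cong[OF refl])
        fix y show "(g y \<bullet> b) * \<phi> n z y = (kern (\<epsilon> n) (z - y) *\<^sub>R g' y) \<bullet> b"
          using \<phi>0[of y z n] inC'[OF z, of y n] by (cases "y \<in> cball z (\<epsilon> n)") (auto simp: g'_def \<phi>_def)
      qed
      also have "\<dots> = moll (\<epsilon> n) g' z \<bullet> b"
        unfolding moll_def using kern_scaleR_integrable(1)[OF ig' \<epsilon>(1)[of n]] by (intro integral_inner_left) auto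
      finally show ?thesis by (simp add: Dn_def)
    qed
    show "moll (\<epsilon> n) g' \<in> borel_measurable borel" for n by measurable
    have "AE z in lborel. (\<lambda>n. moll (\<epsilon> n) u' z) \<longlonglongrightarrow> u' z" by (rule cu(1)) measurable
    then show "AE z in lborel. z \<in> C \<longrightarrow> (\<lambda>n. moll (\<epsilon> n) u' z) \<longlonglongrightarrow> u z"
      by (rule eventually_mono) (auto simp: u'_def CC')
    have "AE z in lborel. (\<lambda>n. moll (\<epsilon> n) g' z) \<longlonglongrightarrow> g' z" by (rule cg) measurable
    then show "AE z in lborel. z \<in> C \<longrightarrow> (\<lambda>n. moll (\<epsilon> n) g' z) \<longlonglongrightarrow> g z"
      by (rule eventually_mono) (auto simp: g'_def CC')
    have "AE z in lborel. (\<lambda>n. moll (\<epsilon> n) F' z) \<longlonglongrightarrow> F' z" by (rule cF) measurable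
    then show "AE z in lborel. z \<in> C \<longrightarrow> (\<lambda>n. moll (\<epsilon> n) F' z) \<longlonglongrightarrow> Aflux p (g z)"
      by (rule eventually_mono) (auto simp: F'_def g'_def CC')
    show "integrable lborel (\<lambda>z. H1 z + H2 z)" using H1 H2 by auto
    show "0 \<le> H1 z + H2 z" for z using H1 H2 by simp
    have J1: "norm (moll (\<epsilon> n) g' z) powr p \<le> norm (moll (\<epsilon> n) P z)" for n z
    proof -
      have "norm (moll (\<epsilon> n) g' z) powr p \<le> moll (\<epsilon> n) (\<lambda>z. norm (g' z) powr p) z"
        using p iP unfolding P_def by (intro moll_Jensen[OF ig' _ _ \<epsilon>(1)]) auto
      also have "\<dots> = moll (\<epsilon> n) P z" by (simp add: P_def[abs_def])
      finally show ?thesis by simp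
    qed
    have J2: "norm (moll (\<epsilon> n) F' z) powr (p / (p - 1)) \<le> norm (moll (\<epsilon> n) P z)" for n z
    proof -
      have "norm (moll (\<epsilon> n) F' z) powr (p / (p - 1)) \<le> moll (\<epsilon> n) (\<lambda>z. norm (F' z) powr (p / (p - 1))) z"
        using p iP by (intro moll_Jensen[OF iF' _ _ \<epsilon>(1)]) (auto simp: PF)
      also have "\<dots> = moll (\<epsilon> n) P z" by (simp add: PF)
      finally show ?thesis by simp
    qed
    show "AE z in lborel. \<forall>n. \<bar>moll (\<epsilon> n) u' z\<bar> \<le> H1 z + H2 z \<and> norm (moll (\<epsilon> n) g' z) powr p \<le> H1 z + H2 z \<and> norm (moll (\<epsilon> n) F' z) powr (p / (p - 1)) \<le> H1 z + H2 z"
      using H1(3) H2(3)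
    proof eventually_elim
      case (elim z)
      show ?case
      proof
        fix n
        show "\<bar>moll (\<epsilon> n) u' z\<bar> \<le> H1 z + H2 z \<and> norm (moll (\<epsilon> n) g' z) powr p \<le> H1 z + H2 z \<and> norm (moll (\<epsilon> n) F' z) powr (p / (p - 1)) \<le> H1 z + H2 z"
          using elim[THEN spec, of n] H1(2)[of z] H2(2)[of z] J1[of n z] J2[of n z] by simp
      qed
    qed
  qed
qed

section \<open>Testing the difference of two supersolutions\<close>

definition gradD :: "('a::euclidean_space \<times> real \<Rightarrow> 'a \<times> real \<Rightarrow> real) \<Rightarrow> 'a \<times> real \<Rightarrow> 'a" where
  "gradD D z = (\<Sum>b\<in>Basis. D z (b, 0) *\<^sub>R b)"

lemma inner_gradD: "w \<bullet> gradD D z = (\<Sum>b\<in>Basis. (w \<bullet> b) * D z (b, 0))"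
  by (simp add: gradD_def inner_sum_right mult.commute)

lemma gradD_inner_Basis: "b \<in> Basis \<Longrightarrow> gradD D z \<bullet> b = D z (b, 0)"
  by (simp add: gradD_def)

lemma continuous_gradD: "C1 \<phi> D \<Longrightarrow> continuous_on UNIV (gradD D)"
  unfolding gradD_def[abs_def] by (intro continuous_intros C1_cont_D)

lemma gradD_measurable[measurable]: "C1 \<phi> D \<Longrightarrow> gradD D \<in> borel_measurable borel"
  using continuous_gradD borel_measurable_continuous_onI by blast

lemma young_simple:
  fixes x y p :: real
  assumes "x \<ge> 0" "y \<ge> 0" "p > 1"
  shows "x * y \<le> x powr (p / (p - 1)) + y powr p"
proof (cases "x \<le> y powr (p - 1)")
  case True
  then have "x * y \<le> y powr (p - 1) * y" using assms by (intro mult_right_mono) auto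
  also have "\<dots> = y powr p" using assms powr_mult_base[of y "p - 1"] by (simp add: mult.commute)
  finally show ?thesis by (simp add: add_increasing)
next
  case False
  then have "(y powr (p - 1)) powr (1 / (p - 1)) \<le> x powr (1 / (p - 1))"
    using assms by (intro powr_mono2) auto
  then have "y \<le> x powr (1 / (p - 1))" using assms by (simp add: powr_powr)
  then have "x * y \<le> x * x powr (1 / (p - 1))" using assms by (intro mult_left_mono) auto
  also have "\<dots> = x powr (1 + 1 / (p - 1))" using assms by (simp add: powr_mult_base)
  also have "1 + 1 / (p - 1) = p / (p - 1)" using assms by (simp add: field_simps)
  finally show ?thesis by (simp add: add_increasing2)
qed

lemma flux_measurable:
  fixes F :: "'e::euclidean_space \<Rightarrow> 'a::euclidean_space"
  assumes "\<And>b. C1 (\<lambda>z. F z \<bullet> b) (DF b)"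
  shows "F \<in> borel_measurable borel"
  using borel_measurable_continuous_onI[OF C1_cont[OF assms]]
  by (simp add: borel_measurable_euclidean_space[of F])

lemma C1_divergence_parts:
  fixes F :: "'a::euclidean_space \<times> real \<Rightarrow> 'a"
  assumes F: "\<And>b. C1 (\<lambda>z. F z \<bullet> b) (DF b)" and a: "C1 a Da" and K: "compact K" "\<And>z. z \<notin> K \<Longrightarrow> a z = 0"
  shows "(\<integral>z. a z * (\<Sum>b\<in>Basis. DF b z (b, 0)) \<partial>lborel) = - (\<integral>z. F z \<bullet> gradD Da z \<partial>lborel)"
    and "integrable lborel (\<lambda>z. a z * (\<Sum>b\<in>Basis. DF b z (b, 0)))"
    and "integrable lborel (\<lambda>z. F z \<bullet> gradD Da z)"
proof -
  have Da0: "Da z v = 0" if "z \<notin> K" for z v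
    by (rule C1_D_zero[OF a compact_imp_closed[OF K(1)] K(2) that])
  have cF: "continuous_on UNIV (\<lambda>z. F z \<bullet> b)" for b using C1_cont[OF F] .
  have i1: "integrable lborel (\<lambda>z. (F z \<bullet> b) * Da z (b, 0))" for b
    by (rule integrable_cont_compact_support[OF _ K(1)]) (auto simp: Da0 intro!: continuous_intros cF C1_cont_D[OF a])
  have i2: "integrable lborel (\<lambda>z. DF b z (b, 0) * a z)" for b
    by (rule integrable_cont_compact_support[OF _ K(1)]) (auto simp: K(2) intro!: continuous_intros C1_cont[OF a] C1_cont_D[OF F])
  have z: "(\<integral>z. (F z \<bullet> b) * Da z (b, 0) + DF b z (b, 0) * a z \<partial>lborel) = 0" for b
    by (rule C1_integral_derivative_zero(1)[OF C1_mult[OF F a] K(1)]) (use K(2) in auto)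
  have e: "(\<integral>z. DF b z (b, 0) * a z \<partial>lborel) = - (\<integral>z. (F z \<bullet> b) * Da z (b, 0) \<partial>lborel)" for b
  proof -
    have "(\<integral>z. (F z \<bullet> b) * Da z (b, 0) + DF b z (b, 0) * a z \<partial>lborel) = (\<integral>z. (F z \<bullet> b) * Da z (b, 0) \<partial>lborel) + (\<integral>z. DF b z (b, 0) * a z \<partial>lborel)"
      by (rule Bochner_Integration.integral_add[OF i1 i2])
    then show ?thesis using z[of b] by linarith
  qed
  have r: "a z * (\<Sum>b\<in>Basis. DF b z (b, 0)) = (\<Sum>b\<in>Basis. DF b z (b, 0) * a z)" for z
    by (simp add: sum_distrib_left mult.commute)
  show "(\<integral>z. a z * (\<Sum>b\<in>Basis. DF b z (b, 0)) \<partial>lborel) = - (\<integral>z. F z \<bullet> gradD Da z \<partial>lborel)"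
    unfolding r inner_gradD using i1 i2 e by (simp add: sum_negf)
  show "integrable lborel (\<lambda>z. a z * (\<Sum>b\<in>Basis. DF b z (b, 0)))" unfolding r using i2 by auto
  show "integrable lborel (\<lambda>z. F z \<bullet> gradD Da z)" unfolding inner_gradD using i1 by auto
qed

lemma C1_parts:
  assumes m: "C1 m Dm" and a: "C1 a Da" and K: "compact K" "\<And>z. z \<notin> K \<Longrightarrow> a z = 0"
  shows "(\<integral>z. a z * Dm z v \<partial>lborel) = - (\<integral>z. m z * Da z v \<partial>lborel)"
    and "integrable lborel (\<lambda>z. a z * Dm z v)" and "integrable lborel (\<lambda>z. m z * Da z v)"
proof -
  have Da0: "Da z v = 0" if "z \<notin> K" for z v
    by (rule C1_D_zero[OF a compact_imp_closed[OF K(1)] K(2) that])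
  show i1: "integrable lborel (\<lambda>z. m z * Da z v)"
    by (rule integrable_cont_compact_support[OF _ K(1)]) (auto simp: Da0 intro!: continuous_intros C1_cont[OF m] C1_cont_D[OF a])
  show i2: "integrable lborel (\<lambda>z. a z * Dm z v)"
    by (rule integrable_cont_compact_support[OF _ K(1)]) (auto simp: K(2) intro!: continuous_intros C1_cont[OF a] C1_cont_D[OF m])
  have i1': "integrable lborel (\<lambda>z. Da z v * m z)" using i1 by (simp add: mult.commute)
  have "(\<integral>z. a z * Dm z v + Da z v * m z \<partial>lborel) = 0"
    by (rule C1_integral_derivative_zero(1)[OF C1_mult[OF a m] K(1)]) (use K(2) in auto)
  then show "(\<integral>z. a z * Dm z v \<partial>lborel) = - (\<integral>z. m z * Da z v \<partial>lborel)"
    unfolding Bochner_Integration.integral_add[OF i2 i1'] by (simp add: mult.commute)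
qed

text \<open>With $s = v - u$, this is the sum of the inequality for $u$ tested with $\varphi\theta(s)$ and the one for $v$ tested with
  $\varphi(1-\theta(s))$. Letting $\theta$ tend to a step function gives the supersolution property of $\min(u,v)$, the term \<open>L\<close>
  controls differences of gradients, and a constant $v$ gives the energy estimates.\<close>

lemma superpair_combine:
  fixes u v \<phi> :: "'a::euclidean_space \<times> real \<Rightarrow> real" and g h :: "'a \<times> real \<Rightarrow> 'a"
  assumes p: "p > 2" and U: "open U" and Su: "superpair U p u g" and Sv: "superpair U p v h"
    and \<phi>: "C1 \<phi> D" and K: "compact K" "K \<subseteq> U" "\<And>z. z \<notin> K \<Longrightarrow> \<phi> z = 0"
    and \<Theta>: "\<And>s. (\<Theta> has_real_derivative \<theta> s) (at s)"
    and \<theta>: "\<And>s. (\<theta> has_real_derivative \<theta>' s) (at s)" and \<theta>'c: "continuous_on UNIV \<theta>'"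
    and \<theta>01: "\<And>s. 0 \<le> \<theta> s" "\<And>s. \<theta> s \<le> 1" and \<theta>'B: "\<And>s. 0 \<le> \<theta>' s" "\<And>s. \<theta>' s \<le> B"
  defines "s z \<equiv> v z - u z"
  defines "L z \<equiv> \<phi> z * \<theta>' (s z) * ((Aflux p (h z) - Aflux p (g z)) \<bullet> (h z - g z))"
    and "R z \<equiv> (\<theta> (s z) *\<^sub>R Aflux p (g z) + (1 - \<theta> (s z)) *\<^sub>R Aflux p (h z)) \<bullet> gradD D z - (v z - \<Theta> (s z)) * D z (0, 1)"
  shows "integrable lborel L" "integrable lborel R"
    and "(\<And>z. 0 \<le> \<phi> z) \<Longrightarrow> (\<integral>z. L z \<partial>lborel) \<le> (\<integral>z. R z \<partial>lborel)"
    and "b \<in> Basis \<Longrightarrow> (\<integral>z. (v z - \<Theta> (s z)) * D z (b, 0) \<partial>lborel)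
           = - (\<integral>z. ((\<theta> (s z) *\<^sub>R g z + (1 - \<theta> (s z)) *\<^sub>R h z) \<bullet> b) * \<phi> z \<partial>lborel)"
    and "b \<in> Basis \<Longrightarrow> integrable lborel (\<lambda>z. (v z - \<Theta> (s z)) * D z (b, 0))"
    and "b \<in> Basis \<Longrightarrow> integrable lborel (\<lambda>z. ((\<theta> (s z) *\<^sub>R g z + (1 - \<theta> (s z)) *\<^sub>R h z) \<bullet> b) * \<phi> z)"
proof -
  obtain un Dun Gn Fn DF Hu where
    un: "\<And>n. C1 (un n) (Dun n)" and Fn: "\<And>n b. C1 (\<lambda>z. Fn n z \<bullet> b) (DF n b)"
    and un_super: "\<And>n z. z \<in> K \<Longrightarrow> (\<Sum>b\<in>Basis. DF n b z (b, 0)) \<le> Dun n z (0, 1)"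
    and Gn: "\<And>n z b. z \<in> K \<Longrightarrow> b \<in> Basis \<Longrightarrow> Dun n z (b, 0) = Gn n z \<bullet> b"
    and Gm[measurable]: "\<And>n. Gn n \<in> borel_measurable borel"
    and lu: "AE z in lborel. z \<in> K \<longrightarrow> (\<lambda>n. un n z) \<longlonglongrightarrow> u z"
    and lg: "AE z in lborel. z \<in> K \<longrightarrow> (\<lambda>n. Gn n z) \<longlonglongrightarrow> g z"
    and lF: "AE z in lborel. z \<in> K \<longrightarrow> (\<lambda>n. Fn n z) \<longlonglongrightarrow> Aflux p (g z)"
    and Hu: "integrable lborel Hu" "\<And>z. 0 \<le> Hu z"
    and du: "AE z in lborel. \<forall>n. \<bar>un n z\<bar> \<le> Hu z \<and> norm (Gn n z) powr p \<le> Hu z \<and> norm (Fn n z) powr (p / (p - 1)) \<le> Hu z"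
    by (rule superpair_approx[OF Su p U K(1,2)]) blast
  obtain vn Dvn Hn En DE Hv where
    vn: "\<And>n. C1 (vn n) (Dvn n)" and En: "\<And>n b. C1 (\<lambda>z. En n z \<bullet> b) (DE n b)"
    and vn_super: "\<And>n z. z \<in> K \<Longrightarrow> (\<Sum>b\<in>Basis. DE n b z (b, 0)) \<le> Dvn n z (0, 1)"
    and Hn: "\<And>n z b. z \<in> K \<Longrightarrow> b \<in> Basis \<Longrightarrow> Dvn n z (b, 0) = Hn n z \<bullet> b"
    and Hm[measurable]: "\<And>n. Hn n \<in> borel_measurable borel"
    and lv: "AE z in lborel. z \<in> K \<longrightarrow> (\<lambda>n. vn n z) \<longlonglongrightarrow> v z"
    and lh: "AE z in lborel. z \<in> K \<longrightarrow> (\<lambda>n. Hn n z) \<longlonglongrightarrow> h z"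
    and lE: "AE z in lborel. z \<in> K \<longrightarrow> (\<lambda>n. En n z) \<longlonglongrightarrow> Aflux p (h z)"
    and Hv: "integrable lborel Hv" "\<And>z. 0 \<le> Hv z"
    and dv: "AE z in lborel. \<forall>n. \<bar>vn n z\<bar> \<le> Hv z \<and> norm (Hn n z) powr p \<le> Hv z \<and> norm (En n z) powr (p / (p - 1)) \<le> Hv z"
    by (rule superpair_approx[OF Sv p U K(1,2)]) blast
  have D0: "D z w = 0" if "z \<notin> K" for z w
    by (rule C1_D_zero[OF \<phi> compact_imp_closed[OF K(1)] K(3) that])
  have G0: "gradD D z = 0" if "z \<notin> K" for z using D0[OF that] by (simp add: gradD_def)
  have [measurable]: "u \<in> borel_measurable borel" "v \<in> borel_measurable borel" "g \<in> borel_measurable borel" "h \<in> borel_measurable borel"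
    using Su Sv by (auto simp: superpair_def)
  have \<Theta>c: "continuous_on UNIV \<Theta>" and \<theta>c: "continuous_on UNIV \<theta>"
    using \<Theta> \<theta> by (meson DERIV_continuous continuous_at_imp_continuous_on)+
  have [measurable]: "\<Theta> \<in> borel_measurable borel" "\<theta> \<in> borel_measurable borel" "\<theta>' \<in> borel_measurable borel"
    using \<Theta>c \<theta>c \<theta>'c by (auto intro: borel_measurable_continuous_onI)
  have [measurable]: "un n \<in> borel_measurable borel" "vn n \<in> borel_measurable borel" for n
    using C1_cont[OF un] C1_cont[OF vn] by (auto intro: borel_measurable_continuous_onI)
  have [measurable]: "Fn n \<in> borel_measurable borel" "En n \<in> borel_measurable borel" for n
    using flux_measurable[OF Fn] flux_measurable[OF En] by auto
  have [measurable]: "\<phi> \<in> borel_measurable borel" "(\<lambda>z. D z w) \<in> borel_measurable borel" for w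
    by (rule borel_measurable_continuous_onI[OF C1_cont[OF \<phi>]], rule borel_measurable_continuous_onI[OF C1_cont_D[OF \<phi>]])
  have [measurable]: "gradD D \<in> borel_measurable borel" using gradD_measurable[OF \<phi>] .
  have [measurable]: "K \<in> sets borel" using K borel_compact by blast
  have Kc: "closed K" using K compact_imp_closed by blast
  obtain B1 where B1: "B1 > 0" "\<And>z. \<bar>\<phi> z\<bar> \<le> B1" using cont_compact_support_bounded[OF C1_cont[OF \<phi>] K(1,3)] by blast
  obtain B2 where B2: "B2 > 0" "\<And>z. \<bar>D z (0,1)\<bar> \<le> B2" using cont_compact_support_bounded[OF C1_cont_D[OF \<phi>] K(1) D0] by blast
  obtain B3 where B3: "B3 > 0" "\<And>z. \<bar>norm (gradD D z)\<bar> \<le> B3"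
    using cont_compact_support_bounded[of "\<lambda>z. norm (gradD D z)", OF continuous_on_norm[OF continuous_gradD[OF \<phi>]] K(1)] G0 by auto
  have Bb: "\<bar>D z (b, 0)\<bar> \<le> B3" if "b \<in> Basis" for z b
    using Basis_le_norm[OF that, of "gradD D z"] B3(2)[of z] by (simp add: gradD_inner_Basis[OF that])
  have B0: "B \<ge> 0" using order_trans[OF \<theta>'B(1)[of 0] \<theta>'B(2)[of 0]] .
  have \<Theta>bound: "\<bar>\<Theta> x\<bar> \<le> \<bar>\<Theta> 0\<bar> + \<bar>x\<bar>" for x
  proof -
    have "\<bar>\<Theta> x - \<Theta> 0\<bar> \<le> 1 * \<bar>x - 0\<bar>"
      using field_differentiable_bound[of UNIV \<Theta> \<theta> 1 x 0] \<Theta> \<theta>01 by (auto simp: has_field_derivative_at_within)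
    then show ?thesis using abs_triangle_ineq2[of "\<Theta> x" "\<Theta> 0"] by simp
  qed
  define W where "W z = indicator K z * (1 + Hu z + Hv z)" for z
  have iW: "integrable lborel W"
  proof -
    have "W = (\<lambda>z. indicator K z + (indicator K z * Hu z + indicator K z * Hv z))" by (auto simp: W_def algebra_simps)
    moreover have "integrable lborel (\<lambda>z. indicator K z * Hu z)" "integrable lborel (\<lambda>z. indicator K z * Hv z)"
      using integrable_real_mult_indicator[OF _ Hu(1), of K] integrable_real_mult_indicator[OF _ Hv(1), of K]
      by (auto simp: mult.commute)
    ultimately show ?thesis using integrable_indicator_compact[OF K(1)] by auto
  qed
  have W0: "0 \<le> W z" for z using Hu(2)[of z] Hv(2)[of z] by (simp add: W_def)
  define c where "c = \<bar>\<Theta> 0\<bar> + 2"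
  have c0: "0 \<le> c" by (simp add: c_def)
  have Mb: "\<bar>b - \<Theta> (b - a)\<bar> \<le> c * W z" if "\<bar>a\<bar> \<le> Hu z" "\<bar>b\<bar> \<le> Hv z" "z \<in> K" for a b z
  proof -
    have "\<bar>b - \<Theta> (b - a)\<bar> \<le> Hv z + (\<bar>\<Theta> 0\<bar> + (Hv z + Hu z))" using \<Theta>bound[of "b - a"] that by linarith
    also have "\<dots> \<le> c * (1 + Hu z + Hv z)" using Hu(2)[of z] Hv(2)[of z] by (simp add: c_def algebra_simps)
    finally show ?thesis using that by (simp add: W_def)
  qed
  have Gb: "norm w \<le> W z" if "z \<in> K" "norm w powr q \<le> Hu z \<or> norm w powr q \<le> Hv z" "q \<ge> 1" for w :: 'a and z q
    using le_one_plus_powr1[of "norm w" q] that Hu(2)[of z] Hv(2)[of z] by (auto simp: W_def)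
  have pp: "p / (p - 1) \<ge> 1" "p \<ge> 1" using p by auto
  have prodb: "norm x * norm y \<le> 2 * W z"
    if "z \<in> K" "norm x powr (p / (p - 1)) \<le> Hu z \<or> norm x powr (p / (p - 1)) \<le> Hv z" "norm y powr p \<le> Hu z \<or> norm y powr p \<le> Hv z" for x y :: 'a and z
    using young_simple[of "norm x" "norm y" p] that p Hu(2)[of z] Hv(2)[of z] by (auto simp: W_def)
  define sn where "sn n z = vn n z - un n z" for n z
  define Ln where "Ln n z = \<phi> z * \<theta>' (sn n z) * ((En n z - Fn n z) \<bullet> (Hn n z - Gn n z))" for n z
  define Rn where "Rn n z = (\<theta> (sn n z) *\<^sub>R Fn n z + (1 - \<theta> (sn n z)) *\<^sub>R En n z) \<bullet> gradD D z - (vn n z - \<Theta> (sn n z)) * D z (0, 1)" for n z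
  have [measurable]: "Ln n \<in> borel_measurable borel" "Rn n \<in> borel_measurable borel" "L \<in> borel_measurable borel" "R \<in> borel_measurable borel" for n
    unfolding Ln_def[abs_def] Rn_def[abs_def] L_def[abs_def] R_def[abs_def] sn_def s_def by measurable
  have tend: "(\<lambda>n. \<Theta> (f n)) \<longlonglongrightarrow> \<Theta> l" "(\<lambda>n. \<theta> (f n)) \<longlonglongrightarrow> \<theta> l" "(\<lambda>n. \<theta>' (f n)) \<longlonglongrightarrow> \<theta>' l" if "f \<longlonglongrightarrow> l" for f l
    using that \<Theta>c \<theta>c \<theta>'c by (auto intro: continuous_on_tendsto_compose)
  have lims: "AE z in lborel. (\<lambda>n. Ln n z) \<longlonglongrightarrow> L z \<and> (\<lambda>n. Rn n z) \<longlonglongrightarrow> R z"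
    using lu lg lF lv lh lE
  proof eventually_elim
    case (elim z)
    show ?case
    proof (cases "z \<in> K")
      case True
      then have t: "(\<lambda>n. un n z) \<longlonglongrightarrow> u z" "(\<lambda>n. Gn n z) \<longlonglongrightarrow> g z" "(\<lambda>n. Fn n z) \<longlonglongrightarrow> Aflux p (g z)"
        "(\<lambda>n. vn n z) \<longlonglongrightarrow> v z" "(\<lambda>n. Hn n z) \<longlonglongrightarrow> h z" "(\<lambda>n. En n z) \<longlonglongrightarrow> Aflux p (h z)" using elim by auto
      have s: "(\<lambda>n. sn n z) \<longlonglongrightarrow> s z" unfolding sn_def s_def by (intro tendsto_intros t)
      show ?thesis unfolding Ln_def L_def Rn_def R_def by (intro conjI tendsto_intros t tend s)
    next
      case False
      then show ?thesis using K(3) D0 G0 by (simp add: Ln_def L_def Rn_def R_def)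
    qed
  qed
  have bL: "AE z in lborel. norm (Ln n z) \<le> (B1 * B * 8) * W z" for n
    using du dv
  proof eventually_elim
    case (elim z)
    show ?case
    proof (cases "z \<in> K")
      case True
      have "\<bar>(En n z - Fn n z) \<bullet> (Hn n z - Gn n z)\<bar> \<le> norm (En n z - Fn n z) * norm (Hn n z - Gn n z)" by (rule Cauchy_Schwarz_ineq2)
      also have "\<dots> \<le> (norm (En n z) + norm (Fn n z)) * (norm (Hn n z) + norm (Gn n z))" by (intro mult_mono norm_triangle_ineq4) auto
      also have "\<dots> = norm (En n z) * norm (Hn n z) + norm (En n z) * norm (Gn n z) + norm (Fn n z) * norm (Hn n z) + norm (Fn n z) * norm (Gn n z)"
        by (simp add: algebra_simps)
      also have "\<dots> \<le> 2 * W z + 2 * W z + 2 * W z + 2 * W z"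
        using elim True by (intro add_mono prodb) auto
      finally have "\<bar>(En n z - Fn n z) \<bullet> (Hn n z - Gn n z)\<bar> \<le> 8 * W z" by simp
      then have "\<bar>\<phi> z\<bar> * \<bar>\<theta>' (sn n z)\<bar> * \<bar>(En n z - Fn n z) \<bullet> (Hn n z - Gn n z)\<bar> \<le> B1 * B * (8 * W z)"
        using B1(2)[of z] \<theta>'B[of "sn n z"] B1(1) B0 by (intro mult_mono) auto
      then show ?thesis by (simp add: Ln_def abs_mult mult.assoc)
    next
      case False then show ?thesis using K(3) by (simp add: Ln_def W_def)
    qed
  qed
  have bR: "AE z in lborel. norm (Rn n z) \<le> (2 * B3 + c * B2) * W z" for n
    using du dv
  proof eventually_elim
    case (elim z)
    show ?case
    proof (cases "z \<in> K")
      case True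
      have w: "norm (Fn n z) \<le> W z" "norm (En n z) \<le> W z"
        using elim[THEN spec, of n] True Gb[of z "Fn n z" "p / (p - 1)"] Gb[of z "En n z" "p / (p - 1)"] pp by auto
      have "norm (\<theta> (sn n z) *\<^sub>R Fn n z + (1 - \<theta> (sn n z)) *\<^sub>R En n z) \<le> \<theta> (sn n z) * norm (Fn n z) + (1 - \<theta> (sn n z)) * norm (En n z)"
        using \<theta>01[of "sn n z"] by (intro order_trans[OF norm_triangle_ineq]) auto
      also have "\<dots> \<le> 1 * W z + 1 * W z" using w \<theta>01[of "sn n z"] by (intro add_mono mult_mono) auto
      finally have "norm (\<theta> (sn n z) *\<^sub>R Fn n z + (1 - \<theta> (sn n z)) *\<^sub>R En n z) \<le> 2 * W z" by simp
      then have "\<bar>(\<theta> (sn n z) *\<^sub>R Fn n z + (1 - \<theta> (sn n z)) *\<^sub>R En n z) \<bullet> gradD D z\<bar> \<le> 2 * W z * B3"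
        using B3(2)[of z] W0[of z] by (intro order_trans[OF Cauchy_Schwarz_ineq2] mult_mono) auto
      moreover have "\<bar>(vn n z - \<Theta> (sn n z)) * D z (0, 1)\<bar> \<le> c * W z * B2"
        unfolding abs_mult sn_def using Mb[of "un n z" z "vn n z"] elim True B2(2)[of z] W0[of z] c0 by (intro mult_mono) auto
      ultimately show ?thesis unfolding Rn_def real_norm_def by (simp add: algebra_simps)
    next
      case False then show ?thesis using D0 G0 by (simp add: Rn_def W_def)
    qed
  qed
  have lL: "AE z in lborel. (\<lambda>n. Ln n z) \<longlonglongrightarrow> L z" and lR: "AE z in lborel. (\<lambda>n. Rn n z) \<longlonglongrightarrow> R z"
    using lims by (auto elim: eventually_mono)
  have iLW: "integrable lborel (\<lambda>z. (B1 * B * 8) * W z)" "integrable lborel (\<lambda>z. (2 * B3 + c * B2) * W z)" using iW by auto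
  show "integrable lborel L" by (rule integrable_dominated_convergence[OF _ _ iLW(1) lL bL]) auto
  show "integrable lborel R" by (rule integrable_dominated_convergence[OF _ _ iLW(2) lR bR]) auto
  have cL: "(\<lambda>n. \<integral>z. Ln n z \<partial>lborel) \<longlonglongrightarrow> (\<integral>z. L z \<partial>lborel)" by (rule integral_dominated_convergence[OF _ _ iLW(1) lL bL]) auto
  have cR: "(\<lambda>n. \<integral>z. Rn n z \<partial>lborel) \<longlonglongrightarrow> (\<integral>z. R z \<partial>lborel)" by (rule integral_dominated_convergence[OF _ _ iLW(2) lR bR]) auto
  have iLn: "integrable lborel (Ln n)" for n by (rule Bochner_Integration.integrable_bound[OF iLW(1)]) (use bL[of n] in \<open>auto elim!: eventually_mono\<close>)
  have iRn: "integrable lborel (Rn n)" for n by (rule Bochner_Integration.integrable_bound[OF iLW(2)]) (use bR[of n] in \<open>auto elim!: eventually_mono\<close>)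
  have snC1: "C1 (sn n) (\<lambda>z w. Dvn n z w - Dun n z w)" for n unfolding sn_def[abs_def] by (rule C1_diff[OF vn un])
  have MC1: "C1 (\<lambda>z. vn n z - \<Theta> (sn n z)) (\<lambda>z w. Dvn n z w - \<theta> (sn n z) * (Dvn n z w - Dun n z w))" for n
    by (rule C1_diff[OF vn C1_compose[OF \<Theta> \<theta>c snC1]])
  show "(\<integral>z. L z \<partial>lborel) \<le> (\<integral>z. R z \<partial>lborel)" if \<phi>0: "\<And>z. 0 \<le> \<phi> z"
  proof (rule LIMSEQ_le[OF cL cR], intro exI[of _ 0] allI impI)
    fix n
    define a where "a z = \<theta> (sn n z) * \<phi> z" for z
    define Da where "Da z w = \<theta> (sn n z) * D z w + (\<theta>' (sn n z) * (Dvn n z w - Dun n z w)) * \<phi> z" for z w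
    define b where "b z = (1 - \<theta> (sn n z)) * \<phi> z" for z
    define Db where "Db z w = (1 - \<theta> (sn n z)) * D z w + (0 - \<theta>' (sn n z) * (Dvn n z w - Dun n z w)) * \<phi> z" for z w
    have aC: "C1 a Da" unfolding a_def[abs_def] Da_def[abs_def] by (rule C1_mult[OF C1_compose[OF \<theta> \<theta>'c snC1] \<phi>])
    have bC: "C1 b Db" unfolding b_def[abs_def] Db_def[abs_def] by (rule C1_mult[OF C1_diff[OF C1_const C1_compose[OF \<theta> \<theta>'c snC1]] \<phi>])
    have a0: "a z = 0" and b0: "b z = 0" if "z \<notin> K" for z using K(3)[OF that] by (auto simp: a_def b_def)
    note pa = C1_divergence_parts[OF Fn aC K(1) a0, of n] and pb = C1_divergence_parts[OF En bC K(1) b0, of n]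
      and pt = C1_parts[OF MC1 \<phi> K(1,3), of n "(0,1)"]
    define Q where "Q z = \<phi> z * (Dvn n z (0,1) - \<theta> (sn n z) * (Dvn n z (0,1) - Dun n z (0,1)))
        - a z * (\<Sum>b\<in>Basis. DF n b z (b, 0)) - b z * (\<Sum>b\<in>Basis. DE n b z (b, 0))" for z
    have "0 \<le> Q z" for z
    proof (cases "z \<in> K")
      case True
      have "0 \<le> a z * (Dun n z (0,1) - (\<Sum>b\<in>Basis. DF n b z (b, 0)))"
        using un_super[OF True, of n] \<phi>0[of z] \<theta>01 by (auto simp: a_def)
      moreover have "0 \<le> b z * (Dvn n z (0,1) - (\<Sum>b\<in>Basis. DE n b z (b, 0)))"
        using vn_super[OF True, of n] \<phi>0[of z] \<theta>01 by (auto simp: b_def)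
      moreover have "Q z = a z * (Dun n z (0,1) - (\<Sum>b\<in>Basis. DF n b z (b, 0))) + b z * (Dvn n z (0,1) - (\<Sum>b\<in>Basis. DE n b z (b, 0)))"
        unfolding Q_def by (simp add: a_def b_def algebra_simps)
      ultimately show ?thesis by simp
    qed (simp add: Q_def a_def b_def K(3))
    then have "0 \<le> (\<integral>z. Q z \<partial>lborel)" by simp
    also have "(\<integral>z. Q z \<partial>lborel) = - (\<integral>z. (vn n z - \<Theta> (sn n z)) * D z (0,1) \<partial>lborel)
        + (\<integral>z. Fn n z \<bullet> gradD Da z \<partial>lborel) + (\<integral>z. En n z \<bullet> gradD Db z \<partial>lborel)"
      unfolding Q_def using pa pb pt by simp
    also have "\<dots> = (\<integral>z. Fn n z \<bullet> gradD Da z + En n z \<bullet> gradD Db z - (vn n z - \<Theta> (sn n z)) * D z (0,1) \<partial>lborel)"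
      using pa(3) pb(3) pt(3) by simp
    also have "\<dots> = (\<integral>z. Rn n z - Ln n z \<partial>lborel)"
    proof (rule Bochner_Integration.integral_cong[OF refl])
      fix z
      show "Fn n z \<bullet> gradD Da z + En n z \<bullet> gradD Db z - (vn n z - \<Theta> (sn n z)) * D z (0,1) = Rn n z - Ln n z"
      proof (cases "z \<in> K")
        case True
        have gDa: "gradD Da z = \<theta> (sn n z) *\<^sub>R gradD D z + (\<theta>' (sn n z) * \<phi> z) *\<^sub>R (Hn n z - Gn n z)"
          by (rule euclidean_eqI) (simp add: gradD_inner_Basis Da_def inner_diff_left inner_add_left Hn[OF True] Gn[OF True])
        have gDb: "gradD Db z = (1 - \<theta> (sn n z)) *\<^sub>R gradD D z - (\<theta>' (sn n z) * \<phi> z) *\<^sub>R (Hn n z - Gn n z)"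
          by (rule euclidean_eqI) (simp add: gradD_inner_Basis Db_def inner_diff_left inner_add_left Hn[OF True] Gn[OF True])
        show ?thesis unfolding gDa gDb Rn_def Ln_def
          by (simp add: inner_diff_left inner_diff_right inner_add_left inner_add_right algebra_simps)
      next
        case False
        then have "gradD Da z = 0" "gradD Db z = 0" using D0[OF False] K(3)[OF False] by (simp_all add: gradD_def Da_def Db_def)
        then show ?thesis using D0[OF False] K(3)[OF False] G0[OF False] by (simp add: Rn_def Ln_def)
      qed
    qed
    finally show "(\<integral>z. Ln n z \<partial>lborel) \<le> (\<integral>z. Rn n z \<partial>lborel)" using iLn iRn by simp
  qed
  assume b: "b \<in> Basis"
  define An where "An n z = (vn n z - \<Theta> (sn n z)) * D z (b, 0)" for n z
  define Bn where "Bn n z = ((\<theta> (sn n z) *\<^sub>R Gn n z + (1 - \<theta> (sn n z)) *\<^sub>R Hn n z) \<bullet> b) * \<phi> z" for n z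
  define A where "A z = (v z - \<Theta> (s z)) * D z (b, 0)" for z
  define BB where "BB z = ((\<theta> (s z) *\<^sub>R g z + (1 - \<theta> (s z)) *\<^sub>R h z) \<bullet> b) * \<phi> z" for z
  have [measurable]: "An n \<in> borel_measurable borel" "Bn n \<in> borel_measurable borel" "A \<in> borel_measurable borel" "BB \<in> borel_measurable borel" for n
    unfolding An_def[abs_def] Bn_def[abs_def] A_def[abs_def] BB_def[abs_def] sn_def s_def by measurable
  have lims': "AE z in lborel. (\<lambda>n. An n z) \<longlonglongrightarrow> A z \<and> (\<lambda>n. Bn n z) \<longlonglongrightarrow> BB z"
    using lu lg lv lh
  proof eventually_elim
    case (elim z)
    show ?case
    proof (cases "z \<in> K")
      case True
      then have t: "(\<lambda>n. un n z) \<longlonglongrightarrow> u z" "(\<lambda>n. Gn n z) \<longlonglongrightarrow> g z"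
        "(\<lambda>n. vn n z) \<longlonglongrightarrow> v z" "(\<lambda>n. Hn n z) \<longlonglongrightarrow> h z" using elim by auto
      have s: "(\<lambda>n. sn n z) \<longlonglongrightarrow> s z" unfolding sn_def s_def by (intro tendsto_intros t)
      show ?thesis unfolding An_def A_def Bn_def BB_def by (intro conjI tendsto_intros t tend s)
    next
      case False
      then show ?thesis using K(3) D0 by (simp add: An_def A_def Bn_def BB_def)
    qed
  qed
  have bA: "AE z in lborel. norm (An n z) \<le> (c * B3) * W z" for n
    using du dv
  proof eventually_elim
    case (elim z)
    show ?case
    proof (cases "z \<in> K")
      case True
      have "\<bar>(vn n z - \<Theta> (sn n z)) * D z (b, 0)\<bar> \<le> c * W z * B3"
        unfolding abs_mult sn_def using Mb[of "un n z" z "vn n z"] elim True Bb[OF b, of z] W0[of z] c0 by (intro mult_mono) auto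
      then show ?thesis by (simp add: An_def mult_ac)
    next
      case False then show ?thesis using D0 by (simp add: An_def W_def)
    qed
  qed
  have bB: "AE z in lborel. norm (Bn n z) \<le> (2 * B1) * W z" for n
    using du dv
  proof eventually_elim
    case (elim z)
    show ?case
    proof (cases "z \<in> K")
      case True
      have w: "norm (Gn n z) \<le> W z" "norm (Hn n z) \<le> W z"
        using elim[THEN spec, of n] True Gb[of z "Gn n z" p] Gb[of z "Hn n z" p] pp by auto
      have "norm (\<theta> (sn n z) *\<^sub>R Gn n z + (1 - \<theta> (sn n z)) *\<^sub>R Hn n z) \<le> \<theta> (sn n z) * norm (Gn n z) + (1 - \<theta> (sn n z)) * norm (Hn n z)"
        using \<theta>01[of "sn n z"] by (intro order_trans[OF norm_triangle_ineq]) auto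
      also have "\<dots> \<le> 1 * W z + 1 * W z" using w \<theta>01[of "sn n z"] by (intro add_mono mult_mono) auto
      finally have "norm (\<theta> (sn n z) *\<^sub>R Gn n z + (1 - \<theta> (sn n z)) *\<^sub>R Hn n z) \<le> 2 * W z" by simp
      then have "\<bar>(\<theta> (sn n z) *\<^sub>R Gn n z + (1 - \<theta> (sn n z)) *\<^sub>R Hn n z) \<bullet> b\<bar> \<le> 2 * W z"
        using Basis_le_norm[OF b] order_trans by blast
      then have "\<bar>(\<theta> (sn n z) *\<^sub>R Gn n z + (1 - \<theta> (sn n z)) *\<^sub>R Hn n z) \<bullet> b\<bar> * \<bar>\<phi> z\<bar> \<le> 2 * W z * B1"
        using B1(2)[of z] W0[of z] by (intro mult_mono) auto
      then show ?thesis by (simp add: Bn_def abs_mult mult_ac)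
    next
      case False then show ?thesis using K(3) by (simp add: Bn_def W_def)
    qed
  qed
  have lA: "AE z in lborel. (\<lambda>n. An n z) \<longlonglongrightarrow> A z" and lB: "AE z in lborel. (\<lambda>n. Bn n z) \<longlonglongrightarrow> BB z"
    using lims' by (auto elim: eventually_mono)
  have iAW: "integrable lborel (\<lambda>z. (c * B3) * W z)" "integrable lborel (\<lambda>z. (2 * B1) * W z)" using iW by auto
  have "integrable lborel A" by (rule integrable_dominated_convergence[OF _ _ iAW(1) lA bA]) auto
  then show "integrable lborel (\<lambda>z. (v z - \<Theta> (s z)) * D z (b, 0))" unfolding A_def .
  have "integrable lborel BB" by (rule integrable_dominated_convergence[OF _ _ iAW(2) lB bB]) auto
  then show "integrable lborel (\<lambda>z. ((\<theta> (s z) *\<^sub>R g z + (1 - \<theta> (s z)) *\<^sub>R h z) \<bullet> b) * \<phi> z)" unfolding BB_def .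
  have cA: "(\<lambda>n. \<integral>z. An n z \<partial>lborel) \<longlonglongrightarrow> (\<integral>z. A z \<partial>lborel)" by (rule integral_dominated_convergence[OF _ _ iAW(1) lA bA]) auto
  have cB: "(\<lambda>n. \<integral>z. Bn n z \<partial>lborel) \<longlonglongrightarrow> (\<integral>z. BB z \<partial>lborel)" by (rule integral_dominated_convergence[OF _ _ iAW(2) lB bB]) auto
  have "(\<integral>z. An n z \<partial>lborel) = - (\<integral>z. Bn n z \<partial>lborel)" for n
  proof -
    have "(\<integral>z. An n z \<partial>lborel) = - (\<integral>z. \<phi> z * (Dvn n z (b,0) - \<theta> (sn n z) * (Dvn n z (b,0) - Dun n z (b,0))) \<partial>lborel)"
      unfolding An_def using C1_parts(1)[OF MC1 \<phi> K(1,3), of n "(b, 0)"] by simp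
    also have "(\<integral>z. \<phi> z * (Dvn n z (b,0) - \<theta> (sn n z) * (Dvn n z (b,0) - Dun n z (b,0))) \<partial>lborel) = (\<integral>z. Bn n z \<partial>lborel)"
    proof (rule Bochner_Integration.integral_cong[OF refl])
      fix z
      show "\<phi> z * (Dvn n z (b,0) - \<theta> (sn n z) * (Dvn n z (b,0) - Dun n z (b,0))) = Bn n z"
        using Gn[of z b n] Hn[of z b n] b K(3)[of z]
        by (cases "z \<in> K") (auto simp: Bn_def inner_add_left algebra_simps)
    qed
    finally show ?thesis .
  qed
  then have "(\<integral>z. A z \<partial>lborel) = - (\<integral>z. BB z \<partial>lborel)"
    using LIMSEQ_unique[OF cA] tendsto_minus[OF cB] by simp
  then show "(\<integral>z. (v z - \<Theta> (s z)) * D z (b, 0) \<partial>lborel) = - (\<integral>z. ((\<theta> (s z) *\<^sub>R g z + (1 - \<theta> (s z)) *\<^sub>R h z) \<bullet> b) * \<phi> z \<partial>lborel)"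
    unfolding A_def BB_def .
qed

section \<open>Smoothstep, cutoffs and the minimum of two supersolutions\<close>

text \<open>\<open>sst\<close> is the smoothstep $3x^2 - 2x^3$ on $[0,1]$, continued by $0$ and $1$; \<open>sst'\<close> is its derivative
  and \<open>sstI\<close> its primitive.\<close>

definition sst :: "real \<Rightarrow> real" where
  "sst x = 3 * max 0 x ^ 2 - 2 * max 0 x ^ 3 + 3 * max 0 (x - 1) ^ 2 + 2 * max 0 (x - 1) ^ 3"

definition sst' :: "real \<Rightarrow> real" where
  "sst' x = 6 * max 0 x - 6 * max 0 x ^ 2 + 6 * max 0 (x - 1) + 6 * max 0 (x - 1) ^ 2"

definition sstI :: "real \<Rightarrow> real" where
  "sstI x = max 0 x ^ 3 - max 0 x ^ 4 / 2 + max 0 (x - 1) ^ 3 + max 0 (x - 1) ^ 4 / 2"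

lemma max_power_derivative:
  "((\<lambda>x::real. max 0 x ^ (Suc (Suc n))) has_real_derivative real (Suc (Suc n)) * max 0 x ^ Suc n) (at x)"
proof -
  consider "x < 0" | "x = 0" | "x > 0" by linarith
  then show ?thesis
  proof cases
    case 1
    have "((\<lambda>x. 0) has_real_derivative 0) (at x)" by simp
    then have "((\<lambda>x::real. max 0 x ^ (Suc (Suc n))) has_real_derivative 0) (at x)"
      by (rule has_field_derivative_transform_within_open[of _ _ _ "{..<0}"]) (use 1 in auto)
    then show ?thesis using 1 by simp
  next
    case 2
    have "((\<lambda>y::real. (max 0 y ^ Suc (Suc n) - max 0 0 ^ Suc (Suc n)) / (y - 0)) \<longlongrightarrow> 0) (at 0)"
    proof (rule Lim_null_comparison)
      show "\<forall>\<^sub>F y in at 0. norm ((max 0 y ^ Suc (Suc n) - max 0 0 ^ Suc (Suc n)) / (y - 0)) \<le> \<bar>y\<bar> ^ Suc n"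
      proof (rule always_eventually, rule allI)
        fix y :: real
        show "norm ((max 0 y ^ Suc (Suc n) - max 0 0 ^ Suc (Suc n)) / (y - 0)) \<le> \<bar>y\<bar> ^ Suc n"
        proof (cases "y \<le> 0")
          case True
          then have "norm ((max 0 y ^ Suc (Suc n) - max 0 0 ^ Suc (Suc n)) / (y - 0)) = 0" by (simp add: max_def)
          then show ?thesis by (metis abs_ge_zero zero_le_power)
        qed (simp add: max_def abs_mult)
      qed
      have "((\<lambda>y::real. \<bar>y\<bar> ^ Suc n) \<longlongrightarrow> \<bar>0\<bar> ^ Suc n) (at 0)" by (intro tendsto_intros)
      then show "((\<lambda>y::real. \<bar>y\<bar> ^ Suc n) \<longlongrightarrow> 0) (at 0)" by simp
    qed
    then show ?thesis using 2 by (simp add: has_field_derivative_iff)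
  next
    case 3
    have "((\<lambda>x. x ^ (Suc (Suc n))) has_real_derivative real (Suc (Suc n)) * x ^ Suc n) (at x)"
      using DERIV_pow[of "Suc (Suc n)" x] by simp
    then have "((\<lambda>x::real. max 0 x ^ (Suc (Suc n))) has_real_derivative real (Suc (Suc n)) * x ^ Suc n) (at x)"
      by (rule has_field_derivative_transform_within_open[of _ _ _ "{0<..}"]) (use 3 in auto)
    then show ?thesis using 3 by simp
  qed
qed

lemma max_power_derivatives:
  "((\<lambda>x::real. max 0 (x - c) ^ 2) has_real_derivative 2 * max 0 (x - c)) (at x)"
  "((\<lambda>x::real. max 0 (x - c) ^ 3) has_real_derivative 3 * max 0 (x - c) ^ 2) (at x)"
  "((\<lambda>x::real. max 0 (x - c) ^ 4) has_real_derivative 4 * max 0 (x - c) ^ 3) (at x)"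
proof -
  have s: "((\<lambda>x. x - c) has_real_derivative 1) (at x)" by (auto intro!: derivative_eq_intros)
  show "((\<lambda>x::real. max 0 (x - c) ^ 2) has_real_derivative 2 * max 0 (x - c)) (at x)"
    using DERIV_chain2[OF max_power_derivative[of 0 "x - c"] s] by (simp add: numeral_eq_Suc)
  show "((\<lambda>x::real. max 0 (x - c) ^ 3) has_real_derivative 3 * max 0 (x - c) ^ 2) (at x)"
    using DERIV_chain2[OF max_power_derivative[of 1 "x - c"] s] by (simp add: numeral_eq_Suc)
  show "((\<lambda>x::real. max 0 (x - c) ^ 4) has_real_derivative 4 * max 0 (x - c) ^ 3) (at x)"
    using DERIV_chain2[OF max_power_derivative[of 2 "x - c"] s] by (simp add: numeral_eq_Suc)
qed

lemma sst_derivative: "(sst has_real_derivative sst' x) (at x)"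
proof -
  note m = max_power_derivatives[of 0 x, unfolded diff_zero] and m1 = max_power_derivatives[of 1 x]
  have "(sst has_real_derivative 3 * (2 * max 0 x) - 2 * (3 * max 0 x ^ 2) + 3 * (2 * max 0 (x - 1)) + 2 * (3 * max 0 (x - 1) ^ 2)) (at x)"
    unfolding sst_def[abs_def] by (intro DERIV_add DERIV_diff DERIV_cmult m m1)
  then show ?thesis by (simp add: sst'_def)
qed

lemma sstI_derivative: "(sstI has_real_derivative sst x) (at x)"
proof -
  note m = max_power_derivatives[of 0 x, unfolded diff_zero] and m1 = max_power_derivatives[of 1 x]
  have "(sstI has_real_derivative 3 * max 0 x ^ 2 - 4 * max 0 x ^ 3 / 2 + 3 * max 0 (x - 1) ^ 2 + 4 * max 0 (x - 1) ^ 3 / 2) (at x)"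
    unfolding sstI_def[abs_def] by (intro DERIV_add DERIV_diff DERIV_cdivide m m1)
  then show ?thesis by (simp add: sst_def)
qed

lemma sst'_continuous: "continuous_on UNIV sst'"
  unfolding sst'_def[abs_def] by (intro continuous_intros)

lemma sst_cases:
  "x \<le> 0 \<Longrightarrow> sst x = 0 \<and> sst' x = 0 \<and> sstI x = 0"
  "0 \<le> x \<Longrightarrow> x \<le> 1 \<Longrightarrow> sst x = 3 * x\<^sup>2 - 2 * x ^ 3 \<and> sst' x = 6 * x * (1 - x) \<and> sstI x = x ^ 3 - x ^ 4 / 2"
  "1 \<le> x \<Longrightarrow> sst x = 1 \<and> sst' x = 0 \<and> sstI x = x - 1 / 2"
proof -
  show "x \<le> 0 \<Longrightarrow> sst x = 0 \<and> sst' x = 0 \<and> sstI x = 0"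
    by (simp add: sst_def sst'_def sstI_def max_def)
  show "0 \<le> x \<Longrightarrow> x \<le> 1 \<Longrightarrow> sst x = 3 * x\<^sup>2 - 2 * x ^ 3 \<and> sst' x = 6 * x * (1 - x) \<and> sstI x = x ^ 3 - x ^ 4 / 2"
    by (simp add: sst_def sst'_def sstI_def max_def power2_eq_square right_diff_distrib)
  assume "1 \<le> x"
  then have m: "max 0 x = x" "max 0 (x - 1) = x - 1" by auto
  have "sst x = 1" unfolding sst_def m by algebra
  moreover have "sst' x = 0" unfolding sst'_def m by algebra
  moreover have "2 * sstI x = 2 * x ^ 3 - x ^ 4 + 2 * (x - 1) ^ 3 + (x - 1) ^ 4" unfolding sstI_def m by simp
  then have "2 * sstI x = 2 * x - 1" by algebra
  ultimately show "sst x = 1 \<and> sst' x = 0 \<and> sstI x = x - 1 / 2" by simp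
qed

lemma sst_range: "0 \<le> sst x" "sst x \<le> 1"
proof -
  have "0 \<le> sst x \<and> sst x \<le> 1"
  proof (cases "x \<le> 0 \<or> x \<ge> 1")
    case True then show ?thesis using sst_cases by auto
  next
    case False
    then have x: "0 \<le> x" "x \<le> 1" by auto
    have "sst x = x\<^sup>2 * (3 - 2 * x)" using sst_cases(2)[OF x] by (simp add: power2_eq_square power3_eq_cube algebra_simps)
    moreover have "1 - sst x = (1 - x)\<^sup>2 * (1 + 2 * x)" using sst_cases(2)[OF x] by (simp add: power2_eq_square power3_eq_cube algebra_simps)
    moreover have "(1 - x)\<^sup>2 * (1 + 2 * x) \<ge> 0" "x\<^sup>2 * (3 - 2 * x) \<ge> 0" using x by auto
    ultimately show ?thesis by linarith
  qed
  then show "0 \<le> sst x" "sst x \<le> 1" by auto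
qed

lemma sst'_range: "0 \<le> sst' x" "sst' x \<le> 3 / 2"
proof -
  have "0 \<le> sst' x \<and> sst' x \<le> 3 / 2"
  proof (cases "x \<le> 0 \<or> x \<ge> 1")
    case True then show ?thesis using sst_cases by auto
  next
    case False
    then have x: "0 \<le> x" "x \<le> 1" by auto
    have "3 / 2 - sst' x = 6 * (x - 1/2)\<^sup>2" using sst_cases(2)[OF x] by (simp add: power2_eq_square algebra_simps)
    moreover have "6 * (x - 1/2)\<^sup>2 \<ge> 0" by simp
    moreover have "sst' x \<ge> 0" using sst_cases(2)[OF x] x by simp
    ultimately show ?thesis by linarith
  qed
  then show "0 \<le> sst' x" "sst' x \<le> 3 / 2" by auto
qed

lemma sst'_lower: "c \<le> x \<Longrightarrow> x \<le> 1 - c \<Longrightarrow> 0 \<le> c \<Longrightarrow> 6 * c * (1 - c) \<le> sst' x"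
proof -
  assume x: "c \<le> x" "x \<le> 1 - c" "0 \<le> c"
  have "0 \<le> 6 * ((x - c) * (1 - c - x))" using x by auto
  also have "\<dots> = 6 * x * (1 - x) - 6 * c * (1 - c)" by (simp add: algebra_simps)
  finally show ?thesis using sst_cases(2)[of x] x by simp
qed

lemma sstI_range: "0 \<le> sstI x" "sstI x \<le> max 0 x" "\<bar>sstI x - max 0 x\<bar> \<le> 1"
proof -
  have "0 \<le> sstI x \<and> sstI x \<le> max 0 x \<and> \<bar>sstI x - max 0 x\<bar> \<le> 1"
  proof (cases "x \<le> 0 \<or> x \<ge> 1")
    case True then show ?thesis using sst_cases by auto
  next
    case False
    then have x: "0 \<le> x" "x \<le> 1" by auto
    have "sstI x = x ^ 3 * (1 - x / 2)" using sst_cases(2)[OF x] by (simp add: power3_eq_cube power4_eq_xxxx algebra_simps)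
    moreover have "0 \<le> x ^ 3 * (1 - x / 2)" using x by auto
    moreover have "x ^ 3 * (1 - x / 2) \<le> x ^ 1 * 1" using x by (intro mult_mono power_decreasing) auto
    moreover have "max 0 x = x" using x by simp
    ultimately have "0 \<le> sstI x" "sstI x \<le> x" "max 0 x = x" by simp_all
    then show ?thesis using x by (simp add: abs_le_iff)
  qed
  then show "0 \<le> sstI x" "sstI x \<le> max 0 x" "\<bar>sstI x - max 0 x\<bar> \<le> 1" by auto
qed

lemma sst_rescaled:
  fixes a d :: real
  assumes "d > 0"
  shows "((\<lambda>s. d * sstI ((s - a) / d)) has_real_derivative sst ((s - a) / d)) (at s)"
    and "((\<lambda>s. sst ((s - a) / d)) has_real_derivative sst' ((s - a) / d) / d) (at s)"
    and "continuous_on UNIV (\<lambda>s. sst' ((s - a) / d) / d)"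
proof -
  have s: "((\<lambda>s. (s - a) / d) has_real_derivative 1 / d) (at s)" using assms by (auto intro!: derivative_eq_intros)
  show "((\<lambda>s. d * sstI ((s - a) / d)) has_real_derivative sst ((s - a) / d)) (at s)"
    using DERIV_cmult[OF DERIV_chain2[OF sstI_derivative s], of d] assms by simp
  show "((\<lambda>s. sst ((s - a) / d)) has_real_derivative sst' ((s - a) / d) / d) (at s)"
    using DERIV_chain2[OF sst_derivative s] by simp
  show "continuous_on UNIV (\<lambda>s. sst' ((s - a) / d) / d)"
    by (intro continuous_intros continuous_on_compose2[OF sst'_continuous]) (use assms in auto)
qed

lemma sst_measurable[measurable]: "sst \<in> borel_measurable borel" "sst' \<in> borel_measurable borel" "sstI \<in> borel_measurable borel"
proof -
  show "sst' \<in> borel_measurable borel" using sst'_continuous by (rule borel_measurable_continuous_onI)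
  have "continuous_on UNIV sst" by (intro continuous_at_imp_continuous_on ballI DERIV_isCont[OF sst_derivative])
  then show "sst \<in> borel_measurable borel" by (rule borel_measurable_continuous_onI)
  have "continuous_on UNIV sstI" by (intro continuous_at_imp_continuous_on ballI DERIV_isCont[OF sstI_derivative])
  then show "sstI \<in> borel_measurable borel" by (rule borel_measurable_continuous_onI)
qed

lemma superpair_combine_sst:
  fixes u v \<phi> :: "'a::euclidean_space \<times> real \<Rightarrow> real" and g h :: "'a \<times> real \<Rightarrow> 'a" and a d :: real
  assumes "p > 2" "open U" "superpair U p u g" "superpair U p v h"
    and "C1 \<phi> D" "compact K" "K \<subseteq> U" "\<And>z. z \<notin> K \<Longrightarrow> \<phi> z = 0" and d: "d > 0"
  defines "x z \<equiv> (v z - u z - a) / d"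
  defines "L z \<equiv> \<phi> z * (sst' (x z) / d) * ((Aflux p (h z) - Aflux p (g z)) \<bullet> (h z - g z))"
    and "R z \<equiv> (sst (x z) *\<^sub>R Aflux p (g z) + (1 - sst (x z)) *\<^sub>R Aflux p (h z)) \<bullet> gradD D z - (v z - d * sstI (x z)) * D z (0, 1)"
  shows "integrable lborel L" "integrable lborel R"
    and "(\<And>z. 0 \<le> \<phi> z) \<Longrightarrow> (\<integral>z. L z \<partial>lborel) \<le> (\<integral>z. R z \<partial>lborel)"
    and "b \<in> Basis \<Longrightarrow> (\<integral>z. (v z - d * sstI (x z)) * D z (b, 0) \<partial>lborel)
           = - (\<integral>z. ((sst (x z) *\<^sub>R g z + (1 - sst (x z)) *\<^sub>R h z) \<bullet> b) * \<phi> z \<partial>lborel)"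
proof -
  have B: "sst' ((s - a) / d) / d \<le> 3 / 2 / d" "0 \<le> sst' ((s - a) / d) / d" for s
    using divide_right_mono[OF sst'_range(2)[of "(s - a) / d"], of d] sst'_range(1)[of "(s - a) / d"] d by simp_all
  note c = superpair_combine[OF assms(1-8) sst_rescaled[OF d, of a] sst_range B(2) B(1)]
  show "integrable lborel L" "integrable lborel R" unfolding L_def R_def x_def by ((rule c(1) c(2)), use assms(8) in auto)+
  show "(\<integral>z. L z \<partial>lborel) \<le> (\<integral>z. R z \<partial>lborel)" if "\<And>z. 0 \<le> \<phi> z"
    unfolding L_def R_def x_def by (rule c(3)) (use assms(8) that in auto)
  show "b \<in> Basis \<Longrightarrow> (\<integral>z. (v z - d * sstI (x z)) * D z (b, 0) \<partial>lborel)
           = - (\<integral>z. ((sst (x z) *\<^sub>R g z + (1 - sst (x z)) *\<^sub>R h z) \<bullet> b) * \<phi> z \<partial>lborel)"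
    unfolding x_def by (rule c(4)) (use assms(8) in auto)
qed

lemma test_funE:
  assumes "test_fun U \<phi>"
  obtains D K where "C1 \<phi> D" "compact K" "K \<subseteq> U" "\<And>z. z \<notin> K \<Longrightarrow> \<phi> z = 0" "D = (\<lambda>z. frechet_derivative \<phi> (at z))"
proof (rule that)
  show "C1 \<phi> (\<lambda>z. frechet_derivative \<phi> (at z))" using assms by (intro smooth_fun_C1) (auto simp: test_fun_def)
  show "compact (closure {z. \<phi> z \<noteq> 0})" "closure {z. \<phi> z \<noteq> 0} \<subseteq> U" using assms by (auto simp: test_fun_def)
  show "\<phi> z = 0" if "z \<notin> closure {z. \<phi> z \<noteq> 0}" for z
  proof (rule ccontr)
    assume "\<phi> z \<noteq> 0"
    then have "z \<in> {z. \<phi> z \<noteq> 0}" by simp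
    then show False using that closure_subset[of "{z. \<phi> z \<noteq> 0}"] by (meson subsetD)
  qed
qed simp

lemma superpairI:
  fixes u :: "'a::euclidean_space \<times> real \<Rightarrow> real" and g :: "'a \<times> real \<Rightarrow> 'a"
  assumes "u \<in> borel_measurable borel" "g \<in> borel_measurable borel"
    and "\<And>K. compact K \<Longrightarrow> K \<subseteq> U \<Longrightarrow> integrable lborel (\<lambda>z. indicator K z * \<bar>u z\<bar> powr p)"
    and "\<And>K. compact K \<Longrightarrow> K \<subseteq> U \<Longrightarrow> integrable lborel (\<lambda>z. indicator K z * norm (g z) powr p)"
    and w: "\<And>\<phi> D K b. C1 \<phi> D \<Longrightarrow> compact K \<Longrightarrow> K \<subseteq> U \<Longrightarrow> (\<And>z. z \<notin> K \<Longrightarrow> \<phi> z = 0) \<Longrightarrow> b \<in> Basis \<Longrightarrow>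
        (\<integral>z. u z * D z (b, 0) \<partial>lborel) = - (\<integral>z. (g z \<bullet> b) * \<phi> z \<partial>lborel)"
    and s: "\<And>\<phi> D K. C1 \<phi> D \<Longrightarrow> compact K \<Longrightarrow> K \<subseteq> U \<Longrightarrow> (\<And>z. z \<notin> K \<Longrightarrow> \<phi> z = 0) \<Longrightarrow> (\<And>z. 0 \<le> \<phi> z) \<Longrightarrow>
        0 \<le> (\<integral>z. Aflux p (g z) \<bullet> gradD D z - u z * D z (0, 1) \<partial>lborel)"
  shows "superpair U p u g"
  unfolding superpair_def
proof (intro conjI allI impI; (elim conjE)?)
  fix \<phi> and b :: 'a assume t: "test_fun U \<phi>" and b: "b \<in> Basis"
  obtain D K where DK: "C1 \<phi> D" "compact K" "K \<subseteq> U" "\<And>z. z \<notin> K \<Longrightarrow> \<phi> z = 0" "D = (\<lambda>z. frechet_derivative \<phi> (at z))"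
    by (rule test_funE[OF t]) blast
  show "(\<integral>z. u z * frechet_derivative \<phi> (at z) (b, 0) \<partial>lborel) = - (\<integral>z. (g z \<bullet> b) * \<phi> z \<partial>lborel)"
    using w[OF DK(1-4) b] DK(5) by simp
next
  fix \<phi> assume t: "test_fun U \<phi>" and n: "\<forall>z. 0 \<le> \<phi> z"
  obtain D K where DK: "C1 \<phi> D" "compact K" "K \<subseteq> U" "\<And>z. z \<notin> K \<Longrightarrow> \<phi> z = 0" "D = (\<lambda>z. frechet_derivative \<phi> (at z))"
    by (rule test_funE[OF t]) blast
  have "grad_x \<phi> z = gradD D z" "dt \<phi> z = D z (0, 1)" for z by (simp_all add: grad_x_def gradD_def dt_def DK(5))
  then show "0 \<le> (\<integral>z. Aflux p (g z) \<bullet> grad_x \<phi> z - u z * dt \<phi> z \<partial>lborel)"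
    using s[OF DK(1-4)] n by simp
qed (use assms(1-4) in auto)

lemma superpair_const:
  assumes "p > 2" shows "superpair U p (\<lambda>z. k) (\<lambda>z. 0)"
proof (rule superpairI)
  fix \<phi> :: "'a \<times> real \<Rightarrow> real" and D K assume a: "C1 \<phi> D" "compact K" "\<And>z. z \<notin> K \<Longrightarrow> \<phi> z = 0"
  note z = C1_integral_derivative_zero[OF this]
  show "(\<integral>z. k * D z (b, 0) \<partial>lborel) = - (\<integral>z. ((0::'a) \<bullet> b) * \<phi> z \<partial>lborel)" for b using z by simp
  show "0 \<le> (\<integral>z. Aflux p (0::'a) \<bullet> gradD D z - k * D z (0, 1) \<partial>lborel)" using z by simp
next
  fix K :: "('a \<times> real) set" assume K: "compact K"
  show "integrable lborel (\<lambda>z. indicator K z * \<bar>k\<bar> powr p)" "integrable lborel (\<lambda>z. indicator K z * norm (0::'a) powr p)"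
    using integrable_indicator_compact[OF K] by auto
qed auto

lemma superpair_local:
  assumes S: "superpair U p u g" and p: "p > 2" and K: "compact K" "K \<subseteq> U"
  shows "integrable lborel (\<lambda>z. indicator K z * \<bar>u z\<bar>)" "integrable lborel (\<lambda>z. indicator K z * norm (g z))"
    "integrable lborel (\<lambda>z. indicator K z * norm (Aflux p (g z)))"
    "integrable lborel (\<lambda>z. indicator K z * \<bar>u z\<bar> powr p)" "integrable lborel (\<lambda>z. indicator K z * norm (g z) powr p)"
    "u \<in> borel_measurable borel" "g \<in> borel_measurable borel"
proof -
  show [measurable]: "u \<in> borel_measurable borel" "g \<in> borel_measurable borel" using S by (auto simp: superpair_def)
  have [measurable]: "K \<in> sets borel" using K borel_compact by blast
  show iu: "integrable lborel (\<lambda>z. indicator K z * \<bar>u z\<bar> powr p)"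
    and ig: "integrable lborel (\<lambda>z. indicator K z * norm (g z) powr p)" using S K by (auto simp: superpair_def)
  have iK: "integrable lborel (indicator K :: _ \<Rightarrow> real)" using integrable_indicator_compact[OF K(1)] .
  show "integrable lborel (\<lambda>z. indicator K z * \<bar>u z\<bar>)"
    by (rule Bochner_Integration.integrable_bound[OF Bochner_Integration.integrable_add[OF iK iu]])
      (use p in \<open>auto simp: indicator_def intro!: le_one_plus_powr1\<close>)
  show "integrable lborel (\<lambda>z. indicator K z * norm (g z))"
    by (rule Bochner_Integration.integrable_bound[OF Bochner_Integration.integrable_add[OF iK ig]])
      (use p in \<open>auto simp: indicator_def intro!: le_one_plus_powr1\<close>)
  show "integrable lborel (\<lambda>z. indicator K z * norm (Aflux p (g z)))"
    by (rule Bochner_Integration.integrable_bound[OF Bochner_Integration.integrable_add[OF iK ig]])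
      (use p in \<open>auto simp: norm_Aflux indicator_def intro!: le_one_plus_powr\<close>)
qed

lemma superpair_min:
  fixes u v :: "'a::euclidean_space \<times> real \<Rightarrow> real" and g h :: "'a \<times> real \<Rightarrow> 'a"
  assumes p: "p > 2" and U: "open U" and Su: "superpair U p u g" and Sv: "superpair U p v h"
  shows "superpair U p (\<lambda>z. min (u z) (v z)) (\<lambda>z. if u z < v z then g z else h z)"
proof (rule superpairI)
  have [measurable]: "u \<in> borel_measurable borel" "v \<in> borel_measurable borel" "g \<in> borel_measurable borel" "h \<in> borel_measurable borel"
    using Su Sv by (auto simp: superpair_def)
  show "(\<lambda>z. min (u z) (v z)) \<in> borel_measurable borel" "(\<lambda>z. if u z < v z then g z else h z) \<in> borel_measurable borel" by measurable
  { fix K assume K: "compact K" "K \<subseteq> U"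
    note lu = superpair_local[OF Su p K] and lv = superpair_local[OF Sv p K]
    have [measurable]: "K \<in> sets borel" using K borel_compact by blast
    show "integrable lborel (\<lambda>z. indicator K z * \<bar>min (u z) (v z)\<bar> powr p)"
      by (rule Bochner_Integration.integrable_bound[OF Bochner_Integration.integrable_add[OF lu(4) lv(4)]])
        (auto simp: indicator_def min_def)
    show "integrable lborel (\<lambda>z. indicator K z * norm (if u z < v z then g z else h z) powr p)"
      by (rule Bochner_Integration.integrable_bound[OF Bochner_Integration.integrable_add[OF lu(5) lv(5)]])
        (auto simp: indicator_def) }
  fix \<phi> :: "'a \<times> real \<Rightarrow> real" and D K assume \<phi>: "C1 \<phi> D" and K: "compact K" "K \<subseteq> U" "\<And>z. z \<notin> K \<Longrightarrow> \<phi> z = 0"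
  note lu = superpair_local[OF Su p K(1,2)] and lv = superpair_local[OF Sv p K(1,2)]
  define d :: "nat \<Rightarrow> real" where "d n = 1 / Suc n" for n
  have d: "d n > 0" "d n \<le> 1" for n by (auto simp: d_def)
  have d0: "d \<longlonglongrightarrow> 0" unfolding d_def using LIMSEQ_inverse_real_of_nat by (simp add: inverse_eq_divide)
  define x where "x n z = (v z - u z - 0) / d n" for n z
  define G where "G z = (if u z < v z then g z else h z)" for z
  define m where "m z = min (u z) (v z)" for z
  note co = superpair_combine_sst[OF p U Su Sv \<phi> K(1,2) _ d(1), where a=0]
  have D0: "D z w = 0" if "z \<notin> K" for z w
    by (rule C1_D_zero[OF \<phi> compact_imp_closed[OF K(1)] K(3) that])
  have G0: "gradD D z = 0" if "z \<notin> K" for z using D0[OF that] by (simp add: gradD_def)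
  have [measurable]: "(\<lambda>z. D z w) \<in> borel_measurable borel" "gradD D \<in> borel_measurable borel" "\<phi> \<in> borel_measurable borel" for w
    by (rule borel_measurable_continuous_onI[OF C1_cont_D[OF \<phi>]], rule gradD_measurable[OF \<phi>], rule borel_measurable_continuous_onI[OF C1_cont[OF \<phi>]])
  have [measurable]: "x n \<in> borel_measurable borel" "G \<in> borel_measurable borel" "m \<in> borel_measurable borel" for n
    unfolding x_def[abs_def] G_def[abs_def] m_def[abs_def] by measurable
  have ls: "(\<lambda>n. sst (x n z)) \<longlonglongrightarrow> (if u z < v z then 1 else 0)" for z
  proof (cases "u z < v z")
    case True
    have "\<forall>\<^sub>F n in sequentially. d n < v z - u z" using d0 True by (intro order_tendstoD(2)) auto
    then have "\<forall>\<^sub>F n in sequentially. sst (x n z) = 1"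
    proof (rule eventually_mono)
      fix n assume "d n < v z - u z"
      then have "1 \<le> x n z" using d(1)[of n] by (simp add: x_def)
      then show "sst (x n z) = 1" using sst_cases(3) by blast
    qed
    then show ?thesis using True by (simp add: tendsto_eventually)
  next
    case False
    then have "x n z \<le> 0" for n using d(1)[of n] by (simp add: x_def divide_nonpos_pos)
    then have "sst (x n z) = 0" for n using sst_cases(1) by blast
    then show ?thesis using False by simp
  qed
  have li: "(\<lambda>n. v z - d n * sstI (x n z)) \<longlonglongrightarrow> m z" for z
  proof -
    have "\<bar>(v z - d n * sstI (x n z)) - m z\<bar> \<le> d n" for n
    proof -
      have "d n * max 0 (x n z) = max 0 (v z - u z)" using d(1)[of n] by (simp add: x_def max_def zero_le_divide_iff field_simps)
      then have "(v z - d n * sstI (x n z)) - m z = - (d n * (sstI (x n z) - max 0 (x n z)))"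
        by (auto simp: m_def right_diff_distrib max_def min_def)
      then show ?thesis using mult_left_mono[OF sstI_range(3)[of "x n z"], of "d n"] d(1)[of n] by (simp add: abs_mult)
    qed
    then have "(\<lambda>n. (v z - d n * sstI (x n z)) - m z) \<longlonglongrightarrow> 0"
      using d0 by (intro Lim_null_comparison[OF _ d0]) auto
    then show ?thesis by (rule LIM_zero_cancel)
  qed
  have mb: "\<bar>v z - d n * sstI (x n z)\<bar> \<le> \<bar>u z\<bar> + 2 * \<bar>v z\<bar>" for n z
  proof -
    have "d n * sstI (x n z) \<le> d n * max 0 (x n z)" "0 \<le> d n * sstI (x n z)"
      using sstI_range[of "x n z"] d(1)[of n] by (auto intro!: mult_left_mono)
    moreover have "d n * max 0 (x n z) = max 0 (v z - u z)" using d(1)[of n] by (simp add: x_def max_def zero_le_divide_iff field_simps)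
    ultimately show ?thesis by (auto simp: max_def split: if_splits)
  qed
  obtain B1 where B1: "B1 > 0" "\<And>z. \<bar>\<phi> z\<bar> \<le> B1" using cont_compact_support_bounded[OF C1_cont[OF \<phi>] K(1,3)] by blast
  obtain B2 where B2: "B2 > 0" "\<And>z. \<bar>D z (0,1)\<bar> \<le> B2" using cont_compact_support_bounded[OF C1_cont_D[OF \<phi>] K(1) D0] by blast
  obtain B3 where B3: "B3 > 0" "\<And>z. \<bar>norm (gradD D z)\<bar> \<le> B3"
    using cont_compact_support_bounded[of "\<lambda>z. norm (gradD D z)", OF continuous_on_norm[OF continuous_gradD[OF \<phi>]] K(1)] G0 by auto
  have conv: "norm (sst y *\<^sub>R a + (1 - sst y) *\<^sub>R b) \<le> norm a + norm b" for y and a b :: 'a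
  proof -
    have "norm (sst y *\<^sub>R a + (1 - sst y) *\<^sub>R b) \<le> sst y * norm a + (1 - sst y) * norm b"
      using sst_range[of y] by (intro order_trans[OF norm_triangle_ineq]) auto
    also have "\<dots> \<le> 1 * norm a + 1 * norm b" using sst_range[of y] by (intro add_mono mult_right_mono) auto
    finally show ?thesis by simp
  qed
  show "(\<integral>z. min (u z) (v z) * D z (b, 0) \<partial>lborel) = - (\<integral>z. ((if u z < v z then g z else h z) \<bullet> b) * \<phi> z \<partial>lborel)"
    if b: "b \<in> Basis" for b
  proof -
    have cA: "(\<lambda>n. \<integral>z. (v z - d n * sstI (x n z)) * D z (b, 0) \<partial>lborel) \<longlonglongrightarrow> (\<integral>z. m z * D z (b, 0) \<partial>lborel)"
    proof (rule integral_dominated_convergence[where w="\<lambda>z. B3 * (indicator K z * \<bar>u z\<bar> + 2 * (indicator K z * \<bar>v z\<bar>))"])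
      show "AE z in lborel. (\<lambda>n. (v z - d n * sstI (x n z)) * D z (b, 0)) \<longlonglongrightarrow> m z * D z (b, 0)"
        by (intro AE_I2 tendsto_intros li)
      show "AE z in lborel. norm ((v z - d n * sstI (x n z)) * D z (b, 0)) \<le> B3 * (indicator K z * \<bar>u z\<bar> + 2 * (indicator K z * \<bar>v z\<bar>))" for n
      proof (rule AE_I2)
        fix z
        have "\<bar>D z (b, 0)\<bar> \<le> B3" using Basis_le_norm[OF b, of "gradD D z"] B3(2)[of z] by (simp add: gradD_inner_Basis[OF b])
        then have "\<bar>v z - d n * sstI (x n z)\<bar> * \<bar>D z (b, 0)\<bar> \<le> (\<bar>u z\<bar> + 2 * \<bar>v z\<bar>) * B3" using mb[of z n] by (intro mult_mono) auto
        then show "norm ((v z - d n * sstI (x n z)) * D z (b, 0)) \<le> B3 * (indicator K z * \<bar>u z\<bar> + 2 * (indicator K z * \<bar>v z\<bar>))"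
          using D0[of z] by (cases "z \<in> K") (auto simp: abs_mult mult.commute)
      qed
    qed (use lu(1) lv(1) in auto)
    have cB: "(\<lambda>n. \<integral>z. ((sst (x n z) *\<^sub>R g z + (1 - sst (x n z)) *\<^sub>R h z) \<bullet> b) * \<phi> z \<partial>lborel) \<longlonglongrightarrow> (\<integral>z. (G z \<bullet> b) * \<phi> z \<partial>lborel)"
    proof (rule integral_dominated_convergence[where w="\<lambda>z. B1 * (indicator K z * norm (g z) + indicator K z * norm (h z))"])
      have "(\<lambda>n. sst (x n z) *\<^sub>R g z + (1 - sst (x n z)) *\<^sub>R h z) \<longlonglongrightarrow> G z" for z
      proof -
        have "(\<lambda>n. sst (x n z) *\<^sub>R g z + (1 - sst (x n z)) *\<^sub>R h z) \<longlonglongrightarrow> (if u z < v z then 1 else 0) *\<^sub>R g z + (1 - (if u z < v z then 1 else 0)) *\<^sub>R h z"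
          by (intro tendsto_intros ls)
        then show ?thesis by (simp add: G_def split: if_splits)
      qed
      then show "AE z in lborel. (\<lambda>n. ((sst (x n z) *\<^sub>R g z + (1 - sst (x n z)) *\<^sub>R h z) \<bullet> b) * \<phi> z) \<longlonglongrightarrow> (G z \<bullet> b) * \<phi> z"
        by (intro AE_I2 tendsto_intros)
      show "AE z in lborel. norm (((sst (x n z) *\<^sub>R g z + (1 - sst (x n z)) *\<^sub>R h z) \<bullet> b) * \<phi> z) \<le> B1 * (indicator K z * norm (g z) + indicator K z * norm (h z))" for n
      proof (rule AE_I2)
        fix z
        have "\<bar>(sst (x n z) *\<^sub>R g z + (1 - sst (x n z)) *\<^sub>R h z) \<bullet> b\<bar> * \<bar>\<phi> z\<bar> \<le> (norm (g z) + norm (h z)) * B1"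
          using order_trans[OF Basis_le_norm[OF b] conv] B1(2)[of z] by (intro mult_mono) auto
        then show "norm (((sst (x n z) *\<^sub>R g z + (1 - sst (x n z)) *\<^sub>R h z) \<bullet> b) * \<phi> z) \<le> B1 * (indicator K z * norm (g z) + indicator K z * norm (h z))"
          unfolding real_norm_def abs_mult using K(3)[of z] by (cases "z \<in> K") (auto simp: mult.commute)
      qed
    qed (use lu(2) lv(2) in auto)
    have "(\<lambda>n. \<integral>z. (v z - d n * sstI (x n z)) * D z (b, 0) \<partial>lborel) = (\<lambda>n. - (\<integral>z. ((sst (x n z) *\<^sub>R g z + (1 - sst (x n z)) *\<^sub>R h z) \<bullet> b) * \<phi> z \<partial>lborel))"
      unfolding x_def by (rule ext, rule co(4)) (use K(3) b in auto)
    then show ?thesis using LIMSEQ_unique[OF cA] tendsto_minus[OF cB] by (simp add: m_def G_def)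
  qed
  show "0 \<le> (\<integral>z. Aflux p (if u z < v z then g z else h z) \<bullet> gradD D z - min (u z) (v z) * D z (0, 1) \<partial>lborel)"
    if \<phi>0: "\<And>z. 0 \<le> \<phi> z"
  proof -
    define R where "R n z = (sst (x n z) *\<^sub>R Aflux p (g z) + (1 - sst (x n z)) *\<^sub>R Aflux p (h z)) \<bullet> gradD D z - (v z - d n * sstI (x n z)) * D z (0, 1)" for n z
    have R0: "0 \<le> (\<integral>z. R n z \<partial>lborel)" for n
    proof -
      have "0 \<le> (\<integral>z. \<phi> z * (sst' (x n z) / d n) * ((Aflux p (h z) - Aflux p (g z)) \<bullet> (h z - g z)) \<partial>lborel)"
      proof (rule Bochner_Integration.integral_nonneg)
        fix z
        have "0 \<le> 2 powr (1 - p) * norm (h z - g z) powr p" by simp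
        then have "0 \<le> (Aflux p (h z) - Aflux p (g z)) \<bullet> (h z - g z)" using Aflux_monotone[OF p] by (rule order_trans)
        then show "0 \<le> \<phi> z * (sst' (x n z) / d n) * ((Aflux p (h z) - Aflux p (g z)) \<bullet> (h z - g z))"
          using \<phi>0[of z] sst'_range(1)[of "x n z"] d(1)[of n]
          by (intro mult_nonneg_nonneg divide_nonneg_pos) auto
      qed
      also have "\<dots> \<le> (\<integral>z. R n z \<partial>lborel)" unfolding R_def x_def by (rule co(3)) (use K(3) \<phi>0 in auto)
      finally show ?thesis .
    qed
    have "(\<lambda>n. \<integral>z. R n z \<partial>lborel) \<longlonglongrightarrow> (\<integral>z. Aflux p (G z) \<bullet> gradD D z - m z * D z (0, 1) \<partial>lborel)"
    proof (rule integral_dominated_convergence[where w="\<lambda>z. B3 * (indicator K z * norm (Aflux p (g z)) + indicator K z * norm (Aflux p (h z))) + B2 * (indicator K z * \<bar>u z\<bar> + 2 * (indicator K z * \<bar>v z\<bar>))"])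
      have lG: "(\<lambda>n. sst (x n z) *\<^sub>R Aflux p (g z) + (1 - sst (x n z)) *\<^sub>R Aflux p (h z)) \<longlonglongrightarrow> Aflux p (G z)" for z
      proof -
        have "(\<lambda>n. sst (x n z) *\<^sub>R Aflux p (g z) + (1 - sst (x n z)) *\<^sub>R Aflux p (h z)) \<longlonglongrightarrow> (if u z < v z then 1 else 0) *\<^sub>R Aflux p (g z) + (1 - (if u z < v z then 1 else 0)) *\<^sub>R Aflux p (h z)"
          by (intro tendsto_intros ls)
        then show ?thesis by (simp add: G_def split: if_splits)
      qed
      show "AE z in lborel. (\<lambda>n. R n z) \<longlonglongrightarrow> Aflux p (G z) \<bullet> gradD D z - m z * D z (0, 1)"
        unfolding R_def by (intro AE_I2 tendsto_intros lG li)
      show "AE z in lborel. norm (R n z) \<le> B3 * (indicator K z * norm (Aflux p (g z)) + indicator K z * norm (Aflux p (h z))) + B2 * (indicator K z * \<bar>u z\<bar> + 2 * (indicator K z * \<bar>v z\<bar>))" for n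
      proof (rule AE_I2)
        fix z
        have 1: "\<bar>(sst (x n z) *\<^sub>R Aflux p (g z) + (1 - sst (x n z)) *\<^sub>R Aflux p (h z)) \<bullet> gradD D z\<bar> \<le> (norm (Aflux p (g z)) + norm (Aflux p (h z))) * B3"
          using conv B3(2)[of z] by (intro order_trans[OF Cauchy_Schwarz_ineq2] mult_mono) auto
        have 2: "\<bar>(v z - d n * sstI (x n z)) * D z (0, 1)\<bar> \<le> (\<bar>u z\<bar> + 2 * \<bar>v z\<bar>) * B2"
          unfolding abs_mult using mb[of z n] B2(2)[of z] by (intro mult_mono) auto
        show "norm (R n z) \<le> B3 * (indicator K z * norm (Aflux p (g z)) + indicator K z * norm (Aflux p (h z))) + B2 * (indicator K z * \<bar>u z\<bar> + 2 * (indicator K z * \<bar>v z\<bar>))"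
        proof (cases "z \<in> K")
          case True
          have "norm (R n z) \<le> (norm (Aflux p (g z)) + norm (Aflux p (h z))) * B3 + (\<bar>u z\<bar> + 2 * \<bar>v z\<bar>) * B2"
            unfolding R_def real_norm_def by (rule order_trans[OF abs_triangle_ineq4 add_mono[OF 1 2]])
          then show ?thesis using True by (simp add: mult.commute)
        qed (simp add: R_def D0 G0)
      qed
      show "(\<lambda>z. R n z) \<in> borel_measurable lborel" for n unfolding R_def by measurable
    qed (use lu(1,3) lv(1,3) in auto)
    then have "0 \<le> (\<integral>z. Aflux p (G z) \<bullet> gradD D z - m z * D z (0, 1) \<partial>lborel)"
      using R0 by (intro LIMSEQ_le_const) auto
    then show ?thesis by (simp add: G_def m_def)
  qed
qed

lemma cutoff_exists:
  fixes K :: "'e::euclidean_space set"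
  assumes K: "compact K" and U: "open U" and KU: "K \<subseteq> U"
  obtains \<eta> D K' where "C1 \<eta> D" "compact K'" "K' \<subseteq> U" "\<And>z. z \<notin> K' \<Longrightarrow> \<eta> z = 0" "\<And>z. z \<in> K \<Longrightarrow> \<eta> z = 1"
    "\<And>z. 0 \<le> \<eta> z" "\<And>z. \<eta> z \<le> 1" "K \<subseteq> K'"
proof -
  obtain e C' where e: "e > 0" "compact C'" "C' \<subseteq> U" "\<And>x. x \<in> K \<Longrightarrow> cball x e \<subseteq> C'"
    using compact_neighbourhood[OF K U KU] by metis
  obtain e2 C2 where e2: "e2 > 0" "compact C2" "C2 \<subseteq> U" "\<And>x. x \<in> C' \<Longrightarrow> cball x e2 \<subseteq> C2"
    using compact_neighbourhood[OF e(2) U e(3)] by metis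
  define \<epsilon> where "\<epsilon> = min e e2"
  have \<epsilon>: "\<epsilon> > 0" "\<epsilon> \<le> e" "\<epsilon> \<le> e2" using e e2 by (auto simp: \<epsilon>_def)
  have [measurable]: "C' \<in> sets borel" using e borel_compact by blast
  define \<eta> where "\<eta> = moll \<epsilon> (indicator C' :: 'e \<Rightarrow> real)"
  have i: "integrable lborel (indicator C' :: 'e \<Rightarrow> real)" using integrable_indicator_compact[OF e(2)] .
  have eq: "\<eta> z = (\<integral>h. kern \<epsilon> h * indicator C' (z + h) \<partial>lborel)" for z
    unfolding \<eta>_def by (subst moll_shift) auto
  note k = kern_integral[OF \<epsilon>(1), where 'e='e]
  have ik: "integrable lborel (\<lambda>h. kern \<epsilon> h * indicator C' (z + h) :: real)" for z
    using kern_scaleR_integrable(2)[OF i \<epsilon>(1)] by simp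
  have cb: "x + h \<in> cball x r" if "norm h \<le> r" for x h :: 'e and r using that by (simp add: dist_norm)
  show ?thesis
  proof (rule that[of \<eta> _ C2])
    show "C1 \<eta> (\<lambda>z v. - (\<integral>y. frechet_derivative (\<lambda>y. kern \<epsilon> (z - y)) (at y) v * indicator C' y \<partial>lborel))"
      unfolding \<eta>_def by (rule moll_C1[OF i \<epsilon>(1)])
    show "compact C2" "C2 \<subseteq> U" using e2 by auto
    show "K \<subseteq> C2" using e(4) e2(4) e(1) e2(1) by (metis centre_in_cball less_imp_le subsetD subsetI)
    show "0 \<le> \<eta> z" for z unfolding eq by (intro Bochner_Integration.integral_nonneg) (auto simp: kern_nonneg)
    show "\<eta> z \<le> 1" for z
    proof -
      have "\<eta> z \<le> (\<integral>h. kern \<epsilon> (h::'e) \<partial>lborel)" unfolding eq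
        by (rule integral_mono[OF ik k(1)]) (auto simp: indicator_def kern_nonneg)
      then show ?thesis using k by simp
    qed
    show "\<eta> z = 1" if "z \<in> K" for z
    proof -
      have "kern \<epsilon> h * indicator C' (z + h) = kern \<epsilon> h" for h :: 'e
        using kern_zero[of \<epsilon> h] e(4)[OF that] cb[of h e z] \<epsilon> by (cases "norm h \<ge> \<epsilon>") (auto simp: indicator_def)
      then have "\<eta> z = (\<integral>h. kern \<epsilon> (h::'e) \<partial>lborel)" unfolding eq by (intro Bochner_Integration.integral_cong refl)
      then show ?thesis using k by simp
    qed
    show "\<eta> z = 0" if "z \<notin> C2" for z
    proof -
      have "kern \<epsilon> h * indicator C' (z + h) = (0::real)" for h :: 'e
      proof (cases "norm h \<ge> \<epsilon>")
        case True then show ?thesis using kern_zero[of \<epsilon> h] \<epsilon> by simp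
      next
        case False
        have "z + h \<notin> C'"
        proof
          assume "z + h \<in> C'"
          from e2(4)[OF this] cb[of "- h" e2 "z + h"] False \<epsilon> have "z \<in> C2" by auto
          then show False using that by simp
        qed
        then show ?thesis by simp
      qed
      then have "\<eta> z = (\<integral>h. 0 \<partial>(lborel::'e measure))" unfolding eq by (intro Bochner_Integration.integral_cong refl)
      then show ?thesis by simp
    qed
  qed
qed

section \<open>Convergence lemmas and the Caccioppoli estimate\<close>

lemma le_add_powr:
  fixes a l r :: real
  assumes "a \<ge> 0" "l > 0" "r \<ge> 1"
  shows "a \<le> l + l powr (1 - r) * a powr r"
proof (cases "a \<le> l")
  case True then show ?thesis using assms by (simp add: add_increasing2)
next
  case False
  then have "l powr (r - 1) \<le> a powr (r - 1)" using assms by (intro powr_mono2) auto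
  then have "a * l powr (r - 1) \<le> a powr r" using assms powr_mult_base[of a "r - 1"] mult_left_mono[of "l powr (r - 1)" "a powr (r - 1)" a] by simp
  then have "l powr (1 - r) * (a * l powr (r - 1)) \<le> l powr (1 - r) * a powr r" by (intro mult_left_mono) auto
  moreover have "l powr (1 - r) * l powr (r - 1) = 1" using assms by (simp flip: powr_add)
  ultimately have "a \<le> l powr (1 - r) * a powr r" by (simp add: algebra_simps)
  then show ?thesis using assms by simp
qed

lemma powr_add_le:
  fixes a b r :: real
  assumes "a \<ge> 0" "b \<ge> 0" "r \<ge> 0"
  shows "(a + b) powr r \<le> 2 powr r * (a powr r + b powr r)"
proof -
  have "(a + b) powr r \<le> (2 * max a b) powr r" using assms by (intro powr_mono2) auto
  also have "\<dots> = 2 powr r * max a b powr r" using assms by (simp add: powr_mult)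
  also have "\<dots> \<le> 2 powr r * (a powr r + b powr r)" by (intro mult_left_mono) (auto simp: max_def)
  finally show ?thesis .
qed

lemma Fatou_Lr:
  fixes f :: "nat \<Rightarrow> 'e::euclidean_space \<Rightarrow> real"
  assumes f[measurable]: "\<And>n. f n \<in> borel_measurable borel" and F[measurable]: "F \<in> borel_measurable borel"
    and nn: "\<And>n z. 0 \<le> f n z" and Fn: "\<And>z. 0 \<le> F z"
    and lim: "AE z in lborel. (\<lambda>n. f n z) \<longlonglongrightarrow> F z"
    and i: "\<And>n. integrable lborel (f n)" and C: "\<And>n. (\<integral>z. f n z \<partial>lborel) \<le> C"
  shows "integrable lborel F" "(\<integral>z. F z \<partial>lborel) \<le> C"
proof -
  have C0: "0 \<le> C" using order_trans[OF Bochner_Integration.integral_nonneg C[of 0]] nn by auto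
  have "(\<integral>\<^sup>+z. F z \<partial>lborel) = (\<integral>\<^sup>+z. liminf (\<lambda>n. ennreal (f n z)) \<partial>lborel)"
  proof (rule nn_integral_cong_AE)
    show "AE z in lborel. ennreal (F z) = liminf (\<lambda>n. ennreal (f n z))"
      using lim
    proof eventually_elim
      case (elim z)
      then have "(\<lambda>n. ennreal (f n z)) \<longlonglongrightarrow> ennreal (F z)" by (rule tendsto_ennrealI)
      then show ?case using lim_imp_Liminf[OF sequentially_bot] by metis
    qed
  qed
  also have "\<dots> \<le> liminf (\<lambda>n. \<integral>\<^sup>+z. f n z \<partial>lborel)" by (rule nn_integral_liminf) measurable
  also have "\<dots> \<le> liminf (\<lambda>n. ennreal C)"
    using i C nn by (intro Liminf_mono always_eventually allI) (subst nn_integral_eq_integral, auto intro!: ennreal_leI)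
  also have "\<dots> = ennreal C" by (simp add: Liminf_const)
  finally have b: "(\<integral>\<^sup>+z. F z \<partial>lborel) \<le> ennreal C" .
  show I: "integrable lborel F" using b Fn by (intro integrableI_nonneg) (auto intro: le_less_trans)
  show "(\<integral>z. F z \<partial>lborel) \<le> C" using b nn_integral_eq_integral[OF I] Fn C0 by simp
qed

lemma Lr_bounded_convergence:
  fixes f :: "nat \<Rightarrow> 'e::euclidean_space \<Rightarrow> real"
  assumes K: "compact K" and f[measurable]: "\<And>n. f n \<in> borel_measurable borel" and F[measurable]: "F \<in> borel_measurable borel"
    and f0: "\<And>n z. z \<notin> K \<Longrightarrow> f n z = 0" and F0: "\<And>z. z \<notin> K \<Longrightarrow> F z = 0"
    and lim: "AE z in lborel. (\<lambda>n. f n z) \<longlonglongrightarrow> F z" and r: "r > 1"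
    and i: "\<And>n. integrable lborel (\<lambda>z. \<bar>f n z\<bar> powr r)" and C: "\<And>n. (\<integral>z. \<bar>f n z\<bar> powr r \<partial>lborel) \<le> C"
  shows "(\<lambda>n. \<integral>z. f n z \<partial>lborel) \<longlonglongrightarrow> (\<integral>z. F z \<partial>lborel)" "integrable lborel F" "\<And>n. integrable lborel (f n)"
proof -
  have C0: "0 \<le> C" using order_trans[OF Bochner_Integration.integral_nonneg C[of 0]] by auto
  have Kb[measurable]: "K \<in> sets borel" using K borel_compact by blast
  have iK: "integrable lborel (indicator K :: 'e \<Rightarrow> real)" using integrable_indicator_compact[OF K] .
  have limr: "AE z in lborel. (\<lambda>n. \<bar>f n z\<bar> powr r) \<longlonglongrightarrow> \<bar>F z\<bar> powr r"
    using lim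
  proof eventually_elim
    case (elim z)
    show ?case by (rule tendsto_powr'[OF tendsto_rabs[OF elim] tendsto_const]) (use r in auto)
  qed
  have iF: "integrable lborel (\<lambda>z. \<bar>F z\<bar> powr r)" and CF: "(\<integral>z. \<bar>F z\<bar> powr r \<partial>lborel) \<le> C"
    by (rule Fatou_Lr[OF _ _ _ _ limr i C]; simp)+
  have b: "\<bar>y\<bar> \<le> indicator K z + \<bar>y\<bar> powr r" if "z \<notin> K \<Longrightarrow> y = 0" for y z
    using le_one_plus_powr1[of "\<bar>y\<bar>" r] r that by (cases "z \<in> K") auto
  show I: "integrable lborel F"
    by (rule Bochner_Integration.integrable_bound[OF Bochner_Integration.integrable_add[OF iK iF]])
      (use b[OF F0] in \<open>auto intro!: AE_I2 order_trans[OF b[OF F0]]\<close>)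
  show In: "integrable lborel (f n)" for n
    by (rule Bochner_Integration.integrable_bound[OF Bochner_Integration.integrable_add[OF iK i[of n]]])
      (use b[OF f0] in \<open>auto intro!: AE_I2 order_trans[OF b[OF f0]]\<close>)
  have dr: "\<bar>f n z - F z\<bar> powr r \<le> 2 powr r * (\<bar>f n z\<bar> powr r + \<bar>F z\<bar> powr r)" for n z
  proof -
    have "\<bar>f n z - F z\<bar> powr r \<le> (\<bar>f n z\<bar> + \<bar>F z\<bar>) powr r" using r by (intro powr_mono2) auto
    also have "\<dots> \<le> 2 powr r * (\<bar>f n z\<bar> powr r + \<bar>F z\<bar> powr r)" using r by (intro powr_add_le) auto
    finally show ?thesis .
  qed
  have idr: "integrable lborel (\<lambda>z. \<bar>f n z - F z\<bar> powr r)" for n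
    by (rule Bochner_Integration.integrable_bound[of _ "\<lambda>z. 2 powr r * (\<bar>f n z\<bar> powr r + \<bar>F z\<bar> powr r)"]) (use dr i iF in auto)
  have Cdr: "(\<integral>z. \<bar>f n z - F z\<bar> powr r \<partial>lborel) \<le> 2 powr r * (2 * C)" for n
  proof -
    have "(\<integral>z. \<bar>f n z - F z\<bar> powr r \<partial>lborel) \<le> (\<integral>z. 2 powr r * (\<bar>f n z\<bar> powr r + \<bar>F z\<bar> powr r) \<partial>lborel)"
      by (rule integral_mono[OF idr _ dr]) (use i iF in auto)
    also have "\<dots> \<le> 2 powr r * (2 * C)" using i iF C[of n] CF by (simp add: mult_left_mono)
    finally show ?thesis .
  qed
  have "(\<lambda>n. \<integral>z. \<bar>f n z - F z\<bar> \<partial>lborel) \<longlonglongrightarrow> 0"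
  proof (rule LIMSEQ_I)
    fix e :: real assume e: "e > 0"
    define C' where "C' = 2 powr r * (2 * C) + 1"
    have C': "C' > 0" using C0 by (simp add: C'_def add_nonneg_pos)
    have "((\<lambda>x::real. x powr (1 - r)) \<longlongrightarrow> 0) at_top" using r by (intro tendsto_neg_powr filterlim_ident) auto
    then have "\<forall>\<^sub>F x in at_top. x powr (1 - r) < e / (2 * C')" using e C' by (intro order_tendstoD(2)) auto
    then have "\<forall>\<^sub>F x::real in at_top. x > 0 \<and> x powr (1 - r) < e / (2 * C')" using eventually_gt_at_top[of "0::real"] by eventually_elim auto
    then obtain l where l: "l > 0" "l powr (1 - r) < e / (2 * C')" using eventually_happens'[OF trivial_limit_at_top_linorder] by blast
    have lm: "(\<lambda>n. \<integral>z. min \<bar>f n z - F z\<bar> l \<partial>lborel) \<longlonglongrightarrow> (\<integral>z. 0 \<partial>(lborel::'e measure))"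
    proof (rule integral_dominated_convergence[where w="\<lambda>z. l * indicator K z"])
      show "AE z in lborel. (\<lambda>n. min \<bar>f n z - F z\<bar> l) \<longlonglongrightarrow> 0"
        using lim
      proof eventually_elim
        case (elim z)
        have "(\<lambda>n. min \<bar>f n z - F z\<bar> l) \<longlonglongrightarrow> min \<bar>F z - F z\<bar> l" by (intro tendsto_intros elim)
        then show ?case using l by simp
      qed
      show "AE z in lborel. norm (min \<bar>f n z - F z\<bar> l) \<le> l * indicator K z" for n
        by (rule AE_I2) (use f0 F0 l in \<open>auto simp: indicator_def\<close>)
    qed (use iK in auto)
    then have "\<forall>\<^sub>F n in sequentially. (\<integral>z. min \<bar>f n z - F z\<bar> l \<partial>lborel) < e / 2" using e by (intro order_tendstoD(2)) auto
    then obtain N where N: "\<And>n. n \<ge> N \<Longrightarrow> (\<integral>z. min \<bar>f n z - F z\<bar> l \<partial>lborel) < e / 2" by (auto simp: eventually_sequentially)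
    show "\<exists>no. \<forall>n\<ge>no. norm ((\<integral>z. \<bar>f n z - F z\<bar> \<partial>lborel) - 0) < e"
    proof (intro exI allI impI)
      fix n assume n: "n \<ge> N"
      have im: "integrable lborel (\<lambda>z. min \<bar>f n z - F z\<bar> l)"
        by (rule Bochner_Integration.integrable_bound[of _ "\<lambda>z. f n z - F z"]) (use In I l in auto)
      have pt: "\<bar>f n z - F z\<bar> \<le> min \<bar>f n z - F z\<bar> l + l powr (1 - r) * \<bar>f n z - F z\<bar> powr r" for z
        using le_add_powr[of "\<bar>f n z - F z\<bar>" l r] l r by (auto simp: min_def)
      have "(\<integral>z. \<bar>f n z - F z\<bar> \<partial>lborel) \<le> (\<integral>z. min \<bar>f n z - F z\<bar> l + l powr (1 - r) * \<bar>f n z - F z\<bar> powr r \<partial>lborel)"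
        by (rule integral_mono[OF _ _ pt]) (use In I im idr in auto)
      also have "\<dots> = (\<integral>z. min \<bar>f n z - F z\<bar> l \<partial>lborel) + l powr (1 - r) * (\<integral>z. \<bar>f n z - F z\<bar> powr r \<partial>lborel)"
        using im idr by simp
      also have "\<dots> < e / 2 + e / 2"
      proof (rule add_less_le_mono[OF N[OF n]])
        have "l powr (1 - r) * (\<integral>z. \<bar>f n z - F z\<bar> powr r \<partial>lborel) \<le> e / (2 * C') * C'"
          using l Cdr[of n] e C' by (intro mult_mono) (auto simp: C'_def)
        then show "l powr (1 - r) * (\<integral>z. \<bar>f n z - F z\<bar> powr r \<partial>lborel) \<le> e / 2" using C' by simp
      qed
      finally show "norm ((\<integral>z. \<bar>f n z - F z\<bar> \<partial>lborel) - 0) < e" by simp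
    qed
  qed
  then have "(\<lambda>n. (\<integral>z. f n z \<partial>lborel) - (\<integral>z. F z \<partial>lborel)) \<longlonglongrightarrow> 0"
  proof (rule Lim_null_comparison[rotated], intro always_eventually allI)
    fix n
    have "(\<integral>z. f n z \<partial>lborel) - (\<integral>z. F z \<partial>lborel) = (\<integral>z. f n z - F z \<partial>lborel)" using In I by simp
    then show "norm ((\<integral>z. f n z \<partial>lborel) - (\<integral>z. F z \<partial>lborel)) \<le> (\<integral>z. \<bar>f n z - F z\<bar> \<partial>lborel)"
      using integral_norm_bound[of lborel "\<lambda>z. f n z - F z"] by simp
  qed
  then show "(\<lambda>n. \<integral>z. f n z \<partial>lborel) \<longlonglongrightarrow> (\<integral>z. F z \<partial>lborel)" by (rule LIM_zero_cancel)
qed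

lemma superpair_energy:
  fixes u \<phi> :: "'a::euclidean_space \<times> real \<Rightarrow> real" and g :: "'a \<times> real \<Rightarrow> 'a" and a d k :: real
  assumes p: "p > 2" and U: "open U" and S: "superpair U p u g"
    and \<phi>: "C1 \<phi> D" and K: "compact K" "K \<subseteq> U" "\<And>z. z \<notin> K \<Longrightarrow> \<phi> z = 0" and \<phi>0: "\<And>z. 0 \<le> \<phi> z" and d: "d > 0"
  defines "x z \<equiv> (k - u z - a) / d"
  shows "integrable lborel (\<lambda>z. \<phi> z * (sst' (x z) / d) * norm (g z) powr p)"
    and "integrable lborel (\<lambda>z. sst (x z) * (Aflux p (g z) \<bullet> gradD D z) + d * sstI (x z) * D z (0, 1))"
    and "(\<integral>z. \<phi> z * (sst' (x z) / d) * norm (g z) powr p \<partial>lborel)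
       \<le> (\<integral>z. sst (x z) * (Aflux p (g z) \<bullet> gradD D z) + d * sstI (x z) * D z (0, 1) \<partial>lborel)"
proof -
  have z0: "(\<integral>z. D z (0,1) \<partial>lborel) = 0" and zi: "integrable lborel (\<lambda>z. D z (0,1))"
    using C1_integral_derivative_zero[OF \<phi> K(1)] K(3) by blast+
  define L where "L z = \<phi> z * (sst' (x z) / d) * norm (g z) powr p" for z
  define R where "R z = sst (x z) * (Aflux p (g z) \<bullet> gradD D z) + d * sstI (x z) * D z (0, 1)" for z
  note co = superpair_combine_sst[OF p U S superpair_const[OF p, of U k] \<phi> K(1,2) _ d, where a=a]
  have eL: "\<phi> z * (sst' ((k - u z - a) / d) / d) * ((Aflux p 0 - Aflux p (g z)) \<bullet> (0 - g z)) = L z" for z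
    using p by (simp add: L_def x_def inner_Aflux_self)
  have eR: "(sst ((k - u z - a) / d) *\<^sub>R Aflux p (g z) + (1 - sst ((k - u z - a) / d)) *\<^sub>R Aflux p 0) \<bullet> gradD D z - (k - d * sstI ((k - u z - a) / d)) * D z (0, 1) = R z - k * D z (0,1)" for z
    by (simp add: R_def x_def algebra_simps)
  have "integrable lborel L" using co(1) K(3) unfolding eL by blast
  then show "integrable lborel (\<lambda>z. \<phi> z * (sst' (x z) / d) * norm (g z) powr p)" unfolding L_def .
  have "integrable lborel (\<lambda>z. R z - k * D z (0,1))" using co(2) K(3) unfolding eR by blast
  then have "integrable lborel (\<lambda>z. (R z - k * D z (0,1)) + k * D z (0,1))" using zi by (intro Bochner_Integration.integrable_add) auto
  then have iR: "integrable lborel R" by simp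
  then show "integrable lborel (\<lambda>z. sst (x z) * (Aflux p (g z) \<bullet> gradD D z) + d * sstI (x z) * D z (0, 1))" unfolding R_def .
  have "(\<integral>z. L z \<partial>lborel) \<le> (\<integral>z. R z - k * D z (0,1) \<partial>lborel)" using co(3)[OF _ \<phi>0] K(3) unfolding eL eR by blast
  also have "\<dots> = (\<integral>z. R z \<partial>lborel)" using iR zi z0 by simp
  finally show "(\<integral>z. \<phi> z * (sst' (x z) / d) * norm (g z) powr p \<partial>lborel)
       \<le> (\<integral>z. sst (x z) * (Aflux p (g z) \<bullet> gradD D z) + d * sstI (x z) * D z (0, 1) \<partial>lborel)" unfolding L_def R_def .
qed

lemma C1_power:
  assumes "C1 \<eta> D" shows "C1 (\<lambda>z. \<eta> z ^ m) (\<lambda>z v. real m * \<eta> z ^ (m - 1) * D z v)"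
  by (rule C1_compose[OF _ _ assms]) (use DERIV_pow[of m] in \<open>auto intro!: continuous_intros\<close>)

lemma gradD_scale: "gradD (\<lambda>z v. c z * D z v) z = c z *\<^sub>R gradD D z"
  by (simp add: gradD_def scaleR_sum_right)

lemma young_powr:
  fixes a b \<epsilon> p :: real
  assumes "a \<ge> 0" "b \<ge> 0" "\<epsilon> > 0" "p > 1"
  shows "a powr (p - 1) * b \<le> \<epsilon> * a powr p + \<epsilon> powr (1 - p) * b powr p"
proof (cases "b \<le> \<epsilon> * a")
  case True
  then have "a powr (p - 1) * b \<le> a powr (p - 1) * (\<epsilon> * a)" by (intro mult_left_mono) auto
  also have "\<dots> = \<epsilon> * a powr p" using powr_mult_base[of a "p - 1"] assms by (simp add: algebra_simps)
  finally show ?thesis by (simp add: add_increasing2)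
next
  case False
  then have "a \<le> b / \<epsilon>" using assms by (simp add: field_simps)
  then have "a powr (p - 1) \<le> (b / \<epsilon>) powr (p - 1)" using assms by (intro powr_mono2) auto
  then have "a powr (p - 1) * b \<le> (b / \<epsilon>) powr (p - 1) * b" using assms by (intro mult_right_mono) auto
  also have "\<dots> = \<epsilon> powr (1 - p) * b powr p"
  proof -
    have "\<epsilon> powr (1 - p) = 1 / \<epsilon> powr (p - 1)" using powr_minus_divide[of \<epsilon> "p - 1"] by simp
    moreover have "b powr p = b powr (p - 1) * b" using powr_mult_base[of b "p - 1"] assms by (simp add: mult.commute)
    ultimately show ?thesis using assms by (simp add: powr_divide)
  qed
  finally show ?thesis using assms by (simp add: add_increasing)
qed

lemma young_cutoff:
  fixes a b \<epsilon> p \<eta> :: real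
  assumes "a \<ge> 0" "b \<ge> 0" "\<epsilon> > 0" "p > 2" "0 \<le> \<eta>" "\<eta> \<le> 1" "real m \<ge> p"
  shows "a powr (p - 1) * (real m * \<eta> ^ (m - 1) * b) \<le> \<epsilon> * (\<eta> ^ m * a powr p) + \<epsilon> powr (1 - p) * (real m * b) powr p"
proof (cases "\<eta> = 0")
  case True
  have "m - 1 > 0" using assms by linarith
  then have "\<eta> ^ (m - 1) = 0" using True by (simp add: zero_power)
  moreover have "0 \<le> \<epsilon> * (\<eta> ^ m * a powr p) + \<epsilon> powr (1 - p) * (real m * b) powr p" using assms by simp
  ultimately show ?thesis by (simp only: mult_zero_right mult_zero_left)
next
  case False
  then have \<eta>: "\<eta> > 0" using assms by simp
  have m: "m > 0" using assms by (cases m) auto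
  define b' where "b' = real m * b / \<eta>"
  have "a powr (p - 1) * b' \<le> \<epsilon> * a powr p + \<epsilon> powr (1 - p) * b' powr p"
    by (rule young_powr) (use assms \<eta> in \<open>auto simp: b'_def\<close>)
  then have "\<eta> ^ m * (a powr (p - 1) * b') \<le> \<eta> ^ m * (\<epsilon> * a powr p + \<epsilon> powr (1 - p) * b' powr p)"
    using \<eta> by (intro mult_left_mono) auto
  moreover have "\<eta> ^ m * (a powr (p - 1) * b') = a powr (p - 1) * (real m * \<eta> ^ (m - 1) * b)"
    using m \<eta> by (cases m) (auto simp: b'_def)
  moreover have "\<eta> ^ m * b' powr p \<le> (real m * b) powr p"
  proof -
    have "\<eta> ^ m * b' powr p = \<eta> powr (real m - p) * (real m * b) powr p"
      using \<eta> assms by (simp add: b'_def powr_divide powr_diff powr_realpow)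
    also have "\<dots> \<le> 1 * (real m * b) powr p"
      using \<eta> assms by (intro mult_right_mono) (auto intro!: powr_le1)
    finally show ?thesis by simp
  qed
  then have "\<epsilon> powr (1 - p) * (\<eta> ^ m * b' powr p) \<le> \<epsilon> powr (1 - p) * (real m * b) powr p" by (intro mult_left_mono) auto
  moreover have "\<eta> ^ m * (\<epsilon> * a powr p + \<epsilon> powr (1 - p) * b' powr p) = \<epsilon> * (\<eta> ^ m * a powr p) + \<epsilon> powr (1 - p) * (\<eta> ^ m * b' powr p)"
    by (simp add: algebra_simps)
  ultimately show ?thesis by linarith
qed

lemma caccioppoli:
  fixes U :: "('a::euclidean_space \<times> real) set"
  assumes p: "p > 2" and U: "open U" and K: "compact K" "K \<subseteq> U" and M: "M > 0"
  obtains C where "\<And>u g. superpair U p u g \<Longrightarrow> (\<And>z. 0 \<le> u z) \<Longrightarrow> (\<And>z. u z \<le> M) \<Longrightarrow> (\<integral>z. indicator K z * norm (g z) powr p \<partial>lborel) \<le> C"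
proof -
  obtain \<eta> D K' where \<eta>: "C1 \<eta> D" "compact K'" "K' \<subseteq> U" "\<And>z. z \<notin> K' \<Longrightarrow> \<eta> z = 0" "\<And>z. z \<in> K \<Longrightarrow> \<eta> z = 1"
    "\<And>z. 0 \<le> \<eta> z" "\<And>z. \<eta> z \<le> 1" "K \<subseteq> K'" using cutoff_exists[OF K(1) U K(2)] by metis
  define m where "m = nat \<lceil>p\<rceil>"
  have m: "real m \<ge> p" unfolding m_def by (rule real_nat_ceiling_ge)
  define \<phi> where "\<phi> z = \<eta> z ^ m" for z
  define D\<phi> where "D\<phi> z v = (real m * \<eta> z ^ (m - 1)) * D z v" for z v
  have m0: "m > 0" using m p by (cases m) auto
  have \<phi>: "C1 \<phi> D\<phi>" unfolding \<phi>_def[abs_def] D\<phi>_def[abs_def] by (rule C1_power[OF \<eta>(1)])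
  have \<phi>K: "\<phi> z = 0" if "z \<notin> K'" for z using \<eta>(4)[OF that] m0 by (simp add: \<phi>_def)
  have \<phi>0: "0 \<le> \<phi> z" for z using \<eta>(6) by (simp add: \<phi>_def)
  have D0: "D z w = 0" if "z \<notin> K'" for z w
    by (rule C1_D_zero[OF \<eta>(1) compact_imp_closed[OF \<eta>(2)] \<eta>(4) that])
  have G0: "gradD D z = 0" if "z \<notin> K'" for z using D0[OF that] by (simp add: gradD_def)
  have DT0: "D\<phi> z (0,1) = 0" if "z \<notin> K'" for z using D0[OF that] by (simp add: D\<phi>_def)
  obtain B2 where B2: "B2 > 0" "\<And>z. \<bar>D\<phi> z (0,1)\<bar> \<le> B2" using cont_compact_support_bounded[OF C1_cont_D[OF \<phi>] \<eta>(2) DT0] by blast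
  obtain B3 where B3: "B3 > 0" "\<And>z. \<bar>norm (gradD D z)\<bar> \<le> B3"
    using cont_compact_support_bounded[of "\<lambda>z. norm (gradD D z)", OF continuous_on_norm[OF continuous_gradD[OF \<eta>(1)]] \<eta>(2)] G0 by auto
  have gD: "gradD D\<phi> z = (real m * \<eta> z ^ (m - 1)) *\<^sub>R gradD D z" for z unfolding D\<phi>_def[abs_def] by (rule gradD_scale)
  define \<epsilon> where "\<epsilon> = 2 / (9 * M)"
  have \<epsilon>: "\<epsilon> > 0" using M by (simp add: \<epsilon>_def)
  define W where "W = \<epsilon> powr (1 - p) * (real m * B3) powr p + 2 * M * B2"
  define C where "C = W * measure lborel K' / \<epsilon>"
  have iK: "integrable lborel (indicator K' :: _ \<Rightarrow> real)" using integrable_indicator_compact[OF \<eta>(2)] .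
  show ?thesis
  proof (rule that[of C])
    fix u :: "'a \<times> real \<Rightarrow> real" and g assume S: "superpair U p u g" and u: "\<And>z. 0 \<le> u z" "\<And>z. u z \<le> M"
    have d: "3 * M > 0" using M by simp
    note en = superpair_energy[OF p U S \<phi> \<eta>(2,3) _ \<phi>0 d, where k=M and a="- M"]
    define x where "x z = (M - u z - - M) / (3 * M)" for z
    have x: "1/3 \<le> x z" "x z \<le> 1 - 1/3" for z using u[of z] M by (auto simp: x_def field_simps)
    have sx: "2 * \<epsilon> \<le> sst' (x z) / (3 * M)" for z
      using sst'_lower[OF x(1)[of z] x(2)[of z]] M by (simp add: \<epsilon>_def field_simps)
    note loc = superpair_local[OF S p \<eta>(2,3)]
    have iP: "integrable lborel (\<lambda>z. \<phi> z * norm (g z) powr p)"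
    proof (rule Bochner_Integration.integrable_bound[OF loc(5)])
      have "C1 \<phi> D\<phi>" by (rule \<phi>)
      then have [measurable]: "\<phi> \<in> borel_measurable borel" using C1_cont borel_measurable_continuous_onI by blast
      show "(\<lambda>z. \<phi> z * norm (g z) powr p) \<in> borel_measurable lborel" using loc(7) by measurable
      show "AE z in lborel. norm (\<phi> z * norm (g z) powr p) \<le> norm (indicator K' z * norm (g z) powr p)"
      proof (rule AE_I2)
        fix z
        have "\<phi> z \<le> 1" unfolding \<phi>_def using \<eta>(6,7) by (intro power_le_one)
        then show "norm (\<phi> z * norm (g z) powr p) \<le> norm (indicator K' z * norm (g z) powr p)"
          using \<phi>0[of z] \<phi>K[of z] by (cases "z \<in> K'") (auto intro!: mult_left_le_one_le)
      qed
    qed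
    have "2 * \<epsilon> * (\<integral>z. \<phi> z * norm (g z) powr p \<partial>lborel) = (\<integral>z. \<phi> z * (2 * \<epsilon>) * norm (g z) powr p \<partial>lborel)"
      by (simp add: mult_ac flip: integral_mult_right_zero)
    also have "\<dots> \<le> (\<integral>z. \<phi> z * (sst' (x z) / (3 * M)) * norm (g z) powr p \<partial>lborel)"
    proof (rule integral_mono)
      show "integrable lborel (\<lambda>z. \<phi> z * (2 * \<epsilon>) * norm (g z) powr p)" using integrable_mult_right[OF iP, of "2 * \<epsilon>"] by (simp add: mult_ac)
      show "integrable lborel (\<lambda>z. \<phi> z * (sst' (x z) / (3 * M)) * norm (g z) powr p)"
        unfolding x_def by (rule en(1)) (use \<phi>K in auto)
      show "\<phi> z * (2 * \<epsilon>) * norm (g z) powr p \<le> \<phi> z * (sst' (x z) / (3 * M)) * norm (g z) powr p" for z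
        using sx[of z] \<phi>0[of z] by (intro mult_right_mono mult_left_mono) auto
    qed
    also have "\<dots> \<le> (\<integral>z. sst (x z) * (Aflux p (g z) \<bullet> gradD D\<phi> z) + (3 * M) * sstI (x z) * D\<phi> z (0, 1) \<partial>lborel)"
      unfolding x_def by (rule en(3)) (use \<phi>K in auto)
    also have "\<dots> \<le> (\<integral>z. \<epsilon> * (\<phi> z * norm (g z) powr p) + W * indicator K' z \<partial>lborel)"
    proof (rule integral_mono)
      show "integrable lborel (\<lambda>z. sst (x z) * (Aflux p (g z) \<bullet> gradD D\<phi> z) + (3 * M) * sstI (x z) * D\<phi> z (0, 1))"
        unfolding x_def by (rule en(2)) (use \<phi>K in auto)
      show "integrable lborel (\<lambda>z. \<epsilon> * (\<phi> z * norm (g z) powr p) + W * indicator K' z)" using iP iK by auto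
      fix z
      show "sst (x z) * (Aflux p (g z) \<bullet> gradD D\<phi> z) + (3 * M) * sstI (x z) * D\<phi> z (0, 1) \<le> \<epsilon> * (\<phi> z * norm (g z) powr p) + W * indicator K' z"
      proof (cases "z \<in> K'")
        case False then show ?thesis using G0 DT0 \<phi>K by (simp add: gD)
      next
        case True
        have "sst (x z) * (Aflux p (g z) \<bullet> gradD D\<phi> z) \<le> 1 * \<bar>Aflux p (g z) \<bullet> gradD D\<phi> z\<bar>"
          using sst_range[of "x z"] by (intro order_trans[OF mult_left_mono[OF abs_ge_self] mult_right_mono]) auto
        also have "\<dots> \<le> norm (g z) powr (p - 1) * (real m * \<eta> z ^ (m - 1) * norm (gradD D z))"
          using Cauchy_Schwarz_ineq2[of "Aflux p (g z)" "gradD D\<phi> z"] \<eta>(6)[of z] by (simp add: norm_Aflux gD)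
        also have "\<dots> \<le> \<epsilon> * (\<eta> z ^ m * norm (g z) powr p) + \<epsilon> powr (1 - p) * (real m * norm (gradD D z)) powr p"
          by (rule young_cutoff) (use \<epsilon> p \<eta>(6,7) m in auto)
        also have "\<dots> \<le> \<epsilon> * (\<phi> z * norm (g z) powr p) + \<epsilon> powr (1 - p) * (real m * B3) powr p"
          unfolding \<phi>_def using B3(2)[of z] p by (intro add_left_mono mult_left_mono powr_mono2) auto
        finally have 1: "sst (x z) * (Aflux p (g z) \<bullet> gradD D\<phi> z) \<le> \<epsilon> * (\<phi> z * norm (g z) powr p) + \<epsilon> powr (1 - p) * (real m * B3) powr p" .
        have "(3 * M) * sstI (x z) * D\<phi> z (0, 1) \<le> ((3 * M) * sstI (x z)) * \<bar>D\<phi> z (0, 1)\<bar>"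
          using M sstI_range(1)[of "x z"] by (intro mult_left_mono) auto
        also have "\<dots> \<le> (2 * M) * B2"
        proof (rule mult_mono)
          have "sstI (x z) \<le> x z" using sstI_range(2)[of "x z"] x(1)[of z] by simp
          then show "(3 * M) * sstI (x z) \<le> 2 * M" using x(2)[of z] M by simp
        qed (use B2(2)[of z] M in auto)
        finally have "(3 * M) * sstI (x z) * D\<phi> z (0, 1) \<le> 2 * M * B2" .
        with 1 show ?thesis using True by (simp add: W_def)
      qed
    qed
    also have "\<dots> = \<epsilon> * (\<integral>z. \<phi> z * norm (g z) powr p \<partial>lborel) + W * measure lborel K'"
      using iP iK by simp
    finally have "\<epsilon> * (\<integral>z. \<phi> z * norm (g z) powr p \<partial>lborel) \<le> W * measure lborel K'" by simp
    then have 2: "(\<integral>z. \<phi> z * norm (g z) powr p \<partial>lborel) \<le> C" using \<epsilon> by (simp add: C_def field_simps)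
    have "(\<integral>z. indicator K z * norm (g z) powr p \<partial>lborel) \<le> (\<integral>z. \<phi> z * norm (g z) powr p \<partial>lborel)"
    proof (rule integral_mono[OF superpair_local(5)[OF S p K] iP])
      fix z show "indicator K z * norm (g z) powr p \<le> \<phi> z * norm (g z) powr p"
        using \<eta>(5)[of z] \<phi>0[of z] by (cases "z \<in> K") (auto simp: \<phi>_def)
    qed
    then show "(\<integral>z. indicator K z * norm (g z) powr p \<partial>lborel) \<le> C" using 2 by simp
  qed
qed

section \<open>Limits of bounded supersolutions\<close>

lemma superpair_weak_gradient:
  fixes u \<phi> :: "'a::euclidean_space \<times> real \<Rightarrow> real"
  assumes p: "p > 2" and U: "open U" and S: "superpair U p u g"
    and \<phi>: "C1 \<phi> D" and K: "compact K" "K \<subseteq> U" "\<And>z. z \<notin> K \<Longrightarrow> \<phi> z = 0" and b: "b \<in> Basis"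
  shows "(\<integral>z. u z * D z (b, 0) \<partial>lborel) = - (\<integral>z. (g z \<bullet> b) * \<phi> z \<partial>lborel)"
proof -
  have e: "sst x *\<^sub>R y + (1 - sst x) *\<^sub>R y = y" for x and y :: 'a by (simp flip: scaleR_add_left)
  have "(\<integral>z. (u z - 1 * sstI ((u z - u z - 0) / 1)) * D z (b, 0) \<partial>lborel)
     = - (\<integral>z. ((sst ((u z - u z - 0) / 1) *\<^sub>R g z + (1 - sst ((u z - u z - 0) / 1)) *\<^sub>R g z) \<bullet> b) * \<phi> z \<partial>lborel)"
    by (rule superpair_combine_sst(4)[OF p U S S \<phi> K(1,2)]) (use K(3) b in auto)
  then show ?thesis using sst_cases(1)[of 0] by simp
qed

lemma superpair_inequality:
  fixes u \<phi> :: "'a::euclidean_space \<times> real \<Rightarrow> real"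
  assumes p: "p > 2" and U: "open U" and S: "superpair U p u g"
    and \<phi>: "C1 \<phi> D" and K: "compact K" "K \<subseteq> U" "\<And>z. z \<notin> K \<Longrightarrow> \<phi> z = 0" and \<phi>0: "\<And>z. 0 \<le> \<phi> z"
  shows "0 \<le> (\<integral>z. Aflux p (g z) \<bullet> gradD D z - u z * D z (0, 1) \<partial>lborel)"
proof -
  have "(\<integral>z. \<phi> z * (sst' ((u z - u z - 0) / 1) / 1) * ((Aflux p (g z) - Aflux p (g z)) \<bullet> (g z - g z)) \<partial>lborel)
     \<le> (\<integral>z. (sst ((u z - u z - 0) / 1) *\<^sub>R Aflux p (g z) + (1 - sst ((u z - u z - 0) / 1)) *\<^sub>R Aflux p (g z)) \<bullet> gradD D z - (u z - 1 * sstI ((u z - u z - 0) / 1)) * D z (0, 1) \<partial>lborel)"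
    by (rule superpair_combine_sst(3)[OF p U S S \<phi> K(1,2)]) (use K(3) \<phi>0 in auto)
  then show ?thesis using sst_cases(1)[of 0] by simp
qed

text \<open>As $\theta' \geq c/\delta$ near the diagonal, \<open>superpair_combine\<close> bounds the monotone quantity
  $(A(h)-A(g))\cdot(h-g)$ on the set where $|v-u|$ is small.\<close>

lemma gradient_difference_estimate:
  fixes U :: "('a::euclidean_space \<times> real) set"
  assumes p: "p > 2" and U: "open U" and K: "compact K" "K \<subseteq> U" and M: "M > 0"
  obtains C where "\<And>u g v h \<delta>. superpair U p u g \<Longrightarrow> (\<And>z. 0 \<le> u z) \<Longrightarrow> (\<And>z. u z \<le> M) \<Longrightarrow>
      superpair U p v h \<Longrightarrow> (\<And>z. 0 \<le> v z) \<Longrightarrow> (\<And>z. v z \<le> M) \<Longrightarrow> 0 < \<delta> \<Longrightarrow> \<delta> \<le> 1 \<Longrightarrow>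
      (\<integral>z. indicator (K \<inter> {z. \<bar>v z - u z\<bar> \<le> \<delta>}) z * norm (h z - g z) powr p \<partial>lborel) \<le> C * \<delta>"
proof -
  obtain \<phi> D K' where \<phi>: "C1 \<phi> D" "compact K'" "K' \<subseteq> U" "\<And>z. z \<notin> K' \<Longrightarrow> \<phi> z = 0" "\<And>z. z \<in> K \<Longrightarrow> \<phi> z = 1"
    "\<And>z. 0 \<le> \<phi> z" "\<And>z. \<phi> z \<le> 1" "K \<subseteq> K'" using cutoff_exists[OF K(1) U K(2)] by metis
  have D0: "D z w = 0" if "z \<notin> K'" for z w
    by (rule C1_D_zero[OF \<phi>(1) compact_imp_closed[OF \<phi>(2)] \<phi>(4) that])
  have G0: "gradD D z = 0" if "z \<notin> K'" for z using D0[OF that] by (simp add: gradD_def)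
  obtain B2 where B2: "B2 > 0" "\<And>z. \<bar>D z (0,1)\<bar> \<le> B2" using cont_compact_support_bounded[OF C1_cont_D[OF \<phi>(1)] \<phi>(2) D0] by blast
  obtain B3 where B3: "B3 > 0" "\<And>z. \<bar>norm (gradD D z)\<bar> \<le> B3"
    using cont_compact_support_bounded[of "\<lambda>z. norm (gradD D z)", OF continuous_on_norm[OF continuous_gradD[OF \<phi>(1)]] \<phi>(2)] G0 by auto
  obtain C0 where C0: "\<And>u g. superpair U p u g \<Longrightarrow> (\<And>z. 0 \<le> u z) \<Longrightarrow> (\<And>z. u z \<le> M) \<Longrightarrow> (\<integral>z. indicator K' z * norm (g z) powr p \<partial>lborel) \<le> C0"
    using caccioppoli[OF p U \<phi>(2,3) M] by blast
  have iK: "integrable lborel (indicator K' :: _ \<Rightarrow> real)" using integrable_indicator_compact[OF \<phi>(2)] .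
  define W where "W = 2 * B3 + (2 * M + 2) * B2"
  define C1' where "C1' = W * measure lborel K' + B3 * (2 * C0)"
  define C where "C = C1' * (32 / 9) / 2 powr (1 - p)"
  show ?thesis
  proof (rule that[of C])
    fix u v :: "'a \<times> real \<Rightarrow> real" and g h and \<delta> :: real
    assume Su: "superpair U p u g" and u: "\<And>z. 0 \<le> u z" "\<And>z. u z \<le> M"
      and Sv: "superpair U p v h" and v: "\<And>z. 0 \<le> v z" "\<And>z. v z \<le> M" and \<delta>: "0 < \<delta>" "\<delta> \<le> 1"
    note lu = superpair_local[OF Su p \<phi>(2,3)] and lv = superpair_local[OF Sv p \<phi>(2,3)]
    have [measurable]: "u \<in> borel_measurable borel" "v \<in> borel_measurable borel" "g \<in> borel_measurable borel" "h \<in> borel_measurable borel"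
      "K \<in> sets borel" using lu(6,7) lv(6,7) K borel_compact by auto
    have d: "4 * \<delta> > 0" using \<delta> by simp
    note co = superpair_combine_sst[OF p U Su Sv \<phi>(1-3) _ d, where a="- 2 * \<delta>"]
    define x where "x z = (v z - u z - - 2 * \<delta>) / (4 * \<delta>)" for z
    define L where "L z = \<phi> z * (sst' (x z) / (4 * \<delta>)) * ((Aflux p (h z) - Aflux p (g z)) \<bullet> (h z - g z))" for z
    define R where "R z = (sst (x z) *\<^sub>R Aflux p (g z) + (1 - sst (x z)) *\<^sub>R Aflux p (h z)) \<bullet> gradD D z - (v z - (4 * \<delta>) * sstI (x z)) * D z (0, 1)" for z
    have iL: "integrable lborel L" unfolding L_def x_def by (rule co(1)) (use \<phi>(4) in auto)
    have iR: "integrable lborel R" unfolding R_def x_def by (rule co(2)) (use \<phi>(4) in auto)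
    have LR: "(\<integral>z. L z \<partial>lborel) \<le> (\<integral>z. R z \<partial>lborel)" unfolding L_def R_def x_def by (rule co(3)) (use \<phi>(4,6) in auto)
    have "(\<integral>z. R z \<partial>lborel) \<le> (\<integral>z. W * indicator K' z + B3 * (indicator K' z * norm (g z) powr p + indicator K' z * norm (h z) powr p) \<partial>lborel)"
    proof (rule integral_mono[OF iR])
      show "integrable lborel (\<lambda>z. W * indicator K' z + B3 * (indicator K' z * norm (g z) powr p + indicator K' z * norm (h z) powr p))"
        using iK lu(5) lv(5) by auto
      fix z
      show "R z \<le> W * indicator K' z + B3 * (indicator K' z * norm (g z) powr p + indicator K' z * norm (h z) powr p)"
      proof (cases "z \<in> K'")
        case False then show ?thesis using D0 G0 by (simp add: R_def)
      next
        case True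
        have nA: "norm (Aflux p w) \<le> 1 + norm w powr p" for w :: 'a unfolding norm_Aflux using p by (intro le_one_plus_powr) auto
        have "norm (sst (x z) *\<^sub>R Aflux p (g z) + (1 - sst (x z)) *\<^sub>R Aflux p (h z)) \<le> sst (x z) * norm (Aflux p (g z)) + (1 - sst (x z)) * norm (Aflux p (h z))"
          using sst_range[of "x z"] by (intro order_trans[OF norm_triangle_ineq]) auto
        also have "\<dots> \<le> 1 * (1 + norm (g z) powr p) + 1 * (1 + norm (h z) powr p)"
          using sst_range[of "x z"] nA by (intro add_mono mult_mono) auto
        finally have "norm (sst (x z) *\<^sub>R Aflux p (g z) + (1 - sst (x z)) *\<^sub>R Aflux p (h z)) \<le> 2 + norm (g z) powr p + norm (h z) powr p" by simp
        then have 1: "\<bar>(sst (x z) *\<^sub>R Aflux p (g z) + (1 - sst (x z)) *\<^sub>R Aflux p (h z)) \<bullet> gradD D z\<bar> \<le> (2 + norm (g z) powr p + norm (h z) powr p) * B3"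
          using B3(2)[of z] by (intro order_trans[OF Cauchy_Schwarz_ineq2] mult_mono) auto
        have "(4 * \<delta>) * sstI (x z) \<le> (4 * \<delta>) * max 0 (x z)" "0 \<le> (4 * \<delta>) * sstI (x z)" using sstI_range[of "x z"] \<delta> by (auto intro!: mult_left_mono)
        moreover have "(4 * \<delta>) * max 0 (x z) = max 0 (v z - u z + 2 * \<delta>)"
          using \<delta> by (simp add: x_def max_def zero_le_divide_iff field_simps)
        moreover have "max 0 (v z - u z + 2 * \<delta>) \<le> M + 2" using u[of z] v[of z] \<delta> M by simp
        ultimately have "\<bar>v z - (4 * \<delta>) * sstI (x z)\<bar> \<le> 2 * M + 2" using v[of z] M by (simp add: abs_le_iff)
        then have "\<bar>(v z - (4 * \<delta>) * sstI (x z)) * D z (0, 1)\<bar> \<le> (2 * M + 2) * B2"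
          unfolding abs_mult using B2(2)[of z] M by (intro mult_mono) auto
        with 1 have "R z \<le> (2 + norm (g z) powr p + norm (h z) powr p) * B3 + (2 * M + 2) * B2" unfolding R_def by linarith
        then show ?thesis using True by (simp add: W_def algebra_simps)
      qed
    qed
    also have "\<dots> = W * measure lborel K' + B3 * ((\<integral>z. indicator K' z * norm (g z) powr p \<partial>lborel) + (\<integral>z. indicator K' z * norm (h z) powr p \<partial>lborel))"
      using iK lu(5) lv(5) by simp
    also have "\<dots> \<le> C1'" unfolding C1'_def using C0[OF Su u] C0[OF Sv v] B3(1) by (intro add_left_mono mult_left_mono) auto
    finally have RC: "(\<integral>z. L z \<partial>lborel) \<le> C1'" using LR by simp
    define c where "c = 9 / 32 / \<delta> * 2 powr (1 - p)"
    have c: "c > 0" using \<delta> by (simp add: c_def)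
    define A where "A = K \<inter> {z. \<bar>v z - u z\<bar> \<le> \<delta>}"
    have [measurable]: "A \<in> sets borel" unfolding A_def by measurable
    have pt: "c * (indicator A z * norm (h z - g z) powr p) \<le> L z" for z
    proof -
      have mono: "2 powr (1 - p) * norm (h z - g z) powr p \<le> (Aflux p (h z) - Aflux p (g z)) \<bullet> (h z - g z)" by (rule Aflux_monotone[OF p])
      then have mono0: "0 \<le> (Aflux p (h z) - Aflux p (g z)) \<bullet> (h z - g z)" using order_trans[of 0 "2 powr (1 - p) * norm (h z - g z) powr p"] by simp
      show ?thesis
      proof (cases "z \<in> A")
        case False
        then show ?thesis unfolding L_def using \<phi>(6)[of z] sst'_range(1)[of "x z"] \<delta> mono0 by simp
      next
        case True
        then have z: "z \<in> K" "\<bar>v z - u z\<bar> \<le> \<delta>" by (auto simp: A_def)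
        have x: "1/4 \<le> x z" "x z \<le> 1 - 1/4" using z(2) \<delta> by (auto simp: x_def field_simps)
        have "9/8 \<le> sst' (x z)" using sst'_lower[OF x] by simp
        then have "9/8 / (4 * \<delta>) \<le> sst' (x z) / (4 * \<delta>)" using \<delta> by (intro divide_right_mono) auto
        then have "9/8 / (4 * \<delta>) * (2 powr (1 - p) * norm (h z - g z) powr p) \<le> sst' (x z) / (4 * \<delta>) * ((Aflux p (h z) - Aflux p (g z)) \<bullet> (h z - g z))"
          using mono \<delta> sst'_range(1)[of "x z"] by (intro mult_mono) auto
        then show ?thesis using True \<phi>(5)[OF z(1)] by (simp add: L_def c_def)
      qed
    qed
    have iA: "integrable lborel (\<lambda>z. indicator A z * norm (h z - g z) powr p)"
    proof (rule Bochner_Integration.integrable_bound[of _ "\<lambda>z. (1 / c) * L z"])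
      show "AE z in lborel. norm (indicator A z * norm (h z - g z) powr p) \<le> norm ((1 / c) * L z)"
      proof (rule AE_I2)
        fix z
        have "indicator A z * norm (h z - g z) powr p \<le> (1 / c) * L z" using pt[of z] c by (simp add: field_simps)
        moreover have "0 \<le> indicator A z * norm (h z - g z) powr p" by simp
        ultimately show "norm (indicator A z * norm (h z - g z) powr p) \<le> norm ((1 / c) * L z)"
          unfolding real_norm_def by linarith
      qed
    qed (use iL in auto)
    have "c * (\<integral>z. indicator A z * norm (h z - g z) powr p \<partial>lborel) = (\<integral>z. c * (indicator A z * norm (h z - g z) powr p) \<partial>lborel)" by simp
    also have "\<dots> \<le> (\<integral>z. L z \<partial>lborel)" by (rule integral_mono[OF _ iL pt]) (use iA in auto)
    also have "\<dots> \<le> C1'" by (rule RC)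
    finally have "(\<integral>z. indicator A z * norm (h z - g z) powr p \<partial>lborel) \<le> C1' / c" using c by (simp add: field_simps)
    also have "\<dots> = C * \<delta>" using \<delta> by (simp add: C_def c_def)
    finally show "(\<integral>z. indicator (K \<inter> {z. \<bar>v z - u z\<bar> \<le> \<delta>}) z * norm (h z - g z) powr p \<partial>lborel) \<le> C * \<delta>" unfolding A_def .
  qed
qed

lemma gradients_Cauchy:
  fixes U :: "('a::euclidean_space \<times> real) set"
  assumes p: "p > 2" and U: "open U" and K: "compact K" "K \<subseteq> U"
    and S: "\<And>n. superpair U p (u n) (g n)" and u: "\<And>n z. 0 \<le> u n z" "\<And>n z. u n z \<le> M"
    and lim: "AE z in lborel. z \<in> U \<longrightarrow> (\<lambda>n. u n z) \<longlonglongrightarrow> v z" and vm: "v \<in> borel_measurable borel" and v: "\<And>z. 0 \<le> v z" "\<And>z. v z \<le> M"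
    and e: "e > 0"
  shows "\<exists>N. \<forall>i\<ge>N. \<forall>j\<ge>N. (\<integral>z. indicator K z * norm (g i z - g j z) \<partial>lborel) < e"
proof -
  define M' where "M' = max M 1"
  have M': "M' > 0" "u n z \<le> M'" for n z using u(2)[of n z] by (auto simp: M'_def max_def)
  obtain C0 where C0: "\<And>u g. superpair U p u g \<Longrightarrow> (\<And>z. 0 \<le> u z) \<Longrightarrow> (\<And>z. u z \<le> M') \<Longrightarrow> (\<integral>z. indicator K z * norm (g z) powr p \<partial>lborel) \<le> C0"
    using caccioppoli[OF p U K M'(1)] by blast
  obtain C1' where C1': "\<And>u g v h \<delta>. superpair U p u g \<Longrightarrow> (\<And>z. 0 \<le> u z) \<Longrightarrow> (\<And>z. u z \<le> M') \<Longrightarrow>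
      superpair U p v h \<Longrightarrow> (\<And>z. 0 \<le> v z) \<Longrightarrow> (\<And>z. v z \<le> M') \<Longrightarrow> 0 < \<delta> \<Longrightarrow> \<delta> \<le> 1 \<Longrightarrow>
      (\<integral>z. indicator (K \<inter> {z. \<bar>v z - u z\<bar> \<le> \<delta>}) z * norm (h z - g z) powr p \<partial>lborel) \<le> C1' * \<delta>"
    using gradient_difference_estimate[OF p U K M'(1)] by blast
  have [measurable]: "K \<in> sets borel" using K borel_compact by blast
  have [measurable]: "u n \<in> borel_measurable borel" "g n \<in> borel_measurable borel" for n using S[of n] by (auto simp: superpair_def)
  have [measurable]: "v \<in> borel_measurable borel" by (rule vm)
  have iK: "integrable lborel (indicator K :: _ \<Rightarrow> real)" using integrable_indicator_compact[OF K(1)] .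
  define m where "m = measure lborel K"
  have m0: "m \<ge> 0" by (simp add: m_def)
  define C2 where "C2 = 2 powr p * (2 * C0)"
  have ip: "integrable lborel (\<lambda>z. indicator K z * norm (g i z) powr p)" for i using superpair_local(5)[OF S p K] .
  have dpt: "indicator K z * norm (g i z - g j z) powr p \<le> 2 powr p * (indicator K z * norm (g i z) powr p + indicator K z * norm (g j z) powr p)" for i j z
  proof -
    have "norm (g i z - g j z) powr p \<le> (norm (g i z) + norm (g j z)) powr p" using p by (intro powr_mono2 norm_triangle_ineq4) auto
    also have "\<dots> \<le> 2 powr p * (norm (g i z) powr p + norm (g j z) powr p)" using p by (intro powr_add_le) auto
    finally show ?thesis by (cases "z \<in> K") auto
  qed
  have idp: "integrable lborel (\<lambda>z. indicator K z * norm (g i z - g j z) powr p)" for i j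
    by (rule Bochner_Integration.integrable_bound[of _ "\<lambda>z. 2 powr p * (indicator K z * norm (g i z) powr p + indicator K z * norm (g j z) powr p)"])
      (use ip dpt in auto)
  have Cdp: "(\<integral>z. indicator K z * norm (g i z - g j z) powr p \<partial>lborel) \<le> C2" for i j
  proof -
    have "(\<integral>z. indicator K z * norm (g i z - g j z) powr p \<partial>lborel) \<le> (\<integral>z. 2 powr p * (indicator K z * norm (g i z) powr p + indicator K z * norm (g j z) powr p) \<partial>lborel)"
      by (rule integral_mono[OF idp _ dpt]) (use ip in auto)
    also have "\<dots> \<le> C2" unfolding C2_def using ip C0[OF S u(1) M'(2), of i] C0[OF S u(1) M'(2), of j] by (simp add: mult_left_mono)
    finally show ?thesis .
  qed
  have C20: "0 \<le> C2" using order_trans[OF Bochner_Integration.integral_nonneg Cdp[of 0 0]] by auto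
  define l where "l = e / (5 * (m + 1))"
  have l: "l > 0" using e m0 by (simp add: l_def)
  define cc where "cc = \<bar>C1'\<bar> + 1"
  have cc: "cc > 0" "C1' \<le> cc" by (auto simp: cc_def)
  define \<delta> where "\<delta> = min 1 (e / (5 * cc * l powr (1 - p)))"
  have lp: "l powr (1 - p) > 0" using l by simp
  have \<delta>: "0 < \<delta>" "\<delta> \<le> 1" using e lp cc by (auto simp: \<delta>_def)
  obtain \<Lambda> where \<Lambda>: "\<Lambda> > 0" "\<Lambda> powr (1 - p) * C2 < e / 5"
  proof -
    have "((\<lambda>x::real. x powr (1 - p) * C2) \<longlongrightarrow> 0 * C2) at_top" using p by (intro tendsto_intros tendsto_neg_powr filterlim_ident) auto
    then have "\<forall>\<^sub>F x in at_top. x powr (1 - p) * C2 < e / 5" using e by (intro order_tendstoD(2)) auto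
    then have "\<forall>\<^sub>F x::real in at_top. x > 0 \<and> x powr (1 - p) * C2 < e / 5" using eventually_gt_at_top[of "0::real"] by eventually_elim auto
    then show ?thesis using that eventually_happens'[OF trivial_limit_at_top_linorder] by blast
  qed
  have "(\<lambda>n. \<integral>z. indicator K z * \<bar>u n z - v z\<bar> \<partial>lborel) \<longlonglongrightarrow> (\<integral>z. 0 \<partial>(lborel::('a \<times> real) measure))"
  proof (rule integral_dominated_convergence[where w="\<lambda>z. (2 * M') * indicator K z"])
    show "AE z in lborel. (\<lambda>n. indicator K z * \<bar>u n z - v z\<bar>) \<longlonglongrightarrow> 0"
      using lim
    proof eventually_elim
      case (elim z)
      show ?case
      proof (cases "z \<in> K")
        case True
        then have "(\<lambda>n. u n z) \<longlonglongrightarrow> v z" using elim K by auto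
        then have "(\<lambda>n. indicator K z * \<bar>u n z - v z\<bar>) \<longlonglongrightarrow> indicator K z * \<bar>v z - v z\<bar>" by (intro tendsto_intros)
        then show ?thesis by simp
      qed simp
    qed
    show "AE z in lborel. norm (indicator K z * \<bar>u n z - v z\<bar>) \<le> (2 * M') * indicator K z" for n
    proof (rule AE_I2)
      fix z
      have "\<bar>u n z - v z\<bar> \<le> 2 * M'" using u(1)[of n z] M'(2)[of n z] v[of z] M'(1) by (auto simp: abs_le_iff M'_def)
      then show "norm (indicator K z * \<bar>u n z - v z\<bar>) \<le> (2 * M') * indicator K z" by (cases "z \<in> K") auto
    qed
  qed (use iK in auto)
  then have "\<forall>\<^sub>F n in sequentially. (\<integral>z. indicator K z * \<bar>u n z - v z\<bar> \<partial>lborel) < e * \<delta> / (10 * \<Lambda>)"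
    using e \<delta> \<Lambda> by (intro order_tendstoD(2)) auto
  then obtain N where N: "\<And>n. n \<ge> N \<Longrightarrow> (\<integral>z. indicator K z * \<bar>u n z - v z\<bar> \<partial>lborel) < e * \<delta> / (10 * \<Lambda>)"
    by (auto simp: eventually_sequentially)
  show ?thesis
  proof (intro exI[of _ N] allI impI)
    fix i j assume ij: "N \<le> i" "N \<le> j"
    define A where "A = K \<inter> {z. \<bar>u i z - u j z\<bar> \<le> \<delta>}"
    define w where "w z = norm (g i z - g j z)" for z
    have [measurable]: "A \<in> sets borel" "w \<in> borel_measurable borel" unfolding A_def w_def[abs_def] by measurable
    have iu: "integrable lborel (\<lambda>z. indicator K z * \<bar>u n z - v z\<bar>)" for n
    proof (rule Bochner_Integration.integrable_bound[of _ "\<lambda>z. (2 * M') * indicator K z"])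
      show "AE z in lborel. norm (indicator K z * \<bar>u n z - v z\<bar>) \<le> norm ((2 * M') * indicator K z)"
      proof (rule AE_I2)
        fix z
        have "\<bar>u n z - v z\<bar> \<le> 2 * M'" using u(1)[of n z] M'(2)[of n z] v[of z] M'(1) by (auto simp: abs_le_iff M'_def)
        then show "norm (indicator K z * \<bar>u n z - v z\<bar>) \<le> norm ((2 * M') * indicator K z)" using M' by (cases "z \<in> K") auto
      qed
    qed (use iK in auto)
    have pt: "indicator K z * w z \<le> l * indicator K z + l powr (1 - p) * (indicator A z * w z powr p)
        + (\<Lambda> / \<delta>) * (indicator K z * \<bar>u i z - v z\<bar> + indicator K z * \<bar>u j z - v z\<bar>) + \<Lambda> powr (1 - p) * (indicator K z * w z powr p)" for z
    proof (cases "z \<in> K")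
      case True
      have w0: "0 \<le> w z" by (simp add: w_def)
      show ?thesis
      proof (cases "z \<in> A")
        case A: True
        have "w z \<le> l + l powr (1 - p) * w z powr p" using le_add_powr[OF w0 l, of p] p by simp
        moreover have "0 \<le> (\<Lambda> / \<delta>) * (\<bar>u i z - v z\<bar> + \<bar>u j z - v z\<bar>) + \<Lambda> powr (1 - p) * w z powr p" using \<Lambda> \<delta> by simp
        ultimately show ?thesis using True A by simp
      next
        case A: False
        then have "\<delta> \<le> \<bar>u i z - u j z\<bar>" using True by (auto simp: A_def)
        also have "\<dots> \<le> \<bar>u i z - v z\<bar> + \<bar>u j z - v z\<bar>" by linarith
        finally have "\<Lambda> / \<delta> * \<delta> \<le> \<Lambda> / \<delta> * (\<bar>u i z - v z\<bar> + \<bar>u j z - v z\<bar>)" using \<Lambda> \<delta> by (intro mult_left_mono) auto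
        then have "\<Lambda> \<le> \<Lambda> / \<delta> * (\<bar>u i z - v z\<bar> + \<bar>u j z - v z\<bar>)" using \<delta> by simp
        moreover have "w z \<le> \<Lambda> + \<Lambda> powr (1 - p) * w z powr p" using le_add_powr[OF w0 \<Lambda>(1), of p] p by simp
        ultimately show ?thesis using True A l by simp
      qed
    qed (use \<Lambda> \<delta> in \<open>simp add: A_def\<close>)
    have iw: "integrable lborel (\<lambda>z. indicator K z * w z powr p)" unfolding w_def by (rule idp)
    have iA: "integrable lborel (\<lambda>z. indicator A z * w z powr p)"
      by (rule Bochner_Integration.integrable_bound[OF iw]) (auto simp: A_def indicator_def)
    have iwK: "integrable lborel (\<lambda>z. indicator K z * w z)"
      by (rule Bochner_Integration.integrable_bound[OF Bochner_Integration.integrable_add[OF iK iw]])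
        (use p in \<open>auto simp: w_def indicator_def intro!: le_one_plus_powr1\<close>)
    have "(\<integral>z. indicator K z * w z \<partial>lborel) \<le> (\<integral>z. l * indicator K z + l powr (1 - p) * (indicator A z * w z powr p)
        + (\<Lambda> / \<delta>) * (indicator K z * \<bar>u i z - v z\<bar> + indicator K z * \<bar>u j z - v z\<bar>) + \<Lambda> powr (1 - p) * (indicator K z * w z powr p) \<partial>lborel)"
      by (rule integral_mono[OF iwK _ pt]) (use iK iA iu iw in auto)
    also have "\<dots> = l * m + l powr (1 - p) * (\<integral>z. indicator A z * w z powr p \<partial>lborel)
        + (\<Lambda> / \<delta>) * ((\<integral>z. indicator K z * \<bar>u i z - v z\<bar> \<partial>lborel) + (\<integral>z. indicator K z * \<bar>u j z - v z\<bar> \<partial>lborel)) + \<Lambda> powr (1 - p) * (\<integral>z. indicator K z * w z powr p \<partial>lborel)"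
      using iK iA iu iw by (simp add: m_def)
    also have "\<dots> < e"
    proof -
      have "l * m \<le> e / 5" using m0 e by (simp add: l_def field_simps)
      moreover have "l powr (1 - p) * (\<integral>z. indicator A z * w z powr p \<partial>lborel) \<le> e / 5"
      proof -
        have "(\<integral>z. indicator A z * w z powr p \<partial>lborel) \<le> C1' * \<delta>"
          unfolding A_def w_def using C1'[OF S u(1) M'(2) S u(1) M'(2) \<delta>, of i j] .
        also have "\<dots> \<le> cc * (e / (5 * cc * l powr (1 - p)))"
          using \<delta>(1) cc by (intro mult_mono) (auto simp: \<delta>_def)
        also have "\<dots> = e / (5 * l powr (1 - p))" using cc by (simp add: field_simps)
        finally have "l powr (1 - p) * (\<integral>z. indicator A z * w z powr p \<partial>lborel) \<le> l powr (1 - p) * (e / (5 * l powr (1 - p)))"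
          using lp by (intro mult_left_mono) auto
        then show ?thesis using lp by simp
      qed
      moreover have "(\<Lambda> / \<delta>) * ((\<integral>z. indicator K z * \<bar>u i z - v z\<bar> \<partial>lborel) + (\<integral>z. indicator K z * \<bar>u j z - v z\<bar> \<partial>lborel)) \<le> e / 5"
      proof -
        have "(\<Lambda> / \<delta>) * ((\<integral>z. indicator K z * \<bar>u i z - v z\<bar> \<partial>lborel) + (\<integral>z. indicator K z * \<bar>u j z - v z\<bar> \<partial>lborel)) \<le> (\<Lambda> / \<delta>) * (e * \<delta> / (10 * \<Lambda>) + e * \<delta> / (10 * \<Lambda>))"
          using N[OF ij(1)] N[OF ij(2)] \<Lambda> \<delta> by (intro mult_left_mono add_mono) auto
        also have "\<dots> = e / 5" using \<Lambda> \<delta> by (simp add: field_simps)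
        finally show ?thesis .
      qed
      moreover have "\<Lambda> powr (1 - p) * (\<integral>z. indicator K z * w z powr p \<partial>lborel) \<le> \<Lambda> powr (1 - p) * C2"
        unfolding w_def by (intro mult_left_mono Cdp) auto
      ultimately show ?thesis using \<Lambda>(2) e by linarith
    qed
    finally show "(\<integral>z. indicator K z * norm (g i z - g j z) \<partial>lborel) < e" by (simp add: w_def)
  qed
qed

lemma superpair_limit:
  fixes U :: "('a::euclidean_space \<times> real) set"
  assumes p: "p > 2" and U: "open U"
    and S: "\<And>n. superpair U p (u n) (g n)" and u: "\<And>n z. 0 \<le> u n z" "\<And>n z. u n z \<le> M"
    and lim: "AE z in lborel. z \<in> U \<longrightarrow> (\<lambda>n. u n z) \<longlonglongrightarrow> v z" and vm: "v \<in> borel_measurable borel" and v: "\<And>z. 0 \<le> v z" "\<And>z. v z \<le> M"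
  shows "\<exists>h. superpair U p v h"
proof -
  define M' where "M' = max M 1"
  have M': "M' > 0" "u n z \<le> M'" "v z \<le> M'" for n z using u(2)[of n z] v(2)[of z] by (auto simp: M'_def max_def)
  have [measurable]: "u n \<in> borel_measurable borel" "g n \<in> borel_measurable borel" for n using S[of n] by (auto simp: superpair_def)
  have [measurable]: "v \<in> borel_measurable borel" by (rule vm)
  obtain Ck :: "nat \<Rightarrow> ('a \<times> real) set" where Ck: "\<And>n. compact (Ck n)" "\<And>n. Ck n \<subseteq> U" "\<Union>(range Ck) = U" "\<And>n. Ck n \<subseteq> interior (Ck (Suc n))"
    using open_Union_compact_subsets[OF U] by metis
  have Cm: "Ck l \<subseteq> Ck m" if "l \<le> m" for l m
    using that by (rule lift_Suc_mono_le[rotated]) (use Ck(4) interior_subset in blast)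
  have [measurable]: "Ck n \<in> sets borel" for n using Ck(1) borel_compact by blast
  have "\<exists>r. \<forall>m. (\<forall>i\<ge>r m. \<forall>j\<ge>r m. (\<integral>z. indicator (Ck m) z * norm (g i z - g j z) \<partial>lborel) < (1/2)^m) \<and> r m < r (Suc m)"
  proof (intro dependent_nat_choice)
    show "\<exists>N. \<forall>i\<ge>N. \<forall>j\<ge>N. (\<integral>z. indicator (Ck 0) z * norm (g i z - g j z) \<partial>lborel) < (1/2)^0"
      by (rule gradients_Cauchy[OF p U Ck(1,2) S u lim vm v]) simp
    fix N m
    obtain N' where N': "\<forall>i\<ge>N'. \<forall>j\<ge>N'. (\<integral>z. indicator (Ck (Suc m)) z * norm (g i z - g j z) \<partial>lborel) < (1/2)^Suc m"
      using gradients_Cauchy[OF p U Ck(1,2) S u lim vm v, of "(1/2)^Suc m" "Suc m"] by auto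
    show "\<exists>y. (\<forall>i\<ge>y. \<forall>j\<ge>y. (\<integral>z. indicator (Ck (Suc m)) z * norm (g i z - g j z) \<partial>lborel) < (1/2)^Suc m) \<and> N < y"
      using N' by (intro exI[of _ "max N' (Suc N)"]) auto
  qed
  then obtain r where r1: "\<And>m i j. i \<ge> r m \<Longrightarrow> j \<ge> r m \<Longrightarrow> (\<integral>z. indicator (Ck m) z * norm (g i z - g j z) \<partial>lborel) < (1/2)^m"
    and r2: "\<And>m. r m < r (Suc m)" by blast
  have r: "strict_mono r" using r2 by (simp add: strict_mono_Suc_iff)
  define G where "G z = (\<Sum>m. ennreal (indicator (Ck m) z * norm (g (r (Suc m)) z - g (r m) z)))" for z
  have [measurable]: "G \<in> borel_measurable borel" unfolding G_def by measurable
  have ig: "integrable lborel (\<lambda>z. indicator (Ck m) z * norm (g i z - g j z))" for m i j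
    by (rule Bochner_Integration.integrable_bound[OF Bochner_Integration.integrable_add[OF superpair_local(2)[OF S p Ck(1,2), of m i] superpair_local(2)[OF S p Ck(1,2), of m j]]])
      (auto simp: indicator_def norm_triangle_ineq4)
  have "(\<integral>\<^sup>+z. G z \<partial>lborel) = (\<Sum>m. (\<integral>\<^sup>+z. ennreal (indicator (Ck m) z * norm (g (r (Suc m)) z - g (r m) z)) \<partial>lborel))"
    unfolding G_def by (rule nn_integral_suminf) measurable
  also have "\<dots> \<le> (\<Sum>m. ennreal ((1/2) ^ m))"
  proof (intro suminf_le)
    fix m
    show "(\<integral>\<^sup>+z. ennreal (indicator (Ck m) z * norm (g (r (Suc m)) z - g (r m) z)) \<partial>lborel) \<le> ennreal ((1/2) ^ m)"
      using r1[of m "r (Suc m)" "r m"] r2[of m] by (subst nn_integral_eq_integral[OF ig]) (auto intro!: ennreal_leI)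
  qed auto
  also have "\<dots> = ennreal (\<Sum>m. (1/2) ^ m)" by (rule suminf_ennreal2) (auto simp: summable_geometric)
  also have "\<dots> < \<infinity>" by simp
  finally have AEG: "AE z in lborel. G z < \<infinity>" by (intro finite_nn_integral_imp_ae_finite) auto
  define h where "h z = lim (\<lambda>m. g (r m) z)" for z
  have [measurable]: "h \<in> borel_measurable borel" unfolding h_def by measurable
  have limg: "AE z in lborel. z \<in> U \<longrightarrow> (\<lambda>m. g (r m) z) \<longlonglongrightarrow> h z"
    using AEG
  proof eventually_elim
    case (elim z)
    show ?case
    proof
      assume "z \<in> U"
      then obtain l where l: "z \<in> Ck l" using Ck(3) by blast
      have "summable (\<lambda>m. indicator (Ck m) z * norm (g (r (Suc m)) z - g (r m) z))"
        using elim unfolding G_def by (intro summable_suminf_not_top) auto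
      then have "summable (\<lambda>m. indicator (Ck (m + l)) z * norm (g (r (Suc (m + l))) z - g (r (m + l)) z))"
        using summable_iff_shift[of "\<lambda>m. indicator (Ck m) z * norm (g (r (Suc m)) z - g (r m) z)" l] by simp
      moreover have "indicator (Ck (m + l)) z = (1::real)" for m using Cm[of l "m + l"] l by auto
      ultimately have "summable (\<lambda>m. norm (g (r (Suc (m + l))) z - g (r (m + l)) z))" by simp
      then have "summable (\<lambda>m. g (r (Suc (m + l))) z - g (r (m + l)) z)" by (rule summable_norm_cancel)
      then have "summable (\<lambda>m. g (r (Suc m)) z - g (r m) z)"
        using summable_iff_shift[of "\<lambda>m. g (r (Suc m)) z - g (r m) z" l] by simp
      then have "convergent (\<lambda>n. \<Sum>m<n. g (r (Suc m)) z - g (r m) z)" by (simp add: summable_iff_convergent)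
      then have "convergent (\<lambda>n. g (r n) z - g (r 0) z)" by (subst (asm) sum_lessThan_telescope)
      then have "convergent (\<lambda>n. g (r n) z)" by (simp add: convergent_diff_const_right_iff)
      then show "(\<lambda>m. g (r m) z) \<longlonglongrightarrow> h z" unfolding h_def by (simp add: convergent_LIMSEQ_iff)
    qed
  qed
  have limu: "AE z in lborel. z \<in> U \<longrightarrow> (\<lambda>m. u (r m) z) \<longlonglongrightarrow> v z"
    using lim
  proof eventually_elim
    case (elim z) then show ?case using LIMSEQ_subseq_LIMSEQ[OF _ r, of "\<lambda>n. u n z"] by (auto simp: o_def)
  qed
  have uconv: "(\<lambda>m. \<integral>z. u (r m) z * \<psi> z \<partial>lborel) \<longlonglongrightarrow> (\<integral>z. v z * \<psi> z \<partial>lborel)" "integrable lborel (\<lambda>z. v z * \<psi> z)" "integrable lborel (\<lambda>z. u (r m) z * \<psi> z)"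
    if c: "continuous_on UNIV \<psi>" and K: "compact K" "K \<subseteq> U" and 0: "\<And>z. z \<notin> K \<Longrightarrow> \<psi> z = 0" for \<psi> K m
  proof -
    have [measurable]: "\<psi> \<in> borel_measurable borel" using c by (rule borel_measurable_continuous_onI)
    have i: "integrable lborel \<psi>" by (rule integrable_cont_compact_support[OF c K(1) 0])
    then have iw: "integrable lborel (\<lambda>z. M' * norm (\<psi> z))" by auto
    have bv: "norm (v z * \<psi> z) \<le> M' * norm (\<psi> z)" for z
      using v(1)[of z] M'(3)[of z] by (auto simp: abs_mult intro!: mult_right_mono)
    have bu: "norm (u n z * \<psi> z) \<le> M' * norm (\<psi> z)" for n z
      using u(1)[of n z] M'(2)[of n z] by (auto simp: abs_mult intro!: mult_right_mono)
    show "(\<lambda>m. \<integral>z. u (r m) z * \<psi> z \<partial>lborel) \<longlonglongrightarrow> (\<integral>z. v z * \<psi> z \<partial>lborel)"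
    proof (rule integral_dominated_convergence[OF _ _ iw])
      show "AE z in lborel. (\<lambda>m. u (r m) z * \<psi> z) \<longlonglongrightarrow> v z * \<psi> z"
        using limu
      proof eventually_elim
        case (elim z)
        show ?case
        proof (cases "z \<in> K")
          case True
          then have "(\<lambda>m. u (r m) z) \<longlonglongrightarrow> v z" using elim K by auto
          then show ?thesis by (intro tendsto_intros)
        qed (use 0 in simp)
      qed
    qed (use bu in auto)
    show "integrable lborel (\<lambda>z. v z * \<psi> z)"
      by (rule Bochner_Integration.integrable_bound[OF iw]) (auto intro!: AE_I2 order_trans[OF bv[unfolded real_norm_def]])
    show "integrable lborel (\<lambda>z. u (r m) z * \<psi> z)"
      by (rule Bochner_Integration.integrable_bound[OF iw]) (auto intro!: AE_I2 order_trans[OF bu[unfolded real_norm_def]])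
  qed
  have "superpair U p v h"
  proof (rule superpairI)
    show "v \<in> borel_measurable borel" "h \<in> borel_measurable borel" by measurable
  next
    fix K assume K: "compact K" "K \<subseteq> U"
    have [measurable]: "K \<in> sets borel" using K borel_compact by blast
    show "integrable lborel (\<lambda>z. indicator K z * \<bar>v z\<bar> powr p)"
    proof (rule Bochner_Integration.integrable_bound[of _ "\<lambda>z. M' powr p * indicator K z"])
      show "AE z in lborel. norm (indicator K z * \<bar>v z\<bar> powr p) \<le> norm (M' powr p * indicator K z)"
        using v(1) M'(3) p by (intro AE_I2) (auto simp: indicator_def intro!: powr_mono2)
    qed (use integrable_indicator_compact[OF K(1)] in auto)
    obtain C0 where C0: "\<And>u g. superpair U p u g \<Longrightarrow> (\<And>z. 0 \<le> u z) \<Longrightarrow> (\<And>z. u z \<le> M') \<Longrightarrow> (\<integral>z. indicator K z * norm (g z) powr p \<partial>lborel) \<le> C0"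
      using caccioppoli[OF p U K M'(1)] by blast
    show "integrable lborel (\<lambda>z. indicator K z * norm (h z) powr p)"
    proof (rule Fatou_Lr(1))
      show "AE z in lborel. (\<lambda>m. indicator K z * norm (g (r m) z) powr p) \<longlonglongrightarrow> indicator K z * norm (h z) powr p"
        using limg
      proof eventually_elim
        case (elim z)
        show ?case
        proof (cases "z \<in> K")
          case True
          then have "(\<lambda>m. g (r m) z) \<longlonglongrightarrow> h z" using elim K by auto
          then have "(\<lambda>m. norm (g (r m) z) powr p) \<longlonglongrightarrow> norm (h z) powr p"
            by (intro tendsto_powr'[OF tendsto_norm tendsto_const]) (use p in auto)
          then show ?thesis by (rule tendsto_mult_left)
        qed simp
      qed
      show "integrable lborel (\<lambda>z. indicator K z * norm (g (r m) z) powr p)" for m using superpair_local(5)[OF S p K] .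
      show "(\<integral>z. indicator K z * norm (g (r m) z) powr p \<partial>lborel) \<le> C0" for m by (rule C0[OF S u(1) M'(2)])
    qed auto
  next
    fix \<phi> :: "'a \<times> real \<Rightarrow> real" and D K assume \<phi>: "C1 \<phi> D" and K: "compact K" "K \<subseteq> U" "\<And>z. z \<notin> K \<Longrightarrow> \<phi> z = 0"
    have [measurable]: "K \<in> sets borel" using K borel_compact by blast
    obtain C0 where C0: "\<And>u g. superpair U p u g \<Longrightarrow> (\<And>z. 0 \<le> u z) \<Longrightarrow> (\<And>z. u z \<le> M') \<Longrightarrow> (\<integral>z. indicator K z * norm (g z) powr p \<partial>lborel) \<le> C0"
      using caccioppoli[OF p U K(1,2) M'(1)] by blast
    have CK: "(\<integral>z. indicator K z * norm (g n z) powr p \<partial>lborel) \<le> C0" for n by (rule C0[OF S u(1) M'(2)])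
    have iK: "integrable lborel (\<lambda>z. indicator K z * norm (g n z) powr p)" for n using superpair_local(5)[OF S p K(1,2)] .
    have D0: "D z w = 0" if "z \<notin> K" for z w
      by (rule C1_D_zero[OF \<phi> compact_imp_closed[OF K(1)] K(3) that])
    have G0: "gradD D z = 0" if "z \<notin> K" for z using D0[OF that] by (simp add: gradD_def)
    have [measurable]: "\<phi> \<in> borel_measurable borel" "gradD D \<in> borel_measurable borel"
      by (rule borel_measurable_continuous_onI[OF C1_cont[OF \<phi>]], rule gradD_measurable[OF \<phi>])
    obtain B1 where B1: "B1 > 0" "\<And>z. \<bar>\<phi> z\<bar> \<le> B1" using cont_compact_support_bounded[OF C1_cont[OF \<phi>] K(1,3)] by blast
    obtain B3 where B3: "B3 > 0" "\<And>z. \<bar>norm (gradD D z)\<bar> \<le> B3"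
      using cont_compact_support_bounded[of "\<lambda>z. norm (gradD D z)", OF continuous_on_norm[OF continuous_gradD[OF \<phi>]] K(1)] G0 by auto
    have key: "(\<lambda>m. \<integral>z. f m z \<partial>lborel) \<longlonglongrightarrow> (\<integral>z. F z \<partial>lborel)" "integrable lborel F" "integrable lborel (f m)"
      if fm[measurable]: "\<And>m. f m \<in> borel_measurable borel" and Fm: "F \<in> borel_measurable borel"
        and l: "AE z in lborel. (\<lambda>m. f m z) \<longlonglongrightarrow> F z" and f0: "\<And>m z. z \<notin> K \<Longrightarrow> f m z = 0" and F0: "\<And>z. z \<notin> K \<Longrightarrow> F z = 0"
        and q: "q > 1" and b: "\<And>m z. \<bar>f m z\<bar> powr q \<le> B * (indicator K z * norm (g (r m) z) powr p)" and B: "B \<ge> 0" for f F q B m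
    proof -
      have i: "integrable lborel (\<lambda>z. \<bar>f m z\<bar> powr q)" for m
        by (rule Bochner_Integration.integrable_bound[of _ "\<lambda>z. B * (indicator K z * norm (g (r m) z) powr p)"])
          (use iK[of "r m"] in \<open>auto intro!: AE_I2 order_trans[OF b]\<close>)
      have C: "(\<integral>z. \<bar>f m z\<bar> powr q \<partial>lborel) \<le> B * C0" for m
      proof -
        have "(\<integral>z. \<bar>f m z\<bar> powr q \<partial>lborel) \<le> (\<integral>z. B * (indicator K z * norm (g (r m) z) powr p) \<partial>lborel)"
          by (rule integral_mono[OF i _ b]) (use iK in auto)
        also have "\<dots> \<le> B * C0" using CK[of "r m"] B by (simp add: mult_left_mono)
        finally show ?thesis .
      qed
      show "(\<lambda>m. \<integral>z. f m z \<partial>lborel) \<longlonglongrightarrow> (\<integral>z. F z \<partial>lborel)" "integrable lborel F" "integrable lborel (f m)"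
        by (rule Lr_bounded_convergence[OF K(1) fm Fm f0 F0 l q i C]; assumption)+
    qed
    show "(\<integral>z. v z * D z (b, 0) \<partial>lborel) = - (\<integral>z. (h z \<bullet> b) * \<phi> z \<partial>lborel)" if b: "b \<in> Basis" for b
    proof -
      have 1: "(\<lambda>m. \<integral>z. (g (r m) z \<bullet> b) * \<phi> z \<partial>lborel) \<longlonglongrightarrow> (\<integral>z. (h z \<bullet> b) * \<phi> z \<partial>lborel)"
      proof (rule key(1)[where q=p and B="B1 powr p"])
        show "AE z in lborel. (\<lambda>m. (g (r m) z \<bullet> b) * \<phi> z) \<longlonglongrightarrow> (h z \<bullet> b) * \<phi> z"
          using limg
        proof eventually_elim
          case (elim z)
          show ?case
          proof (cases "z \<in> K")
            case True
            then have "(\<lambda>m. g (r m) z) \<longlonglongrightarrow> h z" using elim K by auto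
            then show ?thesis by (intro tendsto_intros)
          qed (use K(3) in simp)
        qed
        fix m z
        show "\<bar>(g (r m) z \<bullet> b) * \<phi> z\<bar> powr p \<le> B1 powr p * (indicator K z * norm (g (r m) z) powr p)"
        proof (cases "z \<in> K")
          case True
          have "\<bar>(g (r m) z \<bullet> b) * \<phi> z\<bar> \<le> norm (g (r m) z) * B1"
            unfolding abs_mult using Basis_le_norm[OF b] B1(2)[of z] by (intro mult_mono) auto
          then have "\<bar>(g (r m) z \<bullet> b) * \<phi> z\<bar> powr p \<le> (norm (g (r m) z) * B1) powr p" using p by (intro powr_mono2) auto
          then show ?thesis using True B1(1) by (simp add: powr_mult mult.commute)
        qed (use K(3) p in simp)
      qed (use K(3) p in auto)
      have 2: "(\<lambda>m. \<integral>z. u (r m) z * D z (b, 0) \<partial>lborel) \<longlonglongrightarrow> (\<integral>z. v z * D z (b, 0) \<partial>lborel)"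
        by (rule uconv(1)[OF C1_cont_D[OF \<phi>] K(1,2) D0])
      have "(\<integral>z. u (r m) z * D z (b, 0) \<partial>lborel) = - (\<integral>z. (g (r m) z \<bullet> b) * \<phi> z \<partial>lborel)" for m
        by (rule superpair_weak_gradient[OF p U S \<phi> K(1,2) _ b]) (use K(3) in auto)
      then show ?thesis using LIMSEQ_unique[OF 2] tendsto_minus[OF 1] by simp
    qed
    show "0 \<le> (\<integral>z. Aflux p (h z) \<bullet> gradD D z - v z * D z (0, 1) \<partial>lborel)" if \<phi>0: "\<And>z. 0 \<le> \<phi> z"
    proof -
      have k: "(\<lambda>m. \<integral>z. Aflux p (g (r m) z) \<bullet> gradD D z \<partial>lborel) \<longlonglongrightarrow> (\<integral>z. Aflux p (h z) \<bullet> gradD D z \<partial>lborel)"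
        "integrable lborel (\<lambda>z. Aflux p (h z) \<bullet> gradD D z)" "integrable lborel (\<lambda>z. Aflux p (g (r m) z) \<bullet> gradD D z)" for m
      proof -
        have l: "AE z in lborel. (\<lambda>m. Aflux p (g (r m) z) \<bullet> gradD D z) \<longlonglongrightarrow> Aflux p (h z) \<bullet> gradD D z"
          using limg
        proof eventually_elim
          case (elim z)
          show ?case
          proof (cases "z \<in> K")
            case True
            then have "(\<lambda>m. g (r m) z) \<longlonglongrightarrow> h z" using elim K by auto
            then show ?thesis by (intro tendsto_intros tendsto_Aflux[OF p])
          qed (use G0 in simp)
        qed
        have b: "\<bar>Aflux p (g (r m) z) \<bullet> gradD D z\<bar> powr (p / (p - 1)) \<le> B3 powr (p / (p - 1)) * (indicator K z * norm (g (r m) z) powr p)" for m z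
        proof (cases "z \<in> K")
          case True
          have "\<bar>Aflux p (g (r m) z) \<bullet> gradD D z\<bar> \<le> norm (g (r m) z) powr (p - 1) * B3"
            using B3(2)[of z] by (intro order_trans[OF Cauchy_Schwarz_ineq2] mult_mono) (auto simp: norm_Aflux)
          then have "\<bar>Aflux p (g (r m) z) \<bullet> gradD D z\<bar> powr (p / (p - 1)) \<le> (norm (g (r m) z) powr (p - 1) * B3) powr (p / (p - 1))"
            using p by (intro powr_mono2) auto
          also have "\<dots> = B3 powr (p / (p - 1)) * norm (g (r m) z) powr p"
            using B3(1) p by (simp add: powr_mult powr_powr mult.commute)
          finally show ?thesis using True by simp
        qed (use G0 p in simp)
        have q: "p / (p - 1) > 1" using p by simp
        note kk = key[OF _ _ l _ _ q b]
        show "(\<lambda>m. \<integral>z. Aflux p (g (r m) z) \<bullet> gradD D z \<partial>lborel) \<longlonglongrightarrow> (\<integral>z. Aflux p (h z) \<bullet> gradD D z \<partial>lborel)"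
          by (rule kk(1)) (use G0 in auto)
        show "integrable lborel (\<lambda>z. Aflux p (h z) \<bullet> gradD D z)" by (rule kk(2)) (use G0 in auto)
        show "integrable lborel (\<lambda>z. Aflux p (g (r m) z) \<bullet> gradD D z)" by (rule kk(3)) (use G0 in auto)
      qed
      note uc = uconv[OF C1_cont_D[OF \<phi>, of "(0,1)"] K(1,2) D0]
      have "0 \<le> (\<integral>z. Aflux p (g (r m) z) \<bullet> gradD D z \<partial>lborel) - (\<integral>z. u (r m) z * D z (0, 1) \<partial>lborel)" for m
      proof -
        have "0 \<le> (\<integral>z. Aflux p (g (r m) z) \<bullet> gradD D z - u (r m) z * D z (0, 1) \<partial>lborel)"
          by (rule superpair_inequality[OF p U S \<phi> K(1,2) _ \<phi>0]) (use K(3) in auto)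
        also have "\<dots> = (\<integral>z. Aflux p (g (r m) z) \<bullet> gradD D z \<partial>lborel) - (\<integral>z. u (r m) z * D z (0, 1) \<partial>lborel)"
          by (rule Bochner_Integration.integral_diff[OF k(3) uc(3)]) auto
        finally show ?thesis .
      qed
      moreover have "(\<lambda>m. (\<integral>z. Aflux p (g (r m) z) \<bullet> gradD D z \<partial>lborel) - (\<integral>z. u (r m) z * D z (0, 1) \<partial>lborel)) \<longlonglongrightarrow> (\<integral>z. Aflux p (h z) \<bullet> gradD D z \<partial>lborel) - (\<integral>z. v z * D z (0, 1) \<partial>lborel)"
        by (intro tendsto_diff k(1) uc(1)) auto
      ultimately have "0 \<le> (\<integral>z. Aflux p (h z) \<bullet> gradD D z \<partial>lborel) - (\<integral>z. v z * D z (0, 1) \<partial>lborel)"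
        by (intro LIMSEQ_le_const) auto
      then show ?thesis using Bochner_Integration.integral_diff[OF k(2) uc(2)] by simp
    qed
  qed
  then show ?thesis by blast
qed

section \<open>Translation estimates and time slices\<close>

lemma C1_translation_L1:
  fixes f :: "'e::euclidean_space \<Rightarrow> real"
  assumes f: "C1 f D" and K: "compact K" "\<And>z. z \<notin> K \<Longrightarrow> f z = 0"
  shows "(\<integral>z. \<bar>f (z + v) - f z\<bar> \<partial>lborel) \<le> (\<integral>z. \<bar>D z v\<bar> \<partial>lborel)"
proof -
  have [measurable]: "(\<lambda>z. D z v) \<in> borel_measurable borel" "f \<in> borel_measurable borel"
    by (rule borel_measurable_continuous_onI[OF C1_cont_D[OF f]], rule borel_measurable_continuous_onI[OF C1_cont[OF f]])
  have iD: "integrable lborel (\<lambda>z. D z v)" using C1_integral_derivative_zero(2)[OF f K(1)] K(2) by blast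
  have fi: "integrable lborel f" by (rule integrable_cont_compact_support[OF C1_cont[OF f] K])
  have "(\<integral>\<^sup>+z. ennreal \<bar>f (z + v) - f z\<bar> \<partial>lborel) \<le> (\<integral>\<^sup>+z. (\<integral>\<^sup>+s. ennreal (\<bar>D (z + s *\<^sub>R v) v\<bar> * indicator {0..1} s) \<partial>lborel) \<partial>lborel)"
  proof (rule nn_integral_mono)
    fix z
    have c: "continuous_on UNIV (\<lambda>s. D (z + s *\<^sub>R v) v)"
      by (rule continuous_on_compose2[OF C1_cont_D[OF f, of v]]) (auto intro!: continuous_intros)
    have "(\<integral>s. D (z + s *\<^sub>R v) v * indicator {0..1} s \<partial>lborel) = f (z + 1 *\<^sub>R v) - f (z + 0 *\<^sub>R v)"
      by (rule integral_FTC_Icc_real[OF _ C1_line_derivative[OF f]]) (use c in \<open>auto simp: continuous_on_eq_continuous_at\<close>)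
    then have "\<bar>f (z + v) - f z\<bar> = norm (\<integral>s. D (z + s *\<^sub>R v) v * indicator {0..1} s \<partial>lborel)" by simp
    also have "ennreal \<dots> \<le> (\<integral>\<^sup>+s. ennreal (norm (D (z + s *\<^sub>R v) v * indicator {0..1} s)) \<partial>lborel)"
    proof (rule integral_norm_bound_ennreal)
      have "integrable lborel (\<lambda>s. indicator {0..1::real} s *\<^sub>R D (z + s *\<^sub>R v) v)"
        by (rule borel_integrable_compact) (use c continuous_on_subset in auto)
      then show "integrable lborel (\<lambda>s. D (z + s *\<^sub>R v) v * indicator {0..1} s)" by (simp add: mult.commute)
    qed
    finally show "ennreal \<bar>f (z + v) - f z\<bar> \<le> (\<integral>\<^sup>+s. ennreal (\<bar>D (z + s *\<^sub>R v) v\<bar> * indicator {0..1} s) \<partial>lborel)"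
      by (simp add: abs_mult)
  qed
  also have "\<dots> = (\<integral>\<^sup>+s. (\<integral>\<^sup>+z. ennreal (\<bar>D (z + s *\<^sub>R v) v\<bar> * indicator {0..1::real} s) \<partial>lborel) \<partial>lborel)"
    by (rule lborel_pair.Fubini'[symmetric]) measurable
  also have "\<dots> = (\<integral>\<^sup>+s. (\<integral>\<^sup>+z. ennreal \<bar>D z v\<bar> \<partial>lborel) * indicator {0..1::real} s \<partial>lborel)"
  proof (rule nn_integral_cong)
    fix s :: real
    have "(\<integral>\<^sup>+z. ennreal (\<bar>D (z + s *\<^sub>R v) v\<bar> * indicator {0..1} s) \<partial>lborel) = (\<integral>\<^sup>+z. ennreal \<bar>D (z + s *\<^sub>R v) v\<bar> \<partial>lborel) * indicator {0..1} s"
      by (cases "s \<in> {0..1}") auto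
    also have "(\<integral>\<^sup>+z. ennreal \<bar>D (z + s *\<^sub>R v) v\<bar> \<partial>lborel) = (\<integral>\<^sup>+z. ennreal \<bar>D z v\<bar> \<partial>lborel)"
      by (rule lborel_nn_integral_translation[of "\<lambda>z. ennreal \<bar>D z v\<bar>"]) measurable
    finally show "(\<integral>\<^sup>+z. ennreal (\<bar>D (z + s *\<^sub>R v) v\<bar> * indicator {0..1} s) \<partial>lborel) = (\<integral>\<^sup>+z. ennreal \<bar>D z v\<bar> \<partial>lborel) * indicator {0..1} s" .
  qed
  also have "\<dots> = (\<integral>\<^sup>+z. ennreal \<bar>D z v\<bar> \<partial>lborel)" by (subst nn_integral_cmult) auto
  finally show ?thesis
    using nn_integral_eq_integral[of lborel "\<lambda>z. \<bar>f (z + v) - f z\<bar>"] nn_integral_eq_integral[of lborel "\<lambda>z. \<bar>D z v\<bar>"]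
      iD fi lborel_integrable_translation[OF fi, of v] by simp
qed

lemma C1_divide_const: "C1 f D \<Longrightarrow> C1 (\<lambda>z. f z / c) (\<lambda>z v. D z v / c)"
  unfolding C1_def divide_inverse by (auto intro!: has_derivative_mult_left continuous_intros)

lemma C1_spatial_derivative:
  assumes "C1 f D" shows "D z (h, 0) = h \<bullet> gradD D z"
proof -
  have "(h, 0::real) = (\<Sum>b\<in>Basis. (h \<bullet> b) *\<^sub>R (b, 0))"
    by (simp add: sum_prod prod_eq_iff euclidean_representation)
  then have "D z (h, 0) = (\<Sum>b\<in>Basis. D z ((h \<bullet> b) *\<^sub>R (b, 0)))"
    using linear_sum[OF C1_linear[OF assms]] by metis
  also have "\<dots> = (\<Sum>b\<in>Basis. (h \<bullet> b) * D z (b, 0))"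
    by (intro sum.cong refl) (simp only: linear_scale[OF C1_linear[OF assms]] real_scaleR_def)
  finally have "D z (h, 0) = (\<Sum>b\<in>Basis. (h \<bullet> b) * D z (b, 0))" .
  then show ?thesis by (simp add: inner_gradD)
qed

text \<open>An $L^1$ bound for spatial difference quotients; averaged over translations it replaces the Sobolev inequality in the De Giorgi step.\<close>

lemma superpair_translation:
  fixes u \<eta> :: "'a::euclidean_space \<times> real \<Rightarrow> real" and k d :: real and h :: 'a
  assumes p: "p > 2" and U: "open U" and S: "superpair U p u g"
    and \<eta>: "C1 \<eta> D" and K: "compact K" "K \<subseteq> U" "\<And>z. z \<notin> K \<Longrightarrow> \<eta> z = 0" and \<eta>0: "\<And>z. 0 \<le> \<eta> z" and d: "d > 0"
  defines "f z \<equiv> \<eta> z * sst ((k - u z) / d)"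
    and "J z \<equiv> \<eta> z * (sst' ((k - u z) / d) / d) * norm (g z) + sst ((k - u z) / d) * norm (gradD D z)"
  shows "integrable lborel f" "integrable lborel J"
    and "(\<integral>z. \<bar>f (z + (h, 0)) - f z\<bar> \<partial>lborel) \<le> norm h * (\<integral>z. J z \<partial>lborel)"
proof -
  obtain un Dun Gn Fn DF H where
    un: "\<And>n. C1 (un n) (Dun n)" and Fn: "\<And>n b. C1 (\<lambda>z. Fn n z \<bullet> b) (DF n b)"
    and un_super: "\<And>n z. z \<in> K \<Longrightarrow> (\<Sum>b\<in>Basis. DF n b z (b, 0)) \<le> Dun n z (0, 1)"
    and Gn: "\<And>n z b. z \<in> K \<Longrightarrow> b \<in> Basis \<Longrightarrow> Dun n z (b, 0) = Gn n z \<bullet> b"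
    and Gm[measurable]: "\<And>n. Gn n \<in> borel_measurable borel"
    and lu: "AE z in lborel. z \<in> K \<longrightarrow> (\<lambda>n. un n z) \<longlonglongrightarrow> u z"
    and lg: "AE z in lborel. z \<in> K \<longrightarrow> (\<lambda>n. Gn n z) \<longlonglongrightarrow> g z"
    and lF: "AE z in lborel. z \<in> K \<longrightarrow> (\<lambda>n. Fn n z) \<longlonglongrightarrow> Aflux p (g z)"
    and H: "integrable lborel H" "\<And>z. 0 \<le> H z"
    and du: "AE z in lborel. \<forall>n. \<bar>un n z\<bar> \<le> H z \<and> norm (Gn n z) powr p \<le> H z \<and> norm (Fn n z) powr (p / (p - 1)) \<le> H z"
    by (rule superpair_approx[OF S p U K(1,2)]) blast
  define v :: "'a \<times> real" where "v = (h, 0)"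
  have D0: "D z w = 0" if "z \<notin> K" for z w
    by (rule C1_D_zero[OF \<eta> compact_imp_closed[OF K(1)] K(3) that])
  have G0: "gradD D z = 0" if "z \<notin> K" for z using D0[OF that] by (simp add: gradD_def)
  have [measurable]: "K \<in> sets borel" using K borel_compact by blast
  have [measurable]: "u \<in> borel_measurable borel" "g \<in> borel_measurable borel" using S by (auto simp: superpair_def)
  have [measurable]: "un n \<in> borel_measurable borel" for n using C1_cont[OF un] by (rule borel_measurable_continuous_onI)
  have [measurable]: "\<eta> \<in> borel_measurable borel" "gradD D \<in> borel_measurable borel"
    by (rule borel_measurable_continuous_onI[OF C1_cont[OF \<eta>]], rule gradD_measurable[OF \<eta>])
  obtain B1 where B1: "B1 > 0" "\<And>z. \<bar>\<eta> z\<bar> \<le> B1" using cont_compact_support_bounded[OF C1_cont[OF \<eta>] K(1,3)] by blast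
  obtain B3 where B3: "B3 > 0" "\<And>z. \<bar>norm (gradD D z)\<bar> \<le> B3"
    using cont_compact_support_bounded[of "\<lambda>z. norm (gradD D z)", OF continuous_on_norm[OF continuous_gradD[OF \<eta>]] K(1)] G0 by auto
  have sst_cont: "isCont sst x" "isCont sst' x" for x
    using DERIV_isCont[OF sst_derivative] sst'_continuous by (auto simp: continuous_on_eq_continuous_at)
  define fn where "fn n z = \<eta> z * sst ((k - un n z) / d)" for n z
  define Jn where "Jn n z = \<eta> z * (sst' ((k - un n z) / d) / d) * norm (Gn n z) + sst ((k - un n z) / d) * norm (gradD D z)" for n z
  have [measurable]: "fn n \<in> borel_measurable borel" "Jn n \<in> borel_measurable borel" "f \<in> borel_measurable borel" "J \<in> borel_measurable borel" for n
    unfolding fn_def[abs_def] Jn_def[abs_def] f_def[abs_def] J_def[abs_def] by measurable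
  have lims: "AE z in lborel. (\<lambda>n. fn n z) \<longlonglongrightarrow> f z \<and> (\<lambda>n. Jn n z) \<longlonglongrightarrow> J z"
    using lu lg
  proof eventually_elim
    case (elim z)
    show ?case
    proof (cases "z \<in> K")
      case True
      then have t: "(\<lambda>n. un n z) \<longlonglongrightarrow> u z" "(\<lambda>n. Gn n z) \<longlonglongrightarrow> g z" using elim by auto
      have x: "(\<lambda>n. (k - un n z) / d) \<longlonglongrightarrow> (k - u z) / d" using d by (intro tendsto_intros t) auto
      have s: "(\<lambda>n. sst ((k - un n z) / d)) \<longlonglongrightarrow> sst ((k - u z) / d)" "(\<lambda>n. sst' ((k - un n z) / d)) \<longlonglongrightarrow> sst' ((k - u z) / d)"
        using isCont_tendsto_compose[OF sst_cont(1) x] isCont_tendsto_compose[OF sst_cont(2) x] by auto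
      show ?thesis unfolding fn_def f_def Jn_def J_def using d by (intro conjI tendsto_intros t s) auto
    next
      case False
      then show ?thesis using K(3) G0 by (simp add: fn_def f_def Jn_def J_def)
    qed
  qed
  have iK: "integrable lborel (indicator K :: _ \<Rightarrow> real)" using integrable_indicator_compact[OF K(1)] .
  have fb: "\<bar>\<eta> z * sst y\<bar> \<le> B1 * indicator K z" for z y
  proof (cases "z \<in> K")
    case True
    have "\<bar>\<eta> z\<bar> * \<bar>sst y\<bar> \<le> B1 * 1" using B1(1) B1(2)[of z] sst_range[of y] by (intro mult_mono) auto
    then show ?thesis using True by (simp add: abs_mult)
  qed (use K(3) in simp)
  define c where "c = B1 * (3 / 2 / d) + B3"
  have c0: "c \<ge> 0" using B1 B3 d by (simp add: c_def)
  define W where "W z = c * (indicator K z + indicator K z * H z)" for z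
  have iKH: "integrable lborel (\<lambda>z. indicator K z * H z)"
    using integrable_real_mult_indicator[OF _ H(1), of K] by (simp add: mult.commute)
  have iW: "integrable lborel W" unfolding W_def using iK iKH by auto
  have bJ: "AE z in lborel. norm (Jn n z) \<le> W z" for n
    using du
  proof eventually_elim
    case (elim z)
    show ?case
    proof (cases "z \<in> K")
      case True
      have g: "norm (Gn n z) \<le> 1 + H z" using le_one_plus_powr1[of "norm (Gn n z)" p] p elim[THEN spec, of n] by auto
      have s: "0 \<le> sst' ((k - un n z) / d) / d" "sst' ((k - un n z) / d) / d \<le> 3 / 2 / d"
        using sst'_range[of "(k - un n z) / d"] d by (auto intro!: divide_right_mono simp del: divide_divide_eq_left)
      have "\<eta> z * (sst' ((k - un n z) / d) / d) * norm (Gn n z) \<le> B1 * (3 / 2 / d) * (1 + H z)"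
        using B1(1) B1(2)[of z] \<eta>0[of z] s g d by (intro mult_mono) auto
      moreover have "sst ((k - un n z) / d) * norm (gradD D z) \<le> 1 * B3"
        using sst_range[of "(k - un n z) / d"] B3(2)[of z] by (intro mult_mono) auto
      moreover have "0 \<le> Jn n z" unfolding Jn_def using \<eta>0[of z] s(1) sst_range(1)[of "(k - un n z) / d"] by (intro add_nonneg_nonneg mult_nonneg_nonneg) auto
      moreover have "B3 \<le> B3 * (1 + H z)" using B3(1) H(2)[of z] by (simp add: distrib_left)
      ultimately have "\<bar>Jn n z\<bar> \<le> c * (1 + H z)" unfolding Jn_def c_def by (simp add: distrib_right)
      then show ?thesis using True by (simp add: W_def distrib_left)
    next
      case False then show ?thesis using K(3) G0 by (simp add: Jn_def W_def)
    qed
  qed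
  have lf: "AE z in lborel. (\<lambda>n. fn n z) \<longlonglongrightarrow> f z" and lJ: "AE z in lborel. (\<lambda>n. Jn n z) \<longlonglongrightarrow> J z"
    using lims by (auto elim: eventually_mono)
  show iJ: "integrable lborel J" by (rule integrable_dominated_convergence[OF _ _ iW lJ bJ]) auto
  have cJ: "(\<lambda>n. \<integral>z. Jn n z \<partial>lborel) \<longlonglongrightarrow> (\<integral>z. J z \<partial>lborel)" by (rule integral_dominated_convergence[OF _ _ iW lJ bJ]) auto
  have iJn: "integrable lborel (Jn n)" for n by (rule Bochner_Integration.integrable_bound[OF iW]) (use bJ[of n] in \<open>auto elim!: eventually_mono\<close>)
  have iKB: "integrable lborel (\<lambda>z. B1 * indicator K z)" using iK by auto
  show fi: "integrable lborel f"
    by (rule Bochner_Integration.integrable_bound[OF iKB]) (use fb in \<open>auto simp: f_def intro!: AE_I2 order_trans[OF fb]\<close>)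
  have ifn: "integrable lborel (fn n)" for n
    by (rule Bochner_Integration.integrable_bound[OF iKB]) (use fb in \<open>auto simp: fn_def intro!: AE_I2 order_trans[OF fb]\<close>)
  have cf: "(\<lambda>n. \<integral>z. \<bar>fn n z - f z\<bar> \<partial>lborel) \<longlonglongrightarrow> (\<integral>z. 0 \<partial>(lborel::('a \<times> real) measure))"
  proof (rule integral_dominated_convergence[where w="\<lambda>z. 2 * (B1 * indicator K z)"])
    show "AE z in lborel. (\<lambda>n. \<bar>fn n z - f z\<bar>) \<longlonglongrightarrow> 0"
      using lf
    proof eventually_elim
      case (elim z)
      have "(\<lambda>n. \<bar>fn n z - f z\<bar>) \<longlonglongrightarrow> \<bar>f z - f z\<bar>" by (intro tendsto_intros elim)
      then show ?case by simp
    qed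
    show "AE z in lborel. norm \<bar>fn n z - f z\<bar> \<le> 2 * (B1 * indicator K z)" for n
    proof (rule AE_I2)
      fix z
      show "norm \<bar>fn n z - f z\<bar> \<le> 2 * (B1 * indicator K z)"
        using fb[of z "(k - un n z) / d"] fb[of z "(k - u z) / d"] abs_triangle_ineq4[of "fn n z" "f z"] unfolding fn_def f_def real_norm_def by linarith
    qed
  qed (use iK in auto)
  have main: "(\<integral>z. \<bar>f (z + v) - f z\<bar> \<partial>lborel) \<le> 2 * (\<integral>z. \<bar>fn n z - f z\<bar> \<partial>lborel) + norm h * (\<integral>z. Jn n z \<partial>lborel)" for n
  proof -
    define Dfn where "Dfn z w = \<eta> z * (sst' ((k - un n z) / d) * ((0 - Dun n z w) / d)) + D z w * sst ((k - un n z) / d)" for z w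
    have C: "C1 (fn n) Dfn" unfolding fn_def[abs_def] Dfn_def[abs_def]
      by (rule C1_mult[OF \<eta> C1_compose[OF sst_derivative sst'_continuous C1_divide_const[OF C1_diff[OF C1_const un]]]])
    have fn0: "fn n z = 0" if "z \<notin> K" for z using K(3)[OF that] by (simp add: fn_def)
    have "(\<integral>z. \<bar>fn n (z + v) - fn n z\<bar> \<partial>lborel) \<le> (\<integral>z. \<bar>Dfn z v\<bar> \<partial>lborel)" by (rule C1_translation_L1[OF C K(1) fn0])
    also have "\<dots> \<le> (\<integral>z. norm h * Jn n z \<partial>lborel)"
    proof (rule integral_mono)
      have "integrable lborel (\<lambda>z. Dfn z v)" using C1_integral_derivative_zero(2)[OF C K(1)] fn0 by blast
      then show "integrable lborel (\<lambda>z. \<bar>Dfn z v\<bar>)" by simp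
      show "integrable lborel (\<lambda>z. norm h * Jn n z)" using iJn by auto
      fix z
      show "\<bar>Dfn z v\<bar> \<le> norm h * Jn n z"
      proof (cases "z \<in> K")
        case True
        have gd: "gradD (Dun n) z = Gn n z" by (rule euclidean_eqI) (simp add: gradD_inner_Basis Gn[OF True])
        have e: "Dun n z v = h \<bullet> Gn n z" "D z v = h \<bullet> gradD D z" unfolding v_def using C1_spatial_derivative[OF un, of n z h] C1_spatial_derivative[OF \<eta>, of z h] gd by auto
        define x where "x = (k - un n z) / d"
        have "\<bar>Dfn z v\<bar> \<le> \<bar>\<eta> z * (sst' x * ((0 - h \<bullet> Gn n z) / d))\<bar> + \<bar>(h \<bullet> gradD D z) * sst x\<bar>"
          unfolding Dfn_def e x_def[symmetric] by (rule abs_triangle_ineq)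
        also have "\<dots> = \<eta> z * (sst' x / d) * \<bar>h \<bullet> Gn n z\<bar> + sst x * \<bar>h \<bullet> gradD D z\<bar>"
          using \<eta>0[of z] sst'_range(1)[of x] sst_range(1)[of x] d by (simp add: abs_mult mult.commute)
        also have "\<dots> \<le> \<eta> z * (sst' x / d) * (norm h * norm (Gn n z)) + sst x * (norm h * norm (gradD D z))"
          using \<eta>0[of z] sst'_range(1)[of x] sst_range(1)[of x] d by (intro add_mono mult_left_mono Cauchy_Schwarz_ineq2) auto
        also have "\<dots> = norm h * Jn n z" by (simp add: Jn_def x_def algebra_simps)
        finally show ?thesis .
      next
        case False
        then show ?thesis using K(3)[OF False] D0[OF False] G0[OF False] by (simp add: Dfn_def Jn_def)
      qed
    qed
    finally have 1: "(\<integral>z. \<bar>fn n (z + v) - fn n z\<bar> \<partial>lborel) \<le> norm h * (\<integral>z. Jn n z \<partial>lborel)" by simp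
    note I = fi ifn[of n] lborel_integrable_translation[OF fi, of v] lborel_integrable_translation[OF ifn[of n], of v]
    have "(\<integral>z. \<bar>f (z + v) - f z\<bar> \<partial>lborel) \<le> (\<integral>z. \<bar>fn n (z + v) - f (z + v)\<bar> + \<bar>fn n (z + v) - fn n z\<bar> + \<bar>fn n z - f z\<bar> \<partial>lborel)"
      by (rule integral_mono) (use I in auto)
    also have "\<dots> = (\<integral>z. \<bar>fn n (z + v) - f (z + v)\<bar> \<partial>lborel) + (\<integral>z. \<bar>fn n (z + v) - fn n z\<bar> \<partial>lborel) + (\<integral>z. \<bar>fn n z - f z\<bar> \<partial>lborel)"
      using I by simp
    also have "(\<integral>z. \<bar>fn n (z + v) - f (z + v)\<bar> \<partial>lborel) = (\<integral>z. \<bar>fn n z - f z\<bar> \<partial>lborel)"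
      by (rule lborel_integral_translation[of "\<lambda>z. \<bar>fn n z - f z\<bar>"]) measurable
    finally show ?thesis using 1 by simp
  qed
  have "(\<lambda>n. 2 * (\<integral>z. \<bar>fn n z - f z\<bar> \<partial>lborel) + norm h * (\<integral>z. Jn n z \<partial>lborel)) \<longlonglongrightarrow> 2 * (\<integral>z. 0 \<partial>(lborel::('a \<times> real) measure)) + norm h * (\<integral>z. J z \<partial>lborel)"
    by (intro tendsto_intros cf cJ)
  then have "(\<integral>z. \<bar>f (z + v) - f z\<bar> \<partial>lborel) \<le> 2 * (\<integral>z. 0 \<partial>(lborel::('a \<times> real) measure)) + norm h * (\<integral>z. J z \<partial>lborel)"
    by (rule LIMSEQ_le_const) (use main in auto)
  then show "(\<integral>z. \<bar>f (z + (h, 0)) - f z\<bar> \<partial>lborel) \<le> norm h * (\<integral>z. J z \<partial>lborel)" by (simp add: v_def)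
qed

lemma AE_time_slices:
  assumes "AE t in lborel. P t" shows "AE z in (lborel :: ('a::euclidean_space \<times> real) measure). P (snd z)"
proof -
  obtain N where N: "{t. \<not> P t} \<subseteq> N" "N \<in> sets lborel" "emeasure lborel N = 0"
    using assms by (auto elim!: AE_E)
  have "emeasure (lborel \<Otimes>\<^sub>M lborel) ((UNIV::'a set) \<times> N) = emeasure lborel (UNIV::'a set) * emeasure lborel N"
    using N by (intro lborel.emeasure_pair_measure_Times) auto
  then have e: "emeasure lborel ((UNIV::'a set) \<times> N) = 0" using N(3) by (simp add: lborel_prod)
  have "(UNIV::'a set) \<times> N \<in> sets (lborel \<Otimes>\<^sub>M lborel)" using N by (intro pair_measureI) auto
  then have "(UNIV::'a set) \<times> N \<in> sets lborel" unfolding lborel_prod .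
  then show ?thesis using e N(1) by (intro AE_I[of _ _ "UNIV \<times> N"]) auto
qed

lemma slice_average_bound:
  fixes f :: "'a::euclidean_space \<times> real \<Rightarrow> real"
  assumes f: "integrable lborel f" "\<And>z. 0 \<le> f z" and A[measurable]: "A \<in> sets borel" "emeasure lborel A < \<infinity>"
    and \<rho>: "\<rho> > 0" and N: "N \<ge> 0" and tr: "\<And>h. norm h \<le> \<rho> \<Longrightarrow> (\<integral>z. \<bar>f (z + (h, 0)) - f z\<bar> \<partial>lborel) \<le> \<rho> * N"
    and sl: "AE t in lborel. (\<integral>\<^sup>+x. ennreal (f (x, t)) \<partial>lborel) \<le> ennreal S" and S: "S \<ge> 0"
  shows "(\<integral>z. indicator A z * f z \<partial>lborel) \<le> \<rho> * N + measure lborel A * S / measure lborel (ball (0::'a) \<rho>)"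
proof -
  have [measurable]: "f \<in> borel_measurable borel" using f by auto
  have [measurable]: "ball (0::'a) \<rho> \<in> sets borel" by simp
  have fz[measurable]: "(\<lambda>h. f (z + (h, 0))) \<in> borel_measurable borel" for z
    by (rule measurable_compose[OF borel_measurable_continuous_onI \<open>f \<in> borel_measurable borel\<close>]) (intro continuous_intros)
  have ft[measurable]: "(\<lambda>x. f (x, t)) \<in> borel_measurable borel" for t
    by (rule measurable_compose[OF borel_measurable_continuous_onI \<open>f \<in> borel_measurable borel\<close>]) (intro continuous_intros)
  have fp[measurable]: "(\<lambda>x::('a \<times> real) \<times> 'a. f (fst x + (snd x, 0))) \<in> borel_measurable (lborel \<Otimes>\<^sub>M lborel)"
  proof -
    have "(\<lambda>x::('a \<times> real) \<times> 'a. f (fst x + (snd x, 0))) \<in> borel_measurable borel"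
      by (rule measurable_compose[OF borel_measurable_continuous_onI \<open>f \<in> borel_measurable borel\<close>]) (intro continuous_intros)
    then show ?thesis unfolding lborel_prod by simp
  qed
  define \<beta> where "\<beta> = measure lborel (ball (0::'a) \<rho>)"
  have \<beta>: "\<beta> > 0" unfolding \<beta>_def using \<rho> content_ball_pos by blast
  have e\<beta>: "emeasure lborel (ball (0::'a) \<rho>) = ennreal \<beta>" unfolding \<beta>_def
    by (intro emeasure_eq_ennreal_measure) (use emeasure_lborel_ball_finite[of "0::'a" \<rho>] in auto)
  have iA: "integrable lborel (\<lambda>z. indicator A z * f z)"
    using integrable_real_mult_indicator[OF _ f(1), of A] by (simp add: mult.commute)
  have mA: "emeasure lborel A = ennreal (measure lborel A)"
    using A(2) by (intro emeasure_eq_ennreal_measure) auto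
  have sl': "AE z in lborel. (\<integral>\<^sup>+x. ennreal (f (x, snd (z :: 'a \<times> real))) \<partial>lborel) \<le> ennreal S" by (rule AE_time_slices[OF sl])
  have inner: "(\<integral>\<^sup>+h. indicator (ball (0::'a) \<rho>) h * ennreal (f z) \<partial>lborel) = ennreal \<beta> * ennreal (f z)" for z
    by (subst nn_integral_multc[OF borel_measurable_indicator]) (auto simp: e\<beta>)
  have "ennreal \<beta> * (\<integral>\<^sup>+z. indicator A z * ennreal (f z) \<partial>lborel) = (\<integral>\<^sup>+z. indicator A z * (\<integral>\<^sup>+h. indicator (ball (0::'a) \<rho>) h * ennreal (f z) \<partial>lborel) \<partial>lborel)"
    unfolding inner by (subst nn_integral_cmult[symmetric]) (auto simp: mult_ac intro!: nn_integral_cong)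
  also have "\<dots> \<le> (\<integral>\<^sup>+z. indicator A z * ennreal S + (\<integral>\<^sup>+h. indicator (ball (0::'a) \<rho>) h * ennreal \<bar>f (z + (h, 0)) - f z\<bar> \<partial>lborel) \<partial>lborel)"
  proof (rule nn_integral_mono_AE)
    show "AE z in lborel. indicator A z * (\<integral>\<^sup>+h. indicator (ball (0::'a) \<rho>) h * ennreal (f z) \<partial>lborel)
        \<le> indicator A z * ennreal S + (\<integral>\<^sup>+h. indicator (ball (0::'a) \<rho>) h * ennreal \<bar>f (z + (h, 0)) - f z\<bar> \<partial>lborel)"
      using sl'
    proof eventually_elim
      case (elim z)
      obtain x t where z: "z = (x, t)" by (cases z)
      have "(\<integral>\<^sup>+h. indicator (ball (0::'a) \<rho>) h * ennreal (f z) \<partial>lborel)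
         \<le> (\<integral>\<^sup>+h. ennreal (f (h + x, t)) + indicator (ball (0::'a) \<rho>) h * ennreal \<bar>f (z + (h, 0)) - f z\<bar> \<partial>lborel)"
      proof (rule nn_integral_mono)
        fix h :: 'a
        have "f z \<le> f (h + x, t) + \<bar>f (z + (h, 0)) - f z\<bar>" by (simp add: z add.commute)
        then have "ennreal (f z) \<le> ennreal (f (h + x, t)) + ennreal \<bar>f (z + (h, 0)) - f z\<bar>" using f(2) by (simp flip: ennreal_plus)
        then show "indicator (ball (0::'a) \<rho>) h * ennreal (f z) \<le> ennreal (f (h + x, t)) + indicator (ball (0::'a) \<rho>) h * ennreal \<bar>f (z + (h, 0)) - f z\<bar>"
          by (cases "h \<in> ball 0 \<rho>") auto
      qed
      also have "\<dots> = (\<integral>\<^sup>+h. ennreal (f (h + x, t)) \<partial>lborel) + (\<integral>\<^sup>+h. indicator (ball (0::'a) \<rho>) h * ennreal \<bar>f (z + (h, 0)) - f z\<bar> \<partial>lborel)"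
        by (rule nn_integral_add) measurable
      also have "(\<integral>\<^sup>+h. ennreal (f (h + x, t)) \<partial>lborel) = (\<integral>\<^sup>+h. ennreal (f (h, t)) \<partial>lborel)"
        by (rule lborel_nn_integral_translation[of "\<lambda>h. ennreal (f (h, t))"]) measurable
      also have "\<dots> \<le> ennreal S" using elim by (simp add: z)
      finally show ?case by (cases "z \<in> A") (auto intro: add_mono)
    qed
  qed
  also have "\<dots> = (\<integral>\<^sup>+z. indicator A z * ennreal S \<partial>lborel) + (\<integral>\<^sup>+z. (\<integral>\<^sup>+h. indicator (ball (0::'a) \<rho>) h * ennreal \<bar>f (z + (h, 0)) - f z\<bar> \<partial>lborel) \<partial>lborel)"
    by (rule nn_integral_add) measurable
  also have "(\<integral>\<^sup>+z. (\<integral>\<^sup>+h. indicator (ball (0::'a) \<rho>) h * ennreal \<bar>f (z + (h, 0)) - f z\<bar> \<partial>lborel) \<partial>lborel)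
     = (\<integral>\<^sup>+h. (\<integral>\<^sup>+z. indicator (ball (0::'a) \<rho>) h * ennreal \<bar>f (z + (h, 0)) - f z\<bar> \<partial>lborel) \<partial>lborel)"
    by (rule lborel_pair.Fubini'[symmetric]) measurable
  also have "\<dots> \<le> (\<integral>\<^sup>+h. indicator (ball (0::'a) \<rho>) h * ennreal (\<rho> * N) \<partial>lborel)"
  proof (rule nn_integral_mono)
    fix h :: 'a
    have "(\<integral>\<^sup>+z. ennreal \<bar>f (z + (h, 0)) - f z\<bar> \<partial>lborel) \<le> ennreal (\<rho> * N)" if "norm h \<le> \<rho>"
      using tr[OF that] f(1) lborel_integrable_translation[OF f(1), of "(h, 0)"] by (subst nn_integral_eq_integral) (auto intro!: ennreal_leI)
    then show "(\<integral>\<^sup>+z. indicator (ball (0::'a) \<rho>) h * ennreal \<bar>f (z + (h, 0)) - f z\<bar> \<partial>lborel) \<le> indicator (ball (0::'a) \<rho>) h * ennreal (\<rho> * N)"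
      by (cases "h \<in> ball 0 \<rho>") auto
  qed
  also have "\<dots> = ennreal \<beta> * ennreal (\<rho> * N)" by (simp add: nn_integral_multc e\<beta>)
  also have "(\<integral>\<^sup>+z. indicator A z * ennreal S \<partial>lborel) = ennreal (measure lborel A) * ennreal S" by (simp add: nn_integral_multc mA)
  finally have "ennreal \<beta> * (\<integral>\<^sup>+z. indicator A z * ennreal (f z) \<partial>lborel) \<le> ennreal (measure lborel A) * ennreal S + ennreal \<beta> * ennreal (\<rho> * N)"
    by (simp add: add_left_mono)
  moreover have "(\<integral>\<^sup>+z. indicator A z * ennreal (f z) \<partial>lborel) = ennreal (\<integral>z. indicator A z * f z \<partial>lborel)"
    using nn_integral_eq_integral[OF iA] f(2) by (simp add: ennreal_mult' ennreal_indicator)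
  ultimately have "ennreal (\<beta> * (\<integral>z. indicator A z * f z \<partial>lborel)) \<le> ennreal (measure lborel A * S + \<beta> * (\<rho> * N))"
    using \<beta> S N \<rho> f(2) by (simp add: ennreal_mult ennreal_plus)
  then have "\<beta> * (\<integral>z. indicator A z * f z \<partial>lborel) \<le> measure lborel A * S + \<beta> * (\<rho> * N)"
    using \<beta> S N \<rho> by (subst (asm) ennreal_le_iff) auto
  then show ?thesis using \<beta> by (simp add: \<beta>_def field_simps)
qed

section \<open>The De Giorgi iteration\<close>

lemma sst'_kernel:
  assumes \<epsilon>: "\<epsilon> > 0"
  shows "integrable lborel (\<lambda>h. sst' (h / \<epsilon>) / \<epsilon>)" "(\<integral>h. sst' (h / \<epsilon>) / \<epsilon> \<partial>lborel) = 1"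
    and "sst' (h / \<epsilon>) / \<epsilon> \<noteq> 0 \<Longrightarrow> \<bar>h\<bar> < \<epsilon>"
proof -
  have z: "sst' (h / \<epsilon>) / \<epsilon> = 0" if "h \<notin> {0..\<epsilon>}" for h
  proof -
    have "h / \<epsilon> \<le> 0 \<or> 1 \<le> h / \<epsilon>" using that \<epsilon> by (auto simp: field_simps divide_le_0_iff)
    then show ?thesis using sst_cases by auto
  qed
  have c: "continuous_on UNIV (\<lambda>h. sst' (h / \<epsilon>) / \<epsilon>)"
    by (intro continuous_intros continuous_on_compose2[OF sst'_continuous]) (use \<epsilon> in auto)
  show "integrable lborel (\<lambda>h. sst' (h / \<epsilon>) / \<epsilon>)"
    by (rule integrable_cont_compact_support[OF c, of "{0..\<epsilon>}"]) (use z in auto)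
  have "(\<integral>h. (sst' (h / \<epsilon>) / \<epsilon>) * indicator {0..\<epsilon>} h \<partial>lborel) = sst (\<epsilon> / \<epsilon>) - sst (0 / \<epsilon>)"
    using sst_rescaled(2)[OF \<epsilon>, of 0] c \<epsilon>
    by (intro integral_FTC_Icc_real) (auto simp: continuous_on_eq_continuous_at has_field_derivative_at_within)
  then have I: "(\<integral>h. (sst' (h / \<epsilon>) / \<epsilon>) * indicator {0..\<epsilon>} h \<partial>lborel) = 1" using \<epsilon> sst_cases(1)[of 0] sst_cases(3)[of 1] by simp
  have "(\<lambda>h. (sst' (h / \<epsilon>) / \<epsilon>) * indicator {0..\<epsilon>} h) = (\<lambda>h. sst' (h / \<epsilon>) / \<epsilon>)" using z by (auto simp: fun_eq_iff indicator_def)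
  then show "(\<integral>h. sst' (h / \<epsilon>) / \<epsilon> \<partial>lborel) = 1" using I by metis
  show "\<bar>h\<bar> < \<epsilon>" if "sst' (h / \<epsilon>) / \<epsilon> \<noteq> 0"
  proof (rule ccontr)
    assume "\<not> \<bar>h\<bar> < \<epsilon>"
    then have "h / \<epsilon> \<le> 0 \<or> 1 \<le> h / \<epsilon>" using \<epsilon> by (auto simp: field_simps divide_le_0_iff)
    then show False using sst_cases that by auto
  qed
qed

lemma AE_le_of_kernel_averages:
  fixes G :: "real \<Rightarrow> real"
  assumes G: "integrable lborel G"
    and avg: "\<And>\<tau> \<epsilon>. \<epsilon> > 0 \<Longrightarrow> (\<integral>t. G t * (sst' ((t - \<tau>) / \<epsilon>) / \<epsilon>) \<partial>lborel) \<le> C"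
  shows "AE t in lborel. G t \<le> C"
proof -
  have [measurable]: "G \<in> borel_measurable borel" using G by auto
  have b: "(\<integral>\<^sup>+\<tau>. ennreal (G \<tau> - C) \<partial>lborel) \<le> ennreal e" if e: "e > 0" for e
  proof -
    obtain d where d: "d > 0" "\<And>\<kappa>. \<kappa> \<in> borel_measurable borel \<Longrightarrow> (\<And>h. \<kappa> h \<noteq> 0 \<Longrightarrow> norm h < d) \<Longrightarrow> (\<integral>\<^sup>+h. \<kappa> h \<partial>lborel) \<le> 1 \<Longrightarrow>
       (\<integral>\<^sup>+z. (\<integral>\<^sup>+h. \<kappa> h * ennreal (norm (G (z + h) - G z)) \<partial>lborel) \<partial>lborel) \<le> ennreal e"
      using kernel_average_L1[OF G e] by blast
    define \<kappa> where "\<kappa> h = sst' (h / d) / d" for h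
    note k = sst'_kernel[OF d(1), folded \<kappa>_def]
    have [measurable]: "\<kappa> \<in> borel_measurable borel" using k(1) by auto
    have k0: "0 \<le> \<kappa> h" for h using sst'_range(1)[of "h / d"] d by (simp add: \<kappa>_def)
    have kB: "\<kappa> h \<le> 3 / 2 / d" for h using divide_right_mono[OF sst'_range(2)[of "h / d"], of d] d by (simp add: \<kappa>_def)
    have "(\<integral>\<^sup>+\<tau>. ennreal (G \<tau> - C) \<partial>lborel) \<le> (\<integral>\<^sup>+\<tau>. (\<integral>\<^sup>+h. ennreal (\<kappa> h) * ennreal (norm (G (\<tau> + h) - G \<tau>)) \<partial>lborel) \<partial>lborel)"
    proof (rule nn_integral_mono)
      fix \<tau>
      have iG: "integrable lborel (\<lambda>h. G (\<tau> + h))" using lborel_integrable_translation[OF G, of \<tau>] by (simp add: add.commute)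
      have i1: "integrable lborel (\<lambda>h. \<kappa> h * G (\<tau> + h))"
        by (rule Bochner_Integration.integrable_bound[of _ "\<lambda>h. (3 / 2 / d) * G (\<tau> + h)"])
          (use iG k0 kB d in \<open>auto simp: abs_mult abs_of_nonneg intro!: AE_I2 mult_right_mono simp del: divide_divide_eq_left times_divide_eq_left\<close>)
      have i2: "integrable lborel (\<lambda>h. \<kappa> h * G \<tau>)" using k(1) by auto
      have "(\<integral>t. G t * \<kappa> (t - \<tau>) \<partial>lborel) = (\<integral>h. G (h + \<tau>) * \<kappa> (h + \<tau> - \<tau>) \<partial>lborel)"
        by (rule lborel_integral_translation[symmetric]) measurable
      moreover have "(\<integral>t. G t * \<kappa> (t - \<tau>) \<partial>lborel) \<le> C" using avg[OF d(1), of \<tau>] unfolding \<kappa>_def .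
      ultimately have "(\<integral>h. \<kappa> h * G (\<tau> + h) \<partial>lborel) \<le> C" by (simp add: mult.commute add.commute)
      then have "G \<tau> - C \<le> G \<tau> - (\<integral>h. \<kappa> h * G (\<tau> + h) \<partial>lborel)" by simp
      also have "\<dots> = (\<integral>h. \<kappa> h * G \<tau> \<partial>lborel) - (\<integral>h. \<kappa> h * G (\<tau> + h) \<partial>lborel)" using k(2) by simp
      also have "\<dots> = (\<integral>h. \<kappa> h * G \<tau> - \<kappa> h * G (\<tau> + h) \<partial>lborel)" using i1 i2 by simp
      also have "\<dots> \<le> norm (\<integral>h. \<kappa> h * G \<tau> - \<kappa> h * G (\<tau> + h) \<partial>lborel)" by simp
      finally have "ennreal (G \<tau> - C) \<le> ennreal (norm (\<integral>h. \<kappa> h * G \<tau> - \<kappa> h * G (\<tau> + h) \<partial>lborel))" by (rule ennreal_leI)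
      also have "\<dots> \<le> (\<integral>\<^sup>+h. ennreal (norm (\<kappa> h * G \<tau> - \<kappa> h * G (\<tau> + h))) \<partial>lborel)"
        by (rule integral_norm_bound_ennreal) (use i1 i2 in auto)
      also have "\<dots> = (\<integral>\<^sup>+h. ennreal (\<kappa> h) * ennreal (norm (G (\<tau> + h) - G \<tau>)) \<partial>lborel)"
      proof (rule nn_integral_cong)
        fix h
        have "norm (\<kappa> h * G \<tau> - \<kappa> h * G (\<tau> + h)) = \<kappa> h * norm (G (\<tau> + h) - G \<tau>)"
          using k0[of h] by (simp add: abs_mult abs_minus_commute flip: right_diff_distrib)
        then show "ennreal (norm (\<kappa> h * G \<tau> - \<kappa> h * G (\<tau> + h))) = ennreal (\<kappa> h) * ennreal (norm (G (\<tau> + h) - G \<tau>))"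
          using k0[of h] by (simp add: ennreal_mult)
      qed
      finally show "ennreal (G \<tau> - C) \<le> (\<integral>\<^sup>+h. ennreal (\<kappa> h) * ennreal (norm (G (\<tau> + h) - G \<tau>)) \<partial>lborel)" .
    qed
    also have "\<dots> \<le> ennreal e"
    proof (rule d(2))
      show "norm h < d" if "ennreal (\<kappa> h) \<noteq> 0" for h using k(3)[of h] that by (cases "\<kappa> h = 0") auto
      show "(\<integral>\<^sup>+h. ennreal (\<kappa> h) \<partial>lborel) \<le> 1" using k(1,2) k0 by (subst nn_integral_eq_integral) auto
    qed measurable
    finally show ?thesis .
  qed
  have "(\<integral>\<^sup>+\<tau>. ennreal (G \<tau> - C) \<partial>lborel) \<le> 0"
    by (rule ennreal_le_epsilon) (use b in auto)
  then have "AE \<tau> in lborel. ennreal (G \<tau> - C) = 0" by (subst (asm) le_zero_eq) (simp add: nn_integral_0_iff_AE)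
  then show ?thesis by (rule eventually_mono) (simp add: ennreal_eq_0_iff)
qed

definition pcyl :: "'a::euclidean_space \<Rightarrow> real \<Rightarrow> real \<Rightarrow> real \<Rightarrow> real \<Rightarrow> ('a \<times> real) set" where
  "pcyl x0 t0 p R r = cball x0 (R * r) \<times> cball t0 (R powr p * r)"

lemma sst'_profile_bound:
  fixes L l q :: real
  assumes "0 \<le> l" "l < L" "0 \<le> q"
  shows "sst' ((L\<^sup>2 - q\<^sup>2) / (L\<^sup>2 - l\<^sup>2)) * (2 * q / (L\<^sup>2 - l\<^sup>2)) \<le> 3 / (L - l)"
proof -
  have d: "L\<^sup>2 - l\<^sup>2 = (L - l) * (L + l)" by (simp add: power2_eq_square algebra_simps)
  have d0: "L\<^sup>2 - l\<^sup>2 > 0" unfolding d using assms by simp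
  show ?thesis
  proof (cases "q \<ge> L")
    case True
    then have "L\<^sup>2 \<le> q\<^sup>2" using assms by (intro power_mono) auto
    then have "(L\<^sup>2 - q\<^sup>2) / (L\<^sup>2 - l\<^sup>2) \<le> 0" using d0 by (simp add: divide_le_0_iff)
    then show ?thesis using sst_cases(1) assms by simp
  next
    case False
    have "sst' ((L\<^sup>2 - q\<^sup>2) / (L\<^sup>2 - l\<^sup>2)) * (2 * q / (L\<^sup>2 - l\<^sup>2)) \<le> (3 / 2) * (2 * (L + l) / (L\<^sup>2 - l\<^sup>2))"
      using sst'_range[of "(L\<^sup>2 - q\<^sup>2) / (L\<^sup>2 - l\<^sup>2)"] d0 False assms by (intro mult_mono divide_right_mono) auto
    also have "2 * (L + l) / (L\<^sup>2 - l\<^sup>2) = 2 / (L - l)" unfolding d by (rule mult_divide_mult_cancel_right) (use assms in linarith)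
    also have "3 / 2 * (2 / (L - l)) = 3 / (L - l)" by simp
    finally show ?thesis .
  qed
qed

lemma parabolic_cutoff:
  fixes x0 :: "'a::euclidean_space" and t0 p R r0 r1 :: real
  assumes R: "R > 0" and r: "0 < r1" "r1 < r0"
  obtains \<eta> :: "'a \<times> real \<Rightarrow> real" and D where "C1 \<eta> D" "\<And>z. z \<notin> pcyl x0 t0 p R r0 \<Longrightarrow> \<eta> z = 0" "\<And>z. z \<in> pcyl x0 t0 p R r1 \<Longrightarrow> \<eta> z = 1"
    "\<And>z. 0 \<le> \<eta> z" "\<And>z. \<eta> z \<le> 1" "\<And>z. norm (gradD D z) \<le> 3 / (R * (r0 - r1))" "\<And>z. \<bar>D z (0, 1)\<bar> \<le> 3 / (R powr p * (r0 - r1))"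
proof -
  define P where "P = R powr p"
  have P: "P > 0" using R by (simp add: P_def)
  define L l L' l' where "L = R * r0" and "l = R * r1" and "L' = P * r0" and "l' = P * r1"
  have L: "0 \<le> l" "l < L" "0 \<le> l'" "l' < L'" using R r P by (auto simp: L_def l_def L'_def l'_def)
  have den: "L\<^sup>2 - l\<^sup>2 > 0" "L'\<^sup>2 - l'\<^sup>2 > 0" using L by (auto intro!: power_strict_mono)
  define y y' :: "'a \<times> real \<Rightarrow> real" where "y z = (L\<^sup>2 - (fst z - x0) \<bullet> (fst z - x0)) / (L\<^sup>2 - l\<^sup>2)"
    and "y' z = (L'\<^sup>2 - (snd z - t0) * (snd z - t0)) / (L'\<^sup>2 - l'\<^sup>2)" for z
  define Dy Dy' :: "'a \<times> real \<Rightarrow> 'a \<times> real \<Rightarrow> real" where "Dy z v = (0 - 2 * ((fst z - x0) \<bullet> fst v)) / (L\<^sup>2 - l\<^sup>2)"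
    and "Dy' z v = (0 - 2 * ((snd z - t0) * snd v)) / (L'\<^sup>2 - l'\<^sup>2)" for z v
  have "C1 (\<lambda>z :: 'a \<times> real. (fst z - x0) \<bullet> (fst z - x0)) (\<lambda>z v. 2 * ((fst z - x0) \<bullet> fst v))"
    unfolding C1_def by (auto intro!: derivative_eq_intros continuous_intros simp: inner_commute)
  then have Cy: "C1 y Dy" unfolding y_def[abs_def] Dy_def[abs_def] by (intro C1_divide_const C1_diff C1_const)
  have "C1 (\<lambda>z :: 'a \<times> real. (snd z - t0) * (snd z - t0)) (\<lambda>z v. 2 * ((snd z - t0) * snd v))"
    unfolding C1_def by (auto intro!: derivative_eq_intros continuous_intros simp: mult.commute)
  then have Cy': "C1 y' Dy'" unfolding y'_def[abs_def] Dy'_def[abs_def] by (intro C1_divide_const C1_diff C1_const)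
  define \<eta> where "\<eta> z = sst (y z) * sst (y' z)" for z
  define D where "D z v = sst (y z) * (sst' (y' z) * Dy' z v) + (sst' (y z) * Dy z v) * sst (y' z)" for z v
  have C: "C1 \<eta> D" unfolding \<eta>_def[abs_def] D_def[abs_def]
    by (rule C1_mult[OF C1_compose[OF sst_derivative sst'_continuous Cy] C1_compose[OF sst_derivative sst'_continuous Cy']])
  have nx: "(fst z - x0) \<bullet> (fst z - x0) = (norm (fst z - x0))\<^sup>2" for z :: "'a \<times> real" by (simp add: dot_square_norm)
  have nt: "(snd z - t0) * (snd z - t0) = \<bar>snd z - t0\<bar>\<^sup>2" for z :: "'a \<times> real" by (simp add: power2_eq_square)
  show ?thesis
  proof (rule that[OF C])
    show "\<eta> z = 0" if "z \<notin> pcyl x0 t0 p R r0" for z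
    proof -
      have "norm (fst z - x0) > L \<or> \<bar>snd z - t0\<bar> > L'"
        using that by (cases z) (auto simp: pcyl_def L_def L'_def P_def dist_norm norm_minus_commute)
      then show ?thesis
      proof
        assume "norm (fst z - x0) > L"
        then have "L\<^sup>2 \<le> (norm (fst z - x0))\<^sup>2" using L by (intro power_mono) auto
        then have "y z \<le> 0" unfolding y_def nx using den by (simp add: divide_le_0_iff)
        then show ?thesis using sst_cases(1) by (simp add: \<eta>_def)
      next
        assume "\<bar>snd z - t0\<bar> > L'"
        then have "L'\<^sup>2 \<le> \<bar>snd z - t0\<bar>\<^sup>2" using L by (intro power_mono) auto
        then have "y' z \<le> 0" unfolding y'_def nt using den by (simp add: divide_le_0_iff)
        then show ?thesis using sst_cases(1) by (simp add: \<eta>_def)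
      qed
    qed
    show "\<eta> z = 1" if "z \<in> pcyl x0 t0 p R r1" for z
    proof -
      have "norm (fst z - x0) \<le> l" "\<bar>snd z - t0\<bar> \<le> l'"
        using that by (cases z; auto simp: pcyl_def l_def l'_def P_def dist_norm norm_minus_commute)+
      note b = this
      have "(norm (fst z - x0))\<^sup>2 \<le> l\<^sup>2" by (rule power_mono[OF b(1) norm_ge_zero])
      moreover have "\<bar>snd z - t0\<bar>\<^sup>2 \<le> l'\<^sup>2" by (rule power_mono[OF b(2) abs_ge_zero])
      ultimately
      have "1 \<le> y z" "1 \<le> y' z" unfolding y_def y'_def nx nt using den by (auto simp: le_divide_eq)
      then show ?thesis using sst_cases(3) by (simp add: \<eta>_def)
    qed
    show "0 \<le> \<eta> z" "\<eta> z \<le> 1" for z using sst_range[of "y z"] sst_range[of "y' z"] by (auto simp: \<eta>_def mult_le_one)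
    show "norm (gradD D z) \<le> 3 / (R * (r0 - r1))" for z
    proof -
      have e: "gradD D z = (sst (y' z) * sst' (y z) * (- 2 / (L\<^sup>2 - l\<^sup>2))) *\<^sub>R (fst z - x0)"
        by (rule euclidean_eqI) (simp add: gradD_inner_Basis D_def Dy_def Dy'_def)
      have "norm (gradD D z) = sst (y' z) * (sst' (y z) * (2 * norm (fst z - x0) / (L\<^sup>2 - l\<^sup>2)))"
        unfolding e using sst_range(1)[of "y' z"] sst'_range(1)[of "y z"] den by (simp add: abs_mult)
      also have "\<dots> \<le> 1 * (3 / (L - l))"
        using sst'_profile_bound[OF L(1,2), of "norm (fst z - x0)"] sst_range[of "y' z"] sst'_range(1)[of "y z"] den
        by (intro mult_mono) (auto simp: y_def nx)
      finally show ?thesis by (simp add: L_def l_def right_diff_distrib)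
    qed
    show "\<bar>D z (0, 1)\<bar> \<le> 3 / (R powr p * (r0 - r1))" for z
    proof -
      have ab: "\<bar>2 * t0 - 2 * snd z\<bar> = 2 * \<bar>snd z - t0\<bar>" by (cases "snd z \<le> t0") auto
      have "\<bar>D z (0, 1)\<bar> = sst (y z) * (sst' (y' z) * (2 * \<bar>snd z - t0\<bar> / (L'\<^sup>2 - l'\<^sup>2)))"
        using sst_range(1)[of "y z"] sst'_range(1)[of "y' z"] den by (simp add: D_def Dy_def Dy'_def abs_mult ab)
      also have "\<dots> \<le> 1 * (3 / (L' - l'))"
        using sst'_profile_bound[OF L(3,4), of "\<bar>snd z - t0\<bar>"] sst_range[of "y z"] sst'_range(1)[of "y' z"] den
        by (intro mult_mono) (auto simp: y'_def nt)
      finally show ?thesis by (simp add: L'_def l'_def P_def right_diff_distrib)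
    qed
  qed
qed

lemma de_giorgi_energy:
  fixes u \<eta> :: "'a::euclidean_space \<times> real \<Rightarrow> real" and g :: "'a \<times> real \<Rightarrow> 'a"
  assumes p: "p > 2" and U: "open U" and S: "superpair U p u g" and u0: "\<And>z. 0 \<le> u z" and k: "k > 0"
    and \<eta>: "C1 \<eta> D" and K: "compact K" "K \<subseteq> U" "\<And>z. z \<notin> K \<Longrightarrow> \<eta> z = 0" and \<eta>01: "\<And>z. 0 \<le> \<eta> z" "\<And>z. \<eta> z \<le> 1"
    and Gb: "\<And>z. norm (gradD D z) \<le> Gb" and Tb: "\<And>z. \<bar>D z (0, 1)\<bar> \<le> Tb" and m: "real m \<ge> p"
  defines "x z \<equiv> (k - u z) / (2 * k)" and "Y \<equiv> measure lborel (K \<inter> {z. u z < k})"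
    and "B \<equiv> (2 * k) powr (p - 1) * (real m * Gb) powr p + 2 * k * real m * Tb"
  shows "integrable lborel (\<lambda>z. \<eta> z ^ m * (sst' (x z) / (2 * k)) * norm (g z) powr p)"
    and "(\<integral>z. \<eta> z ^ m * (sst' (x z) / (2 * k)) * norm (g z) powr p \<partial>lborel) \<le> 2 * (B * Y)"
    and "AE t in lborel. (\<integral>\<^sup>+y. ennreal (2 * k * sstI (x (y, t)) * \<eta> (y, t) ^ m) \<partial>lborel) \<le> ennreal (B * Y)"
proof -
  have [measurable]: "u \<in> borel_measurable borel" "g \<in> borel_measurable borel" using S by (auto simp: superpair_def)
  have [measurable]: "K \<in> sets borel" using K borel_compact by blast
  have [measurable]: "\<eta> \<in> borel_measurable borel" by (rule borel_measurable_continuous_onI[OF C1_cont[OF \<eta>]])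
  have [measurable]: "x \<in> borel_measurable borel" unfolding x_def[abs_def] by measurable
  have m0: "m > 0" using m p by (cases m) auto
  have D0: "D z w = 0" if "z \<notin> K" for z w
    by (rule C1_D_zero[OF \<eta> compact_imp_closed[OF K(1)] K(3) that])
  have G0: "gradD D z = 0" if "z \<notin> K" for z using D0[OF that] by (simp add: gradD_def)
  define A where "A = K \<inter> {z. u z < k}"
  have [measurable]: "A \<in> sets borel" unfolding A_def by measurable
  have iK: "integrable lborel (indicator K :: _ \<Rightarrow> real)" using integrable_indicator_compact[OF K(1)] .
  have iA: "integrable lborel (indicator A :: _ \<Rightarrow> real)"
    by (rule Bochner_Integration.integrable_bound[OF iK]) (auto simp: A_def indicator_def)
  have YA: "(\<integral>z. indicator A z \<partial>lborel) = Y" by (simp add: Y_def A_def)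
  have xle: "x z \<le> 1/2" for z using u0[of z] k by (simp add: x_def field_simps)
  define F where "F z = 2 * k * sstI (x z) * \<eta> z ^ m" for z
  have [measurable]: "F \<in> borel_measurable borel" unfolding F_def[abs_def] by measurable
  have F0: "0 \<le> F z" for z using sstI_range(1)[of "x z"] k \<eta>01(1)[of z] by (simp add: F_def)
  have sI1: "sstI (x z) \<le> 1" for z using sstI_range(2)[of "x z"] xle[of z] by (auto simp: max_def split: if_splits)
  have FK: "F z \<le> 2 * k * indicator K z" for z
  proof (cases "z \<in> K")
    case True
    have "2 * k * sstI (x z) * \<eta> z ^ m \<le> 2 * k * 1 * 1"
      using sI1[of z] sstI_range(1)[of "x z"] k \<eta>01[of z] by (intro mult_mono) (auto intro: power_le_one)
    then show ?thesis using True by (simp add: F_def)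
  next
    case False
    then have "\<eta> z ^ m = 0" using K(3) m0 by simp
    then have "F z = 0" unfolding F_def by (simp only: mult_zero_right)
    then show ?thesis using False by simp
  qed
  have iF: "integrable lborel F"
    by (rule Bochner_Integration.integrable_bound[of _ "\<lambda>z. 2 * k * indicator K z"])
      (use iK FK F0 k in \<open>auto intro!: AE_I2 simp: abs_mult\<close>)
  have core: "integrable lborel (\<lambda>z. \<eta> z ^ m * \<zeta> (snd z) * (sst' (x z) / (2 * k)) * norm (g z) powr p)"
    "1/2 * (\<integral>z. \<eta> z ^ m * \<zeta> (snd z) * (sst' (x z) / (2 * k)) * norm (g z) powr p \<partial>lborel) + (\<integral>z. F z * (- \<zeta>' (snd z)) \<partial>lborel) \<le> B * Y"
    if \<zeta>: "\<And>t. (\<zeta> has_real_derivative \<zeta>' t) (at t)" "continuous_on UNIV \<zeta>'" and \<zeta>01: "\<And>t. 0 \<le> \<zeta> t" "\<And>t. \<zeta> t \<le> 1"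
      and \<zeta>'B: "\<And>t. \<bar>\<zeta>' t\<bar> \<le> c" for \<zeta> \<zeta>' :: "real \<Rightarrow> real" and c
  proof -
    have snd: "C1 (snd :: 'a \<times> real \<Rightarrow> real) (\<lambda>z v. snd v)" unfolding C1_def by (auto intro!: derivative_eq_intros)
    define \<phi> where "\<phi> z = \<eta> z ^ m * \<zeta> (snd z)" for z
    define D\<phi> where "D\<phi> z v = \<eta> z ^ m * (\<zeta>' (snd z) * snd v) + (real m * \<eta> z ^ (m - 1) * D z v) * \<zeta> (snd z)" for z v
    have \<phi>: "C1 \<phi> D\<phi>" unfolding \<phi>_def[abs_def] D\<phi>_def[abs_def]
      by (rule C1_mult[OF C1_power[OF \<eta>] C1_compose[OF \<zeta> snd]])
    have [measurable]: "(\<lambda>z::'a \<times> real. \<zeta>' (snd z)) \<in> borel_measurable borel"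
      by (rule borel_measurable_continuous_onI[OF continuous_on_compose2[OF \<zeta>(2)]]) (auto intro!: continuous_intros)
    have \<phi>K: "\<phi> z = 0" if "z \<notin> K" for z using K(3)[OF that] m0 by (simp add: \<phi>_def)
    have \<phi>0: "0 \<le> \<phi> z" for z using \<eta>01 \<zeta>01 by (simp add: \<phi>_def)
    have gD: "gradD D\<phi> z = (\<zeta> (snd z) * (real m * \<eta> z ^ (m - 1))) *\<^sub>R gradD D z" for z
      by (rule euclidean_eqI) (simp add: gradD_inner_Basis D\<phi>_def)
    have d: "2 * k > 0" using k by simp
    note en = superpair_energy[OF p U S \<phi> K(1,2) _ \<phi>0 d, where k=k and a=0]
    define L where "L z = \<phi> z * (sst' (x z) / (2 * k)) * norm (g z) powr p" for z
    define R where "R z = sst (x z) * (Aflux p (g z) \<bullet> gradD D\<phi> z) + (2 * k) * sstI (x z) * D\<phi> z (0, 1)" for z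
    have x: "(k - u z - 0) / (2 * k) = x z" for z by (simp add: x_def)
    have iL: "integrable lborel L" using en(1) \<phi>K unfolding x L_def by blast
    have iR: "integrable lborel R" using en(2) \<phi>K unfolding x R_def by blast
    have LR: "(\<integral>z. L z \<partial>lborel) \<le> (\<integral>z. R z \<partial>lborel)" using en(3) \<phi>K unfolding x L_def R_def by blast
    have iF\<zeta>: "integrable lborel (\<lambda>z. F z * (- \<zeta>' (snd z)))"
      by (rule Bochner_Integration.integrable_bound[of _ "\<lambda>z. c * F z"])
        (use iF \<zeta>'B F0 order_trans[OF abs_ge_zero \<zeta>'B] in \<open>auto intro!: AE_I2 mult_right_mono simp: abs_mult mult.commute\<close>)
    have "(\<integral>z. R z \<partial>lborel) \<le> (\<integral>z. 1/2 * L z + B * indicator A z - F z * (- \<zeta>' (snd z)) \<partial>lborel)"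
    proof (rule integral_mono[OF iR])
      show "integrable lborel (\<lambda>z. 1/2 * L z + B * indicator A z - F z * (- \<zeta>' (snd z)))" using iL iA iF\<zeta> by auto
      fix z
      show "R z \<le> 1/2 * L z + B * indicator A z - F z * (- \<zeta>' (snd z))"
      proof (cases "z \<in> A")
        case False
        then consider "z \<notin> K" | "x z \<le> 0" using k by (auto simp: A_def x_def divide_le_0_iff)
        then show ?thesis
        proof cases
          case 1
          have "\<eta> z = 0" using K(3)[OF 1] .
          then have "D\<phi> z (0, 1) = 0" "gradD D\<phi> z = 0" "\<phi> z = 0" "F z = 0"
            using 1 G0 D0 m0 by (auto simp: D\<phi>_def gD \<phi>_def F_def)
          then show ?thesis using False by (simp add: R_def L_def)
        next
          case 2
          then show ?thesis using sst_cases(1)[OF 2] False by (simp add: R_def L_def F_def)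
        qed
      next
        case True
        then have z: "z \<in> K" "u z < k" by (auto simp: A_def)
        have x0: "0 < x z" using z k by (simp add: x_def)
        have x1: "x z \<le> 1" using xle[of z] by simp
        note sc = sst_cases(2)[OF less_imp_le[OF x0] x1]
        have half: "sst (x z) \<le> sst' (x z) / 2"
        proof -
          have "sst' (x z) / 2 - sst (x z) = x z * (3 - 6 * x z + 2 * x z * x z)"
            using sc by (simp add: power2_eq_square power3_eq_cube algebra_simps)
          moreover have "0 \<le> x z * (3 - 6 * x z + 2 * x z * x z)" using x0 xle[of z] by (intro mult_nonneg_nonneg add_nonneg_nonneg) auto
          ultimately show ?thesis by linarith
        qed
        define a where "a = norm (g z)"
        define \<epsilon> where "\<epsilon> = 1 / (2 * k)"
        have \<epsilon>: "\<epsilon> > 0" using k by (simp add: \<epsilon>_def)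
        have \<epsilon>p: "\<epsilon> powr (1 - p) = (2 * k) powr (p - 1)"
          unfolding \<epsilon>_def using k powr_minus_divide[of "2 * k" "1 - p"] by (simp add: powr_divide)
        have y: "a powr (p - 1) * (real m * \<eta> z ^ (m - 1) * norm (gradD D z)) \<le> \<epsilon> * (\<eta> z ^ m * a powr p) + \<epsilon> powr (1 - p) * (real m * norm (gradD D z)) powr p"
          by (rule young_cutoff) (use \<epsilon> p \<eta>01 m in \<open>auto simp: a_def\<close>)
        have "sst (x z) * (Aflux p (g z) \<bullet> gradD D\<phi> z) \<le> sst (x z) * (norm (Aflux p (g z)) * norm (gradD D\<phi> z))"
          using sst_range(1)[of "x z"] by (intro mult_left_mono order_trans[OF abs_ge_self Cauchy_Schwarz_ineq2])
        also have "\<dots> = (sst (x z) * \<zeta> (snd z)) * (a powr (p - 1) * (real m * \<eta> z ^ (m - 1) * norm (gradD D z)))"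
          using \<zeta>01(1)[of "snd z"] \<eta>01(1)[of z] by (simp add: norm_Aflux gD a_def abs_mult)
        also have "\<dots> \<le> (sst (x z) * \<zeta> (snd z)) * (\<epsilon> * (\<eta> z ^ m * a powr p) + \<epsilon> powr (1 - p) * (real m * norm (gradD D z)) powr p)"
          using sst_range(1)[of "x z"] \<zeta>01(1)[of "snd z"] by (intro mult_left_mono y) auto
        also have "\<dots> = sst (x z) * (\<zeta> (snd z) * \<epsilon> * (\<eta> z ^ m * a powr p)) + (sst (x z) * \<zeta> (snd z)) * (\<epsilon> powr (1 - p) * (real m * norm (gradD D z)) powr p)"
          by (simp add: algebra_simps)
        also have "\<dots> \<le> sst' (x z) / 2 * (\<zeta> (snd z) * \<epsilon> * (\<eta> z ^ m * a powr p)) + (1 * 1) * (\<epsilon> powr (1 - p) * (real m * Gb) powr p)"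
        proof (rule add_mono)
          show "sst (x z) * (\<zeta> (snd z) * \<epsilon> * (\<eta> z ^ m * a powr p)) \<le> sst' (x z) / 2 * (\<zeta> (snd z) * \<epsilon> * (\<eta> z ^ m * a powr p))"
            using half \<zeta>01[of "snd z"] \<epsilon> \<eta>01(1)[of z] by (intro mult_right_mono) auto
          show "(sst (x z) * \<zeta> (snd z)) * (\<epsilon> powr (1 - p) * (real m * norm (gradD D z)) powr p) \<le> (1 * 1) * (\<epsilon> powr (1 - p) * (real m * Gb) powr p)"
            using sst_range[of "x z"] \<zeta>01[of "snd z"] Gb[of z] p by (intro mult_mono powr_mono2 order_refl) auto
        qed
        also have "sst' (x z) / 2 * (\<zeta> (snd z) * \<epsilon> * (\<eta> z ^ m * a powr p)) = 1/2 * L z"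
          unfolding L_def \<phi>_def a_def \<epsilon>_def by simp
        finally have 1: "sst (x z) * (Aflux p (g z) \<bullet> gradD D\<phi> z) \<le> 1/2 * L z + (2 * k) powr (p - 1) * (real m * Gb) powr p"
          unfolding \<epsilon>p by simp
        have "(2 * k * sstI (x z)) * ((real m * \<eta> z ^ (m - 1) * D z (0,1)) * \<zeta> (snd z)) \<le> (2 * k * 1) * ((real m * 1 * Tb) * 1)"
        proof (rule order_trans[OF mult_left_mono[OF abs_ge_self]])
          show "(2 * k * sstI (x z)) * \<bar>(real m * \<eta> z ^ (m - 1) * D z (0,1)) * \<zeta> (snd z)\<bar> \<le> (2 * k * 1) * ((real m * 1 * Tb) * 1)"
            unfolding abs_mult using sI1[of z] sstI_range(1)[of "x z"] k \<eta>01[of z] Tb[of z] \<zeta>01[of "snd z"] order_trans[OF abs_ge_zero Tb[of z]]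
            by (intro mult_mono) (auto intro: power_le_one)
        qed (use sstI_range(1)[of "x z"] k in auto)
        then have "(2 * k) * sstI (x z) * D\<phi> z (0, 1) \<le> F z * \<zeta>' (snd z) + 2 * k * real m * Tb"
          by (simp add: D\<phi>_def F_def algebra_simps)
        with 1 show ?thesis using True by (simp add: R_def B_def)
      qed
    qed
    also have "\<dots> = 1/2 * (\<integral>z. L z \<partial>lborel) + B * Y - (\<integral>z. F z * (- \<zeta>' (snd z)) \<partial>lborel)"
    proof -
      have "(\<integral>z. 1/2 * L z + B * indicator A z - F z * (- \<zeta>' (snd z)) \<partial>lborel)
         = (\<integral>z. 1/2 * L z + B * indicator A z \<partial>lborel) - (\<integral>z. F z * (- \<zeta>' (snd z)) \<partial>lborel)"
        by (rule Bochner_Integration.integral_diff[OF _ iF\<zeta>]) (use iL iA in auto)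
      also have "(\<integral>z. 1/2 * L z + B * indicator A z \<partial>lborel) = (\<integral>z. 1/2 * L z \<partial>lborel) + (\<integral>z. B * indicator A z \<partial>lborel)"
        by (rule Bochner_Integration.integral_add) (use iL iA in auto)
      also have "(\<integral>z. B * indicator A z \<partial>lborel) = B * Y" by (simp only: integral_mult_right_zero YA)
      finally show ?thesis by simp
    qed
    finally have "(\<integral>z. L z \<partial>lborel) \<le> 1/2 * (\<integral>z. L z \<partial>lborel) + B * Y - (\<integral>z. F z * (- \<zeta>' (snd z)) \<partial>lborel)" using LR by linarith
    then have "1/2 * (\<integral>z. L z \<partial>lborel) + (\<integral>z. F z * (- \<zeta>' (snd z)) \<partial>lborel) \<le> B * Y" by linarith
    then show "1/2 * (\<integral>z. \<eta> z ^ m * \<zeta> (snd z) * (sst' (x z) / (2 * k)) * norm (g z) powr p \<partial>lborel) + (\<integral>z. F z * (- \<zeta>' (snd z)) \<partial>lborel) \<le> B * Y"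
      unfolding L_def \<phi>_def .
    show "integrable lborel (\<lambda>z. \<eta> z ^ m * \<zeta> (snd z) * (sst' (x z) / (2 * k)) * norm (g z) powr p)" using iL unfolding L_def \<phi>_def .
  qed
  note c1 = core[of "\<lambda>t. 1" "\<lambda>t. 0" 0]
  show "integrable lborel (\<lambda>z. \<eta> z ^ m * (sst' (x z) / (2 * k)) * norm (g z) powr p)" using c1(1) by simp
  show "(\<integral>z. \<eta> z ^ m * (sst' (x z) / (2 * k)) * norm (g z) powr p \<partial>lborel) \<le> 2 * (B * Y)" using c1(2) by simp
  define G where "G t = (\<integral>y. F (y, t) \<partial>lborel)" for t
  have iF': "integrable (lborel \<Otimes>\<^sub>M lborel) (case_prod (\<lambda>y t. F (y, t)))" using iF by (simp add: lborel_prod)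
  have iG: "integrable lborel G" unfolding G_def by (rule lborel_pair.integrable_snd[OF iF'])
  have "AE t in lborel. G t \<le> B * Y"
  proof (rule AE_le_of_kernel_averages[OF iG])
    fix \<tau> \<epsilon> :: real assume \<epsilon>: "\<epsilon> > 0"
    define \<kappa> where "\<kappa> t = sst' ((t - \<tau>) / \<epsilon>) / \<epsilon>" for t
    have \<kappa>0: "0 \<le> \<kappa> t" "\<kappa> t \<le> 3 / 2 / \<epsilon>" for t
      using divide_right_mono[OF sst'_range(2)[of "(t - \<tau>) / \<epsilon>"], of \<epsilon>] sst'_range(1)[of "(t - \<tau>) / \<epsilon>"] \<epsilon> by (simp_all add: \<kappa>_def)
    have \<kappa>c: "continuous_on UNIV \<kappa>" unfolding \<kappa>_def[abs_def] by (rule sst_rescaled(3)[OF \<epsilon>])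
    have [measurable]: "(\<lambda>z::'a \<times> real. \<kappa> (snd z)) \<in> borel_measurable borel"
      by (rule borel_measurable_continuous_onI[OF continuous_on_compose2[OF \<kappa>c]]) (auto intro!: continuous_intros)
    have c2: "1/2 * (\<integral>z. \<eta> z ^ m * (1 - sst ((snd z - \<tau>) / \<epsilon>)) * (sst' (x z) / (2 * k)) * norm (g z) powr p \<partial>lborel) + (\<integral>z. F z * (- (0 - \<kappa> (snd z))) \<partial>lborel) \<le> B * Y"
    proof (rule core(2)[of "\<lambda>t. 1 - sst ((t - \<tau>) / \<epsilon>)" "\<lambda>t. 0 - \<kappa> t" "3 / 2 / \<epsilon>"])
      show "((\<lambda>t. 1 - sst ((t - \<tau>) / \<epsilon>)) has_real_derivative 0 - \<kappa> t) (at t)" for t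
        unfolding \<kappa>_def by (intro DERIV_diff DERIV_const sst_rescaled(2)[OF \<epsilon>])
      show "continuous_on UNIV (\<lambda>t. 0 - \<kappa> t)" by (intro continuous_intros \<kappa>c)
    qed (use sst_range \<kappa>0 in auto)
    have "0 \<le> (\<integral>z. \<eta> z ^ m * (1 - sst ((snd z - \<tau>) / \<epsilon>)) * (sst' (x z) / (2 * k)) * norm (g z) powr p \<partial>lborel)"
      using \<eta>01 sst_range sst'_range(1) k by (intro Bochner_Integration.integral_nonneg mult_nonneg_nonneg) auto
    then have c3: "(\<integral>z. F z * \<kappa> (snd z) \<partial>lborel) \<le> B * Y" using c2 by simp
    have iFk: "integrable lborel (\<lambda>z. F z * \<kappa> (snd z))"
    proof (rule Bochner_Integration.integrable_bound[of _ "\<lambda>z. F z * (3 / 2 / \<epsilon>)"])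
      show "AE z in lborel. norm (F z * \<kappa> (snd z)) \<le> norm (F z * (3 / 2 / \<epsilon>))"
      proof (rule AE_I2)
        fix z
        have "F z * \<kappa> (snd z) \<le> F z * (3 / 2 / \<epsilon>)" by (rule mult_left_mono[OF \<kappa>0(2) F0])
        moreover have "0 \<le> F z * \<kappa> (snd z)" using F0 \<kappa>0 by simp
        ultimately show "norm (F z * \<kappa> (snd z)) \<le> norm (F z * (3 / 2 / \<epsilon>))" unfolding real_norm_def by linarith
      qed
    qed (use iF in auto)
    have "(\<integral>t. G t * \<kappa> t \<partial>lborel) = (\<integral>t. (\<integral>y. F (y, t) * \<kappa> t \<partial>lborel) \<partial>lborel)"
      unfolding G_def by simp
    also have "\<dots> = (\<integral>z. F z * \<kappa> (snd z) \<partial>(lborel \<Otimes>\<^sub>M lborel))"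
    proof -
      have e: "(\<lambda>(y, t). F (y, t) * \<kappa> t) = (\<lambda>z. F z * \<kappa> (snd z))" by (auto simp: fun_eq_iff)
      have "integrable (lborel \<Otimes>\<^sub>M lborel) (\<lambda>(y, t). F (y, t) * \<kappa> t)" unfolding e lborel_prod by (rule iFk)
      from lborel_pair.integral_snd[OF this] show ?thesis unfolding e .
    qed
    finally have "(\<integral>t. G t * \<kappa> t \<partial>lborel) \<le> B * Y" using c3 unfolding lborel_prod by simp
    then show "(\<integral>t. G t * (sst' ((t - \<tau>) / \<epsilon>) / \<epsilon>) \<partial>lborel) \<le> B * Y" unfolding \<kappa>_def .
  qed
  moreover have "AE t in lborel. integrable lborel (\<lambda>y. F (y, t))" by (rule lborel_pair.AE_integrable_snd[OF iF'])
  ultimately show "AE t in lborel. (\<integral>\<^sup>+y. ennreal (2 * k * sstI (x (y, t)) * \<eta> (y, t) ^ m) \<partial>lborel) \<le> ennreal (B * Y)"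
  proof eventually_elim
    case (elim t)
    have "(\<integral>\<^sup>+y. ennreal (F (y, t)) \<partial>lborel) = ennreal (G t)" unfolding G_def by (rule nn_integral_eq_integral[OF elim(2)]) (use F0 in auto)
    also have "\<dots> \<le> ennreal (B * Y)" using elim(1) by (rule ennreal_leI)
    finally show ?case by (simp add: F_def)
  qed
qed

lemma pcyl_compact: "compact (pcyl x0 t0 p R r)"
  unfolding pcyl_def by (intro compact_Times compact_cball)

lemma pcyl_mono: "r \<le> r' \<Longrightarrow> R \<ge> 0 \<Longrightarrow> pcyl x0 t0 p R r \<subseteq> pcyl x0 t0 p R r'"
  unfolding pcyl_def by (intro Sigma_mono subset_cball mult_left_mono) auto

lemma measure_ball_scale: "\<rho> > 0 \<Longrightarrow> measure lborel (ball (0::'a::euclidean_space) \<rho>) = \<rho> ^ DIM('a) * measure lborel (ball (0::'a) 1)"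
  using content_ball_conv_unit_ball[of \<rho> "0::'a"] by simp

lemma sst_small:
  assumes "0 \<le> x" "x \<le> 1 / 2"
  shows "2 * x\<^sup>2 \<le> sst x" "3 * x \<le> sst' x" "3 / 4 * x ^ 3 \<le> sstI x"
proof -
  have x1: "x \<le> 1" using assms by simp
  note c = sst_cases(2)[OF assms(1) x1]
  have "sst x - 2 * x\<^sup>2 = x\<^sup>2 * (1 - 2 * x)" using c by (simp add: power2_eq_square power3_eq_cube algebra_simps)
  moreover have "0 \<le> x\<^sup>2 * (1 - 2 * x)" using assms by auto
  ultimately show "2 * x\<^sup>2 \<le> sst x" by linarith
  have "sst' x - 3 * x = 3 * x * (1 - 2 * x)" using c by (simp add: algebra_simps)
  moreover have "0 \<le> 3 * x * (1 - 2 * x)" using assms by auto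
  ultimately show "3 * x \<le> sst' x" by linarith
  have "sstI x - 3 / 4 * x ^ 3 = x ^ 3 * (1 - 2 * x) / 4" using c by (simp add: power3_eq_cube power4_eq_xxxx algebra_simps)
  moreover have "0 \<le> x ^ 3 * (1 - 2 * x) / 4" using assms by auto
  ultimately show "3 / 4 * x ^ 3 \<le> sstI x" by linarith
qed

lemma de_giorgi_step:
  fixes p k \<kappa> :: real
  assumes p: "p > 2" and \<kappa>: "0 < \<kappa>" "\<kappa> < k"
  defines "n \<equiv> DIM('a::euclidean_space)" and "m \<equiv> nat \<lceil>p\<rceil>"
  obtains C where "C > 0"
    "\<And>U u g (x0::'a) t0 R Dd k0 k1 k2 r0 r1 r2. open U \<Longrightarrow> superpair U p u g \<Longrightarrow> (\<And>z. 0 \<le> u z) \<Longrightarrow> R > 0 \<Longrightarrow> pcyl x0 t0 p R 1 \<subseteq> U \<Longrightarrow>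
       1 \<le> Dd \<Longrightarrow> \<kappa> \<le> k2 \<Longrightarrow> k2 \<le> k1 - (k - \<kappa>) / (4 * Dd) \<Longrightarrow> k1 \<le> k0 - (k - \<kappa>) / (4 * Dd) \<Longrightarrow> k0 \<le> k \<Longrightarrow>
       0 < r2 \<Longrightarrow> r2 \<le> r1 - 1 / (8 * Dd) \<Longrightarrow> r1 \<le> r0 - 1 / (8 * Dd) \<Longrightarrow> r0 \<le> 1 \<Longrightarrow>
       measure lborel (pcyl x0 t0 p R r2 \<inter> {z. u z < k2}) / (R ^ n * R powr p)
       \<le> C * Dd ^ (2 * m + 8) * (measure lborel (pcyl x0 t0 p R r0 \<inter> {z. u z < k0}) / (R ^ n * R powr p)) powr (1 + 1 / n)"
proof -
  have n: "n > 0" by (simp add: n_def)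
  have m: "real m \<ge> p" unfolding m_def by (rule real_nat_ceiling_ge)
  define c_n where "c_n = measure lborel (ball (0::'a) 1)"
  have c_n: "c_n > 0" unfolding c_n_def using content_ball_pos[of 1 "0::'a"] by simp
  define q where "q = 8 * k / (k - \<kappa>)"
  have q: "q > 0" using \<kappa> by (simp add: q_def)
  define Cb where "Cb = (2 * k) powr (p - 1) * (real m * 24) powr p + 2 * k * real m * 24"
  have Cb: "Cb > 0" unfolding Cb_def using \<kappa> m p by (intro add_nonneg_pos) auto
  define Cn where "Cn = 3 / (4 * \<kappa>) * (1 + 4 * k / 3 * q * Cb) + 24"
  have Cn: "Cn > 0" unfolding Cn_def using \<kappa> q Cb by (intro add_nonneg_pos) auto
  define Cs where "Cs = Cb * q ^ 5 / (3 / 2 * \<kappa> * c_n)"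
  have Cs: "Cs > 0" unfolding Cs_def using Cb q \<kappa> c_n by simp
  define C where "C = Cs powr (1 / n) * Cn * q\<^sup>2"
  have C: "C > 0" unfolding C_def using Cs Cn q by simp
  show ?thesis
  proof (rule that[OF C])
    fix U u g and x0 :: 'a and t0 R Dd k0 k1 k2 r0 r1 r2 :: real
    assume U: "open U" and S: "superpair U p u g" and u0: "\<And>z. 0 \<le> u z" and R: "R > 0" and cU: "pcyl x0 t0 p R 1 \<subseteq> U"
      and Dd: "1 \<le> Dd" and k2: "\<kappa> \<le> k2" "k2 \<le> k1 - (k - \<kappa>) / (4 * Dd)" and k1: "k1 \<le> k0 - (k - \<kappa>) / (4 * Dd)" and k0: "k0 \<le> k"
      and r2: "0 < r2" "r2 \<le> r1 - 1 / (8 * Dd)" and r1: "r1 \<le> r0 - 1 / (8 * Dd)" and r0: "r0 \<le> 1"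
    define \<delta> where "\<delta> = (k - \<kappa>) / (4 * Dd)"
    have \<delta>: "\<delta> > 0" using \<kappa> Dd by (simp add: \<delta>_def)
    have e8: "1 / (8 * Dd) > 0" using Dd by simp
    have rr: "r2 < r1" "r1 < r0" "0 < r1" using r2 r1 e8 by linarith+
    have kk: "k2 < k1" "k1 < k0" "0 < k1" "0 < k0" "\<kappa> \<le> k1" "\<kappa> \<le> k0" "k1 \<le> k" using k2 k1 k0 \<delta> \<kappa> by (auto simp: \<delta>_def[symmetric])
    define P where "P = R powr p"
    have P: "P > 0" using R by (simp add: P_def)
    define Q where "Q r = pcyl x0 t0 p R r" for r
    have Qc: "compact (Q r)" for r unfolding Q_def by (rule pcyl_compact)
    have Qm: "Q r \<subseteq> Q r'" if "r \<le> r'" for r r' unfolding Q_def using that R by (intro pcyl_mono) auto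
    have QU: "Q r0 \<subseteq> U" "Q r1 \<subseteq> U" using Qm[of r0 1] Qm[of r1 1] r0 rr cU by (auto simp: Q_def)
    have [measurable]: "Q r \<in> sets borel" for r using Qc borel_compact by blast
    have [measurable]: "u \<in> borel_measurable borel" "g \<in> borel_measurable borel" using S by (auto simp: superpair_def)
    have fin: "emeasure lborel (Q r \<inter> B) < \<infinity>" if "B \<in> sets borel" for r B
      using emeasure_bounded_finite[OF bounded_subset[OF compact_imp_bounded[OF Qc[of r]], of "Q r \<inter> B"]] by simp
    have iQ: "integrable lborel (indicator (Q r \<inter> B) :: _ \<Rightarrow> real)" if [measurable]: "B \<in> sets borel" for r B
      using fin[OF that, of r] by (intro integrable_real_indicator) auto
    define Y where "Y = measure lborel (Q r0 \<inter> {z. u z < k0})"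
    define A where "A = Q r2 \<inter> {z. u z < k2}"
    define A1 where "A1 = Q r1 \<inter> {z. u z < k1}"
    have mU[measurable]: "{z. u z < c} \<in> sets borel" for c by measurable
    have [measurable]: "A \<in> sets borel" "A1 \<in> sets borel" unfolding A_def A1_def by measurable
    have Y0: "Y \<ge> 0" by (simp add: Y_def)
    have fm: "Q r \<inter> {z. u z < c} \<in> fmeasurable lborel" for r c using fin[of "{z. u z < c}" r] by (intro fmeasurableI) auto
    have A1Y: "measure lborel A1 \<le> Y" unfolding A1_def Y_def
      by (rule measure_mono_fmeasurable) (use Qm[of r1 r0] rr kk fm in auto)
    have AY: "measure lborel A \<le> Y" unfolding A_def Y_def
      by (rule measure_mono_fmeasurable) (use Qm[of r2 r0] rr kk fm in auto)
    have dR: "3 / (R * (a - b)) \<le> 24 * Dd / R" and dP: "3 / (P * (a - b)) \<le> 24 * Dd / P" if "b \<le> a - 1 / (8 * Dd)" for a b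
    proof -
      have ab: "1 / (8 * Dd) \<le> a - b" using that by simp
      then have abp: "a - b > 0" using e8 by linarith
      have "1 \<le> 8 * Dd * (a - b)" using ab Dd by (simp add: field_simps)
      then have "3 / (a - b) \<le> 24 * Dd" using abp by (simp add: divide_le_eq algebra_simps)
      then have "3 / (a - b) / R \<le> 24 * Dd / R" "3 / (a - b) / P \<le> 24 * Dd / P" using R P by (auto intro!: divide_right_mono simp del: divide_divide_eq_left)
      then show "3 / (R * (a - b)) \<le> 24 * Dd / R" "3 / (P * (a - b)) \<le> 24 * Dd / P" by (simp_all add: mult.commute)
    qed
    obtain \<eta>0 D0 where \<eta>0: "C1 \<eta>0 D0" "\<And>z. z \<notin> Q r0 \<Longrightarrow> \<eta>0 z = 0" "\<And>z. z \<in> Q r1 \<Longrightarrow> \<eta>0 z = 1"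
      "\<And>z. 0 \<le> \<eta>0 z" "\<And>z. \<eta>0 z \<le> 1" "\<And>z. norm (gradD D0 z) \<le> 3 / (R * (r0 - r1))" "\<And>z. \<bar>D0 z (0, 1)\<bar> \<le> 3 / (R powr p * (r0 - r1))"
      using parabolic_cutoff[OF R rr(3) rr(2), of x0 t0 p] unfolding Q_def by blast
    obtain \<eta>1 D1 where \<eta>1: "C1 \<eta>1 D1" "\<And>z. z \<notin> Q r1 \<Longrightarrow> \<eta>1 z = 0" "\<And>z. z \<in> Q r2 \<Longrightarrow> \<eta>1 z = 1"
      "\<And>z. 0 \<le> \<eta>1 z" "\<And>z. \<eta>1 z \<le> 1" "\<And>z. norm (gradD D1 z) \<le> 3 / (R * (r1 - r2))" "\<And>z. \<bar>D1 z (0, 1)\<bar> \<le> 3 / (R powr p * (r1 - r2))"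
      using parabolic_cutoff[OF R r2(1) rr(1), of x0 t0 p] unfolding Q_def by blast
    have Gb: "norm (gradD D0 z) \<le> 24 * Dd / R" "\<bar>D0 z (0, 1)\<bar> \<le> 24 * Dd / P" "norm (gradD D1 z) \<le> 24 * Dd / R" for z
      using \<eta>0(6,7)[of z] \<eta>1(6)[of z] dR[OF r1] dP[OF r1] dR[OF r2(2)] by (auto simp: P_def intro: order_trans)
    define x where "x z = (k0 - u z) / (2 * k0)" for z
    define x1 where "x1 z = (k1 - u z) / (2 * k1)" for z
    have [measurable]: "x \<in> borel_measurable borel" "x1 \<in> borel_measurable borel" unfolding x_def[abs_def] x1_def[abs_def] by measurable
    define B where "B = (2 * k0) powr (p - 1) * (real m * (24 * Dd / R)) powr p + 2 * k0 * real m * (24 * Dd / P)"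
    note en = de_giorgi_energy[OF p U S u0 kk(4) \<eta>0(1) Qc QU(1) \<eta>0(2) \<eta>0(4,5) Gb(1) Gb(2) m, folded x_def Y_def B_def]
    have en1: "integrable lborel (\<lambda>z. \<eta>0 z ^ m * (sst' (x z) / (2 * k0)) * norm (g z) powr p)"
      and en2: "(\<integral>z. \<eta>0 z ^ m * (sst' (x z) / (2 * k0)) * norm (g z) powr p \<partial>lborel) \<le> 2 * (B * Y)"
      and en3: "AE t in lborel. (\<integral>\<^sup>+y. ennreal (2 * k0 * sstI (x (y, t)) * \<eta>0 (y, t) ^ m) \<partial>lborel) \<le> ennreal (B * Y)"
      by (rule en; assumption)+
    define B' where "B' = Cb * Dd ^ m / P"
    have B': "B' > 0" using Cb Dd P by (simp add: B'_def)
    have BB': "B \<le> B'"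
    proof -
      have "(real m * (24 * Dd / R)) powr p = (real m * 24) powr p * Dd powr p / P"
        using Dd R by (simp add: P_def powr_mult powr_divide)
      also have "\<dots> \<le> (real m * 24) powr p * Dd ^ m / P"
      proof -
        have "Dd powr p \<le> Dd powr real m" using Dd m by (intro powr_mono) auto
        then have "Dd powr p \<le> Dd ^ m" using Dd by (simp add: powr_realpow)
        then show ?thesis using P by (intro divide_right_mono mult_left_mono) auto
      qed
      finally have 1: "(real m * (24 * Dd / R)) powr p \<le> (real m * 24) powr p * Dd ^ m / P" .
      have "(2 * k0) powr (p - 1) * (real m * (24 * Dd / R)) powr p \<le> (2 * k) powr (p - 1) * ((real m * 24) powr p * Dd ^ m / P)"
        using 1 k0 kk p by (intro mult_mono powr_mono2) auto
      moreover have "2 * k0 * real m * (24 * Dd / P) \<le> 2 * k * real m * 24 * Dd ^ m / P"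
      proof -
        have "Dd ^ 1 \<le> Dd ^ m" using Dd m p by (intro power_increasing) (cases m; auto)+
        then have "(2 * k0 * real m) * (24 * Dd / P) \<le> (2 * k * real m) * (24 * Dd ^ m / P)"
          using k0 kk P Dd by (intro mult_mono divide_right_mono) auto
        then show ?thesis by simp
      qed
      ultimately have "B \<le> (2 * k) powr (p - 1) * ((real m * 24) powr p * Dd ^ m / P) + 2 * k * real m * 24 * Dd ^ m / P" unfolding B_def by linarith
      also have "\<dots> = B'" by (simp add: B'_def Cb_def add_divide_distrib distrib_right)
      finally show ?thesis .
    qed
    define \<omega> where "\<omega> = 1 / (q * Dd)"
    have \<omega>: "\<omega> > 0" using q Dd by (simp add: \<omega>_def)
    have \<omega>\<delta>: "\<omega> = \<delta> / (2 * k)" using \<kappa> Dd by (simp add: \<omega>_def \<delta>_def q_def field_simps)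
    have xlow: "\<omega> \<le> (c - u z) / (2 * c)" "(c - u z) / (2 * c) \<le> 1/2" if "u z < c - \<delta>" "0 < c" "c \<le> k" for z c
    proof -
      have "\<delta> / (2 * k) \<le> (c - u z) / (2 * c)" using that \<delta> by (intro frac_le) auto
      then show "\<omega> \<le> (c - u z) / (2 * c)" by (simp add: \<omega>\<delta>)
      show "(c - u z) / (2 * c) \<le> 1/2" using u0[of z] that by (simp add: field_simps)
    qed
    have xA1: "\<omega> \<le> x z" "x z \<le> 1/2" if "z \<in> A1" for z unfolding x_def using xlow[of z k0] that k1 kk k0 by (auto simp: A1_def \<delta>_def)
    have x1A: "\<omega> \<le> x1 z" "x1 z \<le> 1/2" if "z \<in> A" for z unfolding x1_def using xlow[of z k1] that k2 kk k0 by (auto simp: A_def \<delta>_def)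
    have xx: "x1 z \<le> 0" if "\<not> u z < k1" for z using that kk by (simp add: x1_def divide_le_0_iff)
    have iA1g: "integrable lborel (\<lambda>z. indicator A1 z * norm (g z) powr p)"
      by (rule Bochner_Integration.integrable_bound[OF superpair_local(5)[OF S p Qc QU(2)]]) (auto simp: A1_def indicator_def)
    have gA1: "(\<integral>z. indicator A1 z * norm (g z) powr p \<partial>lborel) \<le> 4 * k / (3 * \<omega>) * (B' * Y)"
    proof -
      have pt: "3 * \<omega> / (2 * k) * (indicator A1 z * norm (g z) powr p) \<le> \<eta>0 z ^ m * (sst' (x z) / (2 * k0)) * norm (g z) powr p" for z
      proof (cases "z \<in> A1")
        case True
        have "3 * \<omega> \<le> sst' (x z)" using sst_small(2)[of "x z"] xA1[OF True] \<omega> by linarith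
        then have "3 * \<omega> / (2 * k) \<le> sst' (x z) / (2 * k0)" using k0 kk \<omega> by (intro frac_le) auto
        then have "3 * \<omega> / (2 * k) * norm (g z) powr p \<le> sst' (x z) / (2 * k0) * norm (g z) powr p" by (intro mult_right_mono) auto
        then show ?thesis using True \<eta>0(3)[of z] by (simp add: A1_def)
      next
        case False
        have "0 \<le> \<eta>0 z ^ m * (sst' (x z) / (2 * k0)) * norm (g z) powr p" using \<eta>0(4)[of z] sst'_range(1)[of "x z"] kk by (intro mult_nonneg_nonneg) auto
        then show ?thesis using False by simp
      qed
      have "3 * \<omega> / (2 * k) * (\<integral>z. indicator A1 z * norm (g z) powr p \<partial>lborel) = (\<integral>z. 3 * \<omega> / (2 * k) * (indicator A1 z * norm (g z) powr p) \<partial>lborel)" by simp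
      also have "\<dots> \<le> (\<integral>z. \<eta>0 z ^ m * (sst' (x z) / (2 * k0)) * norm (g z) powr p \<partial>lborel)"
        by (rule integral_mono[OF _ en1 pt]) (use iA1g in auto)
      also have "\<dots> \<le> 2 * (B * Y)" by (rule en2)
      also have "\<dots> \<le> 2 * (B' * Y)" using BB' Y0 by (intro mult_left_mono mult_right_mono) auto
      finally have "3 * \<omega> / (2 * k) * (\<integral>z. indicator A1 z * norm (g z) powr p \<partial>lborel) \<le> 2 * (B' * Y)" .
      then show ?thesis using \<omega> \<kappa> by (simp add: field_simps)
    qed
    define f where "f z = \<eta>1 z * sst (x1 z)" for z
    define J where "J z = \<eta>1 z * (sst' (x1 z) / (2 * k1)) * norm (g z) + sst (x1 z) * norm (gradD D1 z)" for z
    have tk: "2 * k1 > 0" using kk by simp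
    note tr = superpair_translation[OF p U S \<eta>1(1) Qc QU(2) _ \<eta>1(4) tk, where k=k1]
    have fi: "integrable lborel f" unfolding f_def x1_def by (rule tr(1)) (rule \<eta>1(2))
    have Ji: "integrable lborel J" unfolding J_def x1_def by (rule tr(2)) (rule \<eta>1(2))
    have trh: "(\<integral>z. \<bar>f (z + (h, 0)) - f z\<bar> \<partial>lborel) \<le> norm h * (\<integral>z. J z \<partial>lborel)" for h
      unfolding f_def J_def x1_def by (rule tr(3)) (rule \<eta>1(2))
    have f0: "0 \<le> f z" for z using \<eta>1(4)[of z] sst_range(1)[of "x1 z"] by (simp add: f_def)
    have f1: "f z \<le> indicator A1 z" for z
    proof (cases "z \<in> A1")
      case True
      then show ?thesis using mult_mono[of "\<eta>1 z" 1 "sst (x1 z)" 1] \<eta>1(4,5)[of z] sst_range[of "x1 z"] by (simp add: f_def)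
    next
      case False
      then show ?thesis using \<eta>1(2)[of z] xx[of z] sst_cases(1)[of "x1 z"] by (auto simp: f_def A1_def)
    qed
    have D10: "gradD D1 z = 0" if "z \<notin> Q r1" for z
      using C1_D_zero[OF \<eta>1(1) compact_imp_closed[OF Qc] \<eta>1(2) that] by (simp add: gradD_def)
    have Jb: "J z \<le> 3 / (4 * \<kappa>) * (1 / R * indicator A1 z + R powr (p - 1) * (indicator A1 z * norm (g z) powr p)) + 24 * Dd / R * indicator A1 z" for z
    proof (cases "z \<in> A1")
      case True
      have "norm (g z) \<le> 1 / R + (1 / R) powr (1 - p) * norm (g z) powr p" using le_add_powr[of "norm (g z)" "1 / R" p] R p by simp
      also have "(1 / R) powr (1 - p) = R powr (p - 1)" using R powr_minus_divide[of R "1 - p"] by (simp add: powr_divide)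
      finally have g: "norm (g z) \<le> 1 / R + R powr (p - 1) * norm (g z) powr p" .
      have "sst' (x1 z) / (2 * k1) \<le> (3 / 2) / (2 * \<kappa>)" using sst'_range[of "x1 z"] kk \<kappa> by (intro frac_le) auto
      then have "\<eta>1 z * (sst' (x1 z) / (2 * k1)) * norm (g z) \<le> 1 * (3 / 2 / (2 * \<kappa>)) * (1 / R + R powr (p - 1) * norm (g z) powr p)"
        using g \<eta>1(4,5)[of z] sst'_range(1)[of "x1 z"] kk \<kappa> by (intro mult_mono) auto
      moreover have "sst (x1 z) * norm (gradD D1 z) \<le> 1 * (24 * Dd / R)" using sst_range[of "x1 z"] Gb(3)[of z] by (intro mult_mono) auto
      ultimately show ?thesis using True by (simp add: J_def)
    next
      case False
      then consider "z \<notin> Q r1" | "\<not> u z < k1" by (auto simp: A1_def)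
      then have "J z = 0" using D10 \<eta>1(2) xx[of z] sst_cases(1)[of "x1 z"] by cases (auto simp: J_def)
      then show ?thesis using False by simp
    qed
    have iA1: "integrable lborel (indicator A1 :: _ \<Rightarrow> real)" unfolding A1_def by (rule iQ) measurable
    define N where "N = Y / R * (Cn * Dd ^ (m + 1))"
    have N0: "N \<ge> 0" using Y0 R Cn Dd by (simp add: N_def)
    have JN: "(\<integral>z. J z \<partial>lborel) \<le> N"
    proof -
      have "(\<integral>z. J z \<partial>lborel) \<le> (\<integral>z. 3 / (4 * \<kappa>) * (1 / R * indicator A1 z + R powr (p - 1) * (indicator A1 z * norm (g z) powr p)) + 24 * Dd / R * indicator A1 z \<partial>lborel)"
        by (rule integral_mono[OF Ji _ Jb]) (use iA1 iA1g in auto)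
      also have "\<dots> = 3 / (4 * \<kappa>) * (1 / R * measure lborel A1 + R powr (p - 1) * (\<integral>z. indicator A1 z * norm (g z) powr p \<partial>lborel)) + 24 * Dd / R * measure lborel A1"
      proof -
        have i1: "integrable lborel (\<lambda>z. 1 / R * indicator A1 z)" "integrable lborel (\<lambda>z. R powr (p - 1) * (indicator A1 z * norm (g z) powr p))" "integrable lborel (\<lambda>z. 24 * Dd / R * indicator A1 z)"
          using iA1 iA1g by auto
        note i2 = Bochner_Integration.integrable_add[OF i1(1,2)]
        have mi: "(\<integral>z. indicator A1 z \<partial>lborel) = measure lborel A1" by simp
        show ?thesis unfolding Bochner_Integration.integral_add[OF integrable_mult_right[OF i2] i1(3)] integral_mult_right_zero Bochner_Integration.integral_add[OF i1(1,2)] mi ..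
      qed
      also have "\<dots> \<le> 3 / (4 * \<kappa>) * (1 / R * Y + R powr (p - 1) * (4 * k / (3 * \<omega>) * (B' * Y))) + 24 * Dd / R * Y"
        using A1Y gA1 R \<kappa> Dd by (intro add_mono mult_left_mono) auto
      also have "\<dots> = Y / R * (3 / (4 * \<kappa>) * (1 + 4 * k / 3 * q * Cb * Dd ^ (m + 1)) + 24 * Dd)"
      proof -
        have e: "R powr (p - 1) * B' = Cb * Dd ^ m / R" using R by (simp add: B'_def P_def powr_diff)
        have "R powr (p - 1) * (4 * k / (3 * \<omega>) * (B' * Y)) = 4 * k / (3 * \<omega>) * (R powr (p - 1) * B') * Y" by (simp only: ac_simps)
        then have f1: "R powr (p - 1) * (4 * k / (3 * \<omega>) * (B' * Y)) = 4 * k / (3 * \<omega>) * (Cb * Dd ^ m / R) * Y" unfolding e .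
        have f2: "4 * k / (3 * \<omega>) = 4 * k / 3 * q * Dd" using q Dd by (simp add: \<omega>_def)
        have "R powr (p - 1) * (4 * k / (3 * \<omega>) * (B' * Y)) = 4 * k / 3 * q * Dd * (Cb * Dd ^ m / R) * Y" using f1 unfolding f2 .
        also have "\<dots> = Y / R * (4 * k / 3 * q * Cb * Dd ^ (m + 1))" by (simp add: mult_ac)
        finally have t: "R powr (p - 1) * (4 * k / (3 * \<omega>) * (B' * Y)) = Y / R * (4 * k / 3 * q * Cb * Dd ^ (m + 1))" .
        have "c * (1 / R * Y + Y / R * Z) + 24 * Dd / R * Y = Y / R * (c * (1 + Z) + 24 * Dd)" for c Z :: real
          by (simp add: algebra_simps)
        then show ?thesis unfolding t .
      qed
      also have "\<dots> \<le> Y / R * (Cn * Dd ^ (m + 1))"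
      proof (rule mult_left_mono)
        have D1: "1 \<le> Dd ^ (m + 1)" using Dd by (rule one_le_power)
        have D2: "Dd \<le> Dd ^ (m + 1)" using Dd power_increasing[of 1 "m + 1" Dd] by simp
        have "3 / (4 * \<kappa>) * (1 + 4 * k / 3 * q * Cb * Dd ^ (m + 1)) + 24 * Dd \<le> 3 / (4 * \<kappa>) * (Dd ^ (m + 1) + 4 * k / 3 * q * Cb * Dd ^ (m + 1)) + 24 * Dd ^ (m + 1)"
          using D1 D2 \<kappa> by (intro add_mono mult_left_mono order_refl) auto
        also have "\<dots> = Cn * Dd ^ (m + 1)" by (simp add: Cn_def algebra_simps)
        finally show "3 / (4 * \<kappa>) * (1 + 4 * k / 3 * q * Cb * Dd ^ (m + 1)) + 24 * Dd \<le> Cn * Dd ^ (m + 1)" .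
      qed (use Y0 R in auto)
      finally show ?thesis by (simp add: N_def)
    qed
    define \<sigma> where "\<sigma> = 3 / 2 * \<kappa> * \<omega> ^ 3"
    have \<sigma>: "\<sigma> > 0" using \<kappa> \<omega> by (simp add: \<sigma>_def)
    define Sv where "Sv = B' * Y / \<sigma>"
    have Sv0: "Sv \<ge> 0" using B' Y0 \<sigma> by (simp add: Sv_def)
    have sl: "AE t in lborel. (\<integral>\<^sup>+y. ennreal (f (y, t)) \<partial>lborel) \<le> ennreal Sv"
      using en3
    proof eventually_elim
      case (elim t)
      have pt: "\<sigma> * f z \<le> 2 * k0 * sstI (x z) * \<eta>0 z ^ m" for z
      proof (cases "z \<in> A1")
        case True
        have "3 / 4 * \<omega> ^ 3 \<le> 3 / 4 * x z ^ 3" using xA1(1)[OF True] \<omega> by (intro mult_left_mono power_mono) auto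
        also have "\<dots> \<le> sstI (x z)" using sst_small(3)[of "x z"] xA1[OF True] \<omega> by linarith
        finally have "2 * \<kappa> * (3 / 4 * \<omega> ^ 3) \<le> 2 * k0 * sstI (x z)" using kk \<kappa> \<omega> by (intro mult_mono) auto
        then have s: "\<sigma> \<le> 2 * k0 * sstI (x z)" by (simp add: \<sigma>_def)
        have "\<sigma> * f z \<le> \<sigma> * 1" using f1[of z] True \<sigma> by (intro mult_left_mono) auto
        then show ?thesis using s True \<eta>0(3)[of z] by (simp add: A1_def)
      next
        case False
        then have "f z = 0" using f1[of z] f0[of z] by simp
        moreover have "0 \<le> 2 * k0 * sstI (x z) * \<eta>0 z ^ m" using kk sstI_range(1)[of "x z"] \<eta>0(4)[of z] by simp
        ultimately show ?thesis by simp
      qed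
      have "(\<integral>\<^sup>+y. ennreal (f (y, t)) \<partial>lborel) \<le> (\<integral>\<^sup>+y. ennreal (1 / \<sigma>) * ennreal (2 * k0 * sstI (x (y, t)) * \<eta>0 (y, t) ^ m) \<partial>lborel)"
      proof (rule nn_integral_mono)
        fix y
        have "f (y, t) \<le> 1 / \<sigma> * (2 * k0 * sstI (x (y, t)) * \<eta>0 (y, t) ^ m)" using pt[of "(y, t)"] \<sigma> by (simp add: field_simps)
        then show "ennreal (f (y, t)) \<le> ennreal (1 / \<sigma>) * ennreal (2 * k0 * sstI (x (y, t)) * \<eta>0 (y, t) ^ m)"
          using \<sigma> by (subst ennreal_mult'[symmetric]) (auto intro: ennreal_leI)
      qed
      also have "\<dots> = ennreal (1 / \<sigma>) * (\<integral>\<^sup>+y. ennreal (2 * k0 * sstI (x (y, t)) * \<eta>0 (y, t) ^ m) \<partial>lborel)"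
      proof (rule nn_integral_cmult)
        have c: "(\<lambda>y::'a. (y, t)) \<in> borel_measurable borel" by (rule borel_measurable_continuous_onI) (intro continuous_intros)
        have "(\<lambda>z. ennreal (2 * k0 * sstI (x z) * \<eta>0 z ^ m)) \<in> borel_measurable borel"
          using borel_measurable_continuous_onI[OF C1_cont[OF \<eta>0(1)]] by measurable
        from measurable_compose[OF c this] show "(\<lambda>y. ennreal (2 * k0 * sstI (x (y, t)) * \<eta>0 (y, t) ^ m)) \<in> borel_measurable lborel" by simp
      qed
      also have "\<dots> \<le> ennreal (1 / \<sigma>) * ennreal (B' * Y)"
        using elim BB' Y0 by (intro mult_left_mono order_trans[OF elim] ennreal_leI mult_right_mono) auto
      also have "\<dots> = ennreal Sv" using \<sigma> B' Y0 by (simp add: Sv_def ennreal_mult[symmetric])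
      finally show ?case .
    qed
    define y where "y = Y / (R ^ n * P)"
    have y0: "y \<ge> 0" using Y0 R P by (simp add: y_def)
    have "measure lborel A / (R ^ n * P) \<le> C * Dd ^ (2 * m + 8) * y powr (1 + 1 / n)"
    proof (cases "Y = 0")
      case True
      then have "measure lborel A = 0" using AY measure_nonneg[of lborel A] by linarith
      then show ?thesis using C Dd by simp
    next
      case False
      then have Yp: "Y > 0" using Y0 by simp
      then have yp: "y > 0" using R P by (simp add: y_def)
      define s where "s = (Cs * Dd ^ (m + 5) * y) powr (1 / n)"
      have s: "s > 0" using Cs Dd yp by (simp add: s_def)
      have sn: "s ^ n = Cs * Dd ^ (m + 5) * y"
      proof -
        define X where "X = Cs * Dd ^ (m + 5) * y"
        have X: "X > 0" using Cs Dd yp by (simp add: X_def)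
        have "s ^ n = s powr real n" using s by (simp add: powr_realpow)
        also have "\<dots> = X powr 1" unfolding s_def X_def[symmetric] using n by (simp add: powr_powr)
        finally show ?thesis using X by (simp add: X_def)
      qed
      define \<rho> where "\<rho> = R * s"
      have \<rho>: "\<rho> > 0" using R s by (simp add: \<rho>_def)
      have bal: "measure lborel (ball (0::'a) \<rho>) = \<rho> ^ n * c_n" unfolding n_def c_n_def by (rule measure_ball_scale[OF \<rho>])
      have Sb: "Sv / (\<rho> ^ n * c_n) = \<omega>\<^sup>2"
      proof -
        have "\<rho> ^ n * c_n = R ^ n * (Cs * Dd ^ (m + 5) * y) * c_n" by (simp add: \<rho>_def power_mult_distrib sn)
        also have "\<dots> = Cb * q ^ 5 * Dd ^ (m + 5) * Y / (3 / 2 * \<kappa> * P)"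
        proof -
          have "r * (a / (c * d) * D * (Y / (r * P))) * d = a * D * Y / (c * P)" if "r \<noteq> 0" "d \<noteq> 0" for r a c d D :: real
            using that by simp
          from this[of "R ^ n" c_n] show ?thesis using R c_n unfolding Cs_def y_def by simp
        qed
        finally have 1: "\<rho> ^ n * c_n = Cb * q ^ 5 * Dd ^ (m + 5) * Y / (3 / 2 * \<kappa> * P)" .
        have \<sigma>': "\<sigma> = 3 / 2 * \<kappa> / (q * Dd) ^ 3" by (simp add: \<sigma>_def \<omega>_def power_one_over)
        have 2: "Sv = Cb * Dd ^ m * Y * (q * Dd) ^ 3 / (3 / 2 * \<kappa> * P)" unfolding Sv_def B'_def \<sigma>' by (simp add: mult_ac)
        have "Cb * q ^ 5 * Dd ^ (m + 5) * Y = (Cb * Dd ^ m * Y * (q * Dd) ^ 3) * (q * Dd)\<^sup>2"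
        proof -
          have 5: "a ^ 5 = a ^ 3 * a\<^sup>2" for a :: real by (simp flip: power_add)
          have "q ^ 5 = q ^ 3 * q\<^sup>2" "Dd ^ (m + 5) = Dd ^ m * Dd ^ 3 * Dd\<^sup>2" using 5[of q] 5[of Dd] by (simp_all add: power_add)
          then show ?thesis by (simp only: power_mult_distrib ac_simps)
        qed
        then have "\<rho> ^ n * c_n = Sv * (q * Dd)\<^sup>2" unfolding 1 2 by simp
        moreover have "Sv > 0" using B' Yp \<sigma> by (simp add: Sv_def)
        ultimately show ?thesis using q Dd by (simp add: \<omega>_def power_one_over)
      qed
      have "(\<integral>z. indicator A z * f z \<partial>lborel) \<le> \<rho> * N + measure lborel A * Sv / measure lborel (ball (0::'a) \<rho>)"
      proof (rule slice_average_bound[OF fi f0 _ _ \<rho> N0 _ sl Sv0])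
        show "emeasure lborel A < \<infinity>" unfolding A_def by (rule fin) measurable
        show "(\<integral>z. \<bar>f (z + (h, 0)) - f z\<bar> \<partial>lborel) \<le> \<rho> * N" if "norm h \<le> \<rho>" for h
        proof -
          have "norm h * (\<integral>z. J z \<partial>lborel) \<le> \<rho> * N"
            by (rule order_trans[OF mult_left_mono[OF JN norm_ge_zero] mult_right_mono[OF that N0]])
          then show ?thesis using trh[of h] by linarith
        qed
      qed measurable
      also have "\<dots> = \<rho> * N + measure lborel A * \<omega>\<^sup>2" unfolding bal by (simp only: times_divide_eq_right[symmetric] Sb)
      finally have up: "(\<integral>z. indicator A z * f z \<partial>lborel) \<le> \<rho> * N + measure lborel A * \<omega>\<^sup>2" .
      have "2 * \<omega>\<^sup>2 * measure lborel A = (\<integral>z. 2 * \<omega>\<^sup>2 * indicator A z \<partial>lborel)" by simp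
      also have "\<dots> \<le> (\<integral>z. indicator A z * f z \<partial>lborel)"
      proof (rule integral_mono)
        have "integrable lborel (indicator A :: _ \<Rightarrow> real)" unfolding A_def by (rule iQ) measurable
        then show "integrable lborel (\<lambda>z. 2 * \<omega>\<^sup>2 * indicator A z)" by auto
        show "integrable lborel (\<lambda>z. indicator A z * f z)" using integrable_real_mult_indicator[OF _ fi, of A] by (simp add: mult.commute)
        fix z
        show "2 * \<omega>\<^sup>2 * indicator A z \<le> indicator A z * f z"
        proof (cases "z \<in> A")
          case True
          have "2 * \<omega>\<^sup>2 \<le> 2 * (x1 z)\<^sup>2" using x1A(1)[OF True] \<omega> by (intro mult_left_mono power_mono) auto
          also have "\<dots> \<le> sst (x1 z)" using sst_small(1)[of "x1 z"] x1A[OF True] \<omega> by linarith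
          finally show ?thesis using True \<eta>1(3)[of z] by (simp add: f_def A_def)
        qed simp
      qed
      finally have "\<omega>\<^sup>2 * measure lborel A \<le> \<rho> * N" using up by (simp add: mult.commute)
      then have "measure lborel A \<le> \<rho> * N / \<omega>\<^sup>2" using \<omega> by (simp add: field_simps)
      also have "\<dots> = s * Y * Cn * Dd ^ (m + 1) * (q * Dd)\<^sup>2"
      proof -
        have a: "(R * s) * (Y / R * (Cn * Z)) / w = s * Y * Cn * Z * (1 / w)" for Z w using R by simp
        have b: "1 / \<omega>\<^sup>2 = (q * Dd)\<^sup>2" by (simp add: \<omega>_def power_one_over)
        show ?thesis unfolding \<rho>_def N_def a b ..
      qed
      finally have "measure lborel A / (R ^ n * P) \<le> s * Y * Cn * Dd ^ (m + 1) * (q * Dd)\<^sup>2 / (R ^ n * P)"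
        using R P by (intro divide_right_mono) auto
      also have "\<dots> = s * y * Cn * q\<^sup>2 * Dd ^ (m + 3)"
      proof -
        have "m + 3 = (m + 1) + 2" by simp
        then have "Dd ^ (m + 3) = Dd ^ (m + 1) * Dd\<^sup>2" by (simp only: power_add)
        then show ?thesis unfolding y_def power_mult_distrib by (simp only: times_divide_eq_left times_divide_eq_right ac_simps)
      qed
      also have "\<dots> \<le> (Cs powr (1 / n) * Dd ^ (m + 5) * y powr (1 / n)) * y * Cn * q\<^sup>2 * Dd ^ (m + 3)"
      proof -
        have "s = Cs powr (1 / n) * (Dd ^ (m + 5)) powr (1 / n) * y powr (1 / n)" unfolding s_def using Cs Dd yp by (simp add: powr_mult)
        moreover have "(Dd ^ (m + 5)) powr (1 / n) \<le> (Dd ^ (m + 5)) powr 1" using Dd n by (intro powr_mono) (auto simp: one_le_power)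
        ultimately have "s \<le> Cs powr (1 / n) * Dd ^ (m + 5) * y powr (1 / n)"
          using Dd by (simp add: mult_left_mono mult_right_mono)
        then show ?thesis using yp Cn Dd by (intro mult_right_mono) auto
      qed
      also have "\<dots> = C * Dd ^ (2 * m + 8) * (y * y powr (1 / n))"
      proof -
        have "2 * m + 8 = (m + 5) + (m + 3)" by simp
        then have "Dd ^ (2 * m + 8) = Dd ^ (m + 5) * Dd ^ (m + 3)" by (simp only: power_add)
        then show ?thesis unfolding C_def by (simp only: ac_simps)
      qed
      also have "y * y powr (1 / n) = y powr (1 + 1 / n)" using yp by (simp add: powr_add)
      finally show ?thesis .
    qed
    then show "measure lborel (pcyl x0 t0 p R r2 \<inter> {z. u z < k2}) / (R ^ n * R powr p)
       \<le> C * Dd ^ (2 * m + 8) * (measure lborel (pcyl x0 t0 p R r0 \<inter> {z. u z < k0}) / (R ^ n * R powr p)) powr (1 + 1 / n)"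
      unfolding A_def y_def Y_def P_def Q_def .
  qed
qed

lemma fast_geometric_convergence:
  fixes y :: "nat \<Rightarrow> real"
  assumes C: "C > 0" and b: "b > 1" and \<alpha>: "\<alpha> > 0" and y0: "\<And>i. 0 \<le> y i"
    and step: "\<And>i. y (Suc i) \<le> C * b ^ i * y i powr (1 + \<alpha>)"
    and start: "y 0 \<le> (b powr (- 1 / \<alpha>) / C) powr (1 / \<alpha>)"
  shows "y \<longlonglongrightarrow> 0"
proof -
  define q where "q = b powr (- 1 / \<alpha>)"
  define \<nu> where "\<nu> = (q / C) powr (1 / \<alpha>)"
  have q: "0 < q" "q < 1" using b \<alpha> by (auto simp: q_def powr_less_one)
  have \<nu>: "\<nu> > 0" using q C by (simp add: \<nu>_def)
  have \<nu>\<alpha>: "\<nu> powr \<alpha> = q / C" using q C \<alpha> by (simp add: \<nu>_def powr_powr)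
  have q\<alpha>: "q powr \<alpha> = 1 / b" unfolding q_def powr_powr using b \<alpha> by (simp add: powr_minus_divide)
  have bound: "y i \<le> \<nu> * q ^ i" for i
  proof (induction i)
    case 0 then show ?case using start by (simp add: \<nu>_def q_def)
  next
    case (Suc i)
    have "y i powr (1 + \<alpha>) = y i * y i powr \<alpha>" using y0[of i] by (simp add: powr_mult_base)
    also have "\<dots> \<le> (\<nu> * q ^ i) * (\<nu> * q ^ i) powr \<alpha>"
      using Suc y0[of i] \<nu> q \<alpha> by (intro mult_mono powr_mono2) auto
    also have "(\<nu> * q ^ i) powr \<alpha> = q / C * (1 / b) ^ i"
    proof -
      have "(q ^ i) powr \<alpha> = (q powr \<alpha>) ^ i" using q by (simp add: powr_realpow[symmetric] powr_powr mult.commute)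
      then show ?thesis using \<nu> q by (simp add: powr_mult \<nu>\<alpha> q\<alpha>)
    qed
    finally have "y i powr (1 + \<alpha>) \<le> (\<nu> * q ^ i) * (q / C * (1 / b) ^ i)" .
    then have "C * b ^ i * y i powr (1 + \<alpha>) \<le> C * b ^ i * ((\<nu> * q ^ i) * (q / C * (1 / b) ^ i))" using C b by (intro mult_left_mono) auto
    also have "\<dots> = \<nu> * q ^ Suc i" using C b by (simp add: power_one_over field_simps)
    finally show ?case using step[of i] by linarith
  qed
  show ?thesis
  proof (rule tendsto_sandwich[of "\<lambda>_. 0" _ _ "\<lambda>i. \<nu> * q ^ i"])
    show "(\<lambda>i. \<nu> * q ^ i) \<longlonglongrightarrow> 0" using q LIMSEQ_realpow_zero[of q] by (auto intro: tendsto_mult_right_zero)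
  qed (use y0 bound in auto)
qed

lemma de_giorgi:
  fixes p k \<kappa> :: real
  assumes p: "p > 2" and \<kappa>: "0 < \<kappa>" "\<kappa> < k"
  obtains \<nu> where "\<nu> > 0"
    "\<And>U u g (x0::'a::euclidean_space) t0 R. open U \<Longrightarrow> superpair U p u g \<Longrightarrow> (\<And>z. 0 \<le> u z) \<Longrightarrow> R > 0 \<Longrightarrow> pcyl x0 t0 p R 1 \<subseteq> U \<Longrightarrow>
       measure lborel (pcyl x0 t0 p R 1 \<inter> {z. u z < k}) \<le> \<nu> * (R ^ DIM('a) * R powr p) \<Longrightarrow>
       AE z in lborel. z \<in> pcyl x0 t0 p R (1/2) \<longrightarrow> \<kappa> \<le> u z"
proof -
  define n where "n = DIM('a)"
  define m where "m = nat \<lceil>p\<rceil>"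
  have n: "n > 0" by (simp add: n_def)
  obtain C where C: "C > 0"
    and st: "\<And>U u g (x0::'a) t0 R Dd k0 k1 k2 r0 r1 r2. open U \<Longrightarrow> superpair U p u g \<Longrightarrow> (\<And>z. 0 \<le> u z) \<Longrightarrow> R > 0 \<Longrightarrow> pcyl x0 t0 p R 1 \<subseteq> U \<Longrightarrow>
       1 \<le> Dd \<Longrightarrow> \<kappa> \<le> k2 \<Longrightarrow> k2 \<le> k1 - (k - \<kappa>) / (4 * Dd) \<Longrightarrow> k1 \<le> k0 - (k - \<kappa>) / (4 * Dd) \<Longrightarrow> k0 \<le> k \<Longrightarrow>
       0 < r2 \<Longrightarrow> r2 \<le> r1 - 1 / (8 * Dd) \<Longrightarrow> r1 \<le> r0 - 1 / (8 * Dd) \<Longrightarrow> r0 \<le> 1 \<Longrightarrow>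
       measure lborel (pcyl x0 t0 p R r2 \<inter> {z. u z < k2}) / (R ^ n * R powr p)
       \<le> C * Dd ^ (2 * m + 8) * (measure lborel (pcyl x0 t0 p R r0 \<inter> {z. u z < k0}) / (R ^ n * R powr p)) powr (1 + 1 / n)"
    unfolding n_def m_def by (rule de_giorgi_step[OF p \<kappa>]) blast
  define b :: real where "b = 4 ^ (2 * m + 8)"
  have b: "b > 1" unfolding b_def by (rule one_less_power) auto
  define \<nu> where "\<nu> = (b powr (- 1 / (1 / n)) / C) powr (1 / (1 / n))"
  have \<nu>: "\<nu> > 0" using b C by (simp add: \<nu>_def)
  show ?thesis
  proof (rule that[OF \<nu>])
    fix U u g and x0 :: 'a and t0 R :: real
    assume U: "open U" and S: "superpair U p u g" and u0: "\<And>z. 0 \<le> u z" and R: "R > 0" and cU: "pcyl x0 t0 p R 1 \<subseteq> U"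
      and small: "measure lborel (pcyl x0 t0 p R 1 \<inter> {z. u z < k}) \<le> \<nu> * (R ^ DIM('a) * R powr p)"
    have [measurable]: "u \<in> borel_measurable borel" using S by (auto simp: superpair_def)
    have [measurable]: "pcyl x0 t0 p R r \<in> sets borel" for r using pcyl_compact borel_compact by blast
    have RP: "R ^ n * R powr p > 0" using R by simp
    define kk where "kk j = \<kappa> + (k - \<kappa>) / 2 ^ j" for j :: nat
    define rr :: "nat \<Rightarrow> real" where "rr j = 1/2 + 1 / 2 ^ Suc j" for j :: nat
    define y where "y i = measure lborel (pcyl x0 t0 p R (rr (2 * i)) \<inter> {z. u z < kk (2 * i)}) / (R ^ n * R powr p)" for i
    have "y \<longlonglongrightarrow> 0"
    proof (rule fast_geometric_convergence[OF C b, of "1 / n"])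
      show "1 / real n > 0" using n by simp
      show "0 \<le> y i" for i using RP by (simp add: y_def)
      show "y 0 \<le> (b powr (- 1 / (1 / real n)) / C) powr (1 / (1 / real n))"
        using small RP unfolding \<nu>_def[symmetric] by (simp add: y_def rr_def kk_def n_def divide_le_eq)
      show "y (Suc i) \<le> C * b ^ i * y i powr (1 + 1 / real n)" for i
      proof -
        define Dd :: real where "Dd = 4 ^ i"
        have Dd: "1 \<le> Dd" unfolding Dd_def by simp
        have p2: "(2::real) ^ (2 * i) = Dd" "(2::real) ^ Suc (2 * i) = 2 * Dd" "(2::real) ^ Suc (Suc (2 * i)) = 4 * Dd" "(2::real) ^ Suc (Suc (Suc (2 * i))) = 8 * Dd"
          by (simp_all add: Dd_def power_mult)
        have bD: "b ^ i = Dd ^ (2 * m + 8)" unfolding b_def Dd_def by (simp flip: power_mult add: mult.commute)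
        have "measure lborel (pcyl x0 t0 p R (rr (Suc (Suc (2 * i)))) \<inter> {z. u z < kk (Suc (Suc (2 * i)))}) / (R ^ n * R powr p)
          \<le> C * Dd ^ (2 * m + 8) * (measure lborel (pcyl x0 t0 p R (rr (2 * i)) \<inter> {z. u z < kk (2 * i)}) / (R ^ n * R powr p)) powr (1 + 1 / n)"
        proof (rule st[OF U S u0 R cU Dd, where ?k1.0="kk (Suc (2 * i))" and ?r1.0="rr (Suc (2 * i))"])
          show "\<kappa> \<le> kk (Suc (Suc (2 * i)))" using \<kappa> by (simp add: kk_def)
          show "kk (Suc (Suc (2 * i))) \<le> kk (Suc (2 * i)) - (k - \<kappa>) / (4 * Dd)"
            unfolding kk_def p2 using Dd by (simp add: field_simps)
          have "(k - \<kappa>) / (4 * Dd) \<le> (k - \<kappa>) / (2 * Dd)" using \<kappa> Dd by (intro divide_left_mono) auto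
          moreover have "(k - \<kappa>) / Dd = (k - \<kappa>) / (2 * Dd) + (k - \<kappa>) / (2 * Dd)" by simp
          ultimately show "kk (Suc (2 * i)) \<le> kk (2 * i) - (k - \<kappa>) / (4 * Dd)" unfolding kk_def p2 by linarith
          have "(k - \<kappa>) / Dd \<le> (k - \<kappa>) / 1" using \<kappa> Dd by (intro divide_left_mono) auto
          then show "kk (2 * i) \<le> k" unfolding kk_def p2 by simp
          show "0 < rr (Suc (Suc (2 * i)))" by (simp add: rr_def add_pos_pos)
          show "rr (Suc (Suc (2 * i))) \<le> rr (Suc (2 * i)) - 1 / (8 * Dd)" unfolding rr_def p2 using Dd by (simp add: field_simps)
          have "1 / (8 * Dd) \<le> 1 / (4 * Dd)" using Dd by (intro divide_left_mono) auto
          moreover have "1 / (2 * Dd) = 1 / (4 * Dd) + 1 / (4 * Dd)" by simp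
          ultimately show "rr (Suc (2 * i)) \<le> rr (2 * i) - 1 / (8 * Dd)" unfolding rr_def p2 by linarith
          have "1 / (2 * Dd) \<le> 1 / 2" using Dd by (intro divide_left_mono) auto
          then show "rr (2 * i) \<le> 1" unfolding rr_def p2 by simp
        qed
        then show ?thesis unfolding y_def bD by simp
      qed
    qed
    define Z where "Z = pcyl x0 t0 p R (1/2) \<inter> {z. u z < \<kappa>}"
    have [measurable]: "Z \<in> sets borel" unfolding Z_def by measurable
    have fm: "pcyl x0 t0 p R r \<inter> {z. u z < c} \<in> fmeasurable lborel" for r c
      using emeasure_bounded_finite[OF bounded_subset[OF compact_imp_bounded[OF pcyl_compact[of x0 t0 p R r]], of "pcyl x0 t0 p R r \<inter> {z. u z < c}"]]
      by (intro fmeasurableI) auto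
    have le: "measure lborel Z / (R ^ n * R powr p) \<le> y i" for i
      unfolding y_def Z_def
    proof (intro divide_right_mono measure_mono_fmeasurable fm)
      have "pcyl x0 t0 p R (1/2) \<subseteq> pcyl x0 t0 p R (rr (2 * i))" using R by (intro pcyl_mono) (auto simp: rr_def)
      moreover have "\<kappa> \<le> kk (2 * i)" using \<kappa> by (simp add: kk_def)
      ultimately show "pcyl x0 t0 p R (1/2) \<inter> {z. u z < \<kappa>} \<subseteq> pcyl x0 t0 p R (rr (2 * i)) \<inter> {z. u z < kk (2 * i)}" by auto
      show "pcyl x0 t0 p R (1/2) \<inter> {z. u z < \<kappa>} \<in> sets lborel" by measurable
    qed (use RP in auto)
    have "measure lborel Z / (R ^ n * R powr p) \<le> 0" by (rule LIMSEQ_le_const[OF \<open>y \<longlonglongrightarrow> 0\<close>]) (use le in auto)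
    then have "measure lborel Z = 0" using RP measure_nonneg[of lborel Z] by (simp add: divide_le_0_iff)
    moreover have "emeasure lborel Z = ennreal (measure lborel Z)" using fm[of "1/2" \<kappa>] by (simp add: Z_def emeasure_eq_measure2)
    ultimately have "emeasure lborel Z = 0" by simp
    then have "AE z in lborel. z \<notin> Z" by (intro AE_not_in) (auto simp: null_sets_def)
    then show "AE z in lborel. z \<in> pcyl x0 t0 p R (1/2) \<longrightarrow> \<kappa> \<le> u z" by (rule eventually_mono) (auto simp: Z_def)
  qed
qed

lemma pcyl_translate: "w + z \<in> pcyl (fst z) (snd z) p R r \<longleftrightarrow> w \<in> pcyl 0 0 p R r"
  by (cases z; cases w) (auto simp: pcyl_def dist_norm)

lemma measure_pcyl:
  fixes x0 :: "'a::euclidean_space"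
  assumes R: "R > 0"
  shows "measure lborel (pcyl x0 t0 p R 1) = 2 * measure lborel (ball (0::'a) 1) * (R ^ DIM('a) * R powr p)"
    and "emeasure lborel (pcyl x0 t0 p R 1) = ennreal (measure lborel (pcyl x0 t0 p R 1))"
proof -
  have P: "R powr p > 0" using R by simp
  have "emeasure (lborel \<Otimes>\<^sub>M lborel) (cball x0 R \<times> cball t0 (R powr p)) = emeasure lborel (cball x0 R) * emeasure lborel (cball t0 (R powr p))"
    by (rule lborel.emeasure_pair_measure_Times) auto
  then have "emeasure lborel (pcyl x0 t0 p R 1) = emeasure lborel (cball x0 R) * emeasure lborel (cball t0 (R powr p))"
    by (simp add: lborel_prod pcyl_def)
  then have "measure lborel (pcyl x0 t0 p R 1) = measure lborel (cball x0 R) * measure lborel (cball t0 (R powr p))"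
    by (simp add: measure_def enn2real_mult)
  also have "measure lborel (cball x0 R) = R ^ DIM('a) * measure lborel (ball (0::'a) 1)"
    using content_ball_conv_unit_ball[of R x0] R by (simp add: content_cball_conv_ball)
  also have "measure lborel (cball t0 (R powr p)) = 2 * R powr p" using P by (simp add: cball_eq_atLeastAtMost)
  finally show "measure lborel (pcyl x0 t0 p R 1) = 2 * measure lborel (ball (0::'a) 1) * (R ^ DIM('a) * R powr p)" by simp
  show "emeasure lborel (pcyl x0 t0 p R 1) = ennreal (measure lborel (pcyl x0 t0 p R 1))"
    by (rule emeasure_eq_ennreal_measure) (use emeasure_bounded_finite[OF compact_imp_bounded[OF pcyl_compact[of x0 t0 p R 1]]] in auto)
qed

lemma pcyl_small:
  assumes "d > 0" "p \<ge> 1" obtains \<rho> where "0 < \<rho>" "\<And>R z r. 0 < R \<Longrightarrow> R < \<rho> \<Longrightarrow> r \<le> 1 \<Longrightarrow> pcyl (fst z) (snd z) p R r \<subseteq> ball (z :: 'a::euclidean_space \<times> real) d"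
proof (rule that)
  show "0 < min 1 (d / 2)" using assms by simp
  fix R r :: real and z :: "'a \<times> real" assume R: "0 < R" "R < min 1 (d / 2)" and r: "r \<le> 1"
  show "pcyl (fst z) (snd z) p R r \<subseteq> ball z d"
  proof
    fix w assume w: "w \<in> pcyl (fst z) (snd z) p R r"
    have "dist (fst z) (fst w) \<le> R * r" "dist (snd z) (snd w) \<le> R powr p * r" using w by (auto simp: pcyl_def)
    moreover have "R * r \<le> R * 1" using R r by (intro mult_left_mono) auto
    moreover have "R powr p * r \<le> R powr p * 1" using r by (intro mult_left_mono) auto
    moreover have "R powr p \<le> R" using powr_mono'[of 1 p R] R assms by simp
    ultimately have "dist (fst z) (fst w) \<le> R" "dist (snd z) (snd w) \<le> R" using R by linarith+
    moreover have "dist z w \<le> dist (fst z) (fst w) + dist (snd z) (snd w)"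
      by (cases z; cases w) (auto simp: dist_prod_def intro: sqrt_sum_squares_le_sum)
    ultimately show "w \<in> ball z d" using R by simp
  qed
qed

lemma superpair_lsc_AE:
  fixes u :: "'a::euclidean_space \<times> real \<Rightarrow> real"
  assumes p: "p > 2" and U: "open U" and S: "superpair U p u g" and u0: "\<And>z. 0 \<le> u z"
  shows "AE z in lborel. z \<in> U \<longrightarrow> (\<forall>c. 0 < c \<and> c < u z \<longrightarrow> (\<exists>R>0. AE w in lborel. w \<in> pcyl (fst z) (snd z) p R (1/2) \<longrightarrow> c \<le> u w))"
proof -
  have [measurable]: "u \<in> borel_measurable borel" using S by (auto simp: superpair_def)
  define good where "good z \<longleftrightarrow> (\<forall>c. 0 < c \<and> c < u z \<longrightarrow> (\<exists>R>0. AE w in lborel. w \<in> pcyl (fst z) (snd z) p R (1/2) \<longrightarrow> c \<le> u w))" for z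
  have loc: "AE z in lborel. z \<in> K \<longrightarrow> good z" if K: "compact K" "K \<subseteq> U" for K
  proof -
    obtain e0 C' where e0: "e0 > 0" "compact C'" "C' \<subseteq> U" "\<And>x. x \<in> K \<Longrightarrow> cball x e0 \<subseteq> C'"
      using compact_neighbourhood[OF K(1) U K(2)] by metis
    obtain \<rho>0 where \<rho>0: "0 < \<rho>0" "\<And>R z r. 0 < R \<Longrightarrow> R < \<rho>0 \<Longrightarrow> r \<le> 1 \<Longrightarrow> pcyl (fst z) (snd z) p R r \<subseteq> ball (z :: 'a \<times> real) e0"
      using pcyl_small[OF e0(1), of p] p by auto
    have [measurable]: "C' \<in> sets borel" using e0 borel_compact by blast
    define f where "f z = indicator C' z * u z" for z
    have [measurable]: "f \<in> borel_measurable borel" unfolding f_def[abs_def] by measurable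
    have fi: "integrable lborel f"
      by (rule Bochner_Integration.integrable_bound[OF superpair_local(1)[OF S p e0(2,3)]]) (auto simp: f_def indicator_def)
    define \<kappa> where "\<kappa> R h = indicator (pcyl (0::'a) 0 p R 1) h / ennreal (measure lborel (pcyl (0::'a) 0 p R 1))" for R h
    define a where "a R z = (\<integral>\<^sup>+h. \<kappa> R h * ennreal (norm (f (z + h) - f z)) \<partial>lborel)" for R z
    have pb[measurable]: "pcyl (0::'a) 0 p R 1 \<in> sets borel" for R using pcyl_compact borel_compact by blast
    have \<kappa>m[measurable]: "\<kappa> R \<in> borel_measurable borel" for R unfolding \<kappa>_def[abs_def] by measurable
    have mp: "measure lborel (pcyl (0::'a) 0 p R 1) > 0" if "R > 0" for R
      unfolding measure_pcyl(1)[OF that] using content_ball_pos[of 1 "0::'a"] that by simp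
    have "\<exists>R. 0 < R \<and> R < \<rho>0 \<and> (\<integral>\<^sup>+z. a R z \<partial>lborel) \<le> ennreal ((1/2) ^ j)" for j :: nat
    proof -
      obtain d where d: "d > 0" "\<And>\<kappa>. \<kappa> \<in> borel_measurable borel \<Longrightarrow> (\<And>h. \<kappa> h \<noteq> 0 \<Longrightarrow> norm h < d) \<Longrightarrow> (\<integral>\<^sup>+h. \<kappa> h \<partial>lborel) \<le> 1 \<Longrightarrow>
         (\<integral>\<^sup>+z. (\<integral>\<^sup>+h. \<kappa> h * ennreal (norm (f (z + h) - f z)) \<partial>lborel) \<partial>lborel) \<le> ennreal ((1/2) ^ j)"
        using kernel_average_L1[OF fi, of "(1/2) ^ j"] by auto
      obtain \<rho> where \<rho>: "0 < \<rho>" "\<And>R z r. 0 < R \<Longrightarrow> R < \<rho> \<Longrightarrow> r \<le> 1 \<Longrightarrow> pcyl (fst z) (snd z) p R r \<subseteq> ball (z :: 'a \<times> real) d"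
        using pcyl_small[OF d(1), of p] p by auto
      define R where "R = min \<rho> \<rho>0 / 2"
      have R: "0 < R" "R < \<rho>" "R < \<rho>0" using \<rho>(1) \<rho>0(1) by (auto simp: R_def min_def)
      have "(\<integral>\<^sup>+z. a R z \<partial>lborel) \<le> ennreal ((1/2) ^ j)" unfolding a_def
      proof (rule d(2))
        show "norm h < d" if "\<kappa> R h \<noteq> 0" for h
        proof -
          have "h \<in> pcyl 0 0 p R 1" using that by (auto simp: \<kappa>_def indicator_def split: if_splits)
          then have "h \<in> ball 0 d" using \<rho>(2)[OF R(1,2), of 1 0] by auto
          then show ?thesis by simp
        qed
        have "(\<integral>\<^sup>+h. \<kappa> R h \<partial>lborel) = emeasure lborel (pcyl (0::'a) 0 p R 1) / ennreal (measure lborel (pcyl (0::'a) 0 p R 1))"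
          unfolding \<kappa>_def by (subst nn_integral_divide) auto
        also have "\<dots> = 1" unfolding measure_pcyl(2)[OF R(1)] using mp[OF R(1)] by (intro ennreal_divide_self) auto
        finally show "(\<integral>\<^sup>+h. \<kappa> R h \<partial>lborel) \<le> 1" by simp
      qed measurable
      then show ?thesis using R by blast
    qed
    then obtain R where R: "\<And>j. 0 < R j" "\<And>j. R j < \<rho>0" "\<And>j::nat. (\<integral>\<^sup>+z. a (R j) z \<partial>lborel) \<le> ennreal ((1/2) ^ j)" by metis
    have am: "(\<lambda>z. a (R j) z) \<in> borel_measurable borel" for j unfolding a_def
      by (rule lborel.borel_measurable_nn_integral) measurable
    note [measurable] = am
    have "(\<integral>\<^sup>+z. (\<Sum>j. a (R j) z) \<partial>lborel) = (\<Sum>j. (\<integral>\<^sup>+z. a (R j) z \<partial>lborel))" by (rule nn_integral_suminf) measurable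
    also have "\<dots> \<le> (\<Sum>j. ennreal ((1/2) ^ j))" by (intro suminf_le R) auto
    also have "\<dots> = ennreal (\<Sum>j. (1/2) ^ j)" by (rule suminf_ennreal2) (auto simp: summable_geometric)
    also have "\<dots> < \<infinity>" by simp
    finally have "AE z in lborel. (\<Sum>j. a (R j) z) < \<infinity>" by (intro finite_nn_integral_imp_ae_finite) measurable
    then show ?thesis
    proof (rule eventually_mono, intro impI)
      fix z assume fin: "(\<Sum>j. a (R j) z) < \<infinity>" and zK: "z \<in> K"
      have afin: "a (R j) z < \<infinity>" for j
      proof -
        have "a (R j) z \<le> (\<Sum>j. a (R j) z)" by (rule order_trans[OF _ sum_le_suminf[OF summableI, of "{j}"]]) simp_all
        then show ?thesis using fin by (rule le_less_trans)
      qed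
      have "summable (\<lambda>j. enn2real (a (R j) z))"
      proof (rule summable_suminf_not_top)
        have "(\<Sum>j. ennreal (enn2real (a (R j) z))) = (\<Sum>j. a (R j) z)" using afin by simp
        then show "(\<Sum>j. ennreal (enn2real (a (R j) z))) \<noteq> top" using fin by auto
      qed auto
      then have a0: "(\<lambda>j. enn2real (a (R j) z)) \<longlonglongrightarrow> 0" by (rule summable_LIMSEQ_zero)
      have "z \<in> C'" by (rule subsetD[OF e0(4)[OF zK]]) (use e0(1) in simp)
      then have fz: "f z = u z" by (simp add: f_def)
      show "good z" unfolding good_def
      proof (intro allI impI, elim conjE)
        fix c assume c: "0 < c" "c < u z"
        define k where "k = (c + u z) / 2"
        have k: "c < k" "k < u z" using c by (auto simp: k_def)
        obtain \<nu> where \<nu>: "\<nu> > 0" "\<And>U u g (x0::'a) t0 R. open U \<Longrightarrow> superpair U p u g \<Longrightarrow> (\<And>z. 0 \<le> u z) \<Longrightarrow> R > 0 \<Longrightarrow> pcyl x0 t0 p R 1 \<subseteq> U \<Longrightarrow>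
           measure lborel (pcyl x0 t0 p R 1 \<inter> {z. u z < k}) \<le> \<nu> * (R ^ DIM('a) * R powr p) \<Longrightarrow>
           AE z in lborel. z \<in> pcyl x0 t0 p R (1/2) \<longrightarrow> c \<le> u z"
          using de_giorgi[OF p c(1) k(1)] by blast
        define \<beta> where "\<beta> = 2 * measure lborel (ball (0::'a) 1)"
        have \<beta>: "\<beta> > 0" unfolding \<beta>_def using content_ball_pos[of 1 "0::'a"] by simp
        have "\<forall>\<^sub>F j in sequentially. enn2real (a (R j) z) < \<nu> * (u z - k) / \<beta>"
          using a0 \<nu>(1) k \<beta> by (intro order_tendstoD(2)) auto
        then obtain j where j: "enn2real (a (R j) z) < \<nu> * (u z - k) / \<beta>" using eventually_happens'[OF sequentially_bot] by blast
        define Q where "Q = pcyl (fst z) (snd z) p (R j) 1"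
        define Q0 where "Q0 = pcyl (0::'a) 0 p (R j) 1"
        have [measurable]: "Q \<in> sets borel" "Q0 \<in> sets borel" unfolding Q_def Q0_def using pcyl_compact borel_compact by blast+
        have QC: "Q \<subseteq> C'"
        proof -
          have "Q \<subseteq> ball z e0" unfolding Q_def by (rule \<rho>0(2)[OF R(1,2)]) simp
          then show ?thesis using e0(4)[OF zK] ball_subset_cball[of z e0] by blast
        qed
        define V where "V = Q \<inter> {w. u w < k}"
        have [measurable]: "V \<in> sets borel" unfolding V_def by measurable
        have "ennreal (u z - k) * emeasure lborel V = (\<integral>\<^sup>+w. ennreal (u z - k) * indicator V w \<partial>lborel)" by (rule nn_integral_cmult_indicator[symmetric]) simp
        also have "\<dots> \<le> (\<integral>\<^sup>+w. indicator Q w * ennreal (norm (f w - f z)) \<partial>lborel)"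
        proof (rule nn_integral_mono)
          fix w
          show "ennreal (u z - k) * indicator V w \<le> indicator Q w * ennreal (norm (f w - f z))"
          proof (cases "w \<in> V")
            case True
            then have "w \<in> Q" "u w < k" "f w = u w" using QC by (auto simp: V_def f_def)
            then show ?thesis using True k fz by (simp add: ennreal_leI)
          qed simp
        qed
        also have "\<dots> = (\<integral>\<^sup>+h. indicator Q (h + z) * ennreal (norm (f (h + z) - f z)) \<partial>lborel)"
          by (rule lborel_nn_integral_translation[symmetric]) measurable
        also have "\<dots> = (\<integral>\<^sup>+h. ennreal (measure lborel Q0) * (\<kappa> (R j) h * ennreal (norm (f (z + h) - f z))) \<partial>lborel)"
        proof (rule nn_integral_cong)
          fix h
          have "indicator Q (h + z) = (indicator Q0 h :: ennreal)" unfolding Q_def Q0_def by (simp add: indicator_def pcyl_translate)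
          moreover have "ennreal (measure lborel Q0) * \<kappa> (R j) h = indicator Q0 h"
            unfolding \<kappa>_def Q0_def[symmetric] using mp[OF R(1), of j] unfolding Q0_def[symmetric]
            by (cases "h \<in> Q0") (auto simp: ennreal_times_divide intro: ennreal_divide_self)
          ultimately show "indicator Q (h + z) * ennreal (norm (f (h + z) - f z)) = ennreal (measure lborel Q0) * (\<kappa> (R j) h * ennreal (norm (f (z + h) - f z)))"
            by (simp add: mult.assoc[symmetric] add.commute)
        qed
        also have "\<dots> = ennreal (measure lborel Q0) * a (R j) z" unfolding a_def by (rule nn_integral_cmult) measurable
        also have "a (R j) z = ennreal (enn2real (a (R j) z))" using afin[of j] by simp
        also have "ennreal (measure lborel Q0) * ennreal (enn2real (a (R j) z)) \<le> ennreal (measure lborel Q0) * ennreal (\<nu> * (u z - k) / \<beta>)"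
          using j by (intro mult_left_mono ennreal_leI) auto
        finally have "ennreal (u z - k) * emeasure lborel V \<le> ennreal (measure lborel Q0) * ennreal (\<nu> * (u z - k) / \<beta>)" .
        moreover have "emeasure lborel V = ennreal (measure lborel V)"
          by (rule emeasure_eq_ennreal_measure) (use emeasure_bounded_finite[OF bounded_subset[OF compact_imp_bounded[OF pcyl_compact], of V "fst z" "snd z" p "R j" 1]] in \<open>auto simp: V_def Q_def\<close>)
        ultimately have "ennreal ((u z - k) * measure lborel V) \<le> ennreal (measure lborel Q0 * (\<nu> * (u z - k) / \<beta>))"
          using ennreal_mult[of "u z - k" "measure lborel V"] ennreal_mult[of "measure lborel Q0" "\<nu> * (u z - k) / \<beta>"] k \<nu>(1) \<beta> by simp
        then have "(u z - k) * measure lborel V \<le> measure lborel Q0 * (\<nu> * (u z - k) / \<beta>)"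
          using \<nu>(1) k \<beta> by (subst (asm) ennreal_le_iff) auto
        also have "measure lborel Q0 = \<beta> * (R j ^ DIM('a) * R j powr p)" unfolding Q0_def \<beta>_def by (rule measure_pcyl(1)[OF R(1)])
        also have "\<beta> * (R j ^ DIM('a) * R j powr p) * (\<nu> * (u z - k) / \<beta>) = (u z - k) * (\<nu> * (R j ^ DIM('a) * R j powr p))" using \<beta> by simp
        finally have "measure lborel V \<le> \<nu> * (R j ^ DIM('a) * R j powr p)" using k by simp
        then have "AE w in lborel. w \<in> pcyl (fst z) (snd z) p (R j) (1/2) \<longrightarrow> c \<le> u w"
          unfolding V_def Q_def using QC e0(3) by (intro \<nu>(2)[OF U S u0 R(1)]) (auto simp: Q_def)
        then show "\<exists>R>0. AE w in lborel. w \<in> pcyl (fst z) (snd z) p R (1/2) \<longrightarrow> c \<le> u w" using R(1) by blast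
      qed
    qed
  qed
  obtain Ck :: "nat \<Rightarrow> ('a \<times> real) set" where Ck: "\<And>n. compact (Ck n)" "\<And>n. Ck n \<subseteq> U" "\<Union>(range Ck) = U"
    using open_Union_compact_subsets[OF U] by metis
  have "AE z in lborel. \<forall>n. z \<in> Ck n \<longrightarrow> good z" unfolding AE_all_countable using loc[OF Ck(1,2)] by blast
  then show ?thesis unfolding good_def[symmetric] by (rule eventually_mono) (use Ck(3) in blast)
qed

section \<open>Essential lower limits\<close>

lemma lebesgue_AE_transfer:
  fixes F F' :: "'e::euclidean_space \<Rightarrow> 'b::euclidean_space"
  assumes F': "F' \<in> borel_measurable borel" and ae: "AE z in lebesgue. F z = F' z"
  shows "F \<in> borel_measurable lebesgue" "integrable lebesgue F \<longleftrightarrow> integrable lborel F'" "(\<integral>z. F z \<partial>lebesgue) = (\<integral>z. F' z \<partial>lborel)"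
proof -
  have m': "F' \<in> borel_measurable lborel" using F' by simp
  then have m: "F' \<in> borel_measurable lebesgue" by (rule measurable_completion)
  show mF: "F \<in> borel_measurable lebesgue" by (rule borel_measurable_AE[OF m]) (rule eventually_mono[OF ae], simp)
  have "integrable lebesgue F \<longleftrightarrow> integrable lebesgue F'" by (rule integrable_cong_AE[OF mF m ae])
  then show "integrable lebesgue F \<longleftrightarrow> integrable lborel F'" using integrable_completion[OF m'] by simp
  have "(\<integral>z. F z \<partial>lebesgue) = (\<integral>z. F' z \<partial>lebesgue)" by (rule integral_cong_AE[OF mF m ae])
  then show "(\<integral>z. F z \<partial>lebesgue) = (\<integral>z. F' z \<partial>lborel)" using integral_completion[OF m'] by simp
qed

lemma open_cyl: "open \<Omega> \<Longrightarrow> open (cyl \<Omega> T)" by (simp add: cyl_def open_Times)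

lemma superpair_iff_weak:
  fixes u u' :: "'a::euclidean_space \<times> real \<Rightarrow> real" and g g' :: "'a \<times> real \<Rightarrow> 'a"
  assumes O: "open \<Omega>" and m[measurable]: "u' \<in> borel_measurable borel" "g' \<in> borel_measurable borel"
    and ae: "AE z in lebesgue. z \<in> cyl \<Omega> T \<longrightarrow> u z = u' z" "AE z in lebesgue. z \<in> cyl \<Omega> T \<longrightarrow> g z = g' z"
  shows "superpair (cyl \<Omega> T) p u' g' \<longleftrightarrow> weak_grad_loc \<Omega> T p u g \<and>
        (\<forall>\<phi>. test_fun (cyl \<Omega> T) \<phi> \<and> (\<forall>z. 0 \<le> \<phi> z) \<longrightarrow>
           (\<integral>z. (norm (g z) powr (p - 2)) * (g z \<bullet> grad_x \<phi> z) - u z * dt \<phi> z \<partial>lebesgue) \<ge> 0)"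
proof -
  have oc: "open (cyl \<Omega> T)" by (rule open_cyl[OF O])
  then have [measurable]: "cyl \<Omega> T \<in> sets borel" by (rule borel_open)
  have sm: "set_borel_measurable lebesgue (cyl \<Omega> T) u" unfolding set_borel_measurable_def
    by (rule lebesgue_AE_transfer(1)[of "\<lambda>z. indicator (cyl \<Omega> T) z *\<^sub>R u' z"], measurable) (use ae(1) in \<open>rule eventually_mono, auto simp: indicator_def\<close>)
  have smg: "set_borel_measurable lebesgue (cyl \<Omega> T) g" unfolding set_borel_measurable_def
    by (rule lebesgue_AE_transfer(1)[of "\<lambda>z. indicator (cyl \<Omega> T) z *\<^sub>R g' z"], measurable) (use ae(2) in \<open>rule eventually_mono, auto simp: indicator_def\<close>)
  have ii: "set_integrable lebesgue K (\<lambda>z. \<bar>u z\<bar> powr p) \<longleftrightarrow> integrable lborel (\<lambda>z. indicator K z * \<bar>u' z\<bar> powr p)"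
     "set_integrable lebesgue K (\<lambda>z. norm (g z) powr p) \<longleftrightarrow> integrable lborel (\<lambda>z. indicator K z * norm (g' z) powr p)"
    if K: "compact K \<and> K \<subseteq> cyl \<Omega> T" for K
  proof -
    have [measurable]: "K \<in> sets borel" using K borel_compact by blast
    show "set_integrable lebesgue K (\<lambda>z. \<bar>u z\<bar> powr p) \<longleftrightarrow> integrable lborel (\<lambda>z. indicator K z * \<bar>u' z\<bar> powr p)"
      unfolding set_integrable_def
      by (rule lebesgue_AE_transfer(2), measurable) (use ae(1) in \<open>rule eventually_mono, use K in \<open>auto simp: indicator_def\<close>\<close>)
    show "set_integrable lebesgue K (\<lambda>z. norm (g z) powr p) \<longleftrightarrow> integrable lborel (\<lambda>z. indicator K z * norm (g' z) powr p)"
      unfolding set_integrable_def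
      by (rule lebesgue_AE_transfer(2), measurable) (use ae(2) in \<open>rule eventually_mono, use K in \<open>auto simp: indicator_def\<close>\<close>)
  qed
  have tt: "(\<integral>z. u z * frechet_derivative \<phi> (at z) v \<partial>lebesgue) = (\<integral>z. u' z * frechet_derivative \<phi> (at z) v \<partial>lborel)"
      "(\<integral>z. (g z \<bullet> b) * \<phi> z \<partial>lebesgue) = (\<integral>z. (g' z \<bullet> b) * \<phi> z \<partial>lborel)"
      "(\<integral>z. (norm (g z) powr (p - 2)) * (g z \<bullet> grad_x \<phi> z) - u z * dt \<phi> z \<partial>lebesgue) = (\<integral>z. Aflux p (g' z) \<bullet> grad_x \<phi> z - u' z * dt \<phi> z \<partial>lborel)"
    if t: "test_fun (cyl \<Omega> T) \<phi>" for \<phi> b v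
  proof -
    obtain D K where DK: "C1 \<phi> D" "compact K" "K \<subseteq> cyl \<Omega> T" "\<And>z. z \<notin> K \<Longrightarrow> \<phi> z = 0" "D = (\<lambda>z. frechet_derivative \<phi> (at z))"
      by (rule test_funE[OF t]) blast
    have D0: "frechet_derivative \<phi> (at z) v = 0" "\<phi> z = 0" if "z \<notin> cyl \<Omega> T" for z v
      using C1_D_zero[OF DK(1) compact_imp_closed[OF DK(2)] _ , of z v] DK(3,5) DK(4)[of z] DK(4) that by blast+
    have gx: "grad_x \<phi> = gradD D" "dt \<phi> = (\<lambda>z. D z (0, 1))" by (auto simp: grad_x_def[abs_def] gradD_def[abs_def] dt_def[abs_def] DK(5))
    have [measurable]: "\<phi> \<in> borel_measurable borel" using C1_cont[OF DK(1)] by (rule borel_measurable_continuous_onI)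
    have Dm[measurable]: "(\<lambda>z. frechet_derivative \<phi> (at z) v) \<in> borel_measurable borel" for v
      using C1_cont_D[OF DK(1), of v] unfolding DK(5) by (rule borel_measurable_continuous_onI)
    have [measurable]: "grad_x \<phi> \<in> borel_measurable borel" unfolding gx by (rule gradD_measurable[OF DK(1)])
    have [measurable]: "dt \<phi> \<in> borel_measurable borel" unfolding dt_def[abs_def] by (rule Dm)
    have g0: "grad_x \<phi> z = 0" "dt \<phi> z = 0" if "z \<notin> cyl \<Omega> T" for z using D0[OF that] by (simp_all add: grad_x_def dt_def)
    show "(\<integral>z. u z * frechet_derivative \<phi> (at z) v \<partial>lebesgue) = (\<integral>z. u' z * frechet_derivative \<phi> (at z) v \<partial>lborel)"
      by (rule lebesgue_AE_transfer(3), measurable) (use ae(1) in \<open>rule eventually_mono, metis D0(1) mult_zero_right\<close>)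
    show "(\<integral>z. (g z \<bullet> b) * \<phi> z \<partial>lebesgue) = (\<integral>z. (g' z \<bullet> b) * \<phi> z \<partial>lborel)"
      by (rule lebesgue_AE_transfer(3), measurable) (use ae(2) in \<open>rule eventually_mono, metis D0(2) mult_zero_right\<close>)
    show "(\<integral>z. (norm (g z) powr (p - 2)) * (g z \<bullet> grad_x \<phi> z) - u z * dt \<phi> z \<partial>lebesgue) = (\<integral>z. Aflux p (g' z) \<bullet> grad_x \<phi> z - u' z * dt \<phi> z \<partial>lborel)"
    proof (rule lebesgue_AE_transfer(3))
      show "AE z in lebesgue. (norm (g z) powr (p - 2)) * (g z \<bullet> grad_x \<phi> z) - u z * dt \<phi> z = Aflux p (g' z) \<bullet> grad_x \<phi> z - u' z * dt \<phi> z"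
        using ae by eventually_elim (use g0 in \<open>auto simp: Aflux_def\<close>)
    qed measurable
  qed
  show ?thesis
    unfolding superpair_def weak_grad_loc_def using sm smg m ii tt by auto
qed

lemma weak_supersolE:
  fixes u :: "'a::euclidean_space \<times> real \<Rightarrow> real"
  assumes O: "open \<Omega>" and W: "weak_supersol \<Omega> T p u"
  obtains u' g' where "superpair (cyl \<Omega> T) p u' g'" "AE z in lebesgue. z \<in> cyl \<Omega> T \<longrightarrow> u z = u' z"
proof -
  obtain g where g: "weak_grad_loc \<Omega> T p u g"
     "\<forall>\<phi>. test_fun (cyl \<Omega> T) \<phi> \<and> (\<forall>z. 0 \<le> \<phi> z) \<longrightarrow>
           (\<integral>z. (norm (g z) powr (p - 2)) * (g z \<bullet> grad_x \<phi> z) - u z * dt \<phi> z \<partial>lebesgue) \<ge> 0"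
    using W unfolding weak_supersol_def by blast
  define U where "U = cyl \<Omega> T"
  have um: "(\<lambda>z. indicator U z *\<^sub>R u z) \<in> borel_measurable lebesgue" and gm: "(\<lambda>z. indicator U z *\<^sub>R g z) \<in> borel_measurable lebesgue"
    using g(1) by (auto simp: weak_grad_loc_def set_borel_measurable_def U_def)
  obtain u' where u': "u' \<in> borel_measurable lborel" "AE z in lborel. indicator U z *\<^sub>R u z = u' z"
    using completion_ex_borel_measurable_real[OF um] by blast
  have "\<exists>h\<in>borel_measurable lborel. AE z in lborel. (indicator U z *\<^sub>R g z) \<bullet> b = h z" for b
    by (rule completion_ex_borel_measurable_real) (use gm in measurable)
  then obtain h where h: "\<And>b. h b \<in> borel_measurable lborel" "\<And>b. AE z in lborel. (indicator U z *\<^sub>R g z) \<bullet> b = h b z" by metis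
  define g' where "g' z = (\<Sum>b\<in>Basis. h b z *\<^sub>R b)" for z
  have [measurable]: "h b \<in> borel_measurable borel" for b using h(1)[of b] by simp
  have g'm: "g' \<in> borel_measurable borel" unfolding g'_def[abs_def] by measurable
  have "AE z in lborel. \<forall>b\<in>Basis. (indicator U z *\<^sub>R g z) \<bullet> b = h b z" by (rule AE_finite_allI) (use h(2) in auto)
  then have "AE z in lborel. z \<in> U \<longrightarrow> g z = g' z"
  proof (rule eventually_mono, intro impI)
    fix z assume a: "\<forall>b\<in>Basis. (indicator U z *\<^sub>R g z) \<bullet> b = h b z" "z \<in> U"
    then have "g' z = (\<Sum>b\<in>Basis. (g z \<bullet> b) *\<^sub>R b)" unfolding g'_def by (intro sum.cong) auto
    then show "g z = g' z" by (simp add: euclidean_representation)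
  qed
  then have gae: "AE z in lebesgue. z \<in> U \<longrightarrow> g z = g' z" by (rule AE_completion)
  have "AE z in lborel. z \<in> U \<longrightarrow> u z = u' z" using u'(2) by (rule eventually_mono) auto
  then have uae: "AE z in lebesgue. z \<in> U \<longrightarrow> u z = u' z" by (rule AE_completion)
  have "superpair U p u' g'" unfolding U_def
    by (subst superpair_iff_weak[OF O _ g'm uae[unfolded U_def] gae[unfolded U_def]]) (use g u'(1) in auto)
  then show ?thesis using uae that unfolding U_def by blast
qed

lemma superpair_imp_weak_supersol:
  assumes "open \<Omega>" "superpair (cyl \<Omega> T) p u' g'" "AE z in lebesgue. z \<in> cyl \<Omega> T \<longrightarrow> u z = u' z"
  shows "weak_supersol \<Omega> T p u"
proof -
  have "u' \<in> borel_measurable borel" "g' \<in> borel_measurable borel" using assms(2) by (auto simp: superpair_def)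
  then show ?thesis using superpair_iff_weak[OF assms(1) _ _ assms(3), of g' g' p] assms(2) unfolding weak_supersol_def by blast
qed

lemma weak_supersol_boundedE:
  fixes u :: "'a::euclidean_space \<times> real \<Rightarrow> real"
  assumes O: "open \<Omega>" and W: "weak_supersol \<Omega> T p u" and M: "0 \<le> M" and b: "\<And>z. z \<in> cyl \<Omega> T \<Longrightarrow> 0 \<le> u z \<and> u z \<le> M"
  obtains u' g' where "superpair (cyl \<Omega> T) p u' g'" "AE z in lebesgue. z \<in> cyl \<Omega> T \<longrightarrow> u z = u' z" "\<And>z. 0 \<le> u' z" "\<And>z. u' z \<le> M"
proof -
  obtain u' g' where u': "superpair (cyl \<Omega> T) p u' g'" and ae: "AE z in lebesgue. z \<in> cyl \<Omega> T \<longrightarrow> u z = u' z" by (rule weak_supersolE[OF O W])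
  have m[measurable]: "u' \<in> borel_measurable borel" "g' \<in> borel_measurable borel" using u' by (auto simp: superpair_def)
  define v where "v z = max 0 (min M (u' z))" for z
  have vm: "v \<in> borel_measurable borel" unfolding v_def[abs_def] by measurable
  have ae': "AE z in lebesgue. z \<in> cyl \<Omega> T \<longrightarrow> u z = v z" using ae by (rule eventually_mono) (auto simp: v_def dest: b)
  have "superpair (cyl \<Omega> T) p v g'"
    using superpair_iff_weak[OF O m ae, of g' p] superpair_iff_weak[OF O vm m(2) ae', of g' p] u' by simp
  then show ?thesis by (rule that[OF _ ae']) (use M in \<open>auto simp: v_def\<close>)
qed

lemma Qcyl_mono: "0 < r \<Longrightarrow> r \<le> s \<Longrightarrow> 0 < p \<Longrightarrow> Qcyl p r z \<subseteq> Qcyl p s z"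
proof -
  assume a: "0 < r" "r \<le> s" "0 < p"
  have "r powr p \<le> s powr p" using a by (intro powr_mono2) auto
  then show ?thesis using a by (auto simp: Qcyl_def)
qed

lemma ess_inf_on_mono:
  assumes "A \<subseteq> B" "AE z in lebesgue. z \<in> A \<longrightarrow> f z \<le> h z"
  shows "ess_inf_on f B \<le> ess_inf_on h A"
  unfolding ess_inf_on_def
proof (rule Sup_subset_mono, rule subsetI, rule CollectI, drule CollectD)
  fix c assume "AE z in lebesgue. z \<in> B \<longrightarrow> c \<le> ereal (f z)"
  with assms(2) show "AE z in lebesgue. z \<in> A \<longrightarrow> c \<le> ereal (h z)"
    by eventually_elim (use assms(1) in \<open>auto intro: order_trans\<close>)
qed

lemma ess_liminf_e_eq_SUP:
  assumes p: "p > 0"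
  shows "ess_liminf_e \<Omega> T p f z = (SUP r\<in>{0<..}. ess_inf_on f (Qcyl p r z \<inter> cyl \<Omega> T))"
proof -
  define E where "E r = ess_inf_on f (Qcyl p r z \<inter> cyl \<Omega> T)" for r
  have mono: "E s \<le> E r" if "0 < r" "r \<le> s" for r s
    unfolding E_def using Qcyl_mono[OF that p, of z] by (intro ess_inf_on_mono) auto
  have "(E \<longlongrightarrow> (SUP r\<in>{0<..}. E r)) (at_right 0)"
  proof (rule order_tendstoI)
    fix a assume "a < (SUP r\<in>{0<..}. E r)"
    then obtain s where s: "0 < s" "a < E s" by (auto simp: less_SUP_iff)
    have "\<forall>\<^sub>F r in at_right 0. r \<in> {0<..<s}" by (rule eventually_at_right_real[OF s(1)])
    then show "\<forall>\<^sub>F r in at_right 0. a < E r" by (rule eventually_mono) (use s(2) mono[of _ s] in \<open>auto intro: less_le_trans\<close>)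
  next
    fix a assume a: "(SUP r\<in>{0<..}. E r) < a"
    have "\<forall>\<^sub>F r in at_right (0::real). r \<in> {0<..<1}" by (rule eventually_at_right_real) simp
    then show "\<forall>\<^sub>F r in at_right 0. E r < a" by (rule eventually_mono) (use a in \<open>auto intro: le_less_trans[OF SUP_upper]\<close>)
  qed
  then show ?thesis unfolding ess_liminf_e_def E_def by (intro tendsto_Lim) auto
qed

lemma ess_liminf_e_mono:
  assumes "p > 0" "AE z in lebesgue. z \<in> cyl \<Omega> T \<longrightarrow> f z \<le> h z"
  shows "ess_liminf_e \<Omega> T p f z \<le> ess_liminf_e \<Omega> T p h z"
  unfolding ess_liminf_e_eq_SUP[OF assms(1)]
  by (intro SUP_mono' ess_inf_on_mono order_refl) (use assms(2) in \<open>rule eventually_mono, blast\<close>)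

lemma ess_liminf_e_cong:
  assumes "p > 0" "AE z in lebesgue. z \<in> cyl \<Omega> T \<longrightarrow> f z = h z"
  shows "ess_liminf_e \<Omega> T p f z = ess_liminf_e \<Omega> T p h z"
  by (rule antisym; rule ess_liminf_e_mono[OF assms(1)]; rule eventually_mono[OF assms(2)]) simp_all

lemma less_ess_liminf_eD:
  assumes "p > 0" "ereal c < ess_liminf_e \<Omega> T p f z"
  shows "\<exists>r>0. AE w in lebesgue. w \<in> Qcyl p r z \<inter> cyl \<Omega> T \<longrightarrow> c \<le> f w"
proof -
  obtain r where r: "r > 0" "ereal c < ess_inf_on f (Qcyl p r z \<inter> cyl \<Omega> T)"
    using assms(2) unfolding ess_liminf_e_eq_SUP[OF assms(1)] by (auto simp: less_SUP_iff)
  then obtain d where d: "ereal c < d" "AE w in lebesgue. w \<in> Qcyl p r z \<inter> cyl \<Omega> T \<longrightarrow> d \<le> ereal (f w)"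
    unfolding ess_inf_on_def less_Sup_iff by auto
  have "AE w in lebesgue. w \<in> Qcyl p r z \<inter> cyl \<Omega> T \<longrightarrow> c \<le> f w"
    using d(2)
  proof (rule eventually_mono, intro impI)
    fix w assume "w \<in> Qcyl p r z \<inter> cyl \<Omega> T \<longrightarrow> d \<le> ereal (f w)" "w \<in> Qcyl p r z \<inter> cyl \<Omega> T"
    then have "ereal c < ereal (f w)" using less_le_trans[OF d(1)] by blast
    then show "c \<le> f w" by simp
  qed
  then show ?thesis using r(1) by blast
qed

lemma ess_liminf_e_geI:
  assumes "p > 0" "r > 0" "AE w in lebesgue. w \<in> Qcyl p r z \<inter> cyl \<Omega> T \<longrightarrow> c \<le> f w"
  shows "ereal c \<le> ess_liminf_e \<Omega> T p f z"
proof -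
  have "ereal c \<le> ess_inf_on f (Qcyl p r z \<inter> cyl \<Omega> T)" unfolding ess_inf_on_def using assms(3) by (intro Sup_upper) simp
  also have "\<dots> \<le> ess_liminf_e \<Omega> T p f z" unfolding ess_liminf_e_eq_SUP[OF assms(1)] using assms(2) by (intro SUP_upper) auto
  finally show ?thesis .
qed

lemma ess_liminf_e_ge_const:
  assumes "p > 0" "AE w in lebesgue. w \<in> cyl \<Omega> T \<longrightarrow> c \<le> f w"
  shows "ereal c \<le> ess_liminf_e \<Omega> T p f z"
  by (rule ess_liminf_e_geI[OF assms(1), of 1]) (simp, rule eventually_mono[OF assms(2)], simp)

lemma open_Qcyl: "open (Qcyl p r z)" by (simp add: Qcyl_def open_Times)

lemma centre_in_Qcyl: "r > 0 \<Longrightarrow> z \<in> Qcyl p r z" by (cases z) (auto simp: Qcyl_def)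

lemma not_AE_not_in_open:
  assumes "open S" "(z::'e::euclidean_space) \<in> S" shows "\<not> (AE w in lebesgue. w \<notin> S)"
proof
  assume "AE w in lebesgue. w \<notin> S"
  then have "S \<in> null_sets lebesgue" using assms(1) by (subst AE_iff_null_sets) auto
  then have "negligible S" by (simp add: negligible_iff_null_sets)
  then show False using open_not_negligible[OF assms(1)] assms(2) by auto
qed

lemma ess_liminf_e_le_const:
  assumes p: "p > 0" and O: "open \<Omega>" and z: "z \<in> cyl \<Omega> T" and f: "AE w in lebesgue. w \<in> cyl \<Omega> T \<longrightarrow> f w \<le> c"
  shows "ess_liminf_e \<Omega> T p f z \<le> ereal c"
proof (rule ccontr)
  assume "\<not> ?thesis"
  then obtain d where d: "ereal c < ereal d" "ereal d < ess_liminf_e \<Omega> T p f z" using ereal_dense2[of "ereal c"] by (auto simp: not_le)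
  obtain r where r: "r > 0" "AE w in lebesgue. w \<in> Qcyl p r z \<inter> cyl \<Omega> T \<longrightarrow> d \<le> f w"
    using less_ess_liminf_eD[OF p d(2)] by blast
  from r(2) f have "AE w in lebesgue. w \<notin> Qcyl p r z \<inter> cyl \<Omega> T" by eventually_elim (use d(1) in auto)
  then show False using not_AE_not_in_open[of "Qcyl p r z \<inter> cyl \<Omega> T" z] open_Qcyl open_cyl[OF O] centre_in_Qcyl[OF r(1)] z by blast
qed

lemma ess_liminf_e_min:
  assumes p: "p > 0"
  shows "ess_liminf_e \<Omega> T p (\<lambda>z. min (f z) (h z)) z = min (ess_liminf_e \<Omega> T p f z) (ess_liminf_e \<Omega> T p h z)"
proof (rule antisym)
  show "ess_liminf_e \<Omega> T p (\<lambda>z. min (f z) (h z)) z \<le> min (ess_liminf_e \<Omega> T p f z) (ess_liminf_e \<Omega> T p h z)"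
    by (auto intro!: ess_liminf_e_mono[OF p])
  show "min (ess_liminf_e \<Omega> T p f z) (ess_liminf_e \<Omega> T p h z) \<le> ess_liminf_e \<Omega> T p (\<lambda>z. min (f z) (h z)) z"
  proof (rule ccontr)
    assume "\<not> ?thesis"
    then obtain d where d: "ess_liminf_e \<Omega> T p (\<lambda>z. min (f z) (h z)) z < ereal d" "ereal d < ess_liminf_e \<Omega> T p f z" "ereal d < ess_liminf_e \<Omega> T p h z"
      using ereal_dense2[of _ "min (ess_liminf_e \<Omega> T p f z) (ess_liminf_e \<Omega> T p h z)"] by (auto simp: not_le)
    obtain r s where r: "r > 0" "AE w in lebesgue. w \<in> Qcyl p r z \<inter> cyl \<Omega> T \<longrightarrow> d \<le> f w"
      and s: "s > 0" "AE w in lebesgue. w \<in> Qcyl p s z \<inter> cyl \<Omega> T \<longrightarrow> d \<le> h w"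
      using less_ess_liminf_eD[OF p d(2)] less_ess_liminf_eD[OF p d(3)] by blast
    have sub: "Qcyl p (min r s) z \<subseteq> Qcyl p r z" "Qcyl p (min r s) z \<subseteq> Qcyl p s z" by (rule Qcyl_mono; use r(1) s(1) p in simp)+
    from r(2) s(2) have "AE w in lebesgue. w \<in> Qcyl p (min r s) z \<inter> cyl \<Omega> T \<longrightarrow> d \<le> min (f w) (h w)"
      by eventually_elim (use sub in auto)
    then have "ereal d \<le> ess_liminf_e \<Omega> T p (\<lambda>z. min (f z) (h z)) z" using r(1) s(1) by (intro ess_liminf_e_geI[OF p, of "min r s"]) auto
    then show False using d(1) by simp
  qed
qed

lemma ess_liminf_e_le_AE:
  fixes f :: "'a::euclidean_space \<times> real \<Rightarrow> real"
  assumes p: "p > 0" and O: "open \<Omega>"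
  shows "AE z in lebesgue. z \<in> cyl \<Omega> T \<longrightarrow> ess_liminf_e \<Omega> T p f z \<le> ereal (f z)"
proof -
  obtain B :: "('a \<times> real) set set" where B: "countable B" "topological_basis B" using ex_countable_basis by blast
  have "AE z in lebesgue. \<forall>b\<in>B. \<forall>c\<in>\<rat>. (AE w in lebesgue. w \<in> b \<longrightarrow> c \<le> f w) \<longrightarrow> (z \<in> b \<longrightarrow> c \<le> f z)"
  proof (intro AE_ball_countable[THEN iffD2] B(1) countable_rat ballI)
    fix b c
    show "AE z in lebesgue. (AE w in lebesgue. w \<in> b \<longrightarrow> c \<le> f w) \<longrightarrow> (z \<in> b \<longrightarrow> c \<le> f z)"
      by (cases "AE w in lebesgue. w \<in> b \<longrightarrow> c \<le> f w") simp_all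
  qed
  then show ?thesis
  proof (rule eventually_mono, intro impI)
    fix z assume a: "\<forall>b\<in>B. \<forall>c\<in>\<rat>. (AE w in lebesgue. w \<in> b \<longrightarrow> c \<le> f w) \<longrightarrow> (z \<in> b \<longrightarrow> c \<le> f z)" and z: "z \<in> cyl \<Omega> T"
    show "ess_liminf_e \<Omega> T p f z \<le> ereal (f z)"
    proof (rule ccontr)
      assume "\<not> ?thesis"
      then obtain d where d: "ereal (f z) < ereal d" "ereal d < ess_liminf_e \<Omega> T p f z" using ereal_dense2[of "ereal (f z)"] by (auto simp: not_le)
      obtain r where r: "r > 0" "AE w in lebesgue. w \<in> Qcyl p r z \<inter> cyl \<Omega> T \<longrightarrow> d \<le> f w"
        using less_ess_liminf_eD[OF p d(2)] by blast
      obtain c where c: "c \<in> \<rat>" "f z < c" "c < d" using Rats_dense_in_real[of "f z" d] d(1) by auto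
      have "open (Qcyl p r z \<inter> cyl \<Omega> T)" "z \<in> Qcyl p r z \<inter> cyl \<Omega> T"
        using open_Int[OF open_Qcyl open_cyl[OF O]] centre_in_Qcyl[OF r(1)] z by blast+
      then obtain b where b: "b \<in> B" "z \<in> b" "b \<subseteq> Qcyl p r z \<inter> cyl \<Omega> T" using topological_basisE[OF B(2)] by blast
      have "AE w in lebesgue. w \<in> b \<longrightarrow> c \<le> f w" using r(2) by (rule eventually_mono) (use b(3) c(3) in force)
      then show False using a b c by force
    qed
  qed
qed

lemma superpair_ess_liminf_AE:
  fixes u :: "'a::euclidean_space \<times> real \<Rightarrow> real"
  assumes p: "p > 2" and O: "open \<Omega>" and S: "superpair (cyl \<Omega> T) p u g" and u0: "\<And>z. 0 \<le> u z"
  shows "AE z in lebesgue. z \<in> cyl \<Omega> T \<longrightarrow> ess_liminf_e \<Omega> T p u z = ereal (u z)"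
proof -
  have p0: "p > 0" using p by simp
  from ess_liminf_e_le_AE[OF p0 O, of T u] AE_completion[OF superpair_lsc_AE[OF p open_cyl[OF O] S u0]]
  show ?thesis
  proof eventually_elim
    fix z assume le: "z \<in> cyl \<Omega> T \<longrightarrow> ess_liminf_e \<Omega> T p u z \<le> ereal (u z)"
      and lsc: "z \<in> cyl \<Omega> T \<longrightarrow> (\<forall>c. 0 < c \<and> c < u z \<longrightarrow> (\<exists>R>0. AE w in lborel. w \<in> pcyl (fst z) (snd z) p R (1/2) \<longrightarrow> c \<le> u w))"
    show "z \<in> cyl \<Omega> T \<longrightarrow> ess_liminf_e \<Omega> T p u z = ereal (u z)"
    proof (intro impI antisym le[THEN mp])
      assume z: "z \<in> cyl \<Omega> T"
      have e0: "ereal 0 \<le> ess_liminf_e \<Omega> T p u z" by (rule ess_liminf_e_ge_const[OF p0]) (use u0 in simp)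
      show "ereal (u z) \<le> ess_liminf_e \<Omega> T p u z"
      proof (rule ccontr)
        assume "\<not> ?thesis"
        then obtain c where c: "ess_liminf_e \<Omega> T p u z < ereal c" "ereal c < ereal (u z)" using ereal_dense2[of _ "ereal (u z)"] by (auto simp: not_le)
        have "ereal 0 < ereal c" by (rule le_less_trans[OF e0 c(1)])
        then obtain R where R: "R > 0" "AE w in lborel. w \<in> pcyl (fst z) (snd z) p R (1/2) \<longrightarrow> c \<le> u w"
          using lsc z c(2) by auto
        have "(R / 2) powr p = R powr p * (1 / 2) powr p" using R(1) powr_mult[of R "1/2" p] by simp
        also have "\<dots> \<le> R powr p * (1 / 2)" using powr_mono'[of 1 p "1/2"] p by (intro mult_left_mono) auto
        finally have "(R / 2) powr p \<le> R powr p * (1 / 2)" .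
        moreover have "\<bar>snd z - b\<bar> \<le> (R / 2) powr p" if "snd z - (R / 2) powr p < b" "b < snd z + (R / 2) powr p" for b
          using that by (simp add: abs_le_iff)
        ultimately have "\<bar>snd z - b\<bar> * 2 \<le> R powr p" if "snd z - (R / 2) powr p < b" "b < snd z + (R / 2) powr p" for b
          using that by fastforce
        then have "Qcyl p (R / 2) z \<subseteq> pcyl (fst z) (snd z) p R (1/2)" by (auto simp: Qcyl_def pcyl_def dist_real_def)
        then have "AE w in lebesgue. w \<in> Qcyl p (R / 2) z \<inter> cyl \<Omega> T \<longrightarrow> c \<le> u w"
          by (intro eventually_mono[OF AE_completion[OF R(2)]]) blast
        then have "ereal c \<le> ess_liminf_e \<Omega> T p u z" using R(1) by (intro ess_liminf_e_geI[OF p0, of "R / 2"]) auto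
        then show False using c(1) by simp
      qed
    qed
  qed
qed

section \<open>The least solution\<close>

lemma superpair_regularization:
  fixes u :: "'a::euclidean_space \<times> real \<Rightarrow> real"
  assumes p: "p > 2" and O: "open \<Omega>" and S: "superpair (cyl \<Omega> T) p u g" and u: "\<And>z. 0 \<le> u z" "\<And>z. u z \<le> M"
  defines "V \<equiv> ess_liminf_reg \<Omega> T p u"
  shows "weak_supersol \<Omega> T p V" "ess_liminf_regularized \<Omega> T p V" "AE z in lebesgue. z \<in> cyl \<Omega> T \<longrightarrow> V z = u z"
    "\<And>z. z \<in> cyl \<Omega> T \<Longrightarrow> 0 \<le> V z \<and> V z \<le> M"
proof -
  have p0: "p > 0" using p by simp
  have V: "ereal (V z) = ess_liminf_e \<Omega> T p u z \<and> 0 \<le> V z \<and> V z \<le> M" if "z \<in> cyl \<Omega> T" for z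
  proof -
    have "ereal 0 \<le> ess_liminf_e \<Omega> T p u z" by (rule ess_liminf_e_ge_const[OF p0]) (use u in simp)
    moreover have "ess_liminf_e \<Omega> T p u z \<le> ereal M" by (rule ess_liminf_e_le_const[OF p0 O that]) (use u in simp)
    ultimately show ?thesis unfolding V_def ess_liminf_reg_def by (cases "ess_liminf_e \<Omega> T p u z") auto
  qed
  then show "0 \<le> V z \<and> V z \<le> M" if "z \<in> cyl \<Omega> T" for z using that by blast
  show ae: "AE z in lebesgue. z \<in> cyl \<Omega> T \<longrightarrow> V z = u z"
    using superpair_ess_liminf_AE[OF p O S u(1)] by (rule eventually_mono) (use V in force)
  show "weak_supersol \<Omega> T p V" by (rule superpair_imp_weak_supersol[OF O S ae])
  show "ess_liminf_regularized \<Omega> T p V" unfolding ess_liminf_regularized_def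
    using V ess_liminf_e_cong[OF p0 ae] by simp
qed

lemma weak_supersol_min:
  fixes u v :: "'a::euclidean_space \<times> real \<Rightarrow> real"
  assumes p: "p > 2" and O: "open \<Omega>" and "weak_supersol \<Omega> T p u" "weak_supersol \<Omega> T p v"
  shows "weak_supersol \<Omega> T p (\<lambda>z. min (u z) (v z))"
proof -
  obtain u' g' where u': "superpair (cyl \<Omega> T) p u' g'" "AE z in lebesgue. z \<in> cyl \<Omega> T \<longrightarrow> u z = u' z" by (rule weak_supersolE[OF O assms(3)])
  obtain v' h' where v': "superpair (cyl \<Omega> T) p v' h'" "AE z in lebesgue. z \<in> cyl \<Omega> T \<longrightarrow> v z = v' z" by (rule weak_supersolE[OF O assms(4)])
  from u'(2) v'(2) have "AE z in lebesgue. z \<in> cyl \<Omega> T \<longrightarrow> min (u z) (v z) = min (u' z) (v' z)" by eventually_elim simp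
  then show ?thesis by (rule superpair_imp_weak_supersol[OF O superpair_min[OF p open_cyl[OF O] u'(1) v'(1)]])
qed

lemma S_class_min:
  assumes p: "p > 2" and O: "open \<Omega>" and u: "u \<in> S_class \<Omega> T p \<psi>" and v: "v \<in> S_class \<Omega> T p \<psi>"
  shows "(\<lambda>z. min (u z) (v z)) \<in> S_class \<Omega> T p \<psi>"
proof -
  have "ess_liminf_regularized \<Omega> T p (\<lambda>z. min (u z) (v z))"
    unfolding ess_liminf_regularized_def
  proof
    fix z assume z: "z \<in> cyl \<Omega> T"
    have "ess_liminf_e \<Omega> T p (\<lambda>z. min (u z) (v z)) z = min (ess_liminf_e \<Omega> T p u z) (ess_liminf_e \<Omega> T p v z)"
      by (rule ess_liminf_e_min) (use p in simp)
    also have "\<dots> = min (ereal (u z)) (ereal (v z))" using u v z by (auto simp: S_class_def ess_liminf_regularized_def)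
    finally show "ereal (min (u z) (v z)) = ess_liminf_e \<Omega> T p (\<lambda>z. min (u z) (v z)) z" by (simp add: min_def)
  qed
  moreover have "AE z in lebesgue. z \<in> cyl \<Omega> T \<longrightarrow> \<psi> z \<le> u z" "AE z in lebesgue. z \<in> cyl \<Omega> T \<longrightarrow> \<psi> z \<le> v z"
    using u v by (auto simp: S_class_def)
  then have "AE z in lebesgue. z \<in> cyl \<Omega> T \<longrightarrow> \<psi> z \<le> min (u z) (v z)" by eventually_elim simp
  ultimately show ?thesis using weak_supersol_min[OF p O, of T u v] u v by (simp add: S_class_def)
qed

lemma regularized_le:
  assumes p: "p > 0" and f: "ess_liminf_regularized \<Omega> T p f" and h: "ess_liminf_regularized \<Omega> T p h"
    and ae: "AE z in lebesgue. z \<in> cyl \<Omega> T \<longrightarrow> f z \<le> h z" and z: "z \<in> cyl \<Omega> T"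
  shows "f z \<le> h z"
proof -
  have "ereal (f z) \<le> ereal (h z)" using ess_liminf_e_mono[OF p ae, of z] f h z by (simp add: ess_liminf_regularized_def)
  then show ?thesis by simp
qed

lemma const_regularized:
  assumes "p > 0" "open \<Omega>" shows "ess_liminf_regularized \<Omega> T p (\<lambda>z. c)"
  unfolding ess_liminf_regularized_def
proof
  fix z assume "z \<in> cyl \<Omega> T"
  then have "ess_liminf_e \<Omega> T p (\<lambda>z. c) z \<le> ereal c" by (rule ess_liminf_e_le_const[OF assms]) simp
  moreover have "ereal c \<le> ess_liminf_e \<Omega> T p (\<lambda>z. c) z" by (rule ess_liminf_e_ge_const[OF assms(1)]) simp
  ultimately show "ereal c = ess_liminf_e \<Omega> T p (\<lambda>z. c) z" by simp
qed

lemma S_class_least: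
  fixes \<Omega> :: "'a::euclidean_space set" and T p L :: real and \<psi> :: "'a \<times> real \<Rightarrow> real"
  assumes p: "p > 2" and T: "T > 0" and O: "open \<Omega>" and bd: "bounded \<Omega>" and ne: "\<Omega> \<noteq> {}"
    and \<psi>: "\<And>z. z \<in> cyl \<Omega> T \<Longrightarrow> 0 \<le> \<psi> z \<and> \<psi> z \<le> L"
  obtains V where "V \<in> S_class \<Omega> T p \<psi>" "\<And>u z. u \<in> S_class \<Omega> T p \<psi> \<Longrightarrow> z \<in> cyl \<Omega> T \<Longrightarrow> V z \<le> u z"
proof -
  define U where "U = cyl \<Omega> T"
  have p0: "p > 0" using p by simp
  have oU: "open U" unfolding U_def by (rule open_cyl[OF O])
  obtain x where "x \<in> \<Omega>" using ne by blast
  then have "(x, T / 2) \<in> U" using T by (auto simp: U_def cyl_def)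
  then have L: "0 \<le> L" using \<psi>[of "(x, T / 2)"] unfolding U_def by linarith
  have "bounded U" unfolding U_def cyl_def by (intro bounded_Times bd bounded_box[of 0 T, unfolded box_real])
  then have "emeasure lborel U < \<infinity>" by (rule emeasure_bounded_finite)
  then have iU: "integrable lebesgue (indicator U :: _ \<Rightarrow> real)"
    using oU borel_open[OF oU] by (intro integrable_real_indicator) auto
  define SL where "SL = {u \<in> S_class \<Omega> T p \<psi>. \<forall>z\<in>U. u z \<le> L}"
  have S0: "0 \<le> u z" if u: "u \<in> S_class \<Omega> T p \<psi>" and z: "z \<in> U" for u z
  proof (rule regularized_le[OF p0 const_regularized[OF p0 O], of T u 0])
    have "AE z in lebesgue. z \<in> cyl \<Omega> T \<longrightarrow> \<psi> z \<le> u z" using u by (simp add: S_class_def)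
    then show "AE z in lebesgue. z \<in> cyl \<Omega> T \<longrightarrow> 0 \<le> u z" by (rule eventually_mono) (use \<psi> in force)
  qed (use u z in \<open>auto simp: S_class_def U_def\<close>)
  have Lin: "(\<lambda>z. L) \<in> SL"
  proof -
    have "weak_supersol \<Omega> T p (\<lambda>z. L)" by (rule superpair_imp_weak_supersol[OF O superpair_const[OF p, of _ L]]) simp
    then show ?thesis using const_regularized[OF p0 O] \<psi> by (auto simp: SL_def S_class_def)
  qed
  define J where "J u = (\<integral>z. indicator U z * u z \<partial>lebesgue)" for u :: "'a \<times> real \<Rightarrow> real"
  have int: "integrable lebesgue (\<lambda>z. indicator U z * u z)" if u: "u \<in> SL" for u
  proof (rule Bochner_Integration.integrable_bound)
    show "integrable lebesgue (\<lambda>z. L * indicator U z)" using iU by simp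
    show "(\<lambda>z. indicator U z * u z) \<in> borel_measurable lebesgue"
      using u by (auto simp: SL_def S_class_def weak_supersol_def weak_grad_loc_def set_borel_measurable_def U_def)
    show "AE z in lebesgue. norm (indicator U z * u z) \<le> norm (L * indicator U z)"
      using u S0[of u] L by (auto simp: SL_def indicator_def)
  qed
  have Jmono: "J u \<le> J v" if "u \<in> SL" "v \<in> SL" "\<And>z. z \<in> U \<Longrightarrow> u z \<le> v z" for u v
    unfolding J_def by (rule integral_mono[OF int[OF that(1)] int[OF that(2)]]) (use that(3) in \<open>auto simp: indicator_def\<close>)
  have J0: "0 \<le> J u" if "u \<in> SL" for u
    unfolding J_def by (rule Bochner_Integration.integral_nonneg) (use S0[of u] that in \<open>auto simp: indicator_def SL_def\<close>)
  define m where "m = Inf (J ` SL)"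
  have bb: "bdd_below (J ` SL)" by (rule bdd_belowI2[of _ 0], rule J0)
  have "\<exists>u\<in>SL. J u < m + 1 / real (Suc n)" for n
    using cInf_lessD[of "J ` SL" "m + 1 / real (Suc n)"] Lin by (force simp: m_def)
  then obtain u where u: "\<And>n. u n \<in> SL" "\<And>n. J (u n) < m + 1 / real (Suc n)" by metis
  define v where "v = rec_nat (u 0) (\<lambda>n w z. min (w z) (u (Suc n) z))"
  have v0: "v 0 = u 0" and vS: "v (Suc n) = (\<lambda>z. min (v n z) (u (Suc n) z))" for n by (simp_all add: v_def)
  have vin: "v n \<in> SL" for n
  proof (induction n)
    case 0 then show ?case using u v0 by simp
  next
    case (Suc n) then show ?case using S_class_min[OF p O, of "v n" T \<psi> "u (Suc n)"] u(1)[of "Suc n"] by (auto simp: SL_def vS)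
  qed
  have vu: "v n z \<le> u n z" for n z by (cases n) (auto simp: v0 vS)
  have vdec: "decseq (\<lambda>n. v n z)" for z by (rule decseq_SucI) (simp add: vS)
  have vb: "0 \<le> v n z \<and> v n z \<le> L" if "z \<in> U" for n z using S0[of "v n" z] vin[of n] that by (auto simp: SL_def)
  define v' where "v' z = (INF n. v n z)" for z
  have vlim: "(\<lambda>n. v n z) \<longlonglongrightarrow> v' z" if "z \<in> U" for z
    unfolding v'_def by (rule LIMSEQ_decseq_INF[OF _ vdec]) (rule bdd_belowI2[of _ 0], use vb[OF that] in simp)
  have "\<exists>f g. superpair U p f g \<and> (AE z in lebesgue. z \<in> U \<longrightarrow> v n z = f z) \<and> (\<forall>z. 0 \<le> f z \<and> f z \<le> L)" for n
  proof -
    have w: "weak_supersol \<Omega> T p (v n)" using vin[of n] by (simp add: SL_def S_class_def)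
    obtain f g where "superpair U p f g" "AE z in lebesgue. z \<in> U \<longrightarrow> v n z = f z" "\<And>z. 0 \<le> f z" "\<And>z. f z \<le> L"
      unfolding U_def by (rule weak_supersol_boundedE[OF O w L]) (use vb in \<open>simp add: U_def\<close>, blast)
    then show ?thesis by blast
  qed
  then have "\<exists>f. \<forall>n. \<exists>g. superpair U p (f n) g \<and> (AE z in lebesgue. z \<in> U \<longrightarrow> v n z = f n z) \<and> (\<forall>z. 0 \<le> f n z \<and> f n z \<le> L)"
    by (intro choice allI)
  then obtain f where "\<forall>n. \<exists>g. superpair U p (f n) g \<and> (AE z in lebesgue. z \<in> U \<longrightarrow> v n z = f n z) \<and> (\<forall>z. 0 \<le> f n z \<and> f n z \<le> L)" ..
  then have "\<exists>g. \<forall>n. superpair U p (f n) (g n) \<and> (AE z in lebesgue. z \<in> U \<longrightarrow> v n z = f n z) \<and> (\<forall>z. 0 \<le> f n z \<and> f n z \<le> L)"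
    by (rule choice)
  then obtain g where fg: "\<And>n. superpair U p (f n) (g n)" "\<And>n. AE z in lebesgue. z \<in> U \<longrightarrow> v n z = f n z" "\<And>n z. 0 \<le> f n z \<and> f n z \<le> L" by blast
  have [measurable]: "f n \<in> borel_measurable borel" for n using fg(1)[of n] by (simp add: superpair_def)
  define f' where "f' z = max 0 (min L (lim (\<lambda>n. f n z)))" for z
  have f'm: "f' \<in> borel_measurable borel" unfolding f'_def[abs_def] by measurable
  have f'b: "0 \<le> f' z" "f' z \<le> L" for z using L by (auto simp: f'_def)
  have "AE z in lebesgue. \<forall>n. z \<in> U \<longrightarrow> v n z = f n z" unfolding AE_all_countable using fg(2) by blast
  then have "AE z in lebesgue. z \<in> U \<longrightarrow> (\<lambda>n. f n z) \<longlonglongrightarrow> f' z \<and> f' z = v' z"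
  proof (rule eventually_mono, intro impI)
    fix z assume a: "\<forall>n. z \<in> U \<longrightarrow> v n z = f n z" and z: "z \<in> U"
    have l: "(\<lambda>n. f n z) \<longlonglongrightarrow> v' z" using vlim[OF z] a z by simp
    have "0 \<le> v' z" by (rule LIMSEQ_le_const[OF l]) (use fg(3) in blast)
    moreover have "v' z \<le> L" by (rule LIMSEQ_le_const2[OF l]) (use fg(3) in blast)
    ultimately have "f' z = v' z" using limI[OF l] by (simp add: f'_def)
    then show "(\<lambda>n. f n z) \<longlonglongrightarrow> f' z \<and> f' z = v' z" using l by simp
  qed
  note flim = this
  have "AE z in lborel. z \<in> U \<longrightarrow> (\<lambda>n. f n z) \<longlonglongrightarrow> f' z"
    using flim unfolding AE_completion_iff by (rule eventually_mono) blast
  then have "\<exists>h. superpair U p f' h"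
    by (intro superpair_limit[OF p oU fg(1), where M=L]) (use fg(3) f'm f'b in auto)
  then obtain h where h: "superpair U p f' h" by blast
  define V where "V = ess_liminf_reg \<Omega> T p f'"
  note Vf = superpair_regularization[OF p O h[unfolded U_def] f'b, folded V_def]
  have Vv: "AE z in lebesgue. z \<in> U \<longrightarrow> V z = v' z" using flim Vf(3)[folded U_def] by eventually_elim simp
  have v'v: "v' z \<le> v n z" if "z \<in> U" for z n by (rule decseq_ge[OF vdec vlim[OF that]])
  have "AE z in lebesgue. \<forall>n. z \<in> U \<longrightarrow> \<psi> z \<le> v n z" unfolding AE_all_countable
    using vin by (auto simp: SL_def S_class_def U_def)
  then have "AE z in lebesgue. z \<in> U \<longrightarrow> \<psi> z \<le> V z" using Vv
  proof eventually_elim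
    fix z assume a: "\<forall>n. z \<in> U \<longrightarrow> \<psi> z \<le> v n z" "z \<in> U \<longrightarrow> V z = v' z"
    show "z \<in> U \<longrightarrow> \<psi> z \<le> V z"
    proof
      assume z: "z \<in> U"
      have "\<psi> z \<le> v' z" by (rule LIMSEQ_le_const[OF vlim[OF z]]) (use a z in auto)
      then show "\<psi> z \<le> V z" using a(2) z by simp
    qed
  qed
  then have VS: "V \<in> SL" using Vf by (auto simp: SL_def S_class_def U_def)
  have "J V \<le> J (v n)" for n unfolding J_def
    by (rule integral_mono_AE[OF int[OF VS] int[OF vin]]) (use Vv in \<open>rule eventually_mono, use v'v in \<open>auto simp: indicator_def\<close>\<close>)
  then have "J V \<le> m + 1 / real (Suc n)" for n
    using Jmono[OF vin u(1), of n n] vu u(2)[of n] by (meson less_imp_le order_trans)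
  moreover have "(\<lambda>n. m + 1 / real (Suc n)) \<longlonglongrightarrow> m + 0" by (intro tendsto_intros LIMSEQ_Suc[OF lim_1_over_n])
  ultimately have JV: "J V \<le> m" by (intro LIMSEQ_le_const[of _ "m + 0" "J V", simplified]) auto
  show thesis
  proof (rule that)
    show "V \<in> S_class \<Omega> T p \<psi>" using VS by (simp add: SL_def)
    fix q z assume q: "q \<in> S_class \<Omega> T p \<psi>" and z: "z \<in> cyl \<Omega> T"
    define k where "k z = min (q z) (V z)" for z
    have "k \<in> S_class \<Omega> T p \<psi>" unfolding k_def[abs_def] using S_class_min[OF p O q] VS by (simp add: SL_def)
    then have k: "k \<in> SL" using VS by (auto simp: SL_def k_def min_def intro: order_trans)
    have "J V \<le> J k" using JV cInf_lower[OF imageI[OF k] bb] unfolding m_def by linarith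
    moreover have "J k \<le> J V" by (rule Jmono[OF k VS]) (simp add: k_def)
    ultimately have "(\<integral>z. indicator U z * V z - indicator U z * k z \<partial>lebesgue) = 0"
      using Bochner_Integration.integral_diff[OF int[OF VS] int[OF k]] by (simp add: J_def)
    then have "AE z in lebesgue. indicator U z * V z - indicator U z * k z = 0"
      by (subst (asm) integral_nonneg_eq_0_iff_AE) (use int[OF VS] int[OF k] in \<open>auto simp: indicator_def k_def\<close>)
    then have "AE z in lebesgue. z \<in> cyl \<Omega> T \<longrightarrow> V z \<le> q z"
      by (rule eventually_mono) (auto simp: U_def k_def min_def split: if_splits)
    then show "V z \<le> q z" using Vf(2) q z by (intro regularized_le[OF p0]) (auto simp: S_class_def)
  qed
qed

theorem theorem2p8:
  fixes \<Omega> :: "'a::euclidean_space set" and T p L :: real and \<psi> :: "'a \<times> real \<Rightarrow> real"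
  assumes "p > 2" and "T > 0"
    and "open \<Omega>" and "connected \<Omega>" and "bounded \<Omega>" and "\<Omega> \<noteq> {}"
    and "set_borel_measurable lebesgue (cyl \<Omega> T) \<psi>"
    and "\<forall>z\<in>cyl \<Omega> T. 0 \<le> \<psi> z \<and> \<psi> z \<le> L"
  shows "weak_supersol \<Omega> T p (ess_liminf_reg \<Omega> T p (w_inf \<Omega> T p \<psi>))
     \<and> (AE z in lebesgue. z \<in> cyl \<Omega> T \<longrightarrow>
          w_inf \<Omega> T p \<psi> z = ess_liminf_reg \<Omega> T p (w_inf \<Omega> T p \<psi>) z)"
proof -
  have p0: "p > 0" using assms(1) by simp
  obtain V where V: "V \<in> S_class \<Omega> T p \<psi>" "\<And>u z. u \<in> S_class \<Omega> T p \<psi> \<Longrightarrow> z \<in> cyl \<Omega> T \<Longrightarrow> V z \<le> u z"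
    using S_class_least[OF assms(1,2,3,5,6), of \<psi> L] assms(8) by blast
  have wV: "w_inf \<Omega> T p \<psi> z = V z" if "z \<in> cyl \<Omega> T" for z
    unfolding w_inf_def by (rule cInf_eq_minimum) (use V that in blast)+
  have reg: "ess_liminf_reg \<Omega> T p (w_inf \<Omega> T p \<psi>) z = V z" if z: "z \<in> cyl \<Omega> T" for z
  proof -
    have "ess_liminf_e \<Omega> T p (w_inf \<Omega> T p \<psi>) z = ess_liminf_e \<Omega> T p V z" by (rule ess_liminf_e_cong[OF p0]) (simp add: wV)
    also have "\<dots> = ereal (V z)" using V(1) z by (simp add: S_class_def ess_liminf_regularized_def)
    finally show ?thesis by (simp add: ess_liminf_reg_def)
  qed
  have "weak_supersol \<Omega> T p V" using V(1) by (simp add: S_class_def)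
  then obtain v g where v: "superpair (cyl \<Omega> T) p v g" "AE z in lebesgue. z \<in> cyl \<Omega> T \<longrightarrow> V z = v z" by (rule weak_supersolE[OF assms(3)])
  have "weak_supersol \<Omega> T p (ess_liminf_reg \<Omega> T p (w_inf \<Omega> T p \<psi>))"
    by (rule superpair_imp_weak_supersol[OF assms(3) v(1)]) (use v(2) in \<open>rule eventually_mono, use reg in simp\<close>)
  then show ?thesis using wV reg by simp
qed

end
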